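(* Let $m\ge1$ be an integer and consider the equation $$\partial_tu+(-1)^m\partial_x^{2m+1}u-|u|^{p-2}\partial_xu=0,\qquad u=u(t,x)\in\mathbb{R},\ x\in\mathbb{R}. \qquad ( * )$$ Assume that the Cauchy problem for $( * )$ is globally well posed in $H^{2m}$. Then $( * )$ admits hylomorphic solitons $u_\delta$, $\delta\in(0,\delta_\infty)$ (for some $\delta_\infty>0$), provided that $$2<p<4m+2 .$$ Moreover, for every $\delta\in(0,\delta_\infty)$ there is a suitable $\lambda_\delta\in\mathbb{R}$ such that $u_\delta$ is a (weak) solution of $$(-1)^m\partial_x^{2m+1}u-|u|^{p-2}\partial_xu=\lambda_\delta\,\partial_xu$$ and $U_\delta(t,x)=u_\delta(x-\lambda_\delta t)$ solves $( * )$.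
   Context: Fourier transform: $\hat w(\xi)=\frac1{\sqrt{2\pi}}\int w(y)e^{-iy\xi}\,dy$; $H^{s}$ is the Sobolev space on $\mathbb{R}$ with norm $\left(\int(1+|\xi|^{2s})|\hat u(\xi)|^2d\xi\right)^{1/2}$. "Weak solution" means solution in the sense of distributions. Setting: $X=H^{m}$ (real-valued functions), with energy and hylenic charge $$E(u)=\int\Big(\tfrac12|\partial_x^{m}u|^2-\tfrac{|u|^p}{p(p-1)}\Big)dx,\qquad C(u)=\tfrac12\int u^2\,dx .$$ Flow: for $u_0\in X$, $T(u_0)\ge 0$ is the supremum of the $\tau\in[0,+\infty)$ such that for all $t\in[0,\tau)$ the solution $u(t,\cdot)$ of the evolution equation with initial value $u_0$ satisfies: $u(t,\cdot)$ is the unique solution in $X$; the solution is continuous at every point $(t,v)$ (time, initial datum) of $Z=\{(t,v)\in\mathbb{R}\times X: t\in[0,T(v))\}$; and $t\mapsto E(u(t,\cdot))$, $t\mapsto C(u(t,\cdot))$ are constant. Write $\gamma_tu_0:=u(t,\cdot)$ for $t\in[0,T(u_0))$; $(X,\gamma)$ is regarded as a dynamical system, i.e. $\gamma:Z\to X$ is continuous, $\gamma_0(u)=u$ and $\gamma_t\circ\gamma_r(u)=\gamma_{t+r}(u)$ when $t+r\in[0,T(u))$. Set $X_0=\{u\in X:T(u)=+\infty\}$. (For the KdV equation, $m=1$, the paper takes $X=H^1$ and $X_0=H^2$.) A set $\Gamma\subset X$ is invariant if $\gamma_tu\in\Gamma$ for all $u\in\Gamma$, $t\in[0,T(u))$.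 An invariant set $\Gamma$ is (orbitally) stable if for every $\varepsilon>0$ there is $\eta>0$ such that for all $u\in X$, $d(u,\Gamma)\le\eta$ implies $d(\gamma_tu,\Gamma)\le\varepsilon$ for all $t\in[0,T(u))$. A soliton is a state $u\in\Gamma\subset X_0$, where $\Gamma$ is (i) an invariant, stable set and (ii) compact up to translations: every sequence $u_n\in\Gamma$ has a subsequence $u_{n_k}$ and a sequence $\tau_k\in\mathbb{R}$ such that $u_{n_k}(\cdot-\tau_k)$ converges in $X$. A soliton $u_0$ is hylomorphic if the corresponding $\Gamma$ has the form $\Gamma=\{u\in X: E(u)=e_0,\ |C(u)|=c_0\}$ with $e_0=\min\{E(u):u\in X,\ |C(u)|=c_0\}$. *)

theory Defs
  imports "HOL-Analysis.Analysis"
begin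

text \<open>Elements of function spaces are represented by Borel functions on the line; two functions that
  agree almost everywhere represent the same element.\<close>

section \<open>Test functions and weak derivatives\<close>

definition test_function :: "(real \<Rightarrow> real) \<Rightarrow> bool" where
  "test_function \<phi> \<longleftrightarrow>
     (\<forall>k x. (deriv ^^ k) \<phi> field_differentiable at x) \<and>
     (\<exists>K. compact K \<and> (\<forall>x. x \<notin> K \<longrightarrow> \<phi> x = 0))"

definition locally_integrable :: "(real \<Rightarrow> real) \<Rightarrow> bool" where
  "locally_integrable f \<longleftrightarrow>
     f \<in> borel_measurable borel \<and> (\<forall>a b. set_integrable lborel {a..b} f)"

text \<open>The \<open>k\<close>-th distributional derivative of \<open>f\<close>, evaluated at the test function \<open>\<phi>\<close>.\<close>

definition distr_deriv :: "nat \<Rightarrow> (real \<Rightarrow> real) \<Rightarrow> (real \<Rightarrow> real) \<Rightarrow> real" where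
  "distr_deriv k f \<phi> = (-1) ^ k * (LINT x|lborel. f x * (deriv ^^ k) \<phi> x)"

definition has_weak_deriv :: "nat \<Rightarrow> (real \<Rightarrow> real) \<Rightarrow> (real \<Rightarrow> real) \<Rightarrow> bool" where
  "has_weak_deriv k f g \<longleftrightarrow> locally_integrable f \<and> locally_integrable g \<and>
     (\<forall>\<phi>. test_function \<phi> \<longrightarrow> distr_deriv k f \<phi> = (LINT x|lborel. g x * \<phi> x))"

definition weak_deriv :: "nat \<Rightarrow> (real \<Rightarrow> real) \<Rightarrow> real \<Rightarrow> real" where
  "weak_deriv k f = (SOME g. has_weak_deriv k f g)"

section \<open>Fourier transform and Sobolev spaces\<close>

definition fourier_integral :: "(real \<Rightarrow> real) \<Rightarrow> real \<Rightarrow> complex" where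
  "fourier_integral w \<xi> =
     complex_of_real (1 / sqrt (2 * pi)) *
       (LINT y|lborel. complex_of_real (w y) * exp (- (\<i> * complex_of_real (y * \<xi>))))"

text \<open>For square-integrable \<open>w\<close> the Fourier integral need not converge absolutely; the transform is
  the \<open>L\<^sup>2\<close>-limit of the transforms of the truncations of \<open>w\<close>.\<close>

definition has_fourier_transform :: "(real \<Rightarrow> real) \<Rightarrow> (real \<Rightarrow> complex) \<Rightarrow> bool" where
  "has_fourier_transform w g \<longleftrightarrow> g \<in> borel_measurable borel \<and>
     (\<lambda>n::nat. \<integral>\<^sup>+ \<xi>. ennreal ((cmod (g \<xi> -
          fourier_integral (\<lambda>y. indicat_real {- real n..real n} y * w y) \<xi>))\<^sup>2) \<partial>lborel)
       \<longlonglongrightarrow> 0"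

definition fourier :: "(real \<Rightarrow> real) \<Rightarrow> real \<Rightarrow> complex" where
  "fourier w = (SOME g. has_fourier_transform w g)"

definition sobolev :: "nat \<Rightarrow> (real \<Rightarrow> real) set" where
  "sobolev s = {w. w \<in> borel_measurable borel \<and> integrable lborel (\<lambda>y. (w y)\<^sup>2) \<and>
     integrable lborel (\<lambda>\<xi>. (1 + \<bar>\<xi>\<bar> ^ (2 * s)) * (cmod (fourier w \<xi>))\<^sup>2)}"

definition sobolev_norm :: "nat \<Rightarrow> (real \<Rightarrow> real) \<Rightarrow> real" where
  "sobolev_norm s w = sqrt (LINT \<xi>|lborel. (1 + \<bar>\<xi>\<bar> ^ (2 * s)) * (cmod (fourier w \<xi>))\<^sup>2)"

definition sobolev_dist :: "nat \<Rightarrow> (real \<Rightarrow> real) \<Rightarrow> (real \<Rightarrow> real) \<Rightarrow> real" where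
  "sobolev_dist s u v = sobolev_norm s (\<lambda>x. u x - v x)"

text \<open>Only meaningful for nonempty \<open>\<Gamma>\<close>.\<close>

definition sobolev_setdist :: "nat \<Rightarrow> (real \<Rightarrow> real) \<Rightarrow> (real \<Rightarrow> real) set \<Rightarrow> real" where
  "sobolev_setdist s u \<Gamma> = (INF v\<in>\<Gamma>. sobolev_dist s u v)"

section \<open>Energy and hylenic charge\<close>

definition energy :: "nat \<Rightarrow> real \<Rightarrow> (real \<Rightarrow> real) \<Rightarrow> real" where
  "energy m p u =
     (LINT x|lborel. 1 / 2 * \<bar>weak_deriv m u x\<bar>\<^sup>2 - \<bar>u x\<bar> powr p / (p * (p - 1)))"

definition charge :: "(real \<Rightarrow> real) \<Rightarrow> real" where
  "charge u = 1 / 2 * (LINT x|lborel. (u x)\<^sup>2)"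

section \<open>The evolution equation\<close>

definition dt :: "(real \<Rightarrow> real \<Rightarrow> real) \<Rightarrow> real \<Rightarrow> real \<Rightarrow> real" where
  "dt \<phi> = (\<lambda>t x. deriv (\<lambda>s. \<phi> s x) t)"

definition dx :: "(real \<Rightarrow> real \<Rightarrow> real) \<Rightarrow> real \<Rightarrow> real \<Rightarrow> real" where
  "dx \<phi> = (\<lambda>t x. deriv (\<phi> t) x)"

text \<open>Smooth functions with compact support in \<open>I \<times> \<real>\<close>.\<close>

definition spacetime_test_function :: "real set \<Rightarrow> (real \<Rightarrow> real \<Rightarrow> real) \<Rightarrow> bool" where
  "spacetime_test_function I \<phi> \<longleftrightarrow>
     (\<forall>i j. (\<lambda>(t, x). (dt ^^ i) ((dx ^^ j) \<phi>) t x) differentiable_on UNIV) \<and>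
     (\<exists>K. compact K \<and> K \<subseteq> I \<times> UNIV \<and> (\<forall>t x. (t, x) \<notin> K \<longrightarrow> \<phi> t x = 0))"

text \<open>\<open>u\<close> satisfies \<open>u_t + (-1)^m \<partial>_x^(2m+1) u - |u|^(p-2) \<partial>_x u = 0\<close> as a distribution on \<open>I \<times> \<real>\<close>,
  for an open set \<open>I\<close> of times. Space-time integrals are written as iterated integrals, so that
  choosing representatives at each time separately does not affect measurability.\<close>

definition weak_evolution :: "nat \<Rightarrow> real \<Rightarrow> real set \<Rightarrow> (real \<Rightarrow> real \<Rightarrow> real) \<Rightarrow> bool" where
  "weak_evolution m p I u \<longleftrightarrow> (\<forall>\<phi>. spacetime_test_function I \<phi> \<longrightarrow>
     - (LINT t|lborel. LINT x|lborel. u t x * dt \<phi> t x)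
     + (-1) ^ m * (LINT t|lborel. distr_deriv (2 * m + 1) (u t) (\<phi> t))
     - (LINT t|lborel. LINT x|lborel. \<bar>u t x\<bar> powr (p - 2) * weak_deriv 1 (u t) x * \<phi> t x)
     = 0)"

text \<open>The stationary equation \<open>(-1)^m \<partial>_x^(2m+1) u - |u|^(p-2) \<partial>_x u = lam \<partial>_x u\<close>
  in the sense of distributions.\<close>

definition weak_travelling_profile :: "nat \<Rightarrow> real \<Rightarrow> real \<Rightarrow> (real \<Rightarrow> real) \<Rightarrow> bool" where
  "weak_travelling_profile m p lam u \<longleftrightarrow> (\<forall>\<phi>. test_function \<phi> \<longrightarrow>
     (-1) ^ m * distr_deriv (2 * m + 1) u \<phi>
     - (LINT x|lborel. \<bar>u x\<bar> powr (p - 2) * weak_deriv 1 u x * \<phi> x)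
     = lam * distr_deriv 1 u \<phi>)"

text \<open>Solutions on the time interval \<open>[0, \<tau>)\<close>, continuous with values in \<open>H\<^sup>m\<close>.\<close>

definition cauchy_solution ::
    "nat \<Rightarrow> real \<Rightarrow> (real \<Rightarrow> real) \<Rightarrow> real \<Rightarrow> (real \<Rightarrow> real \<Rightarrow> real) \<Rightarrow> bool" where
  "cauchy_solution m p u0 \<tau> u \<longleftrightarrow>
     u 0 = u0 \<and>
     (\<forall>t\<in>{0..<\<tau>}. u t \<in> sobolev m) \<and>
     (\<forall>t\<in>{0..<\<tau>}. ((\<lambda>s. sobolev_dist m (u s) (u t)) \<longlongrightarrow> 0) (at t within {0..<\<tau>})) \<and>
     weak_evolution m p {0<..<\<tau>} u"

section \<open>The dynamical system\<close>

definition flow :: "nat \<Rightarrow> real \<Rightarrow> real \<Rightarrow> (real \<Rightarrow> real) \<Rightarrow> real \<Rightarrow> real" where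
  "flow m p t u0 = (SOME v. \<exists>\<tau> u. t < \<tau> \<and> cauchy_solution m p u0 \<tau> u \<and> v = u t)"

definition flow_domain ::
    "nat \<Rightarrow> ((real \<Rightarrow> real) \<Rightarrow> ereal) \<Rightarrow> (real \<times> (real \<Rightarrow> real)) set" where
  "flow_domain m T = {(t, v). v \<in> sobolev m \<and> 0 \<le> t \<and> ereal t < T v}"

text \<open>On \<open>[0, \<tau>)\<close> the solution with datum \<open>u0\<close> exists, is the only one, conserves energy and charge,
  and the flow is continuous at each \<open>(t, u0)\<close> with respect to time and datum ranging over the
  domain determined by \<open>T\<close>.\<close>

definition good_time ::
    "nat \<Rightarrow> real \<Rightarrow> ((real \<Rightarrow> real) \<Rightarrow> ereal) \<Rightarrow> (real \<Rightarrow> real) \<Rightarrow> real \<Rightarrow> bool" where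
  "good_time m p T u0 \<tau> \<longleftrightarrow> (\<exists>u. cauchy_solution m p u0 \<tau> u \<and>
     (\<forall>\<sigma> v. cauchy_solution m p u0 \<sigma> v \<longrightarrow>
        (\<forall>t. 0 \<le> t \<and> t < \<tau> \<and> t < \<sigma> \<longrightarrow> (AE x in lborel. v t x = u t x))) \<and>
     (\<forall>t\<in>{0..<\<tau>}. \<forall>\<epsilon>>0. \<exists>\<eta>>0. \<forall>(s, v)\<in>flow_domain m T.
        \<bar>s - t\<bar> < \<eta> \<and> sobolev_dist m v u0 < \<eta> \<longrightarrow> sobolev_dist m (flow m p s v) (u t) < \<epsilon>) \<and>
     (\<forall>t\<in>{0..<\<tau>}. energy m p (u t) = energy m p u0 \<and> charge (u t) = charge u0))"

text \<open>The life span is a supremum whose defining condition refers, through the domain on which the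
  flow has to be continuous, to the life span itself; hence it is characterized by an equation.\<close>

definition is_life_span :: "nat \<Rightarrow> real \<Rightarrow> ((real \<Rightarrow> real) \<Rightarrow> ereal) \<Rightarrow> bool" where
  "is_life_span m p T \<longleftrightarrow>
     (\<forall>u0\<in>sobolev m. T u0 = Sup {ereal \<tau> | \<tau>. 0 \<le> \<tau> \<and> good_time m p T u0 \<tau>})"

definition global_states :: "nat \<Rightarrow> ((real \<Rightarrow> real) \<Rightarrow> ereal) \<Rightarrow> (real \<Rightarrow> real) set" where
  "global_states m T = {u \<in> sobolev m. T u = \<infinity>}"

definition globally_well_posed_in ::
    "nat \<Rightarrow> ((real \<Rightarrow> real) \<Rightarrow> ereal) \<Rightarrow> (real \<Rightarrow> real) set \<Rightarrow> bool" where
  "globally_well_posed_in m T Y \<longleftrightarrow> Y \<subseteq> global_states m T"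

definition invariant_set ::
    "nat \<Rightarrow> real \<Rightarrow> ((real \<Rightarrow> real) \<Rightarrow> ereal) \<Rightarrow> (real \<Rightarrow> real) set \<Rightarrow> bool" where
  "invariant_set m p T \<Gamma> \<longleftrightarrow>
     (\<forall>u\<in>\<Gamma>. \<forall>t. 0 \<le> t \<and> ereal t < T u \<longrightarrow> flow m p t u \<in> \<Gamma>)"

definition stable_set ::
    "nat \<Rightarrow> real \<Rightarrow> ((real \<Rightarrow> real) \<Rightarrow> ereal) \<Rightarrow> (real \<Rightarrow> real) set \<Rightarrow> bool" where
  "stable_set m p T \<Gamma> \<longleftrightarrow>
     (\<forall>\<epsilon>>0. \<exists>\<eta>>0. \<forall>u\<in>sobolev m. sobolev_setdist m u \<Gamma> \<le> \<eta> \<longrightarrow>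
        (\<forall>t. 0 \<le> t \<and> ereal t < T u \<longrightarrow> sobolev_setdist m (flow m p t u) \<Gamma> \<le> \<epsilon>))"

definition compact_up_to_translations :: "nat \<Rightarrow> (real \<Rightarrow> real) set \<Rightarrow> bool" where
  "compact_up_to_translations m \<Gamma> \<longleftrightarrow>
     (\<forall>u :: nat \<Rightarrow> real \<Rightarrow> real. (\<forall>n. u n \<in> \<Gamma>) \<longrightarrow>
        (\<exists>r :: nat \<Rightarrow> nat. strict_mono r \<and> (\<exists>\<tau> :: nat \<Rightarrow> real. \<exists>v\<in>sobolev m.
           (\<lambda>k. sobolev_dist m (\<lambda>x. u (r k) (x - \<tau> k)) v) \<longlonglongrightarrow> 0)))"

definition soliton_via ::
    "nat \<Rightarrow> real \<Rightarrow> ((real \<Rightarrow> real) \<Rightarrow> ereal) \<Rightarrow> (real \<Rightarrow> real) set \<Rightarrow> (real \<Rightarrow> real) \<Rightarrow> bool" where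
  "soliton_via m p T \<Gamma> u \<longleftrightarrow> u \<in> \<Gamma> \<and> \<Gamma> \<subseteq> global_states m T \<and>
     invariant_set m p T \<Gamma> \<and> stable_set m p T \<Gamma> \<and> compact_up_to_translations m \<Gamma>"

text \<open>The charge level \<open>c0 = 0\<close> is excluded: it would make the vacuum \<open>u = 0\<close> a soliton.\<close>

definition hylomorphic_soliton ::
    "nat \<Rightarrow> real \<Rightarrow> ((real \<Rightarrow> real) \<Rightarrow> ereal) \<Rightarrow> (real \<Rightarrow> real) \<Rightarrow> bool" where
  "hylomorphic_soliton m p T u0 \<longleftrightarrow> (\<exists>c0 e0. c0 > 0 \<and>
     e0 \<in> energy m p ` {u \<in> sobolev m. \<bar>charge u\<bar> = c0} \<and>
     (\<forall>u\<in>sobolev m. \<bar>charge u\<bar> = c0 \<longrightarrow> e0 \<le> energy m p u) \<and>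
     soliton_via m p T {u \<in> sobolev m. energy m p u = e0 \<and> \<bar>charge u\<bar> = c0} u0)"

end

theory Submission
  imports Defs "HOL-Probability.Probability" "HOL-Complex_Analysis.Complex_Analysis"
begin

text \<open>The solitons are the functions that minimize the energy on a level set of the mass \<open>\<integral> u\<^sup>2\<close>,
  which is twice the charge. In Fourier variables the energy is
  \<open>kinetic m u / 2 - potential p u / (p * (p - 1))\<close>, where \<open>kinetic\<close> is the squared \<open>L\<^sup>2\<close> norm of
  the \<open>m\<close>-th derivative and \<open>potential\<close> is the integral of \<open>\<bar>u\<bar>\<close> to the power \<open>p\<close>. Three properties
  of this functional carry the proof.

  It is coercive at bounded mass (\<open>energy_coercive\<close>). An element of \<open>H\<^sup>m\<close> is bounded, and its
  supremum grows at most like the kinetic part to the power \<open>1/(4m)\<close>; the potential, at most the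
  mass times the supremum to the power \<open>p - 2\<close>, therefore grows like the kinetic part to the power
  \<open>(p - 2)/(4m)\<close>, which is below \<open>1\<close> exactly when \<open>p < 4m + 2\<close>. It is negative somewhere
  (\<open>negative_energy_state\<close>), because \<open>p > 2\<close> lets the potential of a large multiple of a bump win.
  And it scales strictly (\<open>energy_scaling_strict\<close>): if \<open>I\<close> bounds the energy from below at mass \<open>\<mu>\<close>,
  then a state of smaller positive mass \<open>\<nu>\<close> has energy strictly above \<open>\<nu> / \<mu> * I\<close>, since stretching
  its amplitude up to mass \<open>\<mu>\<close> multiplies the potential by more than the kinetic part.

  These give the compactness theorem \<open>minimizing_sequence_compact\<close>: if masses tend to \<open>\<mu>\<close> and
  energies to \<open>I < 0\<close>, then a subsequence, suitably translated, converges in \<open>H\<^sup>m\<close>. Coercivity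
  bounds the sequence in \<open>H\<^sup>m\<close>. Energies that stay negative forbid the suprema to tend to \<open>0\<close>, so
  that translations place a value bounded away from \<open>0\<close> at the origin. The translates are
  equicontinuous and converge pointwise along a subsequence to some \<open>g \<noteq> 0\<close>, and mass and energy
  split asymptotically into those of \<open>g\<close> and of the remainder. If \<open>g\<close> had mass below \<open>\<mu>\<close>, strict
  scaling applied to \<open>g\<close> and scaling applied to the remainder would add up to an energy above \<open>I\<close>.
  Hence \<open>g\<close> carries the whole mass, and the remainder tends to \<open>0\<close> in \<open>H\<^sup>m\<close>.

  Applied to a minimizing sequence this yields a minimizer, applied to minimizers it yields
  compactness up to translations, and applied to the states reached by orbits that start ever closer
  to the set of minimizers it yields orbital stability, as the flow conserves mass and energy.
  Minimizers solve the Euler--Lagrange equation; it places them in \<open>H\<^sup>2\<^sup>m\<close>, where solutions are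
  global, and its derivative, computed with a chain rule for the nonlinearity, is the profile
  equation with the Lagrange multiplier as speed. Translation turns the profile equation into the
  evolution equation. A single soliton obtained in this way serves for every value of the parameter
  \<open>\<delta>\<close>.

  The norm of \<open>H\<^sup>m\<close> is a weighted \<open>L\<^sup>2\<close> norm of the Fourier transform, so all of this rests on
  Plancherel's theorem. The transform of square-integrable functions is handled through the relation
  \<open>fourier_pair\<close>, which characterizes it by duality and therefore determines it only almost
  everywhere, just as the functions themselves.\<close>

section \<open>Square-integrable functions on the line\<close>

lemma lborel_dominated_convergence:
  fixes f :: "real \<Rightarrow> 'a::{banach, second_countable_topology}"
  assumes "\<And>x. (\<lambda>i. s i x) \<longlonglongrightarrow> f x" "\<And>i x. norm (s i x) \<le> w x" "integrable lborel w"
    and [measurable]: "\<And>i. s i \<in> borel_measurable borel" "f \<in> borel_measurable borel"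
  shows "(\<lambda>i. LINT x|lborel. s i x) \<longlonglongrightarrow> (LINT x|lborel. f x)"
  by (rule Bochner_Integration.integral_dominated_convergence[where w=w]) (use assms in auto)

text \<open>A bilinear form whose quadratic form is nonnegative obeys Cauchy--Schwarz: weighting the two
  arguments by \<open>sqrt B\<close> and \<open>sqrt A\<close> makes the two sides of the hypothesis meet. When \<open>A\<close> or \<open>B\<close>
  vanishes, the other weight is free and can be taken large.\<close>

lemma le_sqrt_mult_sqrt_if_quadratic:
  fixes A B c :: real
  assumes A: "A \<ge> 0" and B: "B \<ge> 0"
    and q: "\<And>a b :: real. 2 * a * b * c \<le> a\<^sup>2 * A + b\<^sup>2 * B"
  shows "c \<le> sqrt A * sqrt B"
proof (cases "A = 0 \<or> B = 0")
  case True
  have "c \<le> 0"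
  proof (rule ccontr)
    assume "\<not> c \<le> 0"
    then have c: "c > 0" by simp
    have "2 * ((A + B + 1) / c) * c \<le> A + B"
      using True q[of "(A + B + 1) / c" 1] q[of 1 "(A + B + 1) / c"] by auto
    then show False using c A B by simp
  qed
  then show ?thesis using A B by (meson mult_nonneg_nonneg order_trans real_sqrt_ge_zero)
next
  case False
  then have pos: "0 < sqrt A * sqrt B" using A B by simp
  have "2 * (sqrt A * sqrt B) * c \<le> 2 * (A * B)"
    using q[of "sqrt B" "sqrt A"] A B by (simp add: mult.commute mult.left_commute)
  also have "A * B = (sqrt A * sqrt B) * (sqrt A * sqrt B)"
    using A B by (simp flip: real_sqrt_mult)
  finally have "(sqrt A * sqrt B) * c \<le> (sqrt A * sqrt B) * (sqrt A * sqrt B)"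
    by simp
  then show ?thesis using pos by (rule mult_left_le_imp_le)
qed

lemma cauchy_schwarz_real:
  fixes f g :: "real \<Rightarrow> real"
  assumes [measurable]: "f \<in> borel_measurable borel" "g \<in> borel_measurable borel"
    and f: "integrable lborel (\<lambda>x. (f x)\<^sup>2)" and g: "integrable lborel (\<lambda>x. (g x)\<^sup>2)"
  shows "integrable lborel (\<lambda>x. f x * g x)"
    and "(LINT x|lborel. \<bar>f x * g x\<bar>) \<le> sqrt (LINT x|lborel. (f x)\<^sup>2) * sqrt (LINT x|lborel. (g x)\<^sup>2)"
proof -
  show i: "integrable lborel (\<lambda>x. f x * g x)"
  proof (rule Bochner_Integration.integrable_bound[OF Bochner_Integration.integrable_add[OF f g]])
    have "\<bar>f x * g x\<bar> \<le> (f x)\<^sup>2 + (g x)\<^sup>2" for x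
    proof -
      have "2 * \<bar>f x\<bar> * \<bar>g x\<bar> \<le> \<bar>f x\<bar>\<^sup>2 + \<bar>g x\<bar>\<^sup>2"
        by (rule sum_squares_bound)
      moreover have "0 \<le> \<bar>f x\<bar> * \<bar>g x\<bar>" by simp
      ultimately show ?thesis unfolding abs_mult power2_abs by linarith
    qed
    then show "AE x in lborel. norm (f x * g x) \<le> norm ((f x)\<^sup>2 + (g x)\<^sup>2)" by simp
  qed simp
  let ?A = "LINT x|lborel. (f x)\<^sup>2" and ?B = "LINT x|lborel. (g x)\<^sup>2"
  let ?c = "LINT x|lborel. \<bar>f x * g x\<bar>"
  have A: "?A \<ge> 0" and B: "?B \<ge> 0" by auto
  have c0: "?c \<ge> 0" by auto
  have q: "2 * a * b * ?c \<le> a\<^sup>2 * ?A + b\<^sup>2 * ?B" for a b :: real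
  proof -
    have i2: "integrable lborel (\<lambda>x. \<bar>f x * g x\<bar>)" using i by simp
    have "(LINT x|lborel. 2 * a * b * \<bar>f x * g x\<bar>) \<le> (LINT x|lborel. a\<^sup>2 * (f x)\<^sup>2 + b\<^sup>2 * (g x)\<^sup>2)"
    proof (rule integral_mono)
      show "integrable lborel (\<lambda>x. 2 * a * b * \<bar>f x * g x\<bar>)" using i2 by simp
      show "integrable lborel (\<lambda>x. a\<^sup>2 * (f x)\<^sup>2 + b\<^sup>2 * (g x)\<^sup>2)" using f g by simp
      fix x
      have "0 \<le> (a * \<bar>f x\<bar> - b * \<bar>g x\<bar>)\<^sup>2" by simp
      then show "2 * a * b * \<bar>f x * g x\<bar> \<le> a\<^sup>2 * (f x)\<^sup>2 + b\<^sup>2 * (g x)\<^sup>2"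
        by (simp add: power2_diff power_mult_distrib abs_mult algebra_simps)
    qed
    then show ?thesis using i2 f g by simp
  qed
  show "?c \<le> sqrt ?A * sqrt ?B"
    by (rule le_sqrt_mult_sqrt_if_quadratic[OF A B q])
qed

definition sqint :: "(real \<Rightarrow> complex) \<Rightarrow> bool" where
  "sqint f \<longleftrightarrow> f \<in> borel_measurable borel \<and> integrable lborel (\<lambda>x. (cmod (f x))\<^sup>2)"

text \<open>The square of the \<open>L\<^sup>2\<close> norm; without the root it is additive over orthogonal pieces and
  passes directly through limit theorems for integrals.\<close>

definition nrm2 :: "(real \<Rightarrow> complex) \<Rightarrow> real" where
  "nrm2 f = (LINT x|lborel. (cmod (f x))\<^sup>2)"

definition inner_L2 :: "(real \<Rightarrow> complex) \<Rightarrow> (real \<Rightarrow> complex) \<Rightarrow> complex" where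
  "inner_L2 f g = (LINT x|lborel. f x * cnj (g x))"

lemma sqintD [measurable_dest]: "sqint f \<Longrightarrow> f \<in> borel_measurable borel"
  by (simp add: sqint_def)

lemma sqint_integrable: "sqint f \<Longrightarrow> integrable lborel (\<lambda>x. (cmod (f x))\<^sup>2)"
  by (simp add: sqint_def)

lemma nrm2_nonneg [simp]: "nrm2 f \<ge> 0" by (simp add: nrm2_def)

lemma sqint_mult_integrable:
  assumes f: "sqint f" and g: "sqint g" shows "integrable lborel (\<lambda>x. f x * g x)"
proof -
  note [measurable] = sqintD[OF f] sqintD[OF g]
  have "integrable lborel (\<lambda>x. cmod (f x) * cmod (g x))"
    by (rule cauchy_schwarz_real) (use f g in \<open>auto simp: sqint_def\<close>)
  then show ?thesis
    by (rule Bochner_Integration.integrable_bound) (auto simp: norm_mult)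
qed

lemma sqint_dominated:
  assumes [measurable]: "f \<in> borel_measurable borel" and g: "sqint g" and le: "\<And>x. cmod (f x) \<le> C * cmod (g x)"
  shows "sqint f"
proof -
  note [measurable] = sqintD[OF g]
  have "integrable lborel (\<lambda>x. C\<^sup>2 * (cmod (g x))\<^sup>2)" using sqint_integrable[OF g] by simp
  then have "integrable lborel (\<lambda>x. (cmod (f x))\<^sup>2)"
  proof (rule Bochner_Integration.integrable_bound)
    have "(cmod (f x))\<^sup>2 \<le> C\<^sup>2 * (cmod (g x))\<^sup>2" for x
      using power_mono[OF le[of x], of 2] by (simp add: power_mult_distrib)
    then show "AE x in lborel. norm ((cmod (f x))\<^sup>2) \<le> norm (C\<^sup>2 * (cmod (g x))\<^sup>2)" by simp
  qed simp
  then show ?thesis by (simp add: sqint_def)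
qed

lemma measurable_cnj [measurable]: "cnj \<in> borel_measurable borel"
  by (intro borel_measurable_continuous_onI continuous_intros)

lemma sqint_cnj [simp, intro]: "sqint f \<Longrightarrow> sqint (\<lambda>x. cnj (f x))"
  by (auto simp: sqint_def)

lemma nrm2_cnj [simp]: "nrm2 (\<lambda>x. cnj (f x)) = nrm2 f"
  by (simp add: nrm2_def)

lemma sqint_add [intro]:
  assumes f: "sqint f" and g: "sqint g" shows "sqint (\<lambda>x. f x + g x)"
proof -
  note [measurable] = sqintD[OF f] sqintD[OF g]
  have "integrable lborel (\<lambda>x. 2 * (cmod (f x))\<^sup>2 + 2 * (cmod (g x))\<^sup>2)"
    using f g by (simp add: sqint_def)
  then have "integrable lborel (\<lambda>x. (cmod (f x + g x))\<^sup>2)"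
  proof (rule Bochner_Integration.integrable_bound)
    have "(cmod (f x + g x))\<^sup>2 \<le> 2 * (cmod (f x))\<^sup>2 + 2 * (cmod (g x))\<^sup>2" for x
    proof -
      have "(cmod (f x + g x))\<^sup>2 \<le> (cmod (f x) + cmod (g x))\<^sup>2"
        by (intro power_mono norm_triangle_ineq) auto
      then show ?thesis using sum_squares_bound[of "cmod (f x)" "cmod (g x)"]
        by (simp add: power2_sum)
    qed
    then show "AE x in lborel. norm ((cmod (f x + g x))\<^sup>2) \<le> norm (2 * (cmod (f x))\<^sup>2 + 2 * (cmod (g x))\<^sup>2)"
      by simp
  qed simp
  then show ?thesis by (simp add: sqint_def)
qed

lemma sqint_cmult [intro]: "sqint f \<Longrightarrow> sqint (\<lambda>x. c * f x)"
  by (auto simp: sqint_def norm_mult power_mult_distrib)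

lemma sqint_uminus [intro]: "sqint f \<Longrightarrow> sqint (\<lambda>x. - f x)"
  using sqint_cmult[of f "-1"] by simp

lemma sqint_diff [intro]: "sqint f \<Longrightarrow> sqint g \<Longrightarrow> sqint (\<lambda>x. f x - g x)"
  using sqint_add[of f "\<lambda>x. - g x"] sqint_uminus[of g] by simp

lemma nrm2_cmult: "nrm2 (\<lambda>x. c * f x) = (cmod c)\<^sup>2 * nrm2 f"
  by (simp add: nrm2_def norm_mult power_mult_distrib)

lemma nrm2_minus_commute: "nrm2 (\<lambda>x. f x - g x) = nrm2 (\<lambda>x. g x - f x)"
  by (simp add: nrm2_def norm_minus_commute)

lemma sqint_mult_bounded:
  assumes f: "sqint f" and [measurable]: "g \<in> borel_measurable borel" and "\<And>x. cmod (g x) \<le> C"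
  shows "sqint (\<lambda>x. g x * f x)"
  by (rule sqint_dominated[OF _ f, of _ C])
     (use sqintD[OF f] assms in \<open>auto simp: norm_mult intro!: mult_right_mono\<close>)

lemma sqint_trunc [intro]: fixes f :: "real \<Rightarrow> complex" shows "sqint f \<Longrightarrow> A \<in> sets borel \<Longrightarrow> sqint (\<lambda>x. indicat_real A x * f x)"
  by (rule sqint_mult_bounded[where C=1]) (auto simp: indicator_def)

lemma sqint_shift [intro]: "sqint f \<Longrightarrow> sqint (\<lambda>x. f (x + a))"
  using lborel_integrable_real_affine[of "\<lambda>x. (cmod (f x))\<^sup>2" 1 a]
  by (auto simp: sqint_def add.commute)

lemma nrm2_shift: "nrm2 (\<lambda>x. f (x + a)) = nrm2 f"
  unfolding nrm2_def using lborel_integral_real_affine[of 1 "\<lambda>x. (cmod (f x))\<^sup>2" a]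
  by (simp add: add.commute)

lemma sqint_reflect [intro]: "sqint f \<Longrightarrow> sqint (\<lambda>x. f (- x))"
  using lborel_integrable_real_affine[of "\<lambda>x. (cmod (f x))\<^sup>2" "-1" 0]
  by (auto simp: sqint_def)

lemma cauchy_schwarz:
  assumes f: "sqint f" and g: "sqint g"
  shows "(LINT x|lborel. cmod (f x * g x)) \<le> sqrt (nrm2 f) * sqrt (nrm2 g)"
  using cauchy_schwarz_real(2)[of "\<lambda>x. cmod (f x)" "\<lambda>x. cmod (g x)"] f g
  by (simp add: sqint_def nrm2_def norm_mult abs_mult)

lemma cauchy_schwarz_mult:
  assumes f: "sqint f" and g: "sqint g"
  shows "cmod (LINT x|lborel. f x * g x) \<le> sqrt (nrm2 f) * sqrt (nrm2 g)"
  using cauchy_schwarz[OF assms] integral_norm_bound[of lborel "\<lambda>x. f x * g x"] by linarith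

lemma cauchy_schwarz_inner:
  assumes f: "sqint f" and g: "sqint g"
  shows "cmod (inner_L2 f g) \<le> sqrt (nrm2 f) * sqrt (nrm2 g)"
  using cauchy_schwarz_mult[OF f sqint_cnj[OF g]] by (simp add: inner_L2_def)

lemma inner_L2_integrable: "sqint f \<Longrightarrow> sqint g \<Longrightarrow> integrable lborel (\<lambda>x. f x * cnj (g x))"
  by (intro sqint_mult_integrable sqint_cnj)

lemma inner_L2_diff_left: "sqint f \<Longrightarrow> sqint g \<Longrightarrow> sqint h \<Longrightarrow> inner_L2 (\<lambda>x. f x - g x) h = inner_L2 f h - inner_L2 g h"
  unfolding inner_L2_def by (simp add: ring_distribs inner_L2_integrable)

lemma inner_L2_diff_right: "sqint f \<Longrightarrow> sqint g \<Longrightarrow> sqint h \<Longrightarrow> inner_L2 h (\<lambda>x. f x - g x) = inner_L2 h f - inner_L2 h g"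
  unfolding inner_L2_def by (simp add: ring_distribs inner_L2_integrable)

lemma inner_L2_self: "inner_L2 f f = complex_of_real (nrm2 f)"
  unfolding inner_L2_def nrm2_def by (simp add: complex_norm_square[symmetric] del: of_real_power flip: integral_of_real)

lemma nrm2_add:
  assumes f: "sqint f" and g: "sqint g"
  shows "nrm2 (\<lambda>x. f x + g x) = nrm2 f + nrm2 g + 2 * Re (inner_L2 f g)"
proof -
  have "nrm2 (\<lambda>x. f x + g x) = (LINT x|lborel. (cmod (f x))\<^sup>2 + (cmod (g x))\<^sup>2 + 2 * Re (f x * cnj (g x)))"
    unfolding nrm2_def by (intro Bochner_Integration.integral_cong refl) (simp add: cmod_power2 power2_sum algebra_simps)
  also have "\<dots> = nrm2 f + nrm2 g + 2 * Re (inner_L2 f g)"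
  proof -
    have i: "integrable lborel (\<lambda>x. 2 * Re (f x * cnj (g x)))"
      using integrable_Re[OF inner_L2_integrable[OF f g]] by (intro integrable_mult_right) auto
    have "(LINT x|lborel. 2 * Re (f x * cnj (g x))) = 2 * Re (inner_L2 f g)"
      unfolding inner_L2_def using integral_Re[OF inner_L2_integrable[OF f g]] by (simp del: times_complex.sel)
    then show ?thesis
      using Bochner_Integration.integral_add[OF Bochner_Integration.integrable_add[OF sqint_integrable[OF f] sqint_integrable[OF g]] i]
        Bochner_Integration.integral_add[OF sqint_integrable[OF f] sqint_integrable[OF g]]
      unfolding nrm2_def by linarith
  qed
  finally show ?thesis .
qed

lemma nrm2_diff:
  assumes f: "sqint f" and g: "sqint g"
  shows "nrm2 (\<lambda>x. f x - g x) = nrm2 f + nrm2 g - 2 * Re (inner_L2 f g)"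
  using nrm2_add[OF f sqint_uminus[OF g]] by (simp add: inner_L2_def nrm2_def)

lemma minkowski:
  assumes f: "sqint f" and g: "sqint g"
  shows "sqrt (nrm2 (\<lambda>x. f x + g x)) \<le> sqrt (nrm2 f) + sqrt (nrm2 g)"
proof (rule real_le_lsqrt)
  have "Re (inner_L2 f g) \<le> sqrt (nrm2 f) * sqrt (nrm2 g)"
    using cauchy_schwarz_inner[OF f g] complex_Re_le_cmod[of "inner_L2 f g"] by linarith
  then show "nrm2 (\<lambda>x. f x + g x) \<le> (sqrt (nrm2 f) + sqrt (nrm2 g))\<^sup>2"
    using nrm2_add[OF f g] by (simp add: power2_sum)
qed simp

lemma minkowski_diff:
  assumes f: "sqint f" and g: "sqint g" and h: "sqint h"
  shows "sqrt (nrm2 (\<lambda>x. f x - h x)) \<le> sqrt (nrm2 (\<lambda>x. f x - g x)) + sqrt (nrm2 (\<lambda>x. g x - h x))"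
  using minkowski[OF sqint_diff[OF f g] sqint_diff[OF g h]] by simp

lemma nrm2_triangle_abs:
  assumes f: "sqint f" and g: "sqint g"
  shows "\<bar>sqrt (nrm2 f) - sqrt (nrm2 g)\<bar> \<le> sqrt (nrm2 (\<lambda>x. f x - g x))"
  using minkowski[OF sqint_diff[OF f g] g] minkowski[OF sqint_diff[OF g f] f]
    nrm2_minus_commute[of f g] by (simp add: abs_le_iff)

lemma nrm2_eq_0_iff: "sqint f \<Longrightarrow> nrm2 f = 0 \<longleftrightarrow> (AE x in lborel. f x = 0)"
  unfolding nrm2_def sqint_def by (subst integral_nonneg_eq_0_iff_AE) auto

lemma nrm2_cong_AE:
  "f \<in> borel_measurable borel \<Longrightarrow> g \<in> borel_measurable borel \<Longrightarrow> AE x in lborel. f x = g x \<Longrightarrow> nrm2 f = nrm2 g"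
  unfolding nrm2_def by (rule integral_cong_AE) auto

lemma sqint_cong_AE:
  "sqint f \<Longrightarrow> g \<in> borel_measurable borel \<Longrightarrow> AE x in lborel. f x = g x \<Longrightarrow> sqint g"
  unfolding sqint_def
  by (elim conjE, intro conjI, assumption, rule integrable_cong_AE_imp[where g="\<lambda>x. (cmod (f x))\<^sup>2"]) auto

lemma inner_L2_cong_AE:
  "f \<in> borel_measurable borel \<Longrightarrow> f' \<in> borel_measurable borel \<Longrightarrow> g \<in> borel_measurable borel \<Longrightarrow> g' \<in> borel_measurable borel \<Longrightarrow>
   AE x in lborel. f x = f' x \<Longrightarrow> AE x in lborel. g x = g' x \<Longrightarrow> inner_L2 f g = inner_L2 f' g'"
  unfolding inner_L2_def by (rule integral_cong_AE) auto

lemma tendsto_truncations: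
  fixes f :: "real \<Rightarrow> complex"
  assumes f: "sqint f"
  shows "(\<lambda>n. nrm2 (\<lambda>x. f x - indicat_real {-real n..real n} x * f x)) \<longlonglongrightarrow> 0"
proof -
  note [measurable] = sqintD[OF f]
  have "(\<lambda>n. LINT x|lborel. (cmod (f x - indicat_real {-real n..real n} x * f x))\<^sup>2) \<longlonglongrightarrow> (LINT x::real|lborel. (0::real))"
  proof (rule lborel_dominated_convergence[where w="\<lambda>x. (cmod (f x))\<^sup>2"])
    fix x :: real
    obtain N where "\<bar>x\<bar> \<le> real N" using real_arch_simple by blast
    then have "\<forall>n\<ge>N. (cmod (f x - complex_of_real (indicat_real {-real n..real n} x) * f x))\<^sup>2 = 0"
      by (auto simp: indicator_def)
    then have "\<forall>\<^sub>F n in sequentially. (cmod (f x - complex_of_real (indicat_real {-real n..real n} x) * f x))\<^sup>2 = 0"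
      unfolding eventually_sequentially by blast
    then show "(\<lambda>n. (cmod (f x - complex_of_real (indicat_real {-real n..real n} x) * f x))\<^sup>2) \<longlonglongrightarrow> 0"
      by (rule tendsto_eventually)
  qed (use sqint_integrable[OF f] in \<open>auto simp: indicator_def\<close>)
  then show ?thesis by (simp add: nrm2_def)
qed

lemma integrable_trunc:
  fixes f :: "real \<Rightarrow> complex"
  assumes f: "sqint f" shows "integrable lborel (\<lambda>x. indicat_real {-a..a} x * f x)"
proof -
  have "sqint (\<lambda>x. complex_of_real (indicat_real {-a..a} x))"
  proof -
    have "(\<lambda>x. (cmod (complex_of_real (indicat_real {-a..a} x)))\<^sup>2) = indicat_real {-a..a}"
      by (auto simp: indicator_def)
    moreover have "integrable lborel (indicat_real {-a..a})" by (rule integrable_real_indicator) (auto simp: emeasure_lborel_Icc_eq)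
    ultimately show ?thesis unfolding sqint_def by simp
  qed
  from sqint_mult_integrable[OF this f] show ?thesis by simp
qed

lemma nrm2_nn: "sqint f \<Longrightarrow> (\<integral>\<^sup>+x. ennreal ((cmod (f x))\<^sup>2) \<partial>lborel) = ennreal (nrm2 f)"
  unfolding nrm2_def by (rule nn_integral_eq_integral) (auto simp: sqint_def)

text \<open>Membership in \<open>L\<^sup>2\<close> from a bound on the nonnegative integral, the form in which Fatou's lemma
  delivers it.\<close>

lemma sqint_nnI:
  assumes [measurable]: "f \<in> borel_measurable borel"
   and "(\<integral>\<^sup>+x. ennreal ((cmod (f x))\<^sup>2) \<partial>lborel) \<le> ennreal C" "C \<ge> 0"
  shows "sqint f" "nrm2 f \<le> C"
proof -
  have "(\<integral>\<^sup>+x. ennreal ((cmod (f x))\<^sup>2) \<partial>lborel) < \<infinity>" using assms(2)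
    by (simp add: le_less_trans)
  then show s: "sqint f" by (auto simp: sqint_def intro!: integrableI_bounded)
  show "nrm2 f \<le> C" using assms(2,3) unfolding nrm2_nn[OF s] by simp
qed

section \<open>The Fourier integral and Plancherel's identity\<close>

definition fourier_int :: "(real \<Rightarrow> complex) \<Rightarrow> real \<Rightarrow> complex" where
  "fourier_int f \<xi> = complex_of_real (1 / sqrt (2 * pi)) *
       (LINT y|lborel. f y * exp (- (\<i> * complex_of_real (y * \<xi>))))"

lemma cmod_kernel [simp]: "cmod (exp (- (\<i> * complex_of_real x))) = 1" "cmod (exp (\<i> * complex_of_real x)) = 1"
  by (auto simp: norm_exp_eq_Re)

lemma fourier_int_measurable [measurable]:
  assumes [measurable]: "f \<in> borel_measurable borel"
  shows "fourier_int f \<in> borel_measurable borel"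
  unfolding fourier_int_def by measurable

lemma fourier_int_integrand:
  assumes "integrable lborel f"
  shows "integrable lborel (\<lambda>y. f y * exp (- (\<i> * complex_of_real (y * \<xi>))))"
  by (rule Bochner_Integration.integrable_bound[OF assms]) (use borel_measurable_integrable[OF assms] in \<open>auto simp: norm_mult\<close>)

lemma fourier_int_bound:
  assumes "integrable lborel f"
  shows "cmod (fourier_int f \<xi>) \<le> (LINT y|lborel. cmod (f y)) / sqrt (2 * pi)"
proof -
  have "cmod (LINT y|lborel. f y * exp (- (\<i> * complex_of_real (y * \<xi>)))) \<le> (LINT y|lborel. cmod (f y * exp (- (\<i> * complex_of_real (y * \<xi>)))))"
    by (rule integral_norm_bound)
  then show ?thesis
    by (simp add: fourier_int_def norm_mult norm_divide divide_right_mono)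
qed

lemma fourier_int_diff:
  assumes f: "integrable lborel f" and g: "integrable lborel g"
  shows "fourier_int (\<lambda>x. f x - g x) \<xi> = fourier_int f \<xi> - fourier_int g \<xi>"
  using Bochner_Integration.integral_diff[OF fourier_int_integrand[OF f, of \<xi>] fourier_int_integrand[OF g, of \<xi>]]
  by (simp add: fourier_int_def left_diff_distrib diff_divide_distrib)

lemma fourier_int_cnj_reflect: "fourier_int (\<lambda>x. cnj (h (- x))) \<xi> = cnj (fourier_int h \<xi>)"
proof -
  have "(LINT y|lborel. cnj (h (- y)) * exp (- (\<i> * complex_of_real (y * \<xi>))))
     = (LINT y|lborel. cnj (h y) * exp (\<i> * complex_of_real (y * \<xi>)))"
    using lborel_integral_real_affine[of "-1" "\<lambda>y. cnj (h (- y)) * exp (- (\<i> * complex_of_real (y * \<xi>)))" 0] by simp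
  also have "\<dots> = (LINT y|lborel. cnj (h y * exp (- (\<i> * complex_of_real (y * \<xi>)))))"
    by (simp add: exp_cnj)
  also have "\<dots> = cnj (LINT y|lborel. h y * exp (- (\<i> * complex_of_real (y * \<xi>))))"
    by (rule Bochner_Integration.integral_cnj)
  finally show ?thesis by (simp add: fourier_int_def)
qed

lemma fourier_int_continuous:
  assumes f: "integrable lborel f"
  shows "continuous_on UNIV (fourier_int f)"
proof -
  note [measurable] = borel_measurable_integrable[OF f]
  have "isCont (fourier_int f) x" for x
    unfolding continuous_at_sequentially
  proof (intro allI impI)
    fix s :: "nat \<Rightarrow> real" assume s: "s \<longlonglongrightarrow> x"
    have "(\<lambda>n. LINT y|lborel. f y * exp (- (\<i> * complex_of_real (y * s n)))) \<longlonglongrightarrow> (LINT y|lborel. f y * exp (- (\<i> * complex_of_real (y * x))))"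
      by (rule lborel_dominated_convergence[where w="\<lambda>y. cmod (f y)"])
         (use f in \<open>auto simp: norm_mult intro!: tendsto_intros s\<close>)
    then show "(fourier_int f \<circ> s) \<longlonglongrightarrow> fourier_int f x"
      unfolding fourier_int_def comp_def by (intro tendsto_intros)
  qed
  then show ?thesis by (simp add: continuous_on_eq_continuous_at)
qed

lemma integrable_times_pair:
  fixes f h :: "real \<Rightarrow> complex"
  assumes f: "integrable lborel f" and h: "integrable lborel h"
    and [measurable]: "k \<in> borel_measurable (borel \<Otimes>\<^sub>M borel)" and k: "\<And>x. cmod (k x) \<le> 1"
  shows "integrable (lborel \<Otimes>\<^sub>M lborel) (\<lambda>(x, y). f x * h y * k (x, y))"
proof -
  note [measurable] = borel_measurable_integrable[OF f] borel_measurable_integrable[OF h]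
  have "integrable (lborel \<Otimes>\<^sub>M lborel) (\<lambda>(x, y). f x * h y)"
  proof (rule lborel_pair.Fubini_integrable)
    show "integrable lborel (\<lambda>x. LINT y|lborel. norm (case (x, y) of (x, y) \<Rightarrow> f x * h y))"
      using f by (simp add: norm_mult)
    show "AE x in lborel. integrable lborel (\<lambda>y. case (x, y) of (x, y) \<Rightarrow> f x * h y)"
      using h by simp
  qed measurable
  then show ?thesis
  proof (rule Bochner_Integration.integrable_bound)
    show "AE x in lborel \<Otimes>\<^sub>M lborel. norm (case x of (x, y) \<Rightarrow> f x * h y * k (x, y)) \<le> norm (case x of (x, y) \<Rightarrow> f x * h y)"
      using k by (auto simp: norm_mult intro!: mult_left_le AE_I2)
  qed measurable
qed

text \<open>Fubini: both sides are the double integral of \<open>f y * h \<xi>\<close> against the symmetric kernel.\<close>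

lemma multiplication_formula:
  assumes f: "integrable lborel f" and h: "integrable lborel h"
  shows "(LINT \<xi>|lborel. fourier_int f \<xi> * h \<xi>) = (LINT y|lborel. f y * fourier_int h y)"
proof -
  let ?c = "complex_of_real (1 / sqrt (2 * pi))"
  let ?k = "\<lambda>p::real \<times> real. exp (- (\<i> * complex_of_real (fst p * snd p)))"
  have i: "integrable (lborel \<Otimes>\<^sub>M lborel) (\<lambda>(x, y). f x * h y * ?k (x, y))"
    by (rule integrable_times_pair[OF f h]) auto
  have "(LINT \<xi>|lborel. fourier_int f \<xi> * h \<xi>) = ?c * (LINT \<xi>|lborel. (LINT y|lborel. f y * h \<xi> * ?k (y, \<xi>)))"
  proof -
    have "fourier_int f \<xi> * h \<xi> = ?c * (LINT y|lborel. f y * h \<xi> * ?k (y, \<xi>))" for \<xi>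
    proof -
      have "(LINT y|lborel. f y * h \<xi> * ?k (y, \<xi>)) = (LINT y|lborel. h \<xi> * (f y * ?k (y, \<xi>)))"
        by (simp add: mult_ac)
      also have "\<dots> = h \<xi> * (LINT y|lborel. f y * ?k (y, \<xi>))"
        by (rule integral_mult_right_zero)
      finally show ?thesis by (simp add: fourier_int_def)
    qed
    then show ?thesis by simp
  qed
  also have "\<dots> = ?c * (LINT y|lborel. (LINT \<xi>|lborel. f y * h \<xi> * ?k (y, \<xi>)))"
    using lborel_pair.Fubini_integral[OF i] by simp
  also have "\<dots> = (LINT y|lborel. f y * fourier_int h y)"
  proof -
    have "f y * fourier_int h y = ?c * (LINT \<xi>|lborel. f y * h \<xi> * ?k (y, \<xi>))" for y
    proof -
      have "(LINT \<xi>|lborel. f y * h \<xi> * ?k (y, \<xi>)) = (LINT \<xi>|lborel. f y * (h \<xi> * ?k (y, \<xi>)))"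
        by (simp add: mult_ac)
      also have "\<dots> = f y * (LINT \<xi>|lborel. h \<xi> * ?k (y, \<xi>))"
        by (rule integral_mult_right_zero)
      finally show ?thesis by (simp add: fourier_int_def mult.commute)
    qed
    then show ?thesis by simp
  qed
  finally show ?thesis .
qed

text \<open>The Gaussian is the characteristic function of the standard normal distribution.\<close>

lemma gaussian_integral:
  fixes \<epsilon> z :: real
  assumes e: "\<epsilon> > 0"
  shows "(LINT \<xi>|lborel. exp (\<i> * complex_of_real (z * \<xi>)) * complex_of_real (exp (- (\<epsilon> * \<xi>)\<^sup>2 / 2)))
     = complex_of_real (2 * pi / \<epsilon> * std_normal_density (z / \<epsilon>))"
proof -
  let ?t = "z / \<epsilon>"
  have "complex_of_real (exp (- (?t\<^sup>2) / 2)) = char std_normal_distribution ?t"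
    by (simp add: char_std_normal_distribution)
  also have "\<dots> = (LINT x|density lborel (\<lambda>x. ennreal (std_normal_density x)). iexp (?t * x))"
    by (simp add: char_def)
  also have "\<dots> = (LINT x|lborel. std_normal_density x *\<^sub>R iexp (?t * x))"
    by (subst integral_density) (auto simp: normal_density_nonneg)
  also have "\<dots> = \<bar>\<epsilon>\<bar> *\<^sub>R (LINT \<xi>|lborel. std_normal_density (0 + \<epsilon> * \<xi>) *\<^sub>R iexp (?t * (0 + \<epsilon> * \<xi>)))"
    by (rule lborel_integral_real_affine) (use e in simp)
  also have "\<dots> = \<bar>\<epsilon>\<bar> *\<^sub>R (LINT \<xi>|lborel. complex_of_real (1 / sqrt (2 * pi)) * (exp (\<i> * complex_of_real (z * \<xi>)) * complex_of_real (exp (- (\<epsilon> * \<xi>)\<^sup>2 / 2))))"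
    using e by (simp add: std_normal_density_def scaleR_conv_of_real mult_ac)
  also have "\<dots> = complex_of_real (\<epsilon> / sqrt (2 * pi)) * (LINT \<xi>|lborel. (exp (\<i> * complex_of_real (z * \<xi>)) * complex_of_real (exp (- (\<epsilon> * \<xi>)\<^sup>2 / 2))))"
    using e by (subst integral_mult_right_zero) (simp add: scaleR_conv_of_real)
  finally have *: "complex_of_real (exp (- (?t\<^sup>2) / 2)) = complex_of_real (\<epsilon> / sqrt (2 * pi)) * (LINT \<xi>|lborel. (exp (\<i> * complex_of_real (z * \<xi>)) * complex_of_real (exp (- (\<epsilon> * \<xi>)\<^sup>2 / 2))))" .
  have "2 * pi / \<epsilon> * std_normal_density (z / \<epsilon>) = sqrt (2 * pi) / \<epsilon> * exp (- (?t\<^sup>2) / 2)"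
  proof -
    have "2 * pi / \<epsilon> * std_normal_density (z / \<epsilon>) = (2 * pi / sqrt (2 * pi)) / \<epsilon> * exp (- (?t\<^sup>2) / 2)"
      by (simp add: std_normal_density_def)
    also have "2 * pi / sqrt (2 * pi) = sqrt (2 * pi)" by (rule real_div_sqrt) simp
    finally show ?thesis .
  qed
  then have "complex_of_real (2 * pi / \<epsilon> * std_normal_density (z / \<epsilon>)) = complex_of_real (sqrt (2 * pi) / \<epsilon>) * complex_of_real (exp (- (?t\<^sup>2) / 2))"
    by (simp only: of_real_mult)
  also have "\<dots> = complex_of_real (sqrt (2 * pi) / \<epsilon>) * complex_of_real (\<epsilon> / sqrt (2 * pi)) * (LINT \<xi>|lborel. (exp (\<i> * complex_of_real (z * \<xi>)) * complex_of_real (exp (- (\<epsilon> * \<xi>)\<^sup>2 / 2))))"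
    unfolding * by (simp only: mult.assoc)
  also have "complex_of_real (sqrt (2 * pi) / \<epsilon>) * complex_of_real (\<epsilon> / sqrt (2 * pi)) = 1"
    using e by (simp flip: of_real_mult)
  finally show ?thesis by simp
qed

lemma integrable_gaussian:
  fixes \<epsilon> :: real assumes "\<epsilon> > 0" shows "integrable lborel (\<lambda>\<xi>. exp (- (\<epsilon> * \<xi>)\<^sup>2 / 2))"
proof -
  have "integrable lborel (\<lambda>x. sqrt (2 * pi) * std_normal_density x)" by simp
  then have "integrable lborel (\<lambda>x::real. exp (- x\<^sup>2 / 2))" by (simp add: std_normal_density_def)
  from lborel_integrable_real_affine[OF this, of \<epsilon> 0] assms show ?thesis by simp
qed

text \<open>A Gaussian factor makes \<open>\<bar>fourier_int f\<bar>\<^sup>2\<close> integrable; the multiplication formula then moves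
  both transforms to the physical side, where the Gaussian becomes a normal density of width \<open>\<epsilon>\<close>. As
  \<open>\<epsilon> \<longrightarrow> 0\<close> the right-hand side tends to the norm of \<open>f\<close>, which is how Plancherel's identity follows.\<close>

lemma gaussian_plancherel:
  assumes f: "integrable lborel f" and e: "\<epsilon> > 0"
  shows "(LINT \<xi>|lborel. complex_of_real ((cmod (fourier_int f \<xi>))\<^sup>2 * exp (- (\<epsilon> * \<xi>)\<^sup>2 / 2)))
    = (LINT x|lborel. f x * cnj (LINT z|lborel. f (x - \<epsilon> * z) * complex_of_real (std_normal_density z)))"
proof -
  note [measurable] = borel_measurable_integrable[OF f]
  let ?G = "\<lambda>\<xi>. complex_of_real (exp (- (\<epsilon> * \<xi>)\<^sup>2 / 2))"
  let ?c = "complex_of_real (1 / sqrt (2 * pi))"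
  have G: "integrable lborel ?G" using integrable_gaussian[OF e] by simp
  let ?h = "\<lambda>\<xi>. cnj (fourier_int f \<xi>) * ?G \<xi>"
  let ?C = "(LINT y|lborel. cmod (f y)) / sqrt (2 * pi)"
  have h: "integrable lborel ?h"
  proof (rule Bochner_Integration.integrable_bound[OF integrable_mult_right[OF G, of "complex_of_real ?C"]])
    have C: "\<bar>?C\<bar> = ?C" by simp
    have "norm (?h \<xi>) \<le> norm (complex_of_real ?C * ?G \<xi>)" for \<xi>
      unfolding norm_mult norm_of_real C complex_mod_cnj
      by (intro mult_right_mono fourier_int_bound[OF f]) auto
    then show "AE \<xi> in lborel. norm (?h \<xi>) \<le> norm (complex_of_real ?C * ?G \<xi>)" by simp
  qed simp
  have Fh: "fourier_int ?h x = cnj (LINT z|lborel. f (x - \<epsilon> * z) * complex_of_real (std_normal_density z))" for x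
  proof -
    let ?g = "\<lambda>\<xi>. exp (\<i> * complex_of_real (x * \<xi>)) * ?G \<xi>"
    have g: "integrable lborel ?g"
      by (rule Bochner_Integration.integrable_bound[OF G]) (auto simp: norm_mult)
    have "(LINT \<xi>|lborel. ?h \<xi> * exp (- (\<i> * complex_of_real (\<xi> * x)))) = (LINT \<xi>|lborel. cnj (fourier_int f \<xi> * ?g \<xi>))"
      by (simp add: exp_cnj mult_ac)
    also have "\<dots> = cnj (LINT \<xi>|lborel. fourier_int f \<xi> * ?g \<xi>)"
      by (rule Bochner_Integration.integral_cnj)
    also have "(LINT \<xi>|lborel. fourier_int f \<xi> * ?g \<xi>) = (LINT y|lborel. f y * fourier_int ?g y)"
      by (rule multiplication_formula[OF f g])
    also have "\<dots> = (LINT y|lborel. complex_of_real (sqrt (2 * pi) / \<epsilon>) * (f y * complex_of_real (std_normal_density ((x - y) / \<epsilon>))))"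
    proof -
      have "fourier_int ?g y = complex_of_real (sqrt (2 * pi) / \<epsilon>) * complex_of_real (std_normal_density ((x - y) / \<epsilon>))" for y
      proof -
        have "(LINT \<xi>|lborel. ?g \<xi> * exp (- (\<i> * complex_of_real (\<xi> * y)))) = (LINT \<xi>|lborel. exp (\<i> * complex_of_real ((x - y) * \<xi>)) * ?G \<xi>)"
        proof (rule Bochner_Integration.integral_cong[OF refl])
          fix \<xi>
          have "exp (\<i> * complex_of_real ((x - y) * \<xi>)) = exp (\<i> * complex_of_real (x * \<xi>)) * exp (- (\<i> * complex_of_real (\<xi> * y)))"
            by (simp flip: exp_add add: algebra_simps)
          then show "?g \<xi> * exp (- (\<i> * complex_of_real (\<xi> * y))) = exp (\<i> * complex_of_real ((x - y) * \<xi>)) * ?G \<xi>"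
            by (simp only: mult_ac)
        qed
        also have "\<dots> = complex_of_real (2 * pi / \<epsilon> * std_normal_density ((x - y) / \<epsilon>))"
          by (rule gaussian_integral[OF e])
        finally have "fourier_int ?g y = ?c * complex_of_real (2 * pi / \<epsilon> * std_normal_density ((x - y) / \<epsilon>))"
          by (simp only: fourier_int_def)
        also have "\<dots> = complex_of_real (1 / sqrt (2 * pi) * (2 * pi) / \<epsilon> * std_normal_density ((x - y) / \<epsilon>))"
          by (simp only: of_real_mult of_real_divide times_divide_eq_right times_divide_eq_left mult_ac)
        also have "1 / sqrt (2 * pi) * (2 * pi) = sqrt (2 * pi)"
          by (simp add: real_div_sqrt)
        finally show ?thesis by simp
      qed
      then show ?thesis by (simp add: mult_ac)
    qed
    also have "\<dots> = complex_of_real (sqrt (2 * pi) / \<epsilon>) * (LINT y|lborel. f y * complex_of_real (std_normal_density ((x - y) / \<epsilon>)))"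
      by (rule integral_mult_right_zero)
    also have "(LINT y|lborel. f y * complex_of_real (std_normal_density ((x - y) / \<epsilon>))) =
        complex_of_real \<epsilon> * (LINT z|lborel. f (x - \<epsilon> * z) * complex_of_real (std_normal_density z))"
      using e lborel_integral_real_affine[of "- \<epsilon>" "\<lambda>y. f y * complex_of_real (std_normal_density ((x - y) / \<epsilon>))" x]
      by (simp add: scaleR_conv_of_real)
    finally have "fourier_int ?h x = ?c * cnj (complex_of_real (sqrt (2 * pi) / \<epsilon>) * (complex_of_real \<epsilon> * (LINT z|lborel. f (x - \<epsilon> * z) * complex_of_real (std_normal_density z))))"
      by (simp only: fourier_int_def)
    also have "\<dots> = (?c * complex_of_real (sqrt (2 * pi) / \<epsilon>) * complex_of_real \<epsilon>) * cnj (LINT z|lborel. f (x - \<epsilon> * z) * complex_of_real (std_normal_density z))"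
      by (simp only: complex_cnj_mult complex_cnj_complex_of_real mult_ac)
    also have "?c * complex_of_real (sqrt (2 * pi) / \<epsilon>) * complex_of_real \<epsilon> = 1"
      using e by (simp flip: of_real_mult)
    finally show ?thesis by simp
  qed
  have "(LINT \<xi>|lborel. complex_of_real ((cmod (fourier_int f \<xi>))\<^sup>2 * exp (- (\<epsilon> * \<xi>)\<^sup>2 / 2))) = (LINT \<xi>|lborel. fourier_int f \<xi> * ?h \<xi>)"
  proof (rule Bochner_Integration.integral_cong[OF refl])
    fix \<xi>
    show "complex_of_real ((cmod (fourier_int f \<xi>))\<^sup>2 * exp (- (\<epsilon> * \<xi>)\<^sup>2 / 2)) = fourier_int f \<xi> * ?h \<xi>"
      by (simp only: of_real_mult complex_norm_square mult.assoc)
  qed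
  also have "\<dots> = (LINT x|lborel. f x * fourier_int ?h x)" by (rule multiplication_formula[OF f h])
  finally show ?thesis by (simp only: Fh)
qed

lemma integrable_indicator_Icc: "integrable lborel (indicat_real {a..b::real})"
  by (rule integrable_real_indicator) (auto simp: emeasure_lborel_Icc_eq)

definition compactly_supported :: "(real \<Rightarrow> 'a::zero) \<Rightarrow> bool" where
  "compactly_supported g \<longleftrightarrow> (\<exists>R. \<forall>x. \<bar>x\<bar> > R \<longrightarrow> g x = 0)"

text \<open>Truncating domain and values gives a bounded function on a bounded interval. It is the
  pointwise limit almost everywhere of continuous functions, and these can be cut off in both ways
  without losing continuity, so that dominated convergence turns the pointwise limit into a limit in
  norm.\<close>

lemma continuous_dense:
  assumes f: "sqint f" and e: "e > 0"
  shows "\<exists>g. continuous_on UNIV g \<and> compactly_supported g \<and> sqint g \<and> sqrt (nrm2 (\<lambda>x. f x - g x)) < e"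
proof -
  note [measurable] = sqintD[OF f]
  define t where "t n x = (if \<bar>x\<bar> \<le> real n \<and> cmod (f x) \<le> real n then f x else 0)" for n x
  have t_meas [measurable]: "t n \<in> borel_measurable borel" for n unfolding t_def by measurable
  have "(\<lambda>n. LINT x|lborel. (cmod (f x - t n x))\<^sup>2) \<longlonglongrightarrow> (LINT x::real|lborel. (0::real))"
  proof (rule lborel_dominated_convergence[where w="\<lambda>x. (cmod (f x))\<^sup>2"])
    fix x :: real
    obtain N where "max \<bar>x\<bar> (cmod (f x)) \<le> real N" using real_arch_simple by blast
    then have "\<forall>n\<ge>N. (cmod (f x - t n x))\<^sup>2 = 0" by (auto simp: t_def)
    then have "\<forall>\<^sub>F n in sequentially. (cmod (f x - t n x))\<^sup>2 = 0"
      unfolding eventually_sequentially by blast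
    then show "(\<lambda>n. (cmod (f x - t n x))\<^sup>2) \<longlonglongrightarrow> 0" by (rule tendsto_eventually)
  qed (use sqint_integrable[OF f] in \<open>auto simp: t_def\<close>)
  then have "(\<lambda>n. sqrt (nrm2 (\<lambda>x. f x - t n x))) \<longlonglongrightarrow> 0"
    unfolding nrm2_def using tendsto_real_sqrt by fastforce
  then have "\<forall>\<^sub>F n in sequentially. sqrt (nrm2 (\<lambda>x. f x - t n x)) < e / 2"
    by (rule order_tendstoD(2)) (use e in simp)
  then obtain n where n: "sqrt (nrm2 (\<lambda>x. f x - t n x)) < e / 2"
    by (auto simp: eventually_sequentially)
  have st: "sqint (t n)" by (rule sqint_dominated[OF _ f, of _ 1]) (auto simp: t_def)
  have "t n measurable_on UNIV"
    using measurable_completion[of "t n" lborel borel] t_meas[of n]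
    by (subst measurable_on_iff_borel_measurable) (simp_all add: lebesgue_on_UNIV_eq)
  then obtain N g where N: "negligible N" and g: "\<And>k. continuous_on UNIV (g k)"
    and lim: "\<And>x. x \<notin> N \<Longrightarrow> (\<lambda>k. g k x) \<longlonglongrightarrow> t n x"
    unfolding measurable_on_def by auto
  \<comment> \<open>A continuous cutoff in space; dividing by the maximum in \<open>G\<close> cuts off the values at \<open>n + 1\<close>,
    and both act as the identity on the limit \<open>t n\<close>.\<close>
  define c :: "real \<Rightarrow> real" where "c x = max 0 (min 1 (real n + 1 - \<bar>x\<bar>))" for x
  define G where "G k x = complex_of_real (c x / max 1 (cmod (g k x) / (real n + 1))) * g k x" for k x
  have Gcont: "continuous_on UNIV (G k)" for k
    unfolding G_def c_def by (intro continuous_intros g) auto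
  have [measurable]: "G k \<in> borel_measurable borel" for k
    by (rule borel_measurable_continuous_onI[OF Gcont])
  have Gzero: "\<bar>x\<bar> > real n + 1 \<Longrightarrow> G k x = 0" for k x by (simp add: G_def c_def)
  have Gbound: "cmod (G k x) \<le> (real n + 1) * indicat_real {-(real n + 1)..real n + 1} x" for k x
  proof (cases "\<bar>x\<bar> > real n + 1")
    case True then show ?thesis using Gzero by (auto simp: indicator_def)
  next
    case False
    let ?m = "max 1 (cmod (g k x) / (real n + 1))"
    have "cmod (G k x) = c x * (cmod (g k x) / ?m)"
      by (simp add: G_def norm_mult norm_divide c_def)
    also have "\<dots> \<le> 1 * (cmod (g k x) / ?m)"
      by (intro mult_right_mono) (auto simp: c_def)
    also have "\<dots> \<le> real n + 1"
    proof -
      have "cmod (g k x) \<le> (real n + 1) * ?m"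
      proof -
        have "cmod (g k x) / (real n + 1) \<le> ?m" by (rule max.cobounded2)
        moreover have "0 < real n + 1" by simp
        ultimately have "cmod (g k x) \<le> ?m * (real n + 1)" by (simp only: pos_divide_le_eq)
        then show ?thesis by (simp only: mult.commute)
      qed
      then show ?thesis by (simp add: divide_le_eq)
    qed
    finally show ?thesis using False by (auto simp: indicator_def)
  qed
  have sG: "sqint (G k)" for k
  proof -
    have "integrable lborel (\<lambda>x. (real n + 1)\<^sup>2 * indicat_real {-(real n + 1)..real n + 1} x)"
      by (intro integrable_mult_right integrable_indicator_Icc)
    then have "integrable lborel (\<lambda>x. (cmod (G k x))\<^sup>2)"
    proof (rule Bochner_Integration.integrable_bound)
      have "(cmod (G k x))\<^sup>2 \<le> (real n + 1)\<^sup>2 * indicat_real {-(real n + 1)..real n + 1} x" for x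
        using power_mono[OF Gbound[of k x], of 2]
        by (auto simp: power_mult_distrib indicator_def split: if_splits)
      then show "AE x in lborel. norm ((cmod (G k x))\<^sup>2) \<le> norm ((real n + 1)\<^sup>2 * indicat_real {-(real n + 1)..real n + 1} x)"
        by simp
    qed simp
    then show ?thesis by (simp add: sqint_def)
  qed
  have Glim: "(\<lambda>k. G k x) \<longlonglongrightarrow> t n x" if "x \<notin> N" for x
  proof -
    have "(\<lambda>k. G k x) \<longlonglongrightarrow> complex_of_real (c x / max 1 (cmod (t n x) / (real n + 1))) * t n x"
      unfolding G_def by (intro tendsto_intros lim that) auto
    also have "complex_of_real (c x / max 1 (cmod (t n x) / (real n + 1))) * t n x = t n x"
      by (auto simp: c_def t_def max_def min_def field_simps)
    finally show ?thesis .
  qed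
  have "(\<lambda>k. LINT x|lborel. (cmod (t n x - G k x))\<^sup>2) \<longlonglongrightarrow> (LINT x::real|lborel. (0::real))"
  proof (rule Bochner_Integration.integral_dominated_convergence[where w="\<lambda>x. (2 * (real n + 1))\<^sup>2 * indicat_real {-(real n + 1)..real n + 1} x"])
    have "AE x in lborel. x \<notin> N"
      using N by (metis AE_not_in AE_completion_iff negligible_iff_null_sets)
    then show "AE x in lborel. (\<lambda>k. (cmod (t n x - G k x))\<^sup>2) \<longlonglongrightarrow> 0"
    proof eventually_elim
      case (elim x)
      have "(\<lambda>k. (cmod (t n x - G k x))\<^sup>2) \<longlonglongrightarrow> (cmod (t n x - t n x))\<^sup>2"
        by (intro tendsto_intros Glim elim)
      then show ?case by simp
    qed
    show "AE x in lborel. norm ((cmod (t n x - G k x))\<^sup>2) \<le> (2 * (real n + 1))\<^sup>2 * indicat_real {-(real n + 1)..real n + 1} x" for k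
    proof (rule AE_I2)
      fix x
      have "cmod (t n x) \<le> (real n + 1) * indicat_real {-(real n + 1)..real n + 1} x"
        by (auto simp: t_def indicator_def)
      then have "cmod (t n x - G k x) \<le> 2 * (real n + 1) * indicat_real {-(real n + 1)..real n + 1} x"
        using Gbound[of k x] norm_triangle_ineq4[of "t n x" "G k x"]
        by (cases "x \<in> {-(real n + 1)..real n + 1}") auto
      from power_mono[OF this, of 2]
      show "norm ((cmod (t n x - G k x))\<^sup>2) \<le> (2 * (real n + 1))\<^sup>2 * indicat_real {-(real n + 1)..real n + 1} x"
        by (auto simp: power_mult_distrib indicator_def split: if_splits)
    qed
  qed (auto intro!: integrable_indicator_Icc)
  then have "(\<lambda>k. sqrt (nrm2 (\<lambda>x. t n x - G k x))) \<longlonglongrightarrow> 0"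
    unfolding nrm2_def using tendsto_real_sqrt by fastforce
  then have "\<forall>\<^sub>F k in sequentially. sqrt (nrm2 (\<lambda>x. t n x - G k x)) < e / 2"
    by (rule order_tendstoD(2)) (use e in simp)
  then obtain k where k: "sqrt (nrm2 (\<lambda>x. t n x - G k x)) < e / 2"
    by (auto simp: eventually_sequentially)
  have "sqrt (nrm2 (\<lambda>x. f x - G k x)) < e"
    using minkowski_diff[OF f st sG[of k]] n k by linarith
  moreover have "compactly_supported (G k)"
    unfolding compactly_supported_def using Gzero by blast
  ultimately show ?thesis using Gcont sG by blast
qed

lemma translation_continuous_compact:
  assumes g: "continuous_on UNIV g" "compactly_supported g" and h: "h \<longlonglongrightarrow> (0::real)"
  shows "(\<lambda>k. nrm2 (\<lambda>x. g (x + h k) - g x)) \<longlonglongrightarrow> 0"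
proof -
  obtain R where R: "\<And>x. \<bar>x\<bar> > R \<Longrightarrow> g x = (0::complex)" using g(2) unfolding compactly_supported_def by blast
  have [measurable]: "g \<in> borel_measurable borel" by (rule borel_measurable_continuous_onI[OF g(1)])
  have "compact (g ` {-R..R})" by (rule compact_continuous_image) (auto intro: continuous_on_subset[OF g(1)])
  then obtain M where M: "\<And>x. x \<in> {-R..R} \<Longrightarrow> cmod (g x) \<le> M" 
    using compact_imp_bounded bounded_iff by (metis imageI)
  have gM: "cmod (g x) \<le> \<bar>M\<bar>" for x
  proof (cases "\<bar>x\<bar> > R")
    case True then show ?thesis using R[of x] by simp
  next
    case False
    then have "cmod (g x) \<le> M" by (intro M) auto
    then show ?thesis by linarith
  qed
  have "\<forall>\<^sub>F k in sequentially. \<bar>h k\<bar> < 1" using tendsto_rabs_zero[OF h] by (rule order_tendstoD(2)) simp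
  then obtain K where K: "\<And>k. k \<ge> K \<Longrightarrow> \<bar>h k\<bar> < 1" by (auto simp: eventually_sequentially)
  have "(\<lambda>k. LINT x|lborel. (cmod (g (x + h (k + K)) - g x))\<^sup>2) \<longlonglongrightarrow> (LINT x::real|lborel. (0::real))"
  proof (rule lborel_dominated_convergence[where w="\<lambda>x. (2 * \<bar>M\<bar>)\<^sup>2 * indicat_real {-(R + 1)..R + 1} x"])
    fix x :: real and k :: nat
    have "(\<lambda>k. (cmod (g (x + h (k + K)) - g x))\<^sup>2) \<longlonglongrightarrow> (cmod (g (x + 0) - g x))\<^sup>2"
    proof -
      have "isCont g x" using g(1) by (simp add: continuous_on_eq_continuous_at)
      then have "(\<lambda>k. g (x + h (k + K))) \<longlonglongrightarrow> g (x + 0)"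
        by (intro isCont_tendsto_compose[of "x + 0" g]) (auto intro!: tendsto_eq_intros LIMSEQ_ignore_initial_segment[OF h])
      then show ?thesis by (intro tendsto_intros)
    qed
    then show "(\<lambda>k. (cmod (g (x + h (k + K)) - g x))\<^sup>2) \<longlonglongrightarrow> 0" by simp
    show "norm ((cmod (g (x + h (k + K)) - g x))\<^sup>2) \<le> (2 * \<bar>M\<bar>)\<^sup>2 * indicat_real {-(R + 1)..R + 1} x"
    proof (cases "\<bar>x\<bar> \<le> R + 1")
      case True
      have "cmod (g (x + h (k + K)) - g x) \<le> 2 * \<bar>M\<bar>"
        using gM[of "x + h (k + K)"] gM[of x] norm_triangle_ineq4[of "g (x + h (k + K))" "g x"] by linarith
      from power_mono[OF this, of 2] show ?thesis using True by (auto simp: indicator_def)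
    next
      case False
      then have "g x = 0" "g (x + h (k + K)) = 0" using K[of "k + K"] by (auto intro!: R)
      then show ?thesis by simp
    qed
  qed (auto intro!: integrable_indicator_Icc)
  then have "(\<lambda>k. nrm2 (\<lambda>x. g (x + h (k + K)) - g x)) \<longlonglongrightarrow> 0" by (simp add: nrm2_def)
  then show ?thesis by (rule LIMSEQ_offset)
qed

text \<open>Translations are isometries, so it suffices to treat a dense class of functions, and for
  continuous functions of compact support the claim is uniform continuity.\<close>

lemma translation_continuous:
  assumes f: "sqint f" and h: "h \<longlonglongrightarrow> (0::real)"
  shows "(\<lambda>k. sqrt (nrm2 (\<lambda>x. f (x + h k) - f x))) \<longlonglongrightarrow> 0"
proof (rule LIMSEQ_I)
  fix r :: real assume r: "r > 0"
  obtain g where g: "continuous_on UNIV g" "compactly_supported g" "sqint g" "sqrt (nrm2 (\<lambda>x. f x - g x)) < r / 3"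
    using continuous_dense[OF f, of "r / 3"] r by auto
  have "(\<lambda>k. sqrt (nrm2 (\<lambda>x. g (x + h k) - g x))) \<longlonglongrightarrow> 0"
    using tendsto_real_sqrt[OF translation_continuous_compact[OF g(1,2) h]] by simp
  then have "\<forall>\<^sub>F k in sequentially. sqrt (nrm2 (\<lambda>x. g (x + h k) - g x)) < r / 3"
    by (rule order_tendstoD(2)) (use r in simp)
  then obtain K where K: "\<And>k. k \<ge> K \<Longrightarrow> sqrt (nrm2 (\<lambda>x. g (x + h k) - g x)) < r / 3"
    by (auto simp: eventually_sequentially)
  have "sqrt (nrm2 (\<lambda>x. f (x + h k) - f x)) < r" if "k \<ge> K" for k
  proof -
    have "sqrt (nrm2 (\<lambda>x. f (x + h k) - f x)) \<le> sqrt (nrm2 (\<lambda>x. f (x + h k) - g (x + h k))) + sqrt (nrm2 (\<lambda>x. g (x + h k) - f x))"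
      by (rule minkowski_diff[OF sqint_shift[OF f] sqint_shift[OF g(3)] f])
    moreover have "sqrt (nrm2 (\<lambda>x. g (x + h k) - f x)) \<le> sqrt (nrm2 (\<lambda>x. g (x + h k) - g x)) + sqrt (nrm2 (\<lambda>x. g x - f x))"
      by (rule minkowski_diff[OF sqint_shift[OF g(3)] g(3) f])
    moreover have "nrm2 (\<lambda>x. f (x + h k) - g (x + h k)) = nrm2 (\<lambda>x. f x - g x)"
      using nrm2_shift[of "\<lambda>x. f x - g x" "h k"] by simp
    moreover have "nrm2 (\<lambda>x. g x - f x) = nrm2 (\<lambda>x. f x - g x)" by (rule nrm2_minus_commute)
    ultimately show ?thesis using g(4) K[OF that] by simp
  qed
  then show "\<exists>no. \<forall>n\<ge>no. norm (sqrt (nrm2 (\<lambda>x. f (x + h n) - f x)) - 0) < r" by auto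
qed

text \<open>The regularized energies \<open>Q j\<close> of \<open>fourier_int f\<close> are averages, over a normal variable \<open>z\<close>, of
  the correlation of \<open>f\<close> with its translate by \<open>e j * z\<close>. Continuity of translations sends them to
  the norm of \<open>f\<close>; Fatou's lemma and dominated convergence identify the limit on the Fourier side.\<close>

theorem plancherel:
  assumes f: "sqint f" and fi: "integrable lborel f"
  shows "sqint (fourier_int f)" "nrm2 (fourier_int f) = nrm2 f"
proof -
  note [measurable] = sqintD[OF f]
  define e :: "nat \<Rightarrow> real" where "e j = 1 / real (Suc j)" for j
  have e: "e j > 0" for j by (simp add: e_def)
  have e0: "e \<longlonglongrightarrow> 0" unfolding e_def using LIMSEQ_inverse_real_of_nat by (simp add: inverse_eq_divide)
  define Q where "Q j = (LINT \<xi>|lborel. (cmod (fourier_int f \<xi>))\<^sup>2 * exp (- (e j * \<xi>)\<^sup>2 / 2))" for j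
  let ?n = std_normal_density
  have Qint: "integrable lborel (\<lambda>\<xi>. (cmod (fourier_int f \<xi>))\<^sup>2 * exp (- (e j * \<xi>)\<^sup>2 / 2))" for j
  proof (rule Bochner_Integration.integrable_bound)
    let ?C = "((LINT y|lborel. cmod (f y)) / sqrt (2 * pi))\<^sup>2"
    show "integrable lborel (\<lambda>\<xi>. ?C * exp (- (e j * \<xi>)\<^sup>2 / 2))"
      by (intro integrable_mult_right integrable_gaussian e)
    have "(cmod (fourier_int f \<xi>))\<^sup>2 \<le> ?C" for \<xi> by (intro power_mono fourier_int_bound[OF fi]) auto
    then have "(cmod (fourier_int f \<xi>))\<^sup>2 * exp (- (e j * \<xi>)\<^sup>2 / 2) \<le> ?C * exp (- (e j * \<xi>)\<^sup>2 / 2)" for \<xi>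
      by (rule mult_right_mono) simp
    then show "AE \<xi> in lborel. norm ((cmod (fourier_int f \<xi>))\<^sup>2 * exp (- (e j * \<xi>)\<^sup>2 / 2)) \<le> norm (?C * exp (- (e j * \<xi>)\<^sup>2 / 2))"
      by (intro AE_I2) simp
  qed measurable
  \<comment> \<open>The inner integrals are correlations with translates; Fubini lets the normal variable be
    integrated last.\<close>
  have Qeq: "complex_of_real (Q j) = (LINT z|lborel. complex_of_real (?n z) * inner_L2 f (\<lambda>x. f (x - e j * z)))" for j
  proof -
    have "complex_of_real (Q j) = (LINT x|lborel. f x * cnj (LINT z|lborel. f (x - e j * z) * complex_of_real (?n z)))"
      unfolding Q_def gaussian_plancherel[OF fi e[of j], symmetric] by (rule integral_of_real[OF Qint, symmetric])
    also have "\<dots> = (LINT x|lborel. LINT z|lborel. f x * cnj (f (x - e j * z)) * complex_of_real (?n z))"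
    proof (rule Bochner_Integration.integral_cong[OF refl])
      fix x
      have "f x * cnj (LINT z|lborel. f (x - e j * z) * complex_of_real (?n z)) = f x * (LINT z|lborel. cnj (f (x - e j * z) * complex_of_real (?n z)))"
        by (subst Bochner_Integration.integral_cnj) rule
      also have "\<dots> = (LINT z|lborel. f x * cnj (f (x - e j * z) * complex_of_real (?n z)))"
        by (rule integral_mult_right_zero[symmetric])
      finally show "f x * cnj (LINT z|lborel. f (x - e j * z) * complex_of_real (?n z)) = (LINT z|lborel. f x * cnj (f (x - e j * z)) * complex_of_real (?n z))"
        by (simp add: mult_ac)
    qed
    also have "\<dots> = (LINT z|lborel. LINT x|lborel. f x * cnj (f (x - e j * z)) * complex_of_real (?n z))"
    proof (rule lborel_pair.Fubini_integral[symmetric])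
      have "integrable (lborel \<Otimes>\<^sub>M lborel) (\<lambda>(z, x). f x * cnj (f (x - e j * z)) * complex_of_real (?n z))"
      proof (rule lborel_pair.Fubini_integrable)
        have sh: "sqint (\<lambda>x. f (x - e j * z))" for z using sqint_shift[OF f, of "- (e j * z)"] by simp
        have nsh: "nrm2 (\<lambda>x. f (x - e j * z)) = nrm2 f" for z using nrm2_shift[of f "- (e j * z)"] by simp
        show "AE z in lborel. integrable lborel (\<lambda>x. case (z, x) of (z, x) \<Rightarrow> f x * cnj (f (x - e j * z)) * complex_of_real (?n z))"
          using inner_L2_integrable[OF f sh] by auto
        have "integrable lborel (\<lambda>z. ?n z * nrm2 f)" by simp
        then show "integrable lborel (\<lambda>z. LINT x|lborel. norm (case (z, x) of (z, x) \<Rightarrow> f x * cnj (f (x - e j * z)) * complex_of_real (?n z)))"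
        proof (rule Bochner_Integration.integrable_bound)
          have "(LINT x|lborel. norm (f x * cnj (f (x - e j * z)) * complex_of_real (?n z))) \<le> ?n z * nrm2 f" for z
          proof -
            have "(LINT x|lborel. norm (f x * cnj (f (x - e j * z)) * complex_of_real (?n z))) = (LINT x|lborel. ?n z * cmod (f x * cnj (f (x - e j * z))))"
              by (simp add: norm_mult normal_density_nonneg mult_ac)
            also have "\<dots> = ?n z * (LINT x|lborel. cmod (f x * cnj (f (x - e j * z))))"
              by (rule integral_mult_right_zero)
            also have "\<dots> \<le> ?n z * (sqrt (nrm2 f) * sqrt (nrm2 (\<lambda>x. cnj (f (x - e j * z)))))"
              by (intro mult_left_mono cauchy_schwarz f sqint_cnj sh) (simp add: normal_density_nonneg)
            also have "\<dots> = ?n z * nrm2 f" by (simp add: nsh)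
            finally show ?thesis .
          qed
          then show "AE z in lborel. norm (LINT x|lborel. norm (case (z, x) of (z, x) \<Rightarrow> f x * cnj (f (x - e j * z)) * complex_of_real (?n z))) \<le> norm (?n z * nrm2 f)"
            by (intro AE_I2) (simp add: normal_density_nonneg)
        qed measurable
      qed measurable
      then show "integrable (lborel \<Otimes>\<^sub>M lborel) (\<lambda>(x, z). f x * cnj (f (x - e j * z)) * complex_of_real (?n z))"
        by (subst (asm) lborel_pair.integrable_product_swap_iff[symmetric]) simp
    qed
    also have "\<dots> = (LINT z|lborel. complex_of_real (?n z) * inner_L2 f (\<lambda>x. f (x - e j * z)))"
      unfolding inner_L2_def by (subst integral_mult_right_zero[symmetric]) (simp add: mult.commute)
    finally show ?thesis .
  qed
  have conv: "(\<lambda>j. inner_L2 f (\<lambda>x. f (x - e j * z))) \<longlonglongrightarrow> inner_L2 f f" for z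
  proof -
    have sh: "sqint (\<lambda>x. f (x - e j * z))" for j using sqint_shift[OF f, of "- (e j * z)"] by simp
    have "(\<lambda>j. - (e j * z)) \<longlonglongrightarrow> 0" using e0 by (auto intro!: tendsto_eq_intros)
    from translation_continuous[OF f this]
    have t: "(\<lambda>j. sqrt (nrm2 f) * sqrt (nrm2 (\<lambda>x. f (x - e j * z) - f x))) \<longlonglongrightarrow> 0"
      by (intro tendsto_mult_right_zero) simp
    have "(\<lambda>j. inner_L2 f (\<lambda>x. f (x - e j * z)) - inner_L2 f f) \<longlonglongrightarrow> 0"
    proof (rule Lim_null_comparison[OF _ t], intro always_eventually allI)
      fix j
      have "inner_L2 f (\<lambda>x. f (x - e j * z)) - inner_L2 f f = inner_L2 f (\<lambda>x. f (x - e j * z) - f x)"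
        by (rule inner_L2_diff_right[OF sh f f, symmetric])
      then show "norm (inner_L2 f (\<lambda>x. f (x - e j * z)) - inner_L2 f f) \<le> sqrt (nrm2 f) * sqrt (nrm2 (\<lambda>x. f (x - e j * z) - f x))"
        using cauchy_schwarz_inner[OF f sqint_diff[OF sh f]] by simp
    qed
    then show ?thesis by (simp add: LIM_zero_iff)
  qed
  have "(\<lambda>j. LINT z|lborel. complex_of_real (?n z) * inner_L2 f (\<lambda>x. f (x - e j * z))) \<longlonglongrightarrow> (LINT z|lborel. complex_of_real (?n z) * inner_L2 f f)"
  proof (rule lborel_dominated_convergence[where w="\<lambda>z. ?n z * nrm2 f"])
    show "norm (complex_of_real (?n z) * inner_L2 f (\<lambda>x. f (x - e j * z))) \<le> ?n z * nrm2 f" for j z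
    proof -
      have sh: "sqint (\<lambda>x. f (x - e j * z))" using sqint_shift[OF f, of "- (e j * z)"] by simp
      have nsh: "nrm2 (\<lambda>x. f (x - e j * z)) = nrm2 f" using nrm2_shift[of f "- (e j * z)"] by simp
      show ?thesis using cauchy_schwarz_inner[OF f sh] unfolding nsh
        by (simp add: norm_mult normal_density_nonneg mult_left_mono)
    qed
    show "(\<lambda>z. complex_of_real (?n z) * inner_L2 f (\<lambda>x. f (x - e j * z))) \<in> borel_measurable borel" for j
      unfolding inner_L2_def by measurable
  qed (auto intro!: tendsto_intros conv)
  also have "(LINT z|lborel. complex_of_real (?n z) * inner_L2 f f) = (LINT z|lborel. complex_of_real (?n z)) * inner_L2 f f"
    by (rule integral_mult_left_zero)
  also have "(LINT z|lborel. complex_of_real (?n z)) = 1"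
    using integral_std_normal_moment_even[of 0] by simp
  finally have "(\<lambda>j. complex_of_real (Q j)) \<longlonglongrightarrow> complex_of_real (nrm2 f)"
    by (simp only: Qeq inner_L2_self mult_1)
  then have Q: "Q \<longlonglongrightarrow> nrm2 f" by (simp only: tendsto_of_real_iff)
  have exp_lim: "(\<lambda>j. (cmod (fourier_int f \<xi>))\<^sup>2 * exp (- (e j * \<xi>)\<^sup>2 / 2)) \<longlonglongrightarrow> (cmod (fourier_int f \<xi>))\<^sup>2" for \<xi>
  proof -
    have "(\<lambda>j. (cmod (fourier_int f \<xi>))\<^sup>2 * exp (- (e j * \<xi>)\<^sup>2 / 2)) \<longlonglongrightarrow> (cmod (fourier_int f \<xi>))\<^sup>2 * exp (- (0 * \<xi>)\<^sup>2 / 2)"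
      by (intro tendsto_intros e0) auto
    then show ?thesis by simp
  qed
  \<comment> \<open>Fatou first: it shows that \<open>fourier_int f\<close> is square-integrable, the domination needed for the
    equality of norms.\<close>
  have "(\<integral>\<^sup>+\<xi>. ennreal ((cmod (fourier_int f \<xi>))\<^sup>2) \<partial>lborel) = (\<integral>\<^sup>+\<xi>. liminf (\<lambda>j. ennreal ((cmod (fourier_int f \<xi>))\<^sup>2 * exp (- (e j * \<xi>)\<^sup>2 / 2))) \<partial>lborel)"
    by (intro nn_integral_cong lim_imp_Liminf[symmetric] tendsto_ennrealI exp_lim) simp
  also have "\<dots> \<le> liminf (\<lambda>j. \<integral>\<^sup>+\<xi>. ennreal ((cmod (fourier_int f \<xi>))\<^sup>2 * exp (- (e j * \<xi>)\<^sup>2 / 2)) \<partial>lborel)"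
    by (rule nn_integral_liminf) measurable
  also have "\<dots> = liminf (\<lambda>j. ennreal (Q j))"
    unfolding Q_def by (subst nn_integral_eq_integral[OF Qint]) auto
  also have "\<dots> = ennreal (nrm2 f)"
    by (intro lim_imp_Liminf tendsto_ennrealI Q) simp
  finally show s: "sqint (fourier_int f)" using sqint_nnI(1)[of "fourier_int f" "nrm2 f"] by simp
  have "Q \<longlonglongrightarrow> (LINT \<xi>|lborel. (cmod (fourier_int f \<xi>))\<^sup>2)"
    unfolding Q_def
    by (rule lborel_dominated_convergence[where w="\<lambda>\<xi>. (cmod (fourier_int f \<xi>))\<^sup>2"])
       (rule exp_lim, auto simp: sqint_integrable[OF s] intro!: mult_left_le)
  then show "nrm2 (fourier_int f) = nrm2 f" using LIMSEQ_unique[OF Q] by (simp add: nrm2_def)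
qed

section \<open>The Fourier transform of square-integrable functions\<close>

lemma tendsto_integral_mult:
  assumes F: "\<And>n. sqint (F n)" and f: "sqint f" and h: "sqint h"
    and lim: "(\<lambda>n. nrm2 (\<lambda>x. F n x - f x)) \<longlonglongrightarrow> 0"
  shows "(\<lambda>n. LINT x|lborel. F n x * h x) \<longlonglongrightarrow> (LINT x|lborel. f x * h x)"
proof -
  have t: "(\<lambda>n. sqrt (nrm2 (\<lambda>x. F n x - f x)) * sqrt (nrm2 h)) \<longlonglongrightarrow> 0"
    using tendsto_real_sqrt[OF lim] by (auto intro: tendsto_mult_left_zero)
  have "(\<lambda>n. (LINT x|lborel. F n x * h x) - (LINT x|lborel. f x * h x)) \<longlonglongrightarrow> 0"
  proof (rule Lim_null_comparison[OF _ t], intro always_eventually allI)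
    fix n
    have "(LINT x|lborel. F n x * h x) - (LINT x|lborel. f x * h x) = (LINT x|lborel. F n x * h x - f x * h x)"
      by (rule Bochner_Integration.integral_diff[symmetric]) (intro sqint_mult_integrable F f h)+
    also have "\<dots> = (LINT x|lborel. (F n x - f x) * h x)" by (simp only: left_diff_distrib)
    finally show "norm ((LINT x|lborel. F n x * h x) - (LINT x|lborel. f x * h x)) \<le> sqrt (nrm2 (\<lambda>x. F n x - f x)) * sqrt (nrm2 h)"
      using cauchy_schwarz_mult[OF sqint_diff[OF F f] h] by simp
  qed
  then show ?thesis by (simp add: LIM_zero_iff)
qed

lemma tendsto_nrm2:
  assumes F: "\<And>n. sqint (F n)" and f: "sqint f" and lim: "(\<lambda>n. nrm2 (\<lambda>x. F n x - f x)) \<longlonglongrightarrow> 0"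
  shows "(\<lambda>n. nrm2 (F n)) \<longlonglongrightarrow> nrm2 f"
proof -
  have t: "(\<lambda>n. sqrt (nrm2 (\<lambda>x. F n x - f x))) \<longlonglongrightarrow> 0"
    using tendsto_real_sqrt[OF lim] by simp
  have "(\<lambda>n. sqrt (nrm2 (F n)) - sqrt (nrm2 f)) \<longlonglongrightarrow> 0"
    by (rule Lim_null_comparison[OF _ t], intro always_eventually allI)
       (use nrm2_triangle_abs[OF F f] in simp)
  then have "(\<lambda>n. sqrt (nrm2 (F n))) \<longlonglongrightarrow> sqrt (nrm2 f)" by (simp add: LIM_zero_iff)
  from tendsto_power[OF this, of 2] show ?thesis by simp
qed

text \<open>Riesz--Fischer. Along a subsequence with increments of squared norm at most \<open>(1/4)^k\<close>, the
  series of the squared increments weighted by \<open>2^k\<close> has a finite integral, hence is finite almost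
  everywhere, and the increments decay geometrically there.\<close>

theorem sqint_complete:
  assumes F: "\<And>n. sqint (F n)"
    and cauchy: "\<And>e. e > 0 \<Longrightarrow> \<exists>N. \<forall>m\<ge>N. \<forall>n\<ge>N. nrm2 (\<lambda>x. F m x - F n x) < e"
  shows "\<exists>g. sqint g \<and> (\<lambda>n. nrm2 (\<lambda>x. F n x - g x)) \<longlonglongrightarrow> 0"
proof -
  note [measurable] = sqintD[OF F]
  have "\<forall>k. \<exists>N. \<forall>m\<ge>N. \<forall>n\<ge>N. nrm2 (\<lambda>x. F m x - F n x) < (1/4)^k"
    using cauchy by simp
  then have "\<exists>N. \<forall>k. \<forall>m\<ge>N k. \<forall>n\<ge>N k. nrm2 (\<lambda>x. F m x - F n x) < (1/4)^k"
    by (rule choice)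
  then obtain N where N: "\<And>k m n. m \<ge> N k \<Longrightarrow> n \<ge> N k \<Longrightarrow> nrm2 (\<lambda>x. F m x - F n x) < (1/4)^k"
    by blast
  \<comment> \<open>Adding \<open>k\<close> and all earlier thresholds makes \<open>r\<close> monotone and unbounded.\<close>
  define r :: "nat \<Rightarrow> nat" where "r k = k + (\<Sum>j\<le>k. N j)" for k
  have rN: "r k \<ge> N k" for k using member_le_sum[of k "{..k}" N] by (simp add: r_def)
  have rk: "r k \<ge> k" for k by (simp add: r_def)
  have rmono: "r k \<le> r (Suc k)" for k by (simp add: r_def)
  define d where "d k x = F (r (Suc k)) x - F (r k) x" for k x
  have [measurable]: "d k \<in> borel_measurable borel" for k unfolding d_def by measurable
  have dn: "nrm2 (d k) \<le> (1/4)^k" for k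
    unfolding d_def
    by (rule less_imp_le[OF N]) (use rN[of k] rmono[of k] in simp_all)
  have ds: "sqint (d k)" for k unfolding d_def by (intro sqint_diff F)
  have "(\<integral>\<^sup>+x. (\<Sum>k. ennreal (2^k * (cmod (d k x))\<^sup>2)) \<partial>lborel) = (\<Sum>k. \<integral>\<^sup>+x. ennreal (2^k * (cmod (d k x))\<^sup>2) \<partial>lborel)"
    by (rule nn_integral_suminf) measurable
  also have "\<dots> \<le> (\<Sum>k. ennreal ((1/2)^k))"
  proof (rule suminf_le)
    fix k :: nat
    have "(\<integral>\<^sup>+x. ennreal (2^k * (cmod (d k x))\<^sup>2) \<partial>lborel) = ennreal (2^k) * ennreal (nrm2 (d k))"
      by (simp add: ennreal_mult nn_integral_cmult nrm2_nn[OF ds])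
    also have "\<dots> = ennreal (2^k * nrm2 (d k))" by (simp add: ennreal_mult)
    also have "\<dots> \<le> ennreal (2^k * (1/4)^k)" by (intro ennreal_leI mult_left_mono dn) simp
    also have "(2::real)^k * (1/4)^k = (1/2)^k" by (simp flip: power_mult_distrib)
    finally show "(\<integral>\<^sup>+x. ennreal (2^k * (cmod (d k x))\<^sup>2) \<partial>lborel) \<le> ennreal ((1/2)^k)" .
  qed auto
  also have "\<dots> = ennreal (\<Sum>k. (1/2::real)^k)"
    by (rule suminf_ennreal2) (auto intro: summable_geometric)
  also have "\<dots> < \<infinity>" by simp
  finally have "(\<integral>\<^sup>+x. (\<Sum>k. ennreal (2^k * (cmod (d k x))\<^sup>2)) \<partial>lborel) \<noteq> \<infinity>" by simp
  then have "AE x in lborel. (\<Sum>k. ennreal (2^k * (cmod (d k x))\<^sup>2)) \<noteq> \<infinity>"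
    by (intro nn_integral_noteq_infinite) measurable
  then have conv: "AE x in lborel. convergent (\<lambda>k. F (r k) x)"
  proof eventually_elim
    case (elim x)
    obtain C where C: "(\<Sum>k. ennreal (2^k * (cmod (d k x))\<^sup>2)) = ennreal C" "C \<ge> 0"
    proof (cases "\<Sum>k. ennreal (2^k * (cmod (d k x))\<^sup>2)" rule: ennreal_cases)
      case (real r) then show ?thesis by (intro that)
    next
      case top then show ?thesis using elim by (simp only: infinity_ennreal_def)
    qed
    have le: "cmod (d k x) \<le> sqrt C * (1 / sqrt 2)^k" for k
    proof -
      have "ennreal (2^k * (cmod (d k x))\<^sup>2) \<le> ennreal C"
        using sum_le_suminf[of "\<lambda>k. ennreal (2^k * (cmod (d k x))\<^sup>2)" "{k}"] by (simp only: C(1)) simp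
      then have "2^k * (cmod (d k x))\<^sup>2 \<le> C" using C(2) by (simp only: ennreal_le_iff)
      then have "(cmod (d k x))\<^sup>2 \<le> C / 2^k" by (simp add: pos_le_divide_eq mult.commute)
      then have "cmod (d k x) \<le> sqrt (C / 2^k)" by (rule real_le_rsqrt)
      then show ?thesis by (simp only: real_sqrt_divide real_sqrt_power power_divide power_one times_divide_eq_right mult_1_right)
    qed
    have "summable (\<lambda>k. d k x)"
    proof (rule summable_comparison_test)
      show "\<exists>N. \<forall>n\<ge>N. norm (d n x) \<le> sqrt C * (1 / sqrt 2)^n" using le by auto
      show "summable (\<lambda>n. sqrt C * (1 / sqrt 2)^n)"
        by (intro summable_mult summable_geometric) (simp add: real_sqrt_gt_1_iff)
    qed
    then have "(\<lambda>n. \<Sum>k<n. d k x) \<longlonglongrightarrow> (\<Sum>k. d k x)" by (rule summable_LIMSEQ)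
    then have "(\<lambda>n. F (r 0) x + (\<Sum>k<n. d k x)) \<longlonglongrightarrow> F (r 0) x + (\<Sum>k. d k x)" by (intro tendsto_intros)
    moreover have "F (r 0) x + (\<Sum>k<n. d k x) = F (r n) x" for n
      unfolding d_def by (subst sum_lessThan_telescope) simp
    ultimately show ?case by (auto simp: convergent_def)
  qed
  define g where "g x = lim (\<lambda>k. F (r k) x)" for x
  have [measurable]: "g \<in> borel_measurable borel" unfolding g_def by measurable
  \<comment> \<open>Fatou's lemma along the subsequence transfers the Cauchy estimate to the limit.\<close>
  have est: "sqint (\<lambda>x. F n x - g x) \<and> nrm2 (\<lambda>x. F n x - g x) \<le> e"
    if e: "e > 0" and n: "\<And>m. m \<ge> n \<Longrightarrow> nrm2 (\<lambda>x. F n x - F m x) < e" for n e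
  proof -
    have "(\<integral>\<^sup>+x. ennreal ((cmod (F n x - g x))\<^sup>2) \<partial>lborel) = (\<integral>\<^sup>+x. liminf (\<lambda>k. ennreal ((cmod (F n x - F (r k) x))\<^sup>2)) \<partial>lborel)"
    proof (rule nn_integral_cong_AE)
      show "AE x in lborel. ennreal ((cmod (F n x - g x))\<^sup>2) = liminf (\<lambda>k. ennreal ((cmod (F n x - F (r k) x))\<^sup>2))"
        using conv
      proof eventually_elim
        case (elim x)
        then have "(\<lambda>k. F (r k) x) \<longlonglongrightarrow> g x" unfolding g_def by (simp add: convergent_LIMSEQ_iff)
        then have "(\<lambda>k. ennreal ((cmod (F n x - F (r k) x))\<^sup>2)) \<longlonglongrightarrow> ennreal ((cmod (F n x - g x))\<^sup>2)"
          by (intro tendsto_ennrealI tendsto_intros)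
        from lim_imp_Liminf[OF trivial_limit_sequentially this] show ?case by (rule sym)
      qed
    qed
    also have "\<dots> \<le> liminf (\<lambda>k. \<integral>\<^sup>+x. ennreal ((cmod (F n x - F (r k) x))\<^sup>2) \<partial>lborel)"
      by (rule nn_integral_liminf) measurable
    also have "\<dots> = liminf (\<lambda>k. ennreal (nrm2 (\<lambda>x. F n x - F (r k) x)))"
      by (simp add: nrm2_nn sqint_diff F)
    also have "\<dots> \<le> ennreal e"
    proof (rule Liminf_le)
      have "nrm2 (\<lambda>x. F n x - F (r k) x) \<le> e" if "k \<ge> n" for k
        by (rule less_imp_le[OF n]) (use rk[of k] that in linarith)
      then show "\<forall>\<^sub>F k in sequentially. ennreal (nrm2 (\<lambda>x. F n x - F (r k) x)) \<le> ennreal e"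
        unfolding eventually_sequentially by (auto intro!: ennreal_leI)
    qed simp
    finally show ?thesis using sqint_nnI[of "\<lambda>x. F n x - g x" e] e by simp
  qed
  obtain N1 where N1: "\<And>m. m \<ge> N1 \<Longrightarrow> nrm2 (\<lambda>x. F N1 x - F m x) < 1"
    using cauchy[OF zero_less_one] by blast
  have "sqint (\<lambda>x. F N1 x - (F N1 x - g x))"
    by (rule sqint_diff[OF F est[OF zero_less_one N1, THEN conjunct1]])
  then have sg: "sqint g" by simp
  have "(\<lambda>n. nrm2 (\<lambda>x. F n x - g x)) \<longlonglongrightarrow> 0"
  proof (rule LIMSEQ_I)
    fix e :: real assume "e > 0"
    then have e: "e / 2 > 0" by simp
    obtain M where M: "\<And>m n. m \<ge> M \<Longrightarrow> n \<ge> M \<Longrightarrow> nrm2 (\<lambda>x. F m x - F n x) < e / 2"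
      using cauchy[OF e] by blast
    have "nrm2 (\<lambda>x. F n x - g x) < e" if "n \<ge> M" for n
    proof -
      have "nrm2 (\<lambda>x. F n x - g x) \<le> e / 2"
        by (rule est[OF e M, THEN conjunct2]) (use that in simp_all)
      then show ?thesis using e by linarith
    qed
    then show "\<exists>no. \<forall>n\<ge>no. norm (nrm2 (\<lambda>x. F n x - g x) - 0) < e" by auto
  qed
  with sg show ?thesis by blast
qed

text \<open>\<open>g\<close> is the \<open>L\<^sup>2\<close> Fourier transform of \<open>f\<close>. The multiplication formula against integrable test
  functions serves as the definition: it is linear, stable under changes on null sets, and makes the
  symmetries of the transform one-line computations on the test function.\<close>

definition fourier_pair :: "(real \<Rightarrow> complex) \<Rightarrow> (real \<Rightarrow> complex) \<Rightarrow> bool" where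
  "fourier_pair f g \<longleftrightarrow> sqint f \<and> sqint g \<and>
     (\<forall>h. sqint h \<longrightarrow> integrable lborel h \<longrightarrow> (LINT x|lborel. f x * fourier_int h x) = (LINT x|lborel. g x * h x))"

lemma fourier_pairD:
  assumes "fourier_pair f g"
  shows "sqint f" "sqint g"
    "\<And>h. sqint h \<Longrightarrow> integrable lborel h \<Longrightarrow> (LINT x|lborel. f x * fourier_int h x) = (LINT x|lborel. g x * h x)"
  using assms by (auto simp: fourier_pair_def)

lemma fourier_pair_fourier_int: "sqint f \<Longrightarrow> integrable lborel f \<Longrightarrow> fourier_pair f (fourier_int f)"
  unfolding fourier_pair_def by (auto intro: plancherel multiplication_formula[symmetric])

lemma fourier_pair_add:
  assumes "fourier_pair f g" "fourier_pair f' g'"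
  shows "fourier_pair (\<lambda>x. f x + f' x) (\<lambda>x. g x + g' x)"
  unfolding fourier_pair_def
proof (intro conjI allI impI)
  fix h assume h: "sqint h" "integrable lborel h"
  have s: "sqint (fourier_int h)" by (rule plancherel[OF h])
  show "(LINT x|lborel. (f x + f' x) * fourier_int h x) = (LINT x|lborel. (g x + g' x) * h x)"
    using fourier_pairD[OF assms(1)] fourier_pairD[OF assms(2)] h s
    by (simp add: distrib_right sqint_mult_integrable)
qed (use fourier_pairD[OF assms(1)] fourier_pairD[OF assms(2)] in auto)

lemma fourier_pair_cmult:
  assumes "fourier_pair f g"
  shows "fourier_pair (\<lambda>x. c * f x) (\<lambda>x. c * g x)"
  unfolding fourier_pair_def
  using fourier_pairD[OF assms] by (auto simp: mult.assoc)

lemma fourier_pair_diff: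
  assumes "fourier_pair f g" "fourier_pair f' g'"
  shows "fourier_pair (\<lambda>x. f x - f' x) (\<lambda>x. g x - g' x)"
  using fourier_pair_add[OF assms(1) fourier_pair_cmult[OF assms(2), of "-1"]] by simp

lemma fourier_pair_cong_AE:
  assumes fg: "fourier_pair f g" and [measurable]: "f' \<in> borel_measurable borel" "g' \<in> borel_measurable borel"
   and ff: "AE x in lborel. f x = f' x" and gg: "AE x in lborel. g x = g' x"
  shows "fourier_pair f' g'"
  unfolding fourier_pair_def
proof (intro conjI allI impI)
  note [measurable] = sqintD[OF fourier_pairD(1)[OF fg]] sqintD[OF fourier_pairD(2)[OF fg]]
  show "sqint f'" by (rule sqint_cong_AE[OF fourier_pairD(1)[OF fg] _ ff]) measurable
  show "sqint g'" by (rule sqint_cong_AE[OF fourier_pairD(2)[OF fg] _ gg]) measurable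
  fix h assume h: "sqint h" "integrable lborel h"
  note [measurable] = sqintD[OF h(1)]
  have "(LINT x|lborel. f' x * fourier_int h x) = (LINT x|lborel. f x * fourier_int h x)"
    by (rule integral_cong_AE) (use ff in auto)
  moreover have "(LINT x|lborel. g' x * h x) = (LINT x|lborel. g x * h x)"
    by (rule integral_cong_AE) (use gg in auto)
  ultimately show "(LINT x|lborel. f' x * fourier_int h x) = (LINT x|lborel. g' x * h x)"
    using fourier_pairD(3)[OF fg h] by simp
qed

text \<open>By Plancherel's identity the transforms of the truncations form a Cauchy sequence. The
  statement records that they converge to \<open>g\<close>, to match the definition of \<open>fourier\<close> as such a
  limit.\<close>

lemma fourier_pair_exists:
  fixes f :: "real \<Rightarrow> complex"
  assumes f: "sqint f"
  shows "\<exists>g. fourier_pair f g \<and> (\<lambda>n. nrm2 (\<lambda>\<xi>. fourier_int (\<lambda>y. complex_of_real (indicat_real {-real n..real n} y) * f y) \<xi> - g \<xi>)) \<longlonglongrightarrow> 0"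
proof -
  define T where "T n y = complex_of_real (indicat_real {-real n..real n} y) * f y" for n y
  have sT: "sqint (T n)" for n unfolding T_def by (rule sqint_trunc[OF f]) simp
  have iT: "integrable lborel (T n)" for n unfolding T_def by (rule integrable_trunc[OF f])
  have "(\<lambda>n. nrm2 (\<lambda>x. f x - T n x)) \<longlonglongrightarrow> 0" unfolding T_def by (rule tendsto_truncations[OF f])
  then have T0: "(\<lambda>n. nrm2 (\<lambda>x. T n x - f x)) \<longlonglongrightarrow> 0" by (subst nrm2_minus_commute)
  then have T1: "(\<lambda>n. sqrt (nrm2 (\<lambda>x. T n x - f x))) \<longlonglongrightarrow> 0" using tendsto_real_sqrt by fastforce
  have sF: "sqint (fourier_int (T n))" for n by (rule plancherel[OF sT iT])
  have iso: "nrm2 (\<lambda>x. fourier_int (T m) x - fourier_int (T n) x) = nrm2 (\<lambda>x. T m x - T n x)" for m n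
    using plancherel(2)[OF sqint_diff[OF sT sT] Bochner_Integration.integrable_diff[OF iT iT], of m n]
    by (simp add: fourier_int_diff[OF iT iT, abs_def])
  have "\<exists>g. sqint g \<and> (\<lambda>n. nrm2 (\<lambda>x. fourier_int (T n) x - g x)) \<longlonglongrightarrow> 0"
  proof (rule sqint_complete[OF sF])
    fix e :: real assume e: "e > 0"
    then have "sqrt e / 2 > 0" by simp
    with T1 have "\<forall>\<^sub>F n in sequentially. sqrt (nrm2 (\<lambda>x. T n x - f x)) < sqrt e / 2" by (rule order_tendstoD(2))
    then obtain N where N: "\<And>n. n \<ge> N \<Longrightarrow> sqrt (nrm2 (\<lambda>x. T n x - f x)) < sqrt e / 2"
      by (auto simp: eventually_sequentially)
    have "nrm2 (\<lambda>x. fourier_int (T m) x - fourier_int (T n) x) < e" if "m \<ge> N" "n \<ge> N" for m n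
    proof -
      have "sqrt (nrm2 (\<lambda>x. T m x - T n x)) \<le> sqrt (nrm2 (\<lambda>x. T m x - f x)) + sqrt (nrm2 (\<lambda>x. f x - T n x))"
        by (rule minkowski_diff[OF sT f sT])
      then have "sqrt (nrm2 (\<lambda>x. T m x - T n x)) < sqrt e"
        using N[OF that(1)] N[OF that(2)] unfolding nrm2_minus_commute[of f "T n"] by linarith
      then show ?thesis by (simp only: iso real_sqrt_less_iff)
    qed
    then show "\<exists>N. \<forall>m\<ge>N. \<forall>n\<ge>N. nrm2 (\<lambda>x. fourier_int (T m) x - fourier_int (T n) x) < e" by blast
  qed
  then obtain g where g: "sqint g" and lim: "(\<lambda>n. nrm2 (\<lambda>x. fourier_int (T n) x - g x)) \<longlonglongrightarrow> 0" by blast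
  have "fourier_pair f g"
    unfolding fourier_pair_def
  proof (intro conjI allI impI f g)
    fix h assume h: "sqint h" "integrable lborel h"
    have "(\<lambda>n. LINT x|lborel. fourier_int (T n) x * h x) \<longlonglongrightarrow> (LINT x|lborel. g x * h x)"
      by (rule tendsto_integral_mult[OF sF g h(1) lim])
    moreover have "(\<lambda>n. LINT x|lborel. T n x * fourier_int h x) \<longlonglongrightarrow> (LINT x|lborel. f x * fourier_int h x)"
      by (rule tendsto_integral_mult[OF sT f plancherel(1)[OF h] T0])
    ultimately show "(LINT x|lborel. f x * fourier_int h x) = (LINT x|lborel. g x * h x)"
      using LIMSEQ_unique by (simp add: multiplication_formula[OF iT h(2)])
  qed
  with lim show ?thesis unfolding T_def by blast
qed

text \<open>The difference of two candidates is orthogonal to all integrable functions in \<open>L\<^sup>2\<close>, in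
  particular to its own truncations, and so to itself.\<close>

lemma fourier_pair_unique:
  assumes "fourier_pair f g" "fourier_pair f g'"
  shows "AE x in lborel. g x = g' x"
proof -
  let ?d = "\<lambda>x. g x - g' x"
  have d: "sqint ?d" using fourier_pairD(2) assms by blast
  define T where "T n y = complex_of_real (indicat_real {-real n..real n} y) * cnj (?d y)" for n y
  have sT: "sqint (T n)" for n unfolding T_def by (rule sqint_trunc[OF sqint_cnj[OF d]]) simp
  have iT: "integrable lborel (T n)" for n unfolding T_def by (rule integrable_trunc[OF sqint_cnj[OF d]])
  have "(\<lambda>n. nrm2 (\<lambda>x. cnj (?d x) - T n x)) \<longlonglongrightarrow> 0" unfolding T_def by (rule tendsto_truncations[OF sqint_cnj[OF d]])
  then have T0: "(\<lambda>n. nrm2 (\<lambda>x. T n x - cnj (?d x))) \<longlonglongrightarrow> 0" by (subst nrm2_minus_commute)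
  have "(LINT x|lborel. T n x * ?d x) = 0" for n
  proof -
    have "(LINT x|lborel. ?d x * T n x) = (LINT x|lborel. g x * T n x) - (LINT x|lborel. g' x * T n x)"
      using fourier_pairD(2)[OF assms(1)] fourier_pairD(2)[OF assms(2)] sT
      by (simp add: left_diff_distrib sqint_mult_integrable)
    then show ?thesis
      using fourier_pairD(3)[OF assms(1) sT[of n] iT[of n]] fourier_pairD(3)[OF assms(2) sT[of n] iT[of n]]
      by (simp add: mult.commute)
  qed
  moreover have "(\<lambda>n. LINT x|lborel. T n x * ?d x) \<longlonglongrightarrow> (LINT x|lborel. cnj (?d x) * ?d x)"
    by (rule tendsto_integral_mult[OF sT sqint_cnj[OF d] d T0])
  ultimately have "(LINT x|lborel. cnj (?d x) * ?d x) = 0" using LIMSEQ_unique[OF tendsto_const] by fastforce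
  then have "inner_L2 ?d ?d = 0" by (simp add: inner_L2_def mult.commute)
  then have "nrm2 ?d = 0" by (simp add: inner_L2_self)
  then show ?thesis using nrm2_eq_0_iff[OF d] by simp
qed

lemma fourier_pair_nrm2:
  assumes fg: "fourier_pair f g" shows "nrm2 g = nrm2 f"
proof -
  have f: "sqint f" and g: "sqint g" using fourier_pairD[OF fg] by auto
  obtain g' where g': "fourier_pair f g'" and lim: "(\<lambda>n. nrm2 (\<lambda>\<xi>. fourier_int (\<lambda>y. complex_of_real (indicat_real {-real n..real n} y) * f y) \<xi> - g' \<xi>)) \<longlonglongrightarrow> 0"
    using fourier_pair_exists[OF f] by blast
  define T where "T n y = complex_of_real (indicat_real {-real n..real n} y) * f y" for n y
  have sT: "sqint (T n)" for n unfolding T_def by (rule sqint_trunc[OF f]) simp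
  have iT: "integrable lborel (T n)" for n unfolding T_def by (rule integrable_trunc[OF f])
  have "(\<lambda>n. nrm2 (\<lambda>x. f x - T n x)) \<longlonglongrightarrow> 0" unfolding T_def by (rule tendsto_truncations[OF f])
  then have T0: "(\<lambda>n. nrm2 (\<lambda>x. T n x - f x)) \<longlonglongrightarrow> 0" by (subst nrm2_minus_commute)
  have sF: "sqint (fourier_int (T n))" for n by (rule plancherel[OF sT iT])
  have "(\<lambda>n. nrm2 (fourier_int (T n))) \<longlonglongrightarrow> nrm2 g'"
    by (rule tendsto_nrm2[OF sF fourier_pairD(2)[OF g']]) (use lim in \<open>simp add: T_def[abs_def]\<close>)
  moreover have "(\<lambda>n. nrm2 (T n)) \<longlonglongrightarrow> nrm2 f" by (rule tendsto_nrm2[OF sT f T0])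
  ultimately have "nrm2 g' = nrm2 f" using LIMSEQ_unique by (simp add: plancherel(2)[OF sT iT])
  moreover have "nrm2 g = nrm2 g'"
    by (rule nrm2_cong_AE[OF sqintD[OF g] sqintD[OF fourier_pairD(2)[OF g']] fourier_pair_unique[OF fg g']])
  ultimately show ?thesis by simp
qed

text \<open>Polarization of \<open>fourier_pair_nrm2\<close>; the imaginary part comes from multiplying one function by
  \<open>\<i>\<close>.\<close>

lemma fourier_pair_parseval:
  assumes p1: "fourier_pair f1 g1" and p2: "fourier_pair f2 g2"
  shows "inner_L2 g1 g2 = inner_L2 f1 f2"
proof -
  have re: "Re (inner_L2 g g') = Re (inner_L2 f f')" if q: "fourier_pair f g" "fourier_pair f' g'" for f g f' g'
    using fourier_pair_nrm2[OF fourier_pair_add[OF q]] fourier_pair_nrm2[OF q(1)] fourier_pair_nrm2[OF q(2)]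
      nrm2_add[OF fourier_pairD(1)[OF q(1)] fourier_pairD(1)[OF q(2)]]
      nrm2_add[OF fourier_pairD(2)[OF q(1)] fourier_pairD(2)[OF q(2)]] by simp
  have im: "inner_L2 f (\<lambda>x. \<i> * f' x) = - \<i> * inner_L2 f f'" for f f'
  proof -
    have "inner_L2 f (\<lambda>x. \<i> * f' x) = (LINT x|lborel. - \<i> * (f x * cnj (f' x)))" unfolding inner_L2_def by (simp add: mult_ac)
    also have "\<dots> = - \<i> * inner_L2 f f'" unfolding inner_L2_def by (rule integral_mult_right_zero)
    finally show ?thesis .
  qed
  have "Re (- \<i> * inner_L2 g1 g2) = Re (- \<i> * inner_L2 f1 f2)"
    using re[OF p1 fourier_pair_cmult[OF p2, of \<i>]] by (simp only: im)
  then show ?thesis using re[OF p1 p2] by (simp add: complex_eq_iff)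
qed

lemma integral_reflect:
  fixes f :: "real \<Rightarrow> 'a::{banach, second_countable_topology}"
  shows "(LINT x|lborel. f (- x)) = (LINT x|lborel. f x)"
  using lborel_integral_real_affine[of "-1" f 0] by simp

lemma integrable_reflect:
  fixes f :: "real \<Rightarrow> 'a::{banach, second_countable_topology}"
  shows "integrable lborel f \<Longrightarrow> integrable lborel (\<lambda>x. f (- x))"
  using lborel_integrable_real_affine[of f "-1" 0] by simp

text \<open>Inversion is duality once more: the conjugate of \<open>fourier_int h\<close> is the transform of the
  reflected conjugate of \<open>h\<close>, and Parseval's identity removes both transforms.\<close>

lemma fourier_pair_inversion:
  assumes fg: "fourier_pair f g" shows "fourier_pair g (\<lambda>x. f (- x))"
  unfolding fourier_pair_def
proof (intro conjI allI impI)
  fix h assume h: "sqint h" "integrable lborel h"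
  define k where "k x = cnj (h (- x))" for x
  have k: "sqint k" "integrable lborel k"
    unfolding k_def using h by (auto intro: integrable_reflect)
  have "(LINT x|lborel. g x * fourier_int h x) = inner_L2 g (fourier_int k)"
    unfolding inner_L2_def k_def fourier_int_cnj_reflect by simp
  also have "\<dots> = inner_L2 f k" by (rule fourier_pair_parseval[OF fg fourier_pair_fourier_int[OF k]])
  also have "\<dots> = (LINT x|lborel. f x * h (- x))" by (simp add: inner_L2_def k_def)
  also have "\<dots> = (LINT x|lborel. f (- x) * h x)"
    using integral_reflect[of "\<lambda>x. f x * h (- x)"] by simp
  finally show "(LINT x|lborel. g x * fourier_int h x) = (LINT x|lborel. f (- x) * h x)" .
qed (use fourier_pairD[OF fg] in auto)

lemma fourier_pair_reflect: "fourier_pair f g \<Longrightarrow> fourier_pair (\<lambda>x. f (- x)) (\<lambda>x. g (- x))"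
  by (intro fourier_pair_inversion)

lemma fourier_pair_exists_inverse:
  assumes "sqint g" shows "\<exists>f. fourier_pair f g"
proof -
  obtain f where "fourier_pair g f" using fourier_pair_exists[OF assms] by blast
  from fourier_pair_reflect[OF fourier_pair_inversion[OF this]] show ?thesis by auto
qed

lemma fourier_pair_cnj:
  assumes fg: "fourier_pair f g" shows "fourier_pair (\<lambda>x. cnj (f x)) (\<lambda>x. cnj (g (- x)))"
  unfolding fourier_pair_def
proof (intro conjI allI impI)
  fix h assume h: "sqint h" "integrable lborel h"
  define k where "k x = cnj (h (- x))" for x
  have k: "sqint k" "integrable lborel k"
    unfolding k_def using h by (auto intro: integrable_reflect)
  have "(LINT x|lborel. cnj (f x) * fourier_int h x) = (LINT x|lborel. cnj (f x * fourier_int k x))"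
    unfolding k_def fourier_int_cnj_reflect by simp
  also have "\<dots> = cnj (LINT x|lborel. f x * fourier_int k x)" by (rule Bochner_Integration.integral_cnj)
  also have "\<dots> = cnj (LINT x|lborel. g x * k x)" by (simp only: fourier_pairD(3)[OF fg k])
  also have "\<dots> = (LINT x|lborel. cnj (g x * k x))" by (rule Bochner_Integration.integral_cnj[symmetric])
  also have "\<dots> = (LINT x|lborel. cnj (g x) * h (- x))" by (simp add: k_def)
  also have "\<dots> = (LINT x|lborel. cnj (g (- x)) * h x)"
    using integral_reflect[of "\<lambda>x. cnj (g x) * h (- x)"] by simp
  finally show "(LINT x|lborel. cnj (f x) * fourier_int h x) = (LINT x|lborel. cnj (g (- x)) * h x)" .
qed (use fourier_pairD[OF fg] in auto)

lemma fourier_pair_unique_inverse: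
  assumes "fourier_pair f g" "fourier_pair f' g"
  shows "AE x in lborel. f x = f' x"
proof -
  have "nrm2 (\<lambda>x. f x - f' x) = 0"
    using fourier_pair_nrm2[OF fourier_pair_diff[OF assms]] by (simp add: nrm2_def)
  then show ?thesis
    using nrm2_eq_0_iff[OF sqint_diff[OF fourier_pairD(1)[OF assms(1)] fourier_pairD(1)[OF assms(2)]]] by simp
qed

lemma fourier_pair_shift:
  assumes fg: "fourier_pair f g"
  shows "fourier_pair (\<lambda>x. f (x - a)) (\<lambda>\<xi>. exp (- (\<i> * complex_of_real (a * \<xi>))) * g \<xi>)"
  unfolding fourier_pair_def
proof (intro conjI allI impI)
  show "sqint (\<lambda>x. f (x - a))" using sqint_shift[OF fourier_pairD(1)[OF fg], of "-a"] by simp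
  show "sqint (\<lambda>\<xi>. exp (- (\<i> * complex_of_real (a * \<xi>))) * g \<xi>)"
    by (rule sqint_mult_bounded[OF fourier_pairD(2)[OF fg], of _ 1]) (auto simp del: of_real_mult)
  fix h assume h: "sqint h" "integrable lborel h"
  define k where "k \<xi> = exp (- (\<i> * complex_of_real (a * \<xi>))) * h \<xi>" for \<xi>
  have k: "sqint k" unfolding k_def
    by (rule sqint_mult_bounded[OF h(1), of _ 1]) (auto simp del: of_real_mult)
  have k2: "integrable lborel k" unfolding k_def using fourier_int_integrand[OF h(2), of a] by (simp add: mult.commute)
  have FIk: "fourier_int h (x + a) = fourier_int k x" for x
  proof -
    have "h y * exp (- (\<i> * complex_of_real (y * (x + a)))) = k y * exp (- (\<i> * complex_of_real (y * x)))" for y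
    proof -
      have "exp (- (\<i> * complex_of_real (y * (x + a)))) = exp (- (\<i> * complex_of_real (a * y))) * exp (- (\<i> * complex_of_real (y * x)))"
        by (simp flip: exp_add add: algebra_simps)
      then show ?thesis by (simp only: k_def mult_ac)
    qed
    then show ?thesis by (simp only: fourier_int_def)
  qed
  have "(LINT x|lborel. f (x - a) * fourier_int h x) = (LINT x|lborel. f x * fourier_int h (x + a))"
    using lborel_integral_real_affine[of 1 "\<lambda>x. f (x - a) * fourier_int h x" a] by (simp add: add.commute)
  also have "\<dots> = (LINT x|lborel. g x * k x)" unfolding FIk by (rule fourier_pairD(3)[OF fg k k2])
  finally show "(LINT x|lborel. f (x - a) * fourier_int h x) = (LINT x|lborel. exp (- (\<i> * complex_of_real (a * x))) * g x * h x)"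
    by (simp only: k_def mult_ac)
qed

abbreviation cplx :: "(real \<Rightarrow> real) \<Rightarrow> real \<Rightarrow> complex" where
  "cplx w \<equiv> (\<lambda>x. complex_of_real (w x))"

lemma fourier_integral_eq_fourier_int:
  "fourier_integral (\<lambda>y. indicat_real A y * w y) = fourier_int (\<lambda>y. complex_of_real (indicat_real A y) * cplx w y)"
  by (simp add: fourier_integral_def fourier_int_def fun_eq_iff)

text \<open>The choice in the definition of \<open>fourier\<close> is made among the \<open>L\<^sup>2\<close> limits of the transforms of
  the truncations; the limit exists and is unique up to null sets.\<close>

lemma fourier_pair_fourier:
  assumes w: "sqint (cplx w)" shows "fourier_pair (cplx w) (fourier w)"
proof -
  obtain g where g: "fourier_pair (cplx w) g" and lim: "(\<lambda>n. nrm2 (\<lambda>\<xi>. fourier_int (\<lambda>y. complex_of_real (indicat_real {-real n..real n} y) * cplx w y) \<xi> - g \<xi>)) \<longlonglongrightarrow> 0"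
    using fourier_pair_exists[OF w] by blast
  define F where "F n = fourier_int (\<lambda>y. complex_of_real (indicat_real {-real n..real n} y) * cplx w y)" for n :: nat
  have sF: "sqint (F n)" for n
    unfolding F_def by (intro plancherel sqint_trunc[OF w] integrable_trunc[OF w]) simp
  note [measurable] = sqintD[OF sF] sqintD[OF fourier_pairD(2)[OF g]]
  have hft: "has_fourier_transform w g' \<longleftrightarrow> g' \<in> borel_measurable borel \<and>
    (\<lambda>n. \<integral>\<^sup>+ \<xi>. ennreal ((cmod (g' \<xi> - F n \<xi>))\<^sup>2) \<partial>lborel) \<longlonglongrightarrow> 0" for g'
    by (simp add: has_fourier_transform_def fourier_integral_eq_fourier_int F_def)
  have "has_fourier_transform w g"
  proof -
    have "(\<lambda>n. ennreal (nrm2 (\<lambda>\<xi>. F n \<xi> - g \<xi>))) \<longlonglongrightarrow> ennreal 0"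
      using lim unfolding F_def by (rule tendsto_ennrealI)
    moreover have "(\<integral>\<^sup>+ \<xi>. ennreal ((cmod (g \<xi> - F n \<xi>))\<^sup>2) \<partial>lborel) = ennreal (nrm2 (\<lambda>\<xi>. F n \<xi> - g \<xi>))" for n
      by (subst nrm2_minus_commute) (rule nrm2_nn[OF sqint_diff[OF fourier_pairD(2)[OF g] sF]])
    ultimately show ?thesis unfolding hft by simp
  qed
  then have h: "has_fourier_transform w (fourier w)" unfolding fourier_def by (rule someI[of "has_fourier_transform w"])
  define g' where "g' = fourier w"
  have [measurable]: "g' \<in> borel_measurable borel" and l: "(\<lambda>n. \<integral>\<^sup>+ \<xi>. ennreal ((cmod (g' \<xi> - F n \<xi>))\<^sup>2) \<partial>lborel) \<longlonglongrightarrow> 0"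
    using h unfolding hft g'_def by auto
  from l have "\<forall>\<^sub>F n in sequentially. (\<integral>\<^sup>+ \<xi>. ennreal ((cmod (g' \<xi> - F n \<xi>))\<^sup>2) \<partial>lborel) < 1"
    by (rule order_tendstoD(2)) simp
  then obtain n where "(\<integral>\<^sup>+ \<xi>. ennreal ((cmod (g' \<xi> - F n \<xi>))\<^sup>2) \<partial>lborel) \<le> ennreal 1"
    by (auto simp: eventually_sequentially intro: less_imp_le)
  then have "sqint (\<lambda>\<xi>. g' \<xi> - F n \<xi>)" using sqint_nnI(1)[of "\<lambda>\<xi>. g' \<xi> - F n \<xi>" 1] by simp
  from sqint_add[OF this sF[of n]] have sg': "sqint g'" by simp
  have "(\<lambda>n. ennreal (nrm2 (\<lambda>\<xi>. g' \<xi> - F n \<xi>))) \<longlonglongrightarrow> ennreal 0"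
    using l by (simp add: nrm2_nn[OF sqint_diff[OF sg' sF]])
  then have l2: "(\<lambda>n. nrm2 (\<lambda>\<xi>. g' \<xi> - F n \<xi>)) \<longlonglongrightarrow> 0"
    by (subst (asm) tendsto_ennreal_iff) auto
  have "(\<lambda>n. sqrt (nrm2 (\<lambda>\<xi>. g' \<xi> - F n \<xi>)) + sqrt (nrm2 (\<lambda>\<xi>. F n \<xi> - g \<xi>))) \<longlonglongrightarrow> sqrt 0 + sqrt 0"
    using lim l2 unfolding F_def by (intro tendsto_intros)
  moreover have "sqrt (nrm2 (\<lambda>\<xi>. g' \<xi> - g \<xi>)) \<le> sqrt (nrm2 (\<lambda>\<xi>. g' \<xi> - F n \<xi>)) + sqrt (nrm2 (\<lambda>\<xi>. F n \<xi> - g \<xi>))" for n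
    by (rule minkowski_diff[OF sg' sF fourier_pairD(2)[OF g]])
  ultimately have "sqrt (nrm2 (\<lambda>\<xi>. g' \<xi> - g \<xi>)) \<le> 0"
    by (intro LIMSEQ_le_const[where X="\<lambda>n. sqrt (nrm2 (\<lambda>\<xi>. g' \<xi> - F n \<xi>)) + sqrt (nrm2 (\<lambda>\<xi>. F n \<xi> - g \<xi>))"]) auto
  then have "nrm2 (\<lambda>\<xi>. g' \<xi> - g \<xi>) = 0" using nrm2_nonneg[of "\<lambda>\<xi>. g' \<xi> - g \<xi>"] by simp
  then have "AE \<xi> in lborel. g \<xi> = g' \<xi>"
    using nrm2_eq_0_iff[OF sqint_diff[OF sg' fourier_pairD(2)[OF g]]] by (auto elim: eventually_mono)
  then show ?thesis unfolding g'_def[symmetric]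
    by (intro fourier_pair_cong_AE[OF g]) (use sqintD[OF w] in auto)
qed

section \<open>Test functions and weak derivatives\<close>

definition smooth :: "(real \<Rightarrow> real) \<Rightarrow> bool" where
  "smooth f \<longleftrightarrow> (\<forall>k x. (deriv ^^ k) f field_differentiable at x)"

text \<open>Differentiability of finite order, as the hypothesis on which product and chain rules can be
  proved by induction.\<close>

definition smooth_upto :: "nat \<Rightarrow> (real \<Rightarrow> real) \<Rightarrow> bool" where
  "smooth_upto n f \<longleftrightarrow> (\<forall>k<n. \<forall>x. (deriv ^^ k) f field_differentiable at x)"

lemma smooth_iff_smooth_upto: "smooth f \<longleftrightarrow> (\<forall>n. smooth_upto n f)"
  by (auto simp: smooth_def smooth_upto_def)

lemma smooth_upto_Suc:
  "smooth_upto (Suc n) f \<longleftrightarrow> (\<forall>x. f field_differentiable at x) \<and> smooth_upto n (deriv f)"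
proof
  assume a: "smooth_upto (Suc n) f"
  have "(deriv ^^ k) (deriv f) field_differentiable at x" if "k < n" for k x
    using a[unfolded smooth_upto_def, rule_format, of "Suc k" x] that by (simp add: funpow_swap1)
  moreover have "f field_differentiable at x" for x
    using a[unfolded smooth_upto_def, rule_format, of 0 x] by simp
  ultimately show "(\<forall>x. f field_differentiable at x) \<and> smooth_upto n (deriv f)"
    by (auto simp: smooth_upto_def)
next
  assume a: "(\<forall>x. f field_differentiable at x) \<and> smooth_upto n (deriv f)"
  show "smooth_upto (Suc n) f"
    unfolding smooth_upto_def
  proof (intro allI impI)
    fix k x assume k: "k < Suc n"
    show "(deriv ^^ k) f field_differentiable at x"
    proof (cases k)
      case 0 then show ?thesis using a by simp
    next
      case (Suc j)
      then have "(deriv ^^ j) (deriv f) field_differentiable at x"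
        using a k by (auto simp: smooth_upto_def)
      then show ?thesis by (simp add: Suc funpow_swap1)
    qed
  qed
qed

lemma smooth_upto_mono: "smooth_upto (Suc n) f \<Longrightarrow> smooth_upto n f"
  by (auto simp: smooth_upto_def)

lemma smooth_deriv: "smooth f \<Longrightarrow> smooth (deriv f)"
  unfolding smooth_iff_smooth_upto using smooth_upto_Suc by blast

lemma smooth_field_differentiable: "smooth f \<Longrightarrow> f field_differentiable at x"
  unfolding smooth_def by (drule spec[of _ 0]) simp

lemma smooth_has_derivative: "smooth f \<Longrightarrow> (f has_field_derivative deriv f x) (at x)"
  by (simp add: smooth_field_differentiable field_differentiable_derivI)

lemma smooth_continuous: "smooth f \<Longrightarrow> continuous_on UNIV f"
  by (meson continuous_at_imp_continuous_on field_differentiable_imp_continuous_at smooth_field_differentiable)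

lemma smooth_upto_add: "smooth_upto n f \<Longrightarrow> smooth_upto n g \<Longrightarrow> smooth_upto n (\<lambda>x. f x + g x)"
proof (induction n arbitrary: f g)
  case 0 then show ?case by (simp add: smooth_upto_def)
next
  case (Suc n)
  then have d: "f field_differentiable at x" "g field_differentiable at x" for x by (auto simp: smooth_upto_Suc)
  have "deriv (\<lambda>x. f x + g x) = (\<lambda>x. deriv f x + deriv g x)" by (simp add: fun_eq_iff d deriv_add)
  then show ?case using Suc d by (auto simp: smooth_upto_Suc intro: field_differentiable_add)
qed

lemma smooth_upto_mult: "smooth_upto n f \<Longrightarrow> smooth_upto n g \<Longrightarrow> smooth_upto n (\<lambda>x. f x * g x)"
proof (induction n arbitrary: f g)
  case 0 then show ?case by (simp add: smooth_upto_def)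
next
  case (Suc n)
  then have d: "f field_differentiable at x" "g field_differentiable at x" for x by (auto simp: smooth_upto_Suc)
  have "deriv (\<lambda>x. f x * g x) = (\<lambda>x. f x * deriv g x + deriv f x * g x)" by (simp add: fun_eq_iff d deriv_mult)
  moreover have "smooth_upto n (\<lambda>x. f x * deriv g x + deriv f x * g x)"
    using Suc.prems smooth_upto_mono by (intro smooth_upto_add Suc.IH) (auto simp: smooth_upto_Suc)
  ultimately show ?case using d by (auto simp: smooth_upto_Suc intro: field_differentiable_mult)
qed

lemma smooth_upto_affine: "smooth_upto n f \<Longrightarrow> smooth_upto n (\<lambda>x. e * f (c * x + d))"
proof (induction n arbitrary: f e)
  case 0 then show ?case by (simp add: smooth_upto_def)
next
  case (Suc n)
  have fd: "(f has_field_derivative deriv f x) (at x)" for x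
    using Suc.prems by (auto simp: smooth_upto_Suc field_differentiable_derivI)
  have D: "((\<lambda>x. e * f (c * x + d)) has_field_derivative (e * c) * deriv f (c * x + d)) (at x)" for x
  proof -
    have "((\<lambda>x. c * x + d) has_field_derivative c) (at x)" by (auto intro!: derivative_eq_intros)
    from DERIV_cmult[OF DERIV_chain2[OF fd this], of e] show ?thesis by (simp only: mult_ac)
  qed
  then have "deriv (\<lambda>x. e * f (c * x + d)) = (\<lambda>x. (e * c) * deriv f (c * x + d))"
    by (simp add: fun_eq_iff DERIV_imp_deriv)
  moreover have "(\<lambda>x. e * f (c * x + d)) field_differentiable at x" for x
    using D unfolding field_differentiable_def by blast
  ultimately show ?case using Suc by (auto simp: smooth_upto_Suc)
qed

lemma smooth_mult: "smooth f \<Longrightarrow> smooth g \<Longrightarrow> smooth (\<lambda>x. f x * g x)"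
  by (simp add: smooth_iff_smooth_upto smooth_upto_mult)

lemma smooth_affine: "smooth f \<Longrightarrow> smooth (\<lambda>x. f (c * x + d))"
  using smooth_upto_affine[of _ f 1 c d] by (simp add: smooth_iff_smooth_upto)

text \<open>The functions \<open>q (1/x) exp (-1/x)\<close>, extended by \<open>0\<close> to the left. The family is closed under
  differentiation, which makes the smoothness of \<open>exp (-1/x)\<close> at \<open>0\<close> a single computation for all
  orders.\<close>

definition flat_exp :: "real poly \<Rightarrow> real \<Rightarrow> real" where
  "flat_exp q x = (if x > 0 then poly q (inverse x) * exp (- inverse x) else 0)"

lemma poly_times_exp_tendsto_0: "((\<lambda>t::real. t ^ k * poly q t * exp (- t)) \<longlongrightarrow> 0) at_top"
proof (induction q arbitrary: k)
  case 0 then show ?case by simp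
next
  case (pCons a q)
  have "((\<lambda>t::real. a * (t ^ k / exp t) + t ^ Suc k * poly q t * exp (- t)) \<longlongrightarrow> a * 0 + 0) at_top"
    by (intro tendsto_intros tendsto_power_div_exp_0 pCons.IH)
  moreover have "a * (t ^ k / exp t) + t ^ Suc k * poly q t * exp (- t) = t ^ k * poly (pCons a q) t * exp (- t)" for t
    by (simp add: exp_minus field_simps)
  ultimately show ?case by simp
qed

text \<open>The exponential beats every polynomial in \<open>1/x\<close>, so the derivative at \<open>0\<close> vanishes.\<close>

lemma flat_exp_has_derivative:
  "(flat_exp q has_field_derivative flat_exp ([:0, 0, 1:] * (q - pderiv q)) x) (at x)"
proof -
  consider "x > 0" | "x < 0" | "x = 0" by linarith
  then show ?thesis
  proof cases
    case 1
    have "((\<lambda>x. poly q (inverse x) * exp (- inverse x)) has_field_derivative flat_exp ([:0, 0, 1:] * (q - pderiv q)) x) (at x)"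
      using 1 by (auto intro!: derivative_eq_intros simp: flat_exp_def field_simps power2_eq_square)
    then show ?thesis
      by (rule has_field_derivative_transform_within_open[of _ _ _ "{0<..}"]) (use 1 in \<open>auto simp: flat_exp_def\<close>)
  next
    case 2
    have "((\<lambda>x. 0) has_field_derivative flat_exp ([:0, 0, 1:] * (q - pderiv q)) x) (at x)"
      using 2 by (simp add: flat_exp_def)
    then show ?thesis
      by (rule has_field_derivative_transform_within_open[of _ _ _ "{..<0}"]) (use 2 in \<open>auto simp: flat_exp_def\<close>)
  next
    case 3
    have "((\<lambda>h. flat_exp q h / h) \<longlongrightarrow> 0) (at_right 0)"
    proof -
      have "((\<lambda>h. inverse h ^ 1 * poly q (inverse h) * exp (- inverse h)) \<longlongrightarrow> (0::real)) (at_right 0)"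
        by (rule filterlim_compose[OF poly_times_exp_tendsto_0 filterlim_inverse_at_top_right])
      moreover have "\<forall>\<^sub>F h in at_right 0. inverse h ^ 1 * poly q (inverse h) * exp (- inverse h) = flat_exp q h / h"
        using eventually_at_right_less[of 0] by eventually_elim (simp add: flat_exp_def field_simps)
      ultimately show ?thesis by (rule Lim_transform_eventually)
    qed
    moreover have "((\<lambda>h. flat_exp q h / h) \<longlongrightarrow> 0) (at_left 0)"
    proof (rule tendsto_eventually)
      have "\<forall>\<^sub>F h in at_left 0. h < (0::real)" by (simp add: eventually_at_filter)
      then show "\<forall>\<^sub>F h in at_left 0. flat_exp q h / h = 0" by eventually_elim (simp add: flat_exp_def)
    qed
    ultimately have "((\<lambda>h. flat_exp q h / h) \<longlongrightarrow> 0) (at 0)"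
      by (simp add: filterlim_at_split)
    then show ?thesis using 3 by (simp add: DERIV_def flat_exp_def)
  qed
qed

lemma smooth_flat_exp: "smooth (flat_exp q)"
proof -
  have "smooth_upto n (flat_exp q)" for n
  proof (induction n arbitrary: q)
    case 0 then show ?case by (simp add: smooth_upto_def)
  next
    case (Suc n)
    have "deriv (flat_exp q) = flat_exp ([:0, 0, 1:] * (q - pderiv q))"
      using flat_exp_has_derivative by (simp add: fun_eq_iff DERIV_imp_deriv)
    then show ?case using Suc flat_exp_has_derivative
      by (auto simp: smooth_upto_Suc field_differentiable_def)
  qed
  then show ?thesis by (simp add: smooth_iff_smooth_upto)
qed

text \<open>Supported in \<open>[a, b]\<close>; raising \<open>n\<close> steepens both flanks, and the limit is the indicator of the
  open interval.\<close>

definition bump :: "real \<Rightarrow> real \<Rightarrow> nat \<Rightarrow> real \<Rightarrow> real" where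
  "bump a b n x = flat_exp 1 (real n * (x - a)) * flat_exp 1 (real n * (b - x))"

lemma test_function_iff: "test_function \<phi> \<longleftrightarrow> smooth \<phi> \<and> (\<exists>K. compact K \<and> (\<forall>x. x \<notin> K \<longrightarrow> \<phi> x = 0))"
  by (simp add: test_function_def smooth_def)

lemma flat_exp_bounds: "0 \<le> flat_exp 1 x" "flat_exp 1 x \<le> 1"
  by (auto simp: flat_exp_def)

lemma bump_bounds: "0 \<le> bump a b n x" "bump a b n x \<le> 1"
  unfolding bump_def using flat_exp_bounds by (auto intro!: mult_le_one mult_nonneg_nonneg)

lemma bump_outside: "x \<notin> {a<..<b} \<Longrightarrow> bump a b n x = 0"
  by (auto simp: bump_def flat_exp_def zero_less_mult_iff)

lemma test_function_bump: "test_function (bump a b n)"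
proof -
  have "smooth (\<lambda>x. flat_exp 1 (real n * x + - (real n * a)) * flat_exp 1 (- real n * x + real n * b))"
    by (intro smooth_mult smooth_affine smooth_flat_exp)
  then have "smooth (bump a b n)" by (simp add: bump_def[abs_def] algebra_simps)
  moreover have "\<forall>x. x \<notin> {a..b} \<longrightarrow> bump a b n x = 0" by (auto intro: bump_outside)
  ultimately show ?thesis unfolding test_function_iff using compact_Icc by blast
qed

lemma bump_tendsto: "(\<lambda>n. bump a b n x) \<longlonglongrightarrow> indicat_real {a<..<b} x"
proof (cases "x \<in> {a<..<b}")
  case True
  have *: "(\<lambda>n. flat_exp 1 (real n * t)) \<longlonglongrightarrow> 1" if t: "t > 0" for t
  proof (rule Lim_transform_eventually)
    have "(\<lambda>n. exp (- (inverse (real n) * inverse t))) \<longlonglongrightarrow> exp (- (0 * inverse t))"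
      by (intro tendsto_intros lim_inverse_n)
    then show "(\<lambda>n. exp (- (inverse (real n) * inverse t))) \<longlonglongrightarrow> 1" by simp
    show "\<forall>\<^sub>F n in sequentially. exp (- (inverse (real n) * inverse t)) = flat_exp 1 (real n * t)"
      using eventually_gt_at_top[of 0] by eventually_elim (use t in \<open>simp add: flat_exp_def\<close>)
  qed
  have "(\<lambda>n. bump a b n x) \<longlonglongrightarrow> 1 * 1"
    unfolding bump_def by (intro tendsto_mult *) (use True in auto)
  then show ?thesis using True by simp
next
  case False
  then show ?thesis by (simp add: bump_outside)
qed

lemma test_function_support:
  assumes "test_function \<phi>"
  obtains R where "R > 0" "\<And>x. \<bar>x\<bar> > R \<Longrightarrow> \<phi> x = 0"
proof -
  obtain K where K: "compact K" "\<And>x. x \<notin> K \<Longrightarrow> \<phi> x = 0" using assms by (auto simp: test_function_def)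
  obtain R where R: "\<And>x. x \<in> K \<Longrightarrow> \<bar>x\<bar> \<le> R" using compact_imp_bounded[OF K(1)] by (auto simp: bounded_iff)
  show thesis
  proof (rule that[of "\<bar>R\<bar> + 1"])
    fix x assume "\<bar>x\<bar> > \<bar>R\<bar> + 1"
    then have "x \<notin> K" using R[of x] by force
    then show "\<phi> x = 0" by (rule K(2))
  qed simp
qed

lemma deriv_zero_outside:
  fixes \<phi> :: "real \<Rightarrow> real"
  assumes "\<And>x. \<bar>x\<bar> > R \<Longrightarrow> \<phi> x = 0" "\<bar>x\<bar> > R"
  shows "deriv \<phi> x = 0"
proof -
  have "((\<lambda>x. 0) has_field_derivative 0) (at x)" by simp
  then have "(\<phi> has_field_derivative 0) (at x)"
    by (rule has_field_derivative_transform_within_open[of _ _ _ "{y. \<bar>y\<bar> > R}"])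
       (use assms in \<open>auto intro!: open_Collect_less continuous_intros\<close>)
  then show ?thesis by (rule DERIV_imp_deriv)
qed

lemma test_functionI: "smooth \<phi> \<Longrightarrow> (\<And>x. \<bar>x\<bar> > R \<Longrightarrow> \<phi> x = 0) \<Longrightarrow> test_function \<phi>"
  unfolding test_function_iff by (auto intro!: exI[of _ "{-R..R}"])

lemma test_function_deriv:
  assumes "test_function \<phi>" shows "test_function (deriv \<phi>)"
proof -
  obtain R where "R > 0" "\<And>x. \<bar>x\<bar> > R \<Longrightarrow> \<phi> x = 0" using test_function_support[OF assms] by blast
  then show ?thesis using assms
    by (intro test_functionI[of _ R] smooth_deriv deriv_zero_outside) (auto simp: test_function_iff)
qed

lemma test_function_higher_deriv: "test_function \<phi> \<Longrightarrow> test_function ((deriv ^^ k) \<phi>)"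
  by (induction k) (auto intro: test_function_deriv)

lemma test_function_smooth: "test_function \<phi> \<Longrightarrow> smooth \<phi>" by (simp add: test_function_iff)

lemma test_function_measurable: "test_function \<phi> \<Longrightarrow> \<phi> \<in> borel_measurable borel"
  by (intro borel_measurable_continuous_onI smooth_continuous test_function_smooth)

lemma continuous_compact_bounded:
  fixes \<phi> :: "real \<Rightarrow> 'a::real_normed_vector"
  assumes c: "continuous_on UNIV \<phi>" and R: "\<And>x. \<bar>x\<bar> > R \<Longrightarrow> \<phi> x = 0"
  obtains M where "M \<ge> 0" "\<And>x. norm (\<phi> x) \<le> M * indicat_real {-R..R} x"
proof -
  have "compact (\<phi> ` {-R..R})" by (rule compact_continuous_image) (auto intro: continuous_on_subset[OF c])
  then obtain M where M: "\<And>x. x \<in> {-R..R} \<Longrightarrow> norm (\<phi> x) \<le> M"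
    using compact_imp_bounded bounded_iff by (metis imageI)
  have "norm (\<phi> x) \<le> \<bar>M\<bar> * indicat_real {-R..R} x" for x
  proof (cases "\<bar>x\<bar> > R")
    case True then show ?thesis using R[of x] by (auto simp: indicator_def)
  next
    case False
    then have x: "x \<in> {-R..R}" by auto
    then show ?thesis using M[OF x] by (simp add: indicator_def)
  qed
  then show thesis using that[of "\<bar>M\<bar>"] by auto
qed

lemma continuous_compact_integrable:
  fixes \<phi> :: "real \<Rightarrow> 'a::{banach, second_countable_topology}"
  assumes c: "continuous_on UNIV \<phi>" and R: "\<And>x. \<bar>x\<bar> > R \<Longrightarrow> \<phi> x = 0"
  shows "integrable lborel \<phi>"
proof -
  obtain M where M: "M \<ge> 0" "\<And>x. norm (\<phi> x) \<le> M * indicat_real {-R..R} x"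
    using continuous_compact_bounded[OF c R] by blast
  have "integrable lborel (\<lambda>x. M * indicat_real {-R..R} x)" by (intro integrable_mult_right integrable_indicator_Icc)
  then show ?thesis
    by (rule Bochner_Integration.integrable_bound) (use M borel_measurable_continuous_onI[OF c] in auto)
qed

lemma test_function_bounded:
  assumes "test_function \<phi>"
  obtains M R where "M \<ge> 0" "\<And>x. \<bar>\<phi> x\<bar> \<le> M * indicat_real {-R..R} x"
proof -
  obtain R where R: "\<And>x. \<bar>x\<bar> > R \<Longrightarrow> \<phi> x = 0" using test_function_support[OF assms] by blast
  show thesis
    using continuous_compact_bounded[OF smooth_continuous[OF test_function_smooth[OF assms]] R] that
    by (metis real_norm_def)
qed

lemma test_function_integrable: "test_function \<phi> \<Longrightarrow> integrable lborel \<phi>"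
  by (rule test_function_support, assumption, rule continuous_compact_integrable[OF smooth_continuous[OF test_function_smooth]])

lemma test_function_sqint:
  assumes t: "test_function \<phi>" shows "sqint (cplx \<phi>)"
proof -
  obtain R where R: "\<And>x. \<bar>x\<bar> > R \<Longrightarrow> \<phi> x = 0" using test_function_support[OF t] by blast
  have "continuous_on UNIV (\<lambda>x. (\<phi> x)\<^sup>2)" by (intro continuous_intros smooth_continuous test_function_smooth t)
  then have "integrable lborel (\<lambda>x. (\<phi> x)\<^sup>2)" by (rule continuous_compact_integrable) (use R in auto)
  then show ?thesis using test_function_measurable[OF t] by (simp add: sqint_def)
qed

lemma integral_derivative_compact:
  fixes F :: "real \<Rightarrow> 'a::euclidean_space"
  assumes D: "\<And>x. (F has_vector_derivative f x) (at x)" and c: "continuous_on UNIV f"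
    and R: "\<And>x. \<bar>x\<bar> > R \<Longrightarrow> F x = 0" "\<And>x. \<bar>x\<bar> > R \<Longrightarrow> f x = 0"
  shows "(LINT x|lborel. f x) = 0"
proof -
  let ?b = "\<bar>R\<bar> + 1"
  have "(LINT x|lborel. indicator {-?b..?b} x *\<^sub>R f x) = F ?b - F (- ?b)"
    by (rule integral_FTC_Icc) (auto intro: has_vector_derivative_at_within D continuous_on_subset[OF c])
  also have "\<dots> = 0" using R(1) by auto
  also have "(\<lambda>x. indicator {-?b..?b} x *\<^sub>R f x) = f"
    using R(2) by (force simp: fun_eq_iff indicator_def)
  finally show ?thesis .
qed

text \<open>Integration by parts: the product of \<open>\<phi>\<close> with the kernel is a compactly supported
  antiderivative of the difference of the two sides.\<close>

lemma fourier_int_deriv: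
  assumes t: "test_function \<phi>"
  shows "fourier_int (cplx (deriv \<phi>)) \<xi> = \<i> * complex_of_real \<xi> * fourier_int (cplx \<phi>) \<xi>"
proof -
  let ?e = "\<lambda>y. exp (- (\<i> * complex_of_real (y * \<xi>)))"
  obtain R where R: "R > 0" "\<And>x. \<bar>x\<bar> > R \<Longrightarrow> \<phi> x = 0" using test_function_support[OF t] by blast
  have R': "\<And>x. \<bar>x\<bar> > R \<Longrightarrow> deriv \<phi> x = 0" by (rule deriv_zero_outside[OF R(2)])
  note c = smooth_continuous[OF test_function_smooth[OF t]] smooth_continuous[OF test_function_smooth[OF test_function_deriv[OF t]]]
  have i1: "integrable lborel (\<lambda>y. cplx (deriv \<phi>) y * ?e y)"
    by (rule fourier_int_integrand) (use test_function_integrable[OF test_function_deriv[OF t]] in simp)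
  have i2: "integrable lborel (\<lambda>y. cplx \<phi> y * ?e y)"
    by (rule fourier_int_integrand) (use test_function_integrable[OF t] in simp)
  have z: "(LINT y|lborel. cplx (deriv \<phi>) y * ?e y + (- \<i> * complex_of_real \<xi>) * (cplx \<phi> y * ?e y)) = 0"
  proof (rule integral_derivative_compact)
    fix x
    have d1: "((\<lambda>y. cplx \<phi> y) has_vector_derivative cplx (deriv \<phi>) x) (at x)"
      using smooth_has_derivative[OF test_function_smooth[OF t], of x]
      by (intro has_vector_derivative_of_real) (simp add: has_real_derivative_iff_has_vector_derivative)
    have "((\<lambda>z. exp (- (\<i> * (z * complex_of_real \<xi>)))) has_field_derivative (- \<i> * complex_of_real \<xi>) * ?e x) (at (complex_of_real x))"
      by (auto intro!: derivative_eq_intros)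
    from has_vector_derivative_real_field[OF this]
    have d2: "(?e has_vector_derivative (- \<i> * complex_of_real \<xi>) * ?e x) (at x)" by simp
    show "((\<lambda>y. cplx \<phi> y * ?e y) has_vector_derivative (cplx (deriv \<phi>) x * ?e x + (- \<i> * complex_of_real \<xi>) * (cplx \<phi> x * ?e x))) (at x)"
      using has_vector_derivative_mult[OF d1 d2] by (simp add: algebra_simps)
  next
    show "continuous_on UNIV (\<lambda>x. cplx (deriv \<phi>) x * ?e x + - \<i> * complex_of_real \<xi> * (cplx \<phi> x * ?e x))"
      by (intro continuous_intros c)
  next
    show "cplx \<phi> x * ?e x = 0" if "\<bar>x\<bar> > R" for x using R(2)[OF that] by simp
    show "cplx (deriv \<phi>) x * ?e x + - \<i> * complex_of_real \<xi> * (cplx \<phi> x * ?e x) = 0" if "\<bar>x\<bar> > R" for x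
      using R(2)[OF that] R'[OF that] by simp
  qed
  have s1: "(LINT y|lborel. cplx (deriv \<phi>) y * ?e y + (- \<i> * complex_of_real \<xi>) * (cplx \<phi> y * ?e y))
    = (LINT y|lborel. cplx (deriv \<phi>) y * ?e y) + (LINT y|lborel. (- \<i> * complex_of_real \<xi>) * (cplx \<phi> y * ?e y))"
    by (rule Bochner_Integration.integral_add[OF i1 integrable_mult_right[OF i2]])
  have s2: "(LINT y|lborel. (- \<i> * complex_of_real \<xi>) * (cplx \<phi> y * ?e y)) = (- \<i> * complex_of_real \<xi>) * (LINT y|lborel. cplx \<phi> y * ?e y)"
    by (rule integral_mult_right_zero)
  have "(LINT y|lborel. cplx (deriv \<phi>) y * ?e y) = - ((- \<i> * complex_of_real \<xi>) * (LINT y|lborel. cplx \<phi> y * ?e y))"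
    using z unfolding s1 s2 by (simp only: eq_neg_iff_add_eq_0)
  then have "(LINT y|lborel. cplx (deriv \<phi>) y * ?e y) = \<i> * complex_of_real \<xi> * (LINT y|lborel. cplx \<phi> y * ?e y)"
    by (simp only: mult_minus_left minus_minus)
  then show ?thesis unfolding fourier_int_def by (simp only: mult_ac)
qed

lemma fourier_int_higher_deriv:
  assumes t: "test_function \<phi>"
  shows "fourier_int (cplx ((deriv ^^ k) \<phi>)) \<xi> = (\<i> * complex_of_real \<xi>) ^ k * fourier_int (cplx \<phi>) \<xi>"
proof (induction k)
  case 0 show ?case by simp
next
  case (Suc k)
  show ?case using fourier_int_deriv[OF test_function_higher_deriv[OF t, of k], of \<xi>] Suc by simp
qed

lemma fourier_pair_test_function:
  assumes t: "test_function \<phi>" shows "fourier_pair (cplx \<phi>) (fourier_int (cplx \<phi>))"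
  by (rule fourier_pair_fourier_int[OF test_function_sqint[OF t]]) (use test_function_integrable[OF t] in simp)

lemma fourier_pair_test_function_deriv:
  assumes t: "test_function \<phi>"
  shows "fourier_pair (cplx ((deriv ^^ k) \<phi>)) (\<lambda>\<xi>. (\<i> * complex_of_real \<xi>) ^ k * fourier_int (cplx \<phi>) \<xi>)"
  using fourier_pair_test_function[OF test_function_higher_deriv[OF t, of k]]
  by (simp add: fourier_int_higher_deriv[OF t, abs_def])

lemma locally_integrable_times_bounded:
  assumes f: "locally_integrable f" and [measurable]: "\<phi> \<in> borel_measurable borel"
    and b: "\<And>x. \<bar>\<phi> x\<bar> \<le> M * indicat_real {-R..R} x"
  shows "integrable lborel (\<lambda>x. f x * \<phi> x)"
proof -
  have [measurable]: "f \<in> borel_measurable borel" and i: "integrable lborel (\<lambda>x. indicat_real {-R..R} x *\<^sub>R f x)"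
    using f by (auto simp: locally_integrable_def set_integrable_def)
  show ?thesis
  proof (rule Bochner_Integration.integrable_bound[OF integrable_mult_right[OF i, of M]])
    have "\<bar>f x * \<phi> x\<bar> \<le> \<bar>M * (indicat_real {-R..R} x *\<^sub>R f x)\<bar>" for x
    proof -
      have "\<bar>f x\<bar> * \<bar>\<phi> x\<bar> \<le> \<bar>f x\<bar> * \<bar>M * indicat_real {-R..R} x\<bar>"
        using b[of x] by (intro mult_left_mono) auto
      then show ?thesis by (simp add: abs_mult mult_ac)
    qed
    then show "AE x in lborel. norm (f x * \<phi> x) \<le> norm (M * (indicat_real {-R..R} x *\<^sub>R f x))" by simp
  qed measurable
qed

lemma locally_integrable_times_test:
  assumes "locally_integrable f" "test_function \<phi>" shows "integrable lborel (\<lambda>x. f x * \<phi> x)"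
  by (rule test_function_bounded[OF assms(2)])
     (rule locally_integrable_times_bounded[OF assms(1) test_function_measurable[OF assms(2)]])

text \<open>Positive and negative part define finite measures that agree on all half-lines, and half-lines
  generate the Borel sets.\<close>

lemma AE_zero_if_interval_integrals_zero:
  fixes f :: "real \<Rightarrow> real"
  assumes f: "integrable lborel f" and z: "\<And>x. (LINT y|lborel. f y * indicat_real {x<..} y) = 0"
  shows "AE x in lborel. f x = 0"
proof -
  have [measurable]: "f \<in> borel_measurable borel" using borel_measurable_integrable[OF f] by simp
  define p where "p x = max 0 (f x)" for x
  define q where "q x = max 0 (- f x)" for x
  have p: "integrable lborel p" and q: "integrable lborel q"
    unfolding p_def q_def using f by auto
  have [measurable]: "p \<in> borel_measurable borel" "q \<in> borel_measurable borel" unfolding p_def q_def by measurable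
  have i: "integrable lborel (\<lambda>y. g y * indicat_real {x<..} y)" if "integrable lborel g" for x and g :: "real \<Rightarrow> real"
    by (rule Bochner_Integration.integrable_bound[OF that]) (use borel_measurable_integrable[OF that] in \<open>auto simp: indicator_def\<close>)
  have em: "emeasure (density lborel (\<lambda>x. ennreal (g x))) {x<..} = ennreal (LINT y|lborel. g y * indicat_real {x<..} y)"
    if "integrable lborel g" "\<And>x. g x \<ge> 0" for g :: "real \<Rightarrow> real" and x :: real
  proof -
    have "emeasure (density lborel (\<lambda>x. ennreal (g x))) {x<..} = (\<integral>\<^sup>+y. ennreal (g y) * indicator {x<..} y \<partial>lborel)"
      using borel_measurable_integrable[OF that(1)] by (subst emeasure_density) auto
    also have "\<dots> = (\<integral>\<^sup>+y. ennreal (g y * indicat_real {x<..} y) \<partial>lborel)"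
      by (intro nn_integral_cong) (auto simp: indicator_def)
    also have "\<dots> = ennreal (LINT y|lborel. g y * indicat_real {x<..} y)"
      by (rule nn_integral_eq_integral[OF i[OF that(1)]]) (use that(2) in auto)
    finally show ?thesis .
  qed
  have "density lborel (\<lambda>x. ennreal (p x)) = density lborel (\<lambda>x. ennreal (q x))"
  proof (rule measure_eqI_lessThan)
    fix x
    show "emeasure (density lborel (\<lambda>x. ennreal (p x))) {x<..} < \<infinity>"
      by (subst em[OF p]) (auto simp: p_def)
    have "(LINT y|lborel. p y * indicat_real {x<..} y) - (LINT y|lborel. q y * indicat_real {x<..} y)
      = (LINT y|lborel. p y * indicat_real {x<..} y - q y * indicat_real {x<..} y)"
      by (rule Bochner_Integration.integral_diff[symmetric, OF i[OF p] i[OF q]])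
    also have "(\<lambda>y. p y * indicat_real {x<..} y - q y * indicat_real {x<..} y) = (\<lambda>y. f y * indicat_real {x<..} y)"
      by (auto simp: p_def q_def fun_eq_iff indicator_def)
    finally have "(LINT y|lborel. p y * indicat_real {x<..} y) = (LINT y|lborel. q y * indicat_real {x<..} y)"
      using z[of x] by linarith
    then show "emeasure (density lborel (\<lambda>x. ennreal (p x))) {x<..} = emeasure (density lborel (\<lambda>x. ennreal (q x))) {x<..}"
      by (subst em[OF p], simp add: p_def, subst em[OF q], simp add: q_def) simp
  qed auto
  moreover have "(\<integral>\<^sup>+x. ennreal (p x) \<partial>lborel) \<noteq> \<infinity>"
    by (subst nn_integral_eq_integral[OF p]) (auto simp: p_def)
  ultimately have "AE x in lborel. ennreal (p x) = ennreal (q x)"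
    by (subst (asm) finite_density_unique) auto
  then show ?thesis
    by eventually_elim (auto simp: p_def q_def max_def split: if_splits)
qed

text \<open>Bumps approximate indicators of intervals, so \<open>f\<close> has integral zero over every bounded
  interval.\<close>

lemma du_bois_reymond:
  assumes f: "locally_integrable f" and z: "\<And>\<phi>. test_function \<phi> \<Longrightarrow> (LINT x|lborel. f x * \<phi> x) = 0"
  shows "AE x in lborel. f x = 0"
proof -
  have [measurable]: "f \<in> borel_measurable borel" using f by (simp add: locally_integrable_def)
  have int0: "(LINT x|lborel. f x * indicat_real {a<..<b} x) = 0" for a b
  proof -
    let ?R = "\<bar>a\<bar> + \<bar>b\<bar>"
    have w: "integrable lborel (\<lambda>x. f x * indicat_real {-?R..?R} x)"
      by (rule locally_integrable_times_bounded[OF f, of _ 1 ?R]) auto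
    have "(\<lambda>n. LINT x|lborel. f x * bump a b n x) \<longlonglongrightarrow> (LINT x|lborel. f x * indicat_real {a<..<b} x)"
    proof (rule lborel_dominated_convergence)
      show "(\<lambda>n. f x * bump a b n x) \<longlonglongrightarrow> f x * indicat_real {a<..<b} x" for x
        by (intro tendsto_intros bump_tendsto)
      show "integrable lborel (\<lambda>x. \<bar>f x * indicat_real {-?R..?R} x\<bar>)" using w by (rule integrable_abs)
      show "norm (f x * bump a b n x) \<le> \<bar>f x * indicat_real {-?R..?R} x\<bar>" for x n
      proof (cases "x \<in> {a<..<b}")
        case True
        then have "x \<in> {-?R..?R}" by auto
        then show ?thesis using bump_bounds[of a b n x] by (simp add: abs_mult mult_left_le)
      next
        case False then show ?thesis by (simp add: bump_outside)
      qed
      show "(\<lambda>x. f x * bump a b n x) \<in> borel_measurable borel" for n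
        using test_function_measurable[OF test_function_bump, of a b n] by measurable
    qed measurable
    moreover have "(LINT x|lborel. f x * bump a b n x) = 0" for n by (rule z[OF test_function_bump])
    ultimately show ?thesis using LIMSEQ_unique[OF tendsto_const] by fastforce
  qed
  have "AE x in lborel. f x * indicat_real {- real n<..<real n} x = 0" for n :: nat
  proof (rule AE_zero_if_interval_integrals_zero)
    show "integrable lborel (\<lambda>x. f x * indicat_real {- real n<..<real n} x)"
      by (rule locally_integrable_times_bounded[OF f, of _ 1 "real n"]) (auto simp: indicator_def)
    fix x
    have "f y * indicat_real {- real n<..<real n} y * indicat_real {x<..} y = f y * indicat_real {max x (- real n)<..<real n} y" for y
      by (auto simp: indicator_def)
    then show "(LINT y|lborel. f y * indicat_real {- real n<..<real n} y * indicat_real {x<..} y) = 0"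
      by (simp only: int0)
  qed
  then have "AE x in lborel. \<forall>n::nat. f x * indicat_real {- real n<..<real n} x = 0"
    by (subst AE_all_countable) blast
  then show ?thesis
  proof eventually_elim
    case (elim x)
    obtain n :: nat where "\<bar>x\<bar> < real n" using reals_Archimedean2 by blast
    then show ?case using elim[rule_format, of n] by (auto simp: indicator_def)
  qed
qed

lemma locally_integrable_diff:
  assumes "locally_integrable f" "locally_integrable g" shows "locally_integrable (\<lambda>x. f x - g x)"
  using assms by (auto simp: locally_integrable_def intro!: set_integral_diff)

lemma has_weak_deriv_unique:
  assumes "has_weak_deriv k f g" "has_weak_deriv k f g'"
  shows "AE x in lborel. g x = g' x"
proof -
  have l: "locally_integrable g" "locally_integrable g'" using assms by (auto simp: has_weak_deriv_def)
  have "AE x in lborel. g x - g' x = 0"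
  proof (rule du_bois_reymond[OF locally_integrable_diff[OF l]])
    fix \<phi> assume t: "test_function \<phi>"
    have "(LINT x|lborel. g x * \<phi> x) = (LINT x|lborel. g' x * \<phi> x)"
      using assms t by (simp add: has_weak_deriv_def)
    then show "(LINT x|lborel. (g x - g' x) * \<phi> x) = 0"
      using Bochner_Integration.integral_diff[OF locally_integrable_times_test[OF l(1) t] locally_integrable_times_test[OF l(2) t]]
      by (simp add: left_diff_distrib)
  qed
  then show ?thesis by eventually_elim simp
qed

lemma weak_deriv_eq: "has_weak_deriv k f g \<Longrightarrow> has_weak_deriv k f (weak_deriv k f)"
  unfolding weak_deriv_def by (rule someI[of "has_weak_deriv k f"])

lemma sqint_locally_integrable:
  assumes s: "sqint (cplx u)" shows "locally_integrable u"
proof -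
  note [measurable] = sqintD[OF s]
  have "(\<lambda>x. Re (cplx u x)) \<in> borel_measurable borel" by measurable
  then have m: "u \<in> borel_measurable borel" by simp
  have "set_integrable lborel {a..b} u" for a b
  proof -
    have "sqint (cplx (indicat_real {a..b}))"
    proof -
      have "(\<lambda>x. (cmod (complex_of_real (indicat_real {a..b} x)))\<^sup>2) = indicat_real {a..b}"
        by (auto simp: indicator_def)
      then show ?thesis unfolding sqint_def using integrable_indicator_Icc[of a b] by simp
    qed
    from sqint_mult_integrable[OF this s] have "integrable lborel (\<lambda>x. complex_of_real (indicat_real {a..b} x * u x))" by simp
    then have "integrable lborel (\<lambda>x. indicat_real {a..b} x * u x)" by (simp only: complex_of_real_integrable_eq)
    then show ?thesis by (simp add: set_integrable_def)
  qed
  with m show ?thesis by (simp add: locally_integrable_def)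
qed

lemma fourier_pair_real_symmetric:
  assumes "fourier_pair (cplx u) U" shows "AE \<xi> in lborel. cnj (U (- \<xi>)) = U \<xi>"
  using fourier_pair_unique[OF fourier_pair_cnj[OF assms]] assms by simp

text \<open>Hermitian symmetry of a transform characterizes real-valued functions: conjugation of \<open>G\<close>
  reflects and conjugates \<open>U\<close>, and transforms are injective.\<close>

lemma fourier_pair_symmetric_real:
  assumes GU: "fourier_pair G U" and s: "AE \<xi> in lborel. cnj (U (- \<xi>)) = U \<xi>"
  shows "\<exists>g. fourier_pair (cplx g) U"
proof -
  note [measurable] = sqintD[OF fourier_pairD(1)[OF GU]] sqintD[OF fourier_pairD(2)[OF GU]]
  have "fourier_pair (\<lambda>x. cnj (G x)) U"
    by (rule fourier_pair_cong_AE[OF fourier_pair_cnj[OF GU]]) (use s in auto)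
  then have "AE x in lborel. cnj (G x) = G x" using fourier_pair_unique_inverse GU by blast
  then have "AE x in lborel. G x = complex_of_real (Re (G x))"
    by eventually_elim (simp add: complex_eq_iff)
  then have "fourier_pair (cplx (\<lambda>x. Re (G x))) U"
    by (intro fourier_pair_cong_AE[OF GU]) auto
  then show ?thesis by (rule exI[of _ "\<lambda>x. Re (G x)"])
qed

lemma inner_L2_cplx: "inner_L2 (cplx f) (cplx g) = complex_of_real (LINT x|lborel. f x * g x)"
  unfolding inner_L2_def by (simp flip: of_real_mult)

text \<open>Differentiation is multiplication by \<open>(\<i> \<xi>)^k\<close>: the inverse transform \<open>g\<close> of the product is
  real by symmetry, and Parseval's identity against a test function moves the symbol from one factor
  to the other.\<close>

lemma weak_deriv_fourier:
  assumes uU: "fourier_pair (cplx u) U" and s: "sqint (\<lambda>\<xi>. (\<i> * complex_of_real \<xi>) ^ k * U \<xi>)"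
  shows "\<exists>g. fourier_pair (cplx g) (\<lambda>\<xi>. (\<i> * complex_of_real \<xi>) ^ k * U \<xi>) \<and> has_weak_deriv k u g"
proof -
  let ?V = "\<lambda>\<xi>. (\<i> * complex_of_real \<xi>) ^ k * U \<xi>"
  obtain G where G: "fourier_pair G ?V" using fourier_pair_exists_inverse[OF s] by blast
  have "AE \<xi> in lborel. cnj (?V (- \<xi>)) = ?V \<xi>"
    using fourier_pair_real_symmetric[OF uU] by eventually_elim simp
  with fourier_pair_symmetric_real[OF G] obtain g where g: "fourier_pair (cplx g) ?V" by blast
  have "has_weak_deriv k u g"
    unfolding has_weak_deriv_def
  proof (intro conjI allI impI sqint_locally_integrable)
    show "sqint (cplx u)" "sqint (cplx g)" using fourier_pairD uU g by auto
    fix \<phi> assume t: "test_function \<phi>"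
    let ?F = "fourier_int (cplx \<phi>)"
    have "inner_L2 (cplx u) (cplx ((deriv ^^ k) \<phi>)) = inner_L2 U (\<lambda>\<xi>. (\<i> * complex_of_real \<xi>) ^ k * ?F \<xi>)"
      by (rule fourier_pair_parseval[OF uU fourier_pair_test_function_deriv[OF t], symmetric])
    also have "\<dots> = (LINT \<xi>|lborel. (-1) ^ k * (?V \<xi> * cnj (?F \<xi>)))"
    proof -
      have "U \<xi> * cnj ((\<i> * complex_of_real \<xi>) ^ k * ?F \<xi>) = (-1) ^ k * (?V \<xi> * cnj (?F \<xi>))" for \<xi>
      proof -
        have "cnj (\<i> * complex_of_real \<xi>) ^ k = (-1) ^ k * (\<i> * complex_of_real \<xi>) ^ k"
          by (simp flip: power_mult_distrib)
        then show ?thesis by (simp only: complex_cnj_mult complex_cnj_power mult_ac)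
      qed
      then show ?thesis unfolding inner_L2_def by (simp only:)
    qed
    also have "\<dots> = (-1) ^ k * inner_L2 ?V ?F" unfolding inner_L2_def by (rule integral_mult_right_zero)
    also have "inner_L2 ?V ?F = inner_L2 (cplx g) (cplx \<phi>)"
      by (rule fourier_pair_parseval[OF g fourier_pair_test_function[OF t]])
    finally have "complex_of_real (LINT x|lborel. u x * (deriv ^^ k) \<phi> x) = complex_of_real ((-1) ^ k * (LINT x|lborel. g x * \<phi> x))"
      by (simp add: inner_L2_cplx)
    then have "(LINT x|lborel. u x * (deriv ^^ k) \<phi> x) = (-1) ^ k * (LINT x|lborel. g x * \<phi> x)"
      by (simp only: of_real_eq_iff)
    then show "distr_deriv k u \<phi> = (LINT x|lborel. g x * \<phi> x)"
      by (simp add: distr_deriv_def flip: power_add mult.assoc)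
  qed
  with g show ?thesis by blast
qed

section \<open>Sobolev spaces in Fourier variables\<close>

definition mass :: "(real \<Rightarrow> real) \<Rightarrow> real" where "mass u = (LINT x|lborel. (u x)\<^sup>2)"

text \<open>The squared norm of the \<open>m\<close>-th derivative, written on the Fourier side, where it makes sense
  without reference to a choice of weak derivative.\<close>

definition kinetic :: "nat \<Rightarrow> (real \<Rightarrow> real) \<Rightarrow> real" where
  "kinetic m u = nrm2 (\<lambda>\<xi>. complex_of_real (\<xi> ^ m) * fourier u \<xi>)"

definition potential :: "real \<Rightarrow> (real \<Rightarrow> real) \<Rightarrow> real" where
  "potential p u = (LINT x|lborel. \<bar>u x\<bar> powr p)"

lemma nrm2_cplx: "nrm2 (cplx u) = mass u" by (simp add: nrm2_def mass_def)

lemma mass_nonneg [simp]: "mass u \<ge> 0" by (simp add: mass_def)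
lemma kinetic_nonneg [simp]: "kinetic m u \<ge> 0" by (simp add: kinetic_def)
lemma potential_nonneg [simp]: "potential p u \<ge> 0" by (simp add: potential_def)

lemma charge_eq_mass: "charge u = mass u / 2" by (simp add: charge_def mass_def)

lemma sqint_cplx_iff: "sqint (cplx u) \<longleftrightarrow> u \<in> borel_measurable borel \<and> integrable lborel (\<lambda>x. (u x)\<^sup>2)"
proof -
  have "cplx u \<in> borel_measurable borel \<longleftrightarrow> u \<in> borel_measurable borel"
  proof
    assume [measurable]: "cplx u \<in> borel_measurable borel"
    have "(\<lambda>x. Re (cplx u x)) \<in> borel_measurable borel" by measurable
    then show "u \<in> borel_measurable borel" by simp
  qed simp
  then show ?thesis by (simp add: sqint_def)
qed

lemma fourier_symbol_norm: "(cmod (complex_of_real (\<xi> ^ m) * z))\<^sup>2 = \<bar>\<xi>\<bar> ^ (2 * m) * (cmod z)\<^sup>2"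
  by (simp add: norm_mult norm_power power_mult_distrib mult.commute flip: power_mult)

text \<open>The weight \<open>1 + \<bar>\<xi>\<bar>^(2 * m)\<close> in the definition separates into two conditions of the same
  kind.\<close>

lemma sobolev_iff:
  "u \<in> sobolev m \<longleftrightarrow> sqint (cplx u) \<and> sqint (\<lambda>\<xi>. complex_of_real (\<xi> ^ m) * fourier u \<xi>)"
proof (cases "sqint (cplx u)")
  case True
  let ?U = "fourier u"
  have U: "sqint ?U" using fourier_pairD(2)[OF fourier_pair_fourier[OF True]] .
  note [measurable] = sqintD[OF U]
  have eq: "(\<lambda>\<xi>. (1 + \<bar>\<xi>\<bar> ^ (2 * m)) * (cmod (?U \<xi>))\<^sup>2) = (\<lambda>\<xi>. (cmod (?U \<xi>))\<^sup>2 + (cmod (complex_of_real (\<xi> ^ m) * ?U \<xi>))\<^sup>2)"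
    unfolding fourier_symbol_norm by (simp add: distrib_right)
  have "integrable lborel (\<lambda>\<xi>. (1 + \<bar>\<xi>\<bar> ^ (2 * m)) * (cmod (?U \<xi>))\<^sup>2) \<longleftrightarrow> integrable lborel (\<lambda>\<xi>. (cmod (complex_of_real (\<xi> ^ m) * ?U \<xi>))\<^sup>2)"
    unfolding eq
  proof
    assume "integrable lborel (\<lambda>\<xi>. (cmod (?U \<xi>))\<^sup>2 + (cmod (complex_of_real (\<xi> ^ m) * ?U \<xi>))\<^sup>2)"
    from Bochner_Integration.integrable_diff[OF this sqint_integrable[OF U]]
    show "integrable lborel (\<lambda>\<xi>. (cmod (complex_of_real (\<xi> ^ m) * ?U \<xi>))\<^sup>2)" by simp
  qed (intro Bochner_Integration.integrable_add sqint_integrable[OF U])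
  moreover have "(\<lambda>\<xi>. complex_of_real (\<xi> ^ m) * ?U \<xi>) \<in> borel_measurable borel" by measurable
  ultimately show ?thesis using True unfolding sobolev_def sqint_cplx_iff by (simp add: sqint_def)
next
  case False then show ?thesis unfolding sobolev_def sqint_cplx_iff by blast
qed

lemma sobolevD:
  assumes "u \<in> sobolev m"
  shows "u \<in> borel_measurable borel" "sqint (cplx u)" "fourier_pair (cplx u) (fourier u)" "sqint (fourier u)"
    "sqint (\<lambda>\<xi>. complex_of_real (\<xi> ^ m) * fourier u \<xi>)" "integrable lborel (\<lambda>x. (u x)\<^sup>2)"
  using assms fourier_pair_fourier fourier_pairD(2) by (auto simp: sobolev_iff sqint_cplx_iff)

lemma fourier_unique_AE: "fourier_pair (cplx u) U \<Longrightarrow> AE \<xi> in lborel. fourier u \<xi> = U \<xi>"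
  using fourier_pair_unique[OF fourier_pair_fourier] fourier_pairD(1) by blast

text \<open>Membership and kinetic energy can be read off from any transform of \<open>u\<close>, not only from the
  chosen one.\<close>

lemma sobolevI:
  assumes p: "fourier_pair (cplx u) U" and s: "sqint (\<lambda>\<xi>. complex_of_real (\<xi> ^ m) * U \<xi>)"
  shows "u \<in> sobolev m" "kinetic m u = nrm2 (\<lambda>\<xi>. complex_of_real (\<xi> ^ m) * U \<xi>)"
proof -
  have "sqint (fourier u)" using fourier_pair_fourier[OF fourier_pairD(1)[OF p]] fourier_pairD(2) by blast
  note [measurable] = sqintD[OF this] sqintD[OF fourier_pairD(2)[OF p]]
  have ae: "AE \<xi> in lborel. complex_of_real (\<xi> ^ m) * U \<xi> = complex_of_real (\<xi> ^ m) * fourier u \<xi>"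
    using fourier_unique_AE[OF p] by eventually_elim simp
  have "sqint (\<lambda>\<xi>. complex_of_real (\<xi> ^ m) * fourier u \<xi>)"
    by (rule sqint_cong_AE[OF s _ ae]) measurable
  then show "u \<in> sobolev m" using fourier_pairD(1)[OF p] by (simp add: sobolev_iff)
  show "kinetic m u = nrm2 (\<lambda>\<xi>. complex_of_real (\<xi> ^ m) * U \<xi>)"
    unfolding kinetic_def by (rule nrm2_cong_AE[symmetric, OF _ _ ae]) measurable
qed

lemma sobolev_norm_eq:
  assumes u: "u \<in> sobolev m" shows "sobolev_norm m u = sqrt (mass u + kinetic m u)"
proof -
  note U = sobolevD[OF u]
  have "(LINT \<xi>|lborel. (1 + \<bar>\<xi>\<bar> ^ (2 * m)) * (cmod (fourier u \<xi>))\<^sup>2)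
    = (LINT \<xi>|lborel. (cmod (fourier u \<xi>))\<^sup>2 + (cmod (complex_of_real (\<xi> ^ m) * fourier u \<xi>))\<^sup>2)"
    unfolding fourier_symbol_norm by (simp add: distrib_right)
  also have "\<dots> = nrm2 (fourier u) + kinetic m u"
    unfolding kinetic_def nrm2_def
    by (rule Bochner_Integration.integral_add[OF sqint_integrable[OF U(4)] sqint_integrable[OF U(5)]])
  also have "nrm2 (fourier u) = mass u" using fourier_pair_nrm2[OF U(3)] by (simp add: nrm2_cplx)
  finally show ?thesis by (simp add: sobolev_norm_def)
qed

lemma fourier_pair_cmult_real: "fourier_pair (cplx u) U \<Longrightarrow> fourier_pair (cplx (\<lambda>x. c * u x)) (\<lambda>x. complex_of_real c * U x)"
  using fourier_pair_cmult[of "cplx u" U "complex_of_real c"] by simp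

lemma fourier_pair_add_real: "fourier_pair (cplx u) U \<Longrightarrow> fourier_pair (cplx v) V \<Longrightarrow> fourier_pair (cplx (\<lambda>x. u x + v x)) (\<lambda>x. U x + V x)"
  using fourier_pair_add[of "cplx u" U "cplx v" V] by simp

lemma sobolev_cmult:
  assumes u: "u \<in> sobolev m"
  shows "(\<lambda>x. c * u x) \<in> sobolev m" "kinetic m (\<lambda>x. c * u x) = c\<^sup>2 * kinetic m u"
proof -
  let ?W = "\<lambda>\<xi>. complex_of_real (\<xi> ^ m) * (complex_of_real c * fourier u \<xi>)"
  have eq: "?W = (\<lambda>\<xi>. complex_of_real c * (complex_of_real (\<xi> ^ m) * fourier u \<xi>))" by (simp only: mult_ac)
  have s: "sqint ?W" unfolding eq by (rule sqint_cmult[OF sobolevD(5)[OF u]])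
  note p = fourier_pair_cmult_real[OF sobolevD(3)[OF u], of c]
  show "(\<lambda>x. c * u x) \<in> sobolev m" by (rule sobolevI(1)[OF p s])
  show "kinetic m (\<lambda>x. c * u x) = c\<^sup>2 * kinetic m u"
    unfolding sobolevI(2)[OF p s] unfolding eq nrm2_cmult kinetic_def by simp
qed

lemma sobolev_add:
  assumes u: "u \<in> sobolev m" and v: "v \<in> sobolev m"
  shows "(\<lambda>x. u x + v x) \<in> sobolev m" "sqrt (kinetic m (\<lambda>x. u x + v x)) \<le> sqrt (kinetic m u) + sqrt (kinetic m v)"
    "kinetic m (\<lambda>x. u x + v x) = kinetic m u + kinetic m v
      + 2 * Re (inner_L2 (\<lambda>\<xi>. complex_of_real (\<xi> ^ m) * fourier u \<xi>) (\<lambda>\<xi>. complex_of_real (\<xi> ^ m) * fourier v \<xi>))"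
proof -
  let ?W = "\<lambda>\<xi>. complex_of_real (\<xi> ^ m) * (fourier u \<xi> + fourier v \<xi>)"
  have eq: "?W = (\<lambda>\<xi>. complex_of_real (\<xi> ^ m) * fourier u \<xi> + complex_of_real (\<xi> ^ m) * fourier v \<xi>)"
    by (simp only: distrib_left)
  have s: "sqint ?W" unfolding eq by (rule sqint_add[OF sobolevD(5)[OF u] sobolevD(5)[OF v]])
  note p = fourier_pair_add_real[OF sobolevD(3)[OF u] sobolevD(3)[OF v]]
  show "(\<lambda>x. u x + v x) \<in> sobolev m" by (rule sobolevI(1)[OF p s])
  show "sqrt (kinetic m (\<lambda>x. u x + v x)) \<le> sqrt (kinetic m u) + sqrt (kinetic m v)"
    unfolding sobolevI(2)[OF p s] unfolding eq kinetic_def by (rule minkowski[OF sobolevD(5)[OF u] sobolevD(5)[OF v]])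
  show "kinetic m (\<lambda>x. u x + v x) = kinetic m u + kinetic m v
      + 2 * Re (inner_L2 (\<lambda>\<xi>. complex_of_real (\<xi> ^ m) * fourier u \<xi>) (\<lambda>\<xi>. complex_of_real (\<xi> ^ m) * fourier v \<xi>))"
    unfolding sobolevI(2)[OF p s] unfolding eq kinetic_def by (rule nrm2_add[OF sobolevD(5)[OF u] sobolevD(5)[OF v]])
qed

lemma sobolev_diff:
  assumes u: "u \<in> sobolev m" and v: "v \<in> sobolev m"
  shows "(\<lambda>x. u x - v x) \<in> sobolev m"
  using sobolev_add(1)[OF u sobolev_cmult(1)[OF v, of "-1"]] by simp

lemma mass_cmult: "mass (\<lambda>x. c * u x) = c\<^sup>2 * mass u"
  by (simp add: mass_def power_mult_distrib)

lemma mass_triangle: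
  assumes u: "u \<in> sobolev m" and v: "v \<in> sobolev m"
  shows "sqrt (mass (\<lambda>x. u x + v x)) \<le> sqrt (mass u) + sqrt (mass v)"
  using minkowski[OF sobolevD(2)[OF u] sobolevD(2)[OF v]] by (simp flip: nrm2_cplx)

lemma sobolev_shift:
  assumes u: "u \<in> sobolev m"
  shows "(\<lambda>x. u (x - a)) \<in> sobolev m" "kinetic m (\<lambda>x. u (x - a)) = kinetic m u"
proof -
  let ?e = "\<lambda>\<xi>. exp (- (\<i> * complex_of_real (a * \<xi>)))"
  let ?W = "\<lambda>\<xi>. complex_of_real (\<xi> ^ m) * (?e \<xi> * fourier u \<xi>)"
  have eq: "?W = (\<lambda>\<xi>. ?e \<xi> * (complex_of_real (\<xi> ^ m) * fourier u \<xi>))" by (simp only: mult_ac)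
  have s: "sqint ?W" unfolding eq by (rule sqint_mult_bounded[OF sobolevD(5)[OF u], of _ 1]) (auto simp del: of_real_mult)
  note p = fourier_pair_shift[OF sobolevD(3)[OF u], of a]
  show "(\<lambda>x. u (x - a)) \<in> sobolev m" by (rule sobolevI(1)[OF p s])
  show "kinetic m (\<lambda>x. u (x - a)) = kinetic m u"
    unfolding sobolevI(2)[OF p s] unfolding eq kinetic_def nrm2_def by (simp add: norm_mult del: of_real_mult)
qed

lemma integral_shift:
  fixes f :: "real \<Rightarrow> 'a::{banach, second_countable_topology}"
  shows "(LINT x|lborel. f (x - a)) = (LINT x|lborel. f x)"
  using lborel_integral_real_affine[of 1 f "-a"] by simp

lemma mass_shift: "mass (\<lambda>x. u (x - a)) = mass u"
  unfolding mass_def by (rule integral_shift)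

lemma potential_shift: "potential p (\<lambda>x. u (x - a)) = potential p u"
  unfolding potential_def by (rule integral_shift)

lemma sobolev_cong_AE:
  assumes u: "u \<in> sobolev m" and v: "v \<in> borel_measurable borel" and ae: "AE x in lborel. u x = v x"
  shows "v \<in> sobolev m" "kinetic m v = kinetic m u" "mass v = mass u" "potential p v = potential p u"
proof -
  note [measurable] = v sobolevD(1)[OF u] sqintD[OF sobolevD(4)[OF u]]
  have p: "fourier_pair (cplx v) (fourier u)"
    by (rule fourier_pair_cong_AE[OF sobolevD(3)[OF u]]) (use ae in auto)
  show "v \<in> sobolev m" by (rule sobolevI(1)[OF p sobolevD(5)[OF u]])
  show "kinetic m v = kinetic m u" unfolding sobolevI(2)[OF p sobolevD(5)[OF u]] by (simp add: kinetic_def)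
  show "mass v = mass u" unfolding mass_def by (rule integral_cong_AE) (use ae in auto)
  show "potential p v = potential p u" unfolding potential_def by (rule integral_cong_AE) (use ae in auto)
qed

text \<open>The symbol times the transform is, up to a unimodular factor, the transform of the \<open>m\<close>-th
  derivative, again a test function.\<close>

lemma test_function_sobolev:
  assumes t: "test_function \<phi>" shows "\<phi> \<in> sobolev m"
proof (rule sobolevI(1)[OF fourier_pair_test_function[OF t]])
  have "sqint (\<lambda>\<xi>. (\<i> * complex_of_real \<xi>) ^ m * fourier_int (cplx \<phi>) \<xi>)"
    using fourier_pairD(2)[OF fourier_pair_test_function_deriv[OF t]] .
  then show "sqint (\<lambda>\<xi>. complex_of_real (\<xi> ^ m) * fourier_int (cplx \<phi>) \<xi>)"
    by (rule sqint_dominated[of _ _ 1, rotated])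
       (use sqintD[OF fourier_pairD(2)[OF fourier_pair_test_function[OF t]]] in \<open>auto simp: norm_mult norm_power\<close>)
qed

section \<open>The Sobolev distance\<close>

lemma sobolev_dist_eq:
  assumes "u \<in> sobolev m" "v \<in> sobolev m"
  shows "sobolev_dist m u v = sqrt (mass (\<lambda>x. u x - v x) + kinetic m (\<lambda>x. u x - v x))"
  unfolding sobolev_dist_def by (rule sobolev_norm_eq[OF sobolev_diff[OF assms]])

lemma sobolev_dist_nonneg [simp]: "sobolev_dist m u v \<ge> 0"
  by (simp add: sobolev_dist_def sobolev_norm_def)

lemma sobolev_dist_commute:
  assumes u: "u \<in> sobolev m" and v: "v \<in> sobolev m"
  shows "sobolev_dist m u v = sobolev_dist m v u"
proof -
  have "(\<lambda>x. v x - u x) = (\<lambda>x. (-1) * (u x - v x))" by simp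
  then have "mass (\<lambda>x. v x - u x) = mass (\<lambda>x. u x - v x)" "kinetic m (\<lambda>x. v x - u x) = kinetic m (\<lambda>x. u x - v x)"
    using sobolev_cmult(2)[OF sobolev_diff[OF u v], of "-1"] mass_cmult[of "-1" "\<lambda>x. u x - v x"] by simp_all
  then show ?thesis by (simp add: sobolev_dist_eq u v)
qed

lemma sobolev_dist_shift:
  assumes u: "u \<in> sobolev m" and v: "v \<in> sobolev m"
  shows "sobolev_dist m (\<lambda>x. u (x - a)) (\<lambda>x. v (x - a)) = sobolev_dist m u v"
  using sobolev_shift(2)[OF sobolev_diff[OF u v], of a] mass_shift[of "\<lambda>x. u x - v x" a]
  by (simp add: sobolev_dist_eq u v sobolev_shift)

lemma sobolev_dist_bounds:
  assumes u: "u \<in> sobolev m" and v: "v \<in> sobolev m"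
  shows "sqrt (mass (\<lambda>x. u x - v x)) \<le> sobolev_dist m u v" "sqrt (kinetic m (\<lambda>x. u x - v x)) \<le> sobolev_dist m u v"
  by (simp_all add: sobolev_dist_eq u v)

lemma sobolev_dist_cong_AE:
  assumes u: "u \<in> sobolev m" and v: "v \<in> sobolev m" and u': "u' \<in> sobolev m" and ae: "AE x in lborel. u x = u' x"
  shows "sobolev_dist m u' v = sobolev_dist m u v"
proof -
  have ae2: "AE x in lborel. u x - v x = u' x - v x" using ae by eventually_elim simp
  from sobolev_cong_AE[OF sobolev_diff[OF u v] sobolevD(1)[OF sobolev_diff[OF u' v]] ae2]
  show ?thesis by (simp add: sobolev_dist_eq u v u')
qed

section \<open>Continuous representatives\<close>

lemma one_plus_even_power_pos: "0 < 1 + (x::real) ^ (2 * m)"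
  by (rule add_pos_nonneg) (auto simp: power_mult)

text \<open>Reduces the weights of higher order to \<open>1 + t\<^sup>2\<close>, whose reciprocal has the arctangent as
  antiderivative.\<close>

lemma one_plus_le_twice_one_plus_power:
  fixes s :: real
  assumes s: "0 \<le> s" and m: "m \<ge> 1" shows "1 + s \<le> 2 * (1 + s ^ m)"
proof (cases "s \<le> 1")
  case True
  then have "1 + s \<le> 2 * (1 + 0)" by simp
  also have "\<dots> \<le> 2 * (1 + s ^ m)" using s by (intro mult_left_mono add_left_mono) auto
  finally show ?thesis .
next
  case False
  then have "1 + s \<le> 2 * (0 + s)" by simp
  also have "\<dots> \<le> 2 * (1 + s ^ m)" using False m by (intro mult_left_mono add_mono self_le_power) auto
  finally show ?thesis .
qed

lemma integrable_weight:
  assumes m: "m \<ge> 1" shows "integrable lborel (\<lambda>t::real. 1 / (1 + t ^ (2 * m)))"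
proof -
  have "set_integrable lborel (einterval (-\<infinity>) \<infinity>) (\<lambda>x::real. inverse (1 + x\<^sup>2))"
    by (rule integrable_inverse_1_plus_square)
  then have "integrable lborel (\<lambda>x::real. 2 * inverse (1 + x\<^sup>2))"
    by (simp add: set_integrable_def)
  then show ?thesis
  proof (rule Bochner_Integration.integrable_bound)
    show "AE t::real in lborel. norm (1 / (1 + t ^ (2 * m))) \<le> norm (2 * inverse (1 + t\<^sup>2))"
    proof (rule AE_I2)
    fix t :: real
    have p: "0 < 1 + t ^ (2 * m)" "0 < 1 + t\<^sup>2" using one_plus_even_power_pos[of t m] one_plus_even_power_pos[of t 1] by auto
    have "1 / (1 + t ^ (2 * m)) \<le> 2 / (1 + t\<^sup>2)"
      using one_plus_le_twice_one_plus_power[of "t\<^sup>2" m] m p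
      by (simp only: pos_divide_le_eq pos_le_divide_eq times_divide_eq_left power_mult zero_le_power2 mult_1)
    moreover have "0 \<le> 1 / (1 + t ^ (2 * m))" "0 \<le> 2 / (1 + t\<^sup>2)" using p by (simp_all only: divide_nonneg_pos zero_le_one zero_le_numeral)
    ultimately show "norm (1 / (1 + t ^ (2 * m))) \<le> norm (2 * inverse (1 + t\<^sup>2))"
      by (simp only: real_norm_def abs_of_nonneg divide_inverse)
    qed
  qed measurable
qed

definition weight_integral :: "nat \<Rightarrow> real" where
  "weight_integral m = (LINT t|lborel. 1 / (1 + t ^ (2 * m)))"

lemma weight_integral_nonneg: "weight_integral m \<ge> 0"
  unfolding weight_integral_def
  by (rule Bochner_Integration.integral_nonneg) (simp add: less_imp_le[OF one_plus_even_power_pos])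

text \<open>The frequency scale \<open>R\<close> is a free parameter: choosing it in terms of the kinetic energy yields
  the interpolation exponent that decides coercivity.\<close>

lemma fourier_weighted:
  assumes u: "u \<in> sobolev m" and R: "R > 0"
  shows "sqint (\<lambda>\<xi>. complex_of_real (sqrt (1 + (\<xi> / R) ^ (2 * m))) * fourier u \<xi>)"
    "nrm2 (\<lambda>\<xi>. complex_of_real (sqrt (1 + (\<xi> / R) ^ (2 * m))) * fourier u \<xi>) = mass u + kinetic m u / R ^ (2 * m)"
proof -
  note U = sobolevD[OF u]
  note [measurable] = sqintD[OF U(4)]
  let ?W = "\<lambda>\<xi>. complex_of_real (sqrt (1 + (\<xi> / R) ^ (2 * m))) * fourier u \<xi>"
  have eq: "(cmod (?W \<xi>))\<^sup>2 = (cmod (fourier u \<xi>))\<^sup>2 + 1 / R ^ (2 * m) * (cmod (complex_of_real (\<xi> ^ m) * fourier u \<xi>))\<^sup>2" for \<xi>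
  proof -
    have "(cmod (?W \<xi>))\<^sup>2 = (1 + (\<xi> / R) ^ (2 * m)) * (cmod (fourier u \<xi>))\<^sup>2"
      using one_plus_even_power_pos[of "\<xi> / R" m] by (simp add: norm_mult power_mult_distrib)
    also have "\<dots> = (1 + 1 / R ^ (2 * m) * \<bar>\<xi>\<bar> ^ (2 * m)) * (cmod (fourier u \<xi>))\<^sup>2"
      by (simp add: power_divide power_mult)
    also have "(1 + 1 / R ^ (2 * m) * \<bar>\<xi>\<bar> ^ (2 * m)) * (cmod (fourier u \<xi>))\<^sup>2
      = (cmod (fourier u \<xi>))\<^sup>2 + 1 / R ^ (2 * m) * (\<bar>\<xi>\<bar> ^ (2 * m) * (cmod (fourier u \<xi>))\<^sup>2)"
      by (simp only: distrib_right mult_1 mult.assoc)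
    finally show ?thesis unfolding fourier_symbol_norm .
  qed
  note i1 = sqint_integrable[OF U(4)] and i2 = integrable_mult_right[OF sqint_integrable[OF U(5)], of "1 / R ^ (2 * m)"]
  have "integrable lborel (\<lambda>\<xi>. (cmod (?W \<xi>))\<^sup>2)"
    unfolding eq by (rule Bochner_Integration.integrable_add[OF i1 i2])
  then show "sqint ?W" unfolding sqint_def by simp
  have "nrm2 ?W = nrm2 (fourier u) + (LINT \<xi>|lborel. 1 / R ^ (2 * m) * (cmod (complex_of_real (\<xi> ^ m) * fourier u \<xi>))\<^sup>2)"
    unfolding nrm2_def eq by (rule Bochner_Integration.integral_add[OF i1 i2])
  also have "(LINT \<xi>|lborel. 1 / R ^ (2 * m) * (cmod (complex_of_real (\<xi> ^ m) * fourier u \<xi>))\<^sup>2) = 1 / R ^ (2 * m) * kinetic m u"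
    unfolding kinetic_def nrm2_def by (rule integral_mult_right_zero)
  also have "nrm2 (fourier u) = mass u" using fourier_pair_nrm2[OF U(3)] by (simp add: nrm2_cplx)
  finally show "nrm2 ?W = mass u + kinetic m u / R ^ (2 * m)" by simp
qed

text \<open>Cauchy--Schwarz between the weighted transform and the reciprocal of the weight. For \<open>k = 1\<close>
  it bounds the supremum of \<open>u\<close>, for a difference of two exponentials its modulus of continuity.\<close>

lemma fourier_integrable_times_bounded:
  assumes m: "m \<ge> 1" and u: "u \<in> sobolev m" and R: "R > 0"
    and [measurable]: "k \<in> borel_measurable borel" and k: "\<And>x. cmod (k x) \<le> C"
  shows "sqint (\<lambda>\<xi>. k \<xi> / complex_of_real (sqrt (1 + (\<xi> / R) ^ (2 * m))))"
    "integrable lborel (\<lambda>\<xi>. fourier u \<xi> * k \<xi>)"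
    "(LINT \<xi>|lborel. cmod (fourier u \<xi> * k \<xi>)) \<le> sqrt (mass u + kinetic m u / R ^ (2 * m)) *
       sqrt (LINT \<xi>|lborel. (cmod (k \<xi>))\<^sup>2 / (1 + (\<xi> / R) ^ (2 * m)))"
proof -
  let ?g = "\<lambda>\<xi>. k \<xi> / complex_of_real (sqrt (1 + (\<xi> / R) ^ (2 * m)))"
  let ?W = "\<lambda>\<xi>. complex_of_real (sqrt (1 + (\<xi> / R) ^ (2 * m))) * fourier u \<xi>"
  have sq: "(cmod (?g \<xi>))\<^sup>2 = (cmod (k \<xi>))\<^sup>2 / (1 + (\<xi> / R) ^ (2 * m))" for \<xi>
    using one_plus_even_power_pos[of "\<xi> / R" m] by (simp add: norm_divide power_divide)
  have "integrable lborel (\<lambda>\<xi>. C\<^sup>2 * (1 / (1 + (0 + (1 / R) * \<xi>) ^ (2 * m))))"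
    using R by (intro integrable_mult_right lborel_integrable_real_affine[OF integrable_weight[OF m]]) simp
  then have "integrable lborel (\<lambda>\<xi>. (cmod (?g \<xi>))\<^sup>2)"
  proof (rule Bochner_Integration.integrable_bound)
    have "(cmod (?g \<xi>))\<^sup>2 \<le> C\<^sup>2 * (1 / (1 + (0 + (1 / R) * \<xi>) ^ (2 * m)))" for \<xi>
      unfolding sq using one_plus_even_power_pos[of "\<xi> / R" m] power_mono[OF k[of \<xi>], of 2]
      by (simp add: divide_right_mono)
    then show "AE \<xi> in lborel. norm ((cmod (?g \<xi>))\<^sup>2) \<le> norm (C\<^sup>2 * (1 / (1 + (0 + (1 / R) * \<xi>) ^ (2 * m))))"
      by (intro AE_I2) (metis abs_ge_self abs_of_nonneg order_trans real_norm_def zero_le_power2)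
  qed measurable
  then show s: "sqint ?g" unfolding sqint_def by simp
  have e: "?W \<xi> * ?g \<xi> = fourier u \<xi> * k \<xi>" for \<xi>
  proof -
    have "complex_of_real (sqrt (1 + (\<xi> / R) ^ (2 * m))) \<noteq> 0" using one_plus_even_power_pos[of "\<xi> / R" m] by simp
    then show ?thesis by (simp del: of_real_eq_0_iff real_sqrt_eq_0_iff)
  qed
  show "integrable lborel (\<lambda>\<xi>. fourier u \<xi> * k \<xi>)"
    using sqint_mult_integrable[OF fourier_weighted(1)[OF u R] s] unfolding e .
  show "(LINT \<xi>|lborel. cmod (fourier u \<xi> * k \<xi>)) \<le> sqrt (mass u + kinetic m u / R ^ (2 * m)) *
       sqrt (LINT \<xi>|lborel. (cmod (k \<xi>))\<^sup>2 / (1 + (\<xi> / R) ^ (2 * m)))"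
    using cauchy_schwarz[OF fourier_weighted(1)[OF u R] s]
    unfolding e fourier_weighted(2)[OF u R] unfolding nrm2_def sq .
qed

lemma fourier_integrable:
  assumes m: "m \<ge> 1" and u: "u \<in> sobolev m" shows "integrable lborel (fourier u)"
  using fourier_integrable_times_bounded(2)[OF m u zero_less_one, of "\<lambda>_. 1" 1] by simp

text \<open>The continuous function that represents \<open>u\<close>: Fourier inversion evaluated at every point, which
  is possible because transforms of elements of \<open>H\<^sup>m\<close> are integrable. Reflecting the transform turns
  the inverse transform into \<open>fourier_int\<close>.\<close>

definition continuous_rep :: "(real \<Rightarrow> real) \<Rightarrow> real \<Rightarrow> real" where
  "continuous_rep u x = Re (fourier_int (\<lambda>\<xi>. fourier u (- \<xi>)) x)"

lemma continuous_rep_AE_eq: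
  assumes m: "m \<ge> 1" and u: "u \<in> sobolev m" shows "AE x in lborel. u x = continuous_rep u x"
proof -
  have "fourier_pair (\<lambda>\<xi>. fourier u (- \<xi>)) (cplx u)"
    using fourier_pair_reflect[OF fourier_pair_inversion[OF sobolevD(3)[OF u]]] by simp
  moreover have "fourier_pair (\<lambda>\<xi>. fourier u (- \<xi>)) (fourier_int (\<lambda>\<xi>. fourier u (- \<xi>)))"
    by (rule fourier_pair_fourier_int[OF sqint_reflect[OF sobolevD(4)[OF u]] integrable_reflect[OF fourier_integrable[OF m u]]])
  ultimately have "AE x in lborel. cplx u x = fourier_int (\<lambda>\<xi>. fourier u (- \<xi>)) x" by (rule fourier_pair_unique)
  then show ?thesis by eventually_elim (metis Re_complex_of_real continuous_rep_def)
qed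

lemma continuous_on_continuous_rep:
  assumes m: "m \<ge> 1" and u: "u \<in> sobolev m" shows "continuous_on UNIV (continuous_rep u)"
  unfolding continuous_rep_def[abs_def]
  by (intro continuous_intros fourier_int_continuous integrable_reflect fourier_integrable[OF m u])

lemma continuous_rep_measurable:
  assumes m: "m \<ge> 1" and u: "u \<in> sobolev m" shows "continuous_rep u \<in> borel_measurable borel"
  by (rule borel_measurable_continuous_onI[OF continuous_on_continuous_rep[OF m u]])

lemma continuous_rep_sobolev:
  assumes m: "m \<ge> 1" and u: "u \<in> sobolev m"
  shows "continuous_rep u \<in> sobolev m" "kinetic m (continuous_rep u) = kinetic m u" "mass (continuous_rep u) = mass u" "potential p (continuous_rep u) = potential p u"
  using sobolev_cong_AE[OF u continuous_rep_measurable[OF m u] continuous_rep_AE_eq[OF m u]] by auto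

text \<open>The supremum is at most the \<open>L\<^sup>1\<close> norm of the transform. The integral of the weight at scale
  \<open>R\<close> is \<open>R\<close> times that at scale \<open>1\<close>.\<close>

lemma continuous_rep_sup_bound:
  assumes m: "m \<ge> 1" and u: "u \<in> sobolev m" and R: "R > 0"
  shows "(continuous_rep u x)\<^sup>2 \<le> weight_integral m * (R * (mass u + kinetic m u / R ^ (2 * m)))"
proof -
  let ?A = "LINT \<xi>|lborel. cmod (fourier u \<xi>)"
  have w: "(LINT \<xi>|lborel. 1 / (1 + (\<xi> / R) ^ (2 * m))) = R * weight_integral m"
    using lborel_integral_real_affine[of R "\<lambda>\<xi>. 1 / (1 + (\<xi> / R) ^ (2 * m))" 0] R by (simp add: weight_integral_def)
  have "?A \<le> sqrt (mass u + kinetic m u / R ^ (2 * m)) * sqrt (R * weight_integral m)"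
    using fourier_integrable_times_bounded(3)[OF m u R, of "\<lambda>_. 1" 1] by (simp add: w)
  then have A: "?A\<^sup>2 \<le> (sqrt (mass u + kinetic m u / R ^ (2 * m)) * sqrt (R * weight_integral m))\<^sup>2"
    by (rule power_mono) simp
  have A2: "?A\<^sup>2 \<le> (mass u + kinetic m u / R ^ (2 * m)) * (R * weight_integral m)"
    using A R weight_integral_nonneg[of m] by (simp add: power_mult_distrib)
  have "\<bar>continuous_rep u x\<bar> \<le> cmod (fourier_int (\<lambda>\<xi>. fourier u (- \<xi>)) x)" unfolding continuous_rep_def by (rule abs_Re_le_cmod)
  also have "\<dots> \<le> (LINT \<xi>|lborel. cmod (fourier u (- \<xi>))) / sqrt (2 * pi)"
    by (rule fourier_int_bound[OF integrable_reflect[OF fourier_integrable[OF m u]]])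
  also have "(LINT \<xi>|lborel. cmod (fourier u (- \<xi>))) = ?A" by (rule integral_reflect)
  also have "?A / sqrt (2 * pi) \<le> ?A / 1"
  proof (intro divide_left_mono)
    show "1 \<le> sqrt (2 * pi)" using pi_gt3 by simp
  qed auto
  finally have "\<bar>continuous_rep u x\<bar> \<le> ?A" by simp
  then have "(continuous_rep u x)\<^sup>2 \<le> ?A\<^sup>2" by (simp add: abs_le_square_iff[symmetric])
  with A2 show ?thesis by (simp add: mult_ac)
qed

text \<open>A modulus of continuity common to a bounded subset of \<open>H\<^sup>m\<close>.\<close>

definition modulus :: "nat \<Rightarrow> real \<Rightarrow> real" where
  "modulus m h = (LINT \<xi>|lborel. (cmod (exp (- (\<i> * complex_of_real (h * \<xi>))) - 1))\<^sup>2 / (1 + \<xi> ^ (2 * m)))"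

lemma continuous_rep_equicontinuous:
  assumes m: "m \<ge> 1" and u: "u \<in> sobolev m"
  shows "\<bar>continuous_rep u x - continuous_rep u y\<bar> \<le> sqrt (mass u + kinetic m u) * sqrt (modulus m (x - y))"
proof -
  let ?U = "\<lambda>\<xi>. fourier u (- \<xi>)"
  let ?e = "\<lambda>a \<xi>. exp (- (\<i> * complex_of_real (\<xi> * a)))"
  have iU: "integrable lborel ?U" by (rule integrable_reflect[OF fourier_integrable[OF m u]])
  let ?k = "\<lambda>\<xi>. ?e x (- \<xi>) - ?e y (- \<xi>)"
  have k: "cmod (?k \<xi>) \<le> 2" for \<xi>
    by (rule order_trans[OF norm_triangle_ineq4]) (simp only: cmod_kernel)
  have kmod: "cmod (?k \<xi>) = cmod (exp (- (\<i> * complex_of_real ((x - y) * - \<xi>))) - 1)" for \<xi>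
  proof -
    have "?k \<xi> = ?e y (- \<xi>) * (exp (- (\<i> * complex_of_real ((x - y) * - \<xi>))) - 1)"
      by (simp add: right_diff_distrib algebra_simps flip: exp_add)
    then show ?thesis by (simp only: norm_mult cmod_kernel mult_1)
  qed
  have "\<bar>continuous_rep u x - continuous_rep u y\<bar> \<le> cmod (fourier_int ?U x - fourier_int ?U y)"
    unfolding continuous_rep_def by (metis abs_Re_le_cmod minus_complex.sel(1))
  also have "fourier_int ?U x - fourier_int ?U y = complex_of_real (1 / sqrt (2 * pi)) * (LINT \<xi>|lborel. ?U \<xi> * ?e x \<xi> - ?U \<xi> * ?e y \<xi>)"
    unfolding fourier_int_def using Bochner_Integration.integral_diff[OF fourier_int_integrand[OF iU, of x] fourier_int_integrand[OF iU, of y]]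
    by (simp only: right_diff_distrib)
  also have "(LINT \<xi>|lborel. ?U \<xi> * ?e x \<xi> - ?U \<xi> * ?e y \<xi>) = (LINT \<xi>|lborel. fourier u \<xi> * ?k \<xi>)"
    using integral_reflect[of "\<lambda>\<xi>. fourier u \<xi> * ?k \<xi>"] by (simp only: minus_minus right_diff_distrib)
  also have "cmod (complex_of_real (1 / sqrt (2 * pi)) * (LINT \<xi>|lborel. fourier u \<xi> * ?k \<xi>)) \<le> 1 * (LINT \<xi>|lborel. cmod (fourier u \<xi> * ?k \<xi>))"
    unfolding norm_mult
  proof (rule mult_mono)
    have "1 \<le> sqrt (2 * pi)" using pi_gt3 by simp
    then show "cmod (complex_of_real (1 / sqrt (2 * pi))) \<le> 1" by (simp only: norm_of_real) simp
    show "cmod (LINT \<xi>|lborel. fourier u \<xi> * ?k \<xi>) \<le> (LINT \<xi>|lborel. cmod (fourier u \<xi>) * cmod (?k \<xi>))"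
      using integral_norm_bound[of lborel "\<lambda>\<xi>. fourier u \<xi> * ?k \<xi>"] by (simp only: norm_mult)
  qed auto
  also have "\<dots> \<le> sqrt (mass u + kinetic m u / 1 ^ (2 * m)) * sqrt (LINT \<xi>|lborel. (cmod (?k \<xi>))\<^sup>2 / (1 + (\<xi> / 1) ^ (2 * m)))"
    unfolding mult_1 by (rule fourier_integrable_times_bounded(3)[OF m u zero_less_one _ k]) measurable
  also have "(LINT \<xi>|lborel. (cmod (?k \<xi>))\<^sup>2 / (1 + (\<xi> / 1) ^ (2 * m))) = modulus m (x - y)"
    unfolding kmod modulus_def
    using integral_reflect[of "\<lambda>\<xi>. (cmod (exp (- (\<i> * complex_of_real ((x - y) * \<xi>))) - 1))\<^sup>2 / (1 + \<xi> ^ (2 * m))"]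
    by (simp add: power_mult)
  finally show ?thesis by simp
qed

lemma modulus_tendsto_0:
  assumes m: "m \<ge> 1" and h: "h \<longlonglongrightarrow> (0::real)"
  shows "(\<lambda>n. modulus m (h n)) \<longlonglongrightarrow> 0"
proof -
  have "(\<lambda>n. LINT \<xi>|lborel. (cmod (exp (- (\<i> * complex_of_real (h n * \<xi>))) - 1))\<^sup>2 / (1 + \<xi> ^ (2 * m))) \<longlonglongrightarrow> (LINT \<xi>::real|lborel. (0::real))"
  proof (rule lborel_dominated_convergence[where w="\<lambda>\<xi>. 4 * (1 / (1 + \<xi> ^ (2 * m)))"])
    show "integrable lborel (\<lambda>\<xi>::real. 4 * (1 / (1 + \<xi> ^ (2 * m))))" by (intro integrable_mult_right integrable_weight m)
    fix \<xi> :: real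
    have nz: "1 + \<xi> ^ (2 * m) \<noteq> 0" using one_plus_even_power_pos[of \<xi> m] by linarith
    have "(\<lambda>n. (cmod (exp (- (\<i> * complex_of_real (h n * \<xi>))) - 1))\<^sup>2 / (1 + \<xi> ^ (2 * m))) \<longlonglongrightarrow> (cmod (exp (- (\<i> * complex_of_real (0 * \<xi>))) - 1))\<^sup>2 / (1 + \<xi> ^ (2 * m))"
      by (intro tendsto_intros h nz)
    then show "(\<lambda>n. (cmod (exp (- (\<i> * complex_of_real (h n * \<xi>))) - 1))\<^sup>2 / (1 + \<xi> ^ (2 * m))) \<longlonglongrightarrow> 0" by simp
    fix n
    have "cmod (exp (- (\<i> * complex_of_real (h n * \<xi>))) - 1) \<le> 1 + 1"
      by (rule order_trans[OF norm_triangle_ineq4]) (simp only: cmod_kernel norm_one)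
    from power_mono[OF this, of 2] have "(cmod (exp (- (\<i> * complex_of_real (h n * \<xi>))) - 1))\<^sup>2 \<le> 4" by simp
    then show "norm ((cmod (exp (- (\<i> * complex_of_real (h n * \<xi>))) - 1))\<^sup>2 / (1 + \<xi> ^ (2 * m))) \<le> 4 * (1 / (1 + \<xi> ^ (2 * m)))"
      using one_plus_even_power_pos[of \<xi> m] by (simp add: divide_right_mono abs_of_pos)
  qed measurable
  then show ?thesis by (simp add: modulus_def[abs_def])
qed

section \<open>The energy in Fourier variables\<close>

lemma powr_bound:
  fixes a M p :: real
  assumes "0 \<le> a" "a \<le> M" "2 < p" shows "a powr p \<le> M powr (p - 2) * a\<^sup>2"
proof (cases "a = 0")
  case False
  then have "a powr p = a powr (p - 2) * a powr 2" by (simp flip: powr_add)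
  also have "a powr 2 = a\<^sup>2" using assms False by simp
  also have "a powr (p - 2) * a\<^sup>2 \<le> M powr (p - 2) * a\<^sup>2"
    by (intro mult_right_mono powr_mono2) (use assms in auto)
  finally show ?thesis .
qed simp

text \<open>All but two of the \<open>p\<close> factors are estimated by the supremum.\<close>

lemma potential_bound:
  assumes p: "2 < p" and s: "sqint (cplx u)" and M: "\<And>x. \<bar>u x\<bar> \<le> M"
  shows "integrable lborel (\<lambda>x. \<bar>u x\<bar> powr p)" "potential p u \<le> M powr (p - 2) * mass u"
proof -
  have [measurable]: "u \<in> borel_measurable borel" and i: "integrable lborel (\<lambda>x. (u x)\<^sup>2)" using s by (auto simp: sqint_cplx_iff)
  have b: "\<bar>u x\<bar> powr p \<le> M powr (p - 2) * (u x)\<^sup>2" for x using powr_bound[of "\<bar>u x\<bar>" M p] M[of x] p by simp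
  have i2: "integrable lborel (\<lambda>x. M powr (p - 2) * (u x)\<^sup>2)" using i by simp
  show i3: "integrable lborel (\<lambda>x. \<bar>u x\<bar> powr p)"
    by (rule Bochner_Integration.integrable_bound[OF i2]) (use b in auto)
  have "potential p u \<le> (LINT x|lborel. M powr (p - 2) * (u x)\<^sup>2)"
    unfolding potential_def by (rule integral_mono[OF i3 i2 b])
  then show "potential p u \<le> M powr (p - 2) * mass u" by (simp add: mass_def)
qed

lemma continuous_rep_bounded:
  assumes m: "m \<ge> 1" and u: "u \<in> sobolev m" shows "\<bar>continuous_rep u x\<bar> \<le> sqrt (weight_integral m * (mass u + kinetic m u))"
  using continuous_rep_sup_bound[OF m u zero_less_one, of x] by (simp add: real_le_rsqrt)

lemma potential_integrable:
  assumes m: "m \<ge> 1" and u: "u \<in> sobolev m" and p: "2 < p"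
  shows "integrable lborel (\<lambda>x. \<bar>u x\<bar> powr p)"
proof -
  note [measurable] = sobolevD(1)[OF u] continuous_rep_measurable[OF m u]
  have "integrable lborel (\<lambda>x. \<bar>continuous_rep u x\<bar> powr p)"
    by (rule potential_bound(1)[OF p sobolevD(2)[OF continuous_rep_sobolev(1)[OF m u]] continuous_rep_bounded[OF m u]])
  then show ?thesis
    by (rule integrable_cong_AE_imp) (use continuous_rep_AE_eq[OF m u] in auto)
qed

lemma sqint_times_i:
  assumes "sqint (\<lambda>\<xi>. complex_of_real (\<xi> ^ m) * U \<xi>)"
  shows "sqint (\<lambda>\<xi>. (\<i> * complex_of_real \<xi>) ^ m * U \<xi>)"
    "nrm2 (\<lambda>\<xi>. (\<i> * complex_of_real \<xi>) ^ m * U \<xi>) = nrm2 (\<lambda>\<xi>. complex_of_real (\<xi> ^ m) * U \<xi>)"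
proof -
  have "(\<lambda>\<xi>. (\<i> * complex_of_real \<xi>) ^ m * U \<xi>) = (\<lambda>\<xi>. \<i> ^ m * (complex_of_real (\<xi> ^ m) * U \<xi>))"
    by (simp add: power_mult_distrib mult_ac)
  then show "sqint (\<lambda>\<xi>. (\<i> * complex_of_real \<xi>) ^ m * U \<xi>)"
    "nrm2 (\<lambda>\<xi>. (\<i> * complex_of_real \<xi>) ^ m * U \<xi>) = nrm2 (\<lambda>\<xi>. complex_of_real (\<xi> ^ m) * U \<xi>)"
    using sqint_cmult[OF assms, of "\<i> ^ m"] by (simp_all add: nrm2_cmult norm_power)
qed

lemma weak_deriv_sobolev:
  assumes u: "u \<in> sobolev k"
  shows "\<exists>g. fourier_pair (cplx g) (\<lambda>\<xi>. (\<i> * complex_of_real \<xi>) ^ k * fourier u \<xi>) \<and> (AE x in lborel. weak_deriv k u x = g x)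
     \<and> locally_integrable (weak_deriv k u)"
proof -
  obtain g where g: "fourier_pair (cplx g) (\<lambda>\<xi>. (\<i> * complex_of_real \<xi>) ^ k * fourier u \<xi>)" "has_weak_deriv k u g"
    using weak_deriv_fourier[OF sobolevD(3)[OF u] sqint_times_i(1)[OF sobolevD(5)[OF u]]] by blast
  have "has_weak_deriv k u (weak_deriv k u)" by (rule weak_deriv_eq[OF g(2)])
  then show ?thesis using g has_weak_deriv_unique[OF _ g(2)] by (auto simp: has_weak_deriv_def)
qed

text \<open>Replaces the weak derivative in the definition of the energy by its Fourier transform. Since
  the definition is a single integral, both of its parts have to be integrable before it may be
  separated.\<close>

lemma energy_eq:
  assumes m: "m \<ge> 1" and u: "u \<in> sobolev m" and p: "2 < p"
  shows "energy m p u = kinetic m u / 2 - potential p u / (p * (p - 1))"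
proof -
  obtain g where g: "fourier_pair (cplx g) (\<lambda>\<xi>. (\<i> * complex_of_real \<xi>) ^ m * fourier u \<xi>)"
    and ae: "AE x in lborel. weak_deriv m u x = g x" and l: "locally_integrable (weak_deriv m u)"
    using weak_deriv_sobolev[OF u] by blast
  have [measurable]: "weak_deriv m u \<in> borel_measurable borel" "g \<in> borel_measurable borel" "u \<in> borel_measurable borel"
    using l fourier_pairD(1)[OF g] sobolevD(1)[OF u] by (auto simp: locally_integrable_def sqint_cplx_iff)
  have ig: "integrable lborel (\<lambda>x. (g x)\<^sup>2)" using fourier_pairD(1)[OF g] by (simp add: sqint_cplx_iff)
  have "mass g = kinetic m u"
    using fourier_pair_nrm2[OF g] sqint_times_i(2)[OF sobolevD(5)[OF u]] by (simp add: nrm2_cplx kinetic_def)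
  have "energy m p u = (LINT x|lborel. 1 / 2 * (g x)\<^sup>2 - \<bar>u x\<bar> powr p / (p * (p - 1)))"
    unfolding energy_def by (rule integral_cong_AE) (use ae in auto)
  also have "\<dots> = (LINT x|lborel. 1 / 2 * (g x)\<^sup>2) - (LINT x|lborel. \<bar>u x\<bar> powr p / (p * (p - 1)))"
    by (intro Bochner_Integration.integral_diff integrable_mult_right integrable_divide_zero ig potential_integrable[OF m u p])
  also have "\<dots> = mass g / 2 - potential p u / (p * (p - 1))" by (simp add: mass_def potential_def)
  finally show ?thesis using \<open>mass g = kinetic m u\<close> by simp
qed

section \<open>Integrals against a fixed square-integrable function\<close>

lemma tendsto_zero_by_approximation:
  fixes b :: "nat \<Rightarrow> 'a::real_normed_vector"
  assumes a: "\<And>R. (\<lambda>n. a R n) \<longlonglongrightarrow> (0::'a)" and c: "c \<longlonglongrightarrow> (0::real)" and d: "\<And>n R::nat. norm (b n - a R n) \<le> c R"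
  shows "b \<longlonglongrightarrow> 0"
proof (rule LIMSEQ_I)
  fix e :: real assume e: "e > 0"
  from c have "\<forall>\<^sub>F R in sequentially. c R < e / 2" by (rule order_tendstoD(2)) (use e in simp)
  then obtain R where R: "c R < e / 2" by (auto simp: eventually_sequentially)
  have "\<forall>\<^sub>F n in sequentially. norm (a R n) < e / 2"
    using tendsto_norm_zero[OF a[of R]] by (rule order_tendstoD(2)) (use e in simp)
  then obtain N where N: "\<And>n. n \<ge> N \<Longrightarrow> norm (a R n) < e / 2" by (auto simp: eventually_sequentially)
  have "norm (b n - 0) < e" if "n \<ge> N" for n
  proof -
    have "norm (b n) \<le> norm (b n - a R n) + norm (a R n)" using norm_triangle_ineq[of "b n - a R n" "a R n"] by simp
    then show ?thesis using d[of n R] R N[OF that] by simp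
  qed
  then show "\<exists>no. \<forall>n\<ge>no. norm (b n - 0) < e" by blast
qed

lemma tail_tendsto_0:
  fixes v :: "real \<Rightarrow> real"
  assumes [measurable]: "v \<in> borel_measurable borel" and v: "integrable lborel (\<lambda>x. (v x)\<^sup>2)"
  shows "(\<lambda>n::nat. LINT x|lborel. (indicat_real (- {-real n..real n}) x * v x)\<^sup>2) \<longlonglongrightarrow> 0"
proof -
  have "(\<lambda>n::nat. LINT x|lborel. (indicat_real (- {-real n..real n}) x * v x)\<^sup>2) \<longlonglongrightarrow> (LINT x::real|lborel. (0::real))"
  proof (rule lborel_dominated_convergence[where w="\<lambda>x. (v x)\<^sup>2", OF _ _ v])
    fix x :: real
    obtain N where "\<bar>x\<bar> \<le> real N" using real_arch_simple by blast
    then have "\<forall>n\<ge>N. (indicat_real (- {-real n..real n}) x * v x)\<^sup>2 = 0" by (auto simp: indicator_def)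
    then have "\<forall>\<^sub>F n in sequentially. (indicat_real (- {-real n..real n}) x * v x)\<^sup>2 = 0"
      unfolding eventually_sequentially by blast
    then show "(\<lambda>n. (indicat_real (- {-real n..real n}) x * v x)\<^sup>2) \<longlonglongrightarrow> 0" by (rule tendsto_eventually)
  qed (auto simp: indicator_def)
  then show ?thesis by simp
qed

text \<open>Pointwise convergence suffices when the integrands are dominated by a bounded sequence in
  \<open>L\<^sup>2\<close> times one fixed function \<open>v\<close> in \<open>L\<^sup>2\<close>: on bounded intervals dominated convergence applies,
  and outside a large interval \<open>v\<close> has small norm, uniformly in \<open>n\<close>. Weak convergence and the
  splitting of the potential are both instances.\<close>

lemma integral_tendsto_0_local:
  fixes f h :: "nat \<Rightarrow> real \<Rightarrow> real" and v :: "real \<Rightarrow> real"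
  assumes [measurable]: "\<And>n. f n \<in> borel_measurable borel" "\<And>n. h n \<in> borel_measurable borel" "v \<in> borel_measurable borel"
    and lim: "\<And>x. (\<lambda>n. f n x) \<longlonglongrightarrow> 0"
    and b: "\<And>n x. \<bar>f n x\<bar> \<le> h n x * v x" and h: "\<And>n x. 0 \<le> h n x" "\<And>n x. h n x \<le> K"
    and hi: "\<And>n. integrable lborel (\<lambda>x. (h n x)\<^sup>2)" "\<And>n. (LINT x|lborel. (h n x)\<^sup>2) \<le> C"
    and v: "integrable lborel (\<lambda>x. (v x)\<^sup>2)" "\<And>x. 0 \<le> v x"
  shows "(\<lambda>n. LINT x|lborel. f n x) \<longlonglongrightarrow> 0"
proof (rule tendsto_zero_by_approximation)
  let ?in = "\<lambda>R::nat. indicat_real {-real R..real R}" and ?out = "\<lambda>R::nat. indicat_real (- {-real R..real R})"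
  have vloc: "integrable lborel (\<lambda>x. ?in R x * v x)" for R
  proof -
    have "sqint (cplx v)" using v by (simp add: sqint_cplx_iff)
    from integrable_trunc[OF this, of "real R"] have "integrable lborel (\<lambda>x. complex_of_real (?in R x * v x))" by simp
    then show ?thesis by (simp only: complex_of_real_integrable_eq)
  qed
  show "(\<lambda>n. LINT x|lborel. ?in R x * f n x) \<longlonglongrightarrow> 0" for R
  proof -
    have "(\<lambda>n. LINT x|lborel. ?in R x * f n x) \<longlonglongrightarrow> (LINT x::real|lborel. (0::real))"
    proof (rule lborel_dominated_convergence[where w="\<lambda>x. K * (?in R x * v x)"])
      show "(\<lambda>n. ?in R x * f n x) \<longlonglongrightarrow> 0" for x by (intro tendsto_mult_right_zero lim)
      show "norm (?in R x * f n x) \<le> K * (?in R x * v x)" for n x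
      proof -
        have "\<bar>f n x\<bar> \<le> K * v x" using b[of n x] h(2)[of n x] v(2)[of x] by (meson mult_right_mono order_trans)
        then show ?thesis by (auto simp: indicator_def)
      qed
    qed (use vloc in auto)
    then show ?thesis by simp
  qed
  have hv: "integrable lborel (\<lambda>x. h n x * v x)" for n by (rule cauchy_schwarz_real(1)) (use hi v in auto)
  have fi: "integrable lborel (f n)" for n
    by (rule Bochner_Integration.integrable_bound[OF hv[of n]]) (use b h v in \<open>auto simp: abs_mult intro!: AE_I2\<close>)
  show "(\<lambda>R. sqrt \<bar>C\<bar> * sqrt (LINT x|lborel. (?out R x * v x)\<^sup>2)) \<longlonglongrightarrow> 0"
    using tendsto_real_sqrt[OF tail_tendsto_0[OF _ v(1)]] by (auto intro!: tendsto_mult_right_zero)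
  show "norm ((LINT x|lborel. f n x) - (LINT x|lborel. ?in R x * f n x)) \<le> sqrt \<bar>C\<bar> * sqrt (LINT x|lborel. (?out R x * v x)\<^sup>2)" for n R
  proof -
    have i1: "integrable lborel (\<lambda>x. ?in R x * f n x)"
      by (rule Bochner_Integration.integrable_bound[OF fi[of n]]) (auto simp: indicator_def)
    have vo: "integrable lborel (\<lambda>x. (?out R x * v x)\<^sup>2)"
      by (rule Bochner_Integration.integrable_bound[OF v(1)]) (auto simp: indicator_def)
    have cs: "integrable lborel (\<lambda>x. h n x * (?out R x * v x))"
      "(LINT x|lborel. \<bar>h n x * (?out R x * v x)\<bar>) \<le> sqrt (LINT x|lborel. (h n x)\<^sup>2) * sqrt (LINT x|lborel. (?out R x * v x)\<^sup>2)"
      by (rule cauchy_schwarz_real; use hi vo in auto)+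
    have "(LINT x|lborel. f n x) - (LINT x|lborel. ?in R x * f n x) = (LINT x|lborel. f n x - ?in R x * f n x)"
      by (rule Bochner_Integration.integral_diff[OF fi i1, symmetric])
    also have "norm \<dots> \<le> (LINT x|lborel. norm (f n x - ?in R x * f n x))" by (rule integral_norm_bound)
    also have "\<dots> \<le> (LINT x|lborel. \<bar>h n x * (?out R x * v x)\<bar>)"
    proof (rule integral_mono)
      show "integrable lborel (\<lambda>x. norm (f n x - ?in R x * f n x))"
        by (intro integrable_norm Bochner_Integration.integrable_diff fi i1)
      show "integrable lborel (\<lambda>x. \<bar>h n x * (?out R x * v x)\<bar>)" using cs(1) by (rule integrable_abs)
      show "norm (f n x - ?in R x * f n x) \<le> \<bar>h n x * (?out R x * v x)\<bar>" for x
        using b[of n x] h(1)[of n x] v(2)[of x] by (auto simp: indicator_def abs_mult)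
    qed
    also have "\<dots> \<le> sqrt \<bar>C\<bar> * sqrt (LINT x|lborel. (?out R x * v x)\<^sup>2)"
      using hi(2)[of n] by (intro order_trans[OF cs(2)] mult_right_mono real_sqrt_le_mono) auto
    finally show ?thesis .
  qed
qed

section \<open>Power inequalities\<close>

lemma powr_diff_bound:
  fixes a b p :: real
  assumes "0 \<le> a" "0 \<le> b" "1 < p"
  shows "\<bar>a powr p - b powr p\<bar> \<le> p * (max a b) powr (p - 1) * \<bar>a - b\<bar>"
proof -
  have main: "x powr p - y powr p \<le> p * x powr (p - 1) * (x - y)" if "0 \<le> y" "y < x" for x y :: real
  proof (cases "y = 0")
    case True
    have "x powr p = x powr ((p - 1) + 1)" by simp
    also have "\<dots> = x powr (p - 1) * x powr 1" by (rule powr_add)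
    also have "\<dots> = 1 * (x powr (p - 1) * x)" using that by simp
    also have "\<dots> \<le> p * (x powr (p - 1) * x)" using that assms(3) by (intro mult_right_mono) auto
    finally show ?thesis using True assms(3) by (simp add: mult.assoc)
  next
    case False
    then have y: "y > 0" using that by simp
    have yx: "y < x" by (rule that(2))
    obtain z where z: "y < z" "z < x" "x powr p - y powr p = (x - y) * (p * z powr (p - 1))"
    proof (atomize_elim, rule exE[OF MVT2[OF yx]])
      fix t assume t: "y \<le> t" "t \<le> x"
      then show "((\<lambda>t. t powr p) has_field_derivative p * t powr (p - 1)) (at t)"
        using y by (intro has_real_derivative_powr) simp
    qed blast
    have "z powr (p - 1) \<le> x powr (p - 1)" using z y assms(3) by (intro powr_mono2) auto
    then have "(x - y) * (p * z powr (p - 1)) \<le> (x - y) * (p * x powr (p - 1))"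
      using that assms(3) by (intro mult_left_mono) auto
    then show ?thesis using z(3) by (simp add: mult_ac)
  qed
  have mono: "y powr p \<le> x powr p" if "0 \<le> y" "y \<le> x" for x y using that assms(3) by (intro powr_mono2) auto
  consider "a = b" | "a < b" | "b < a" by linarith
  then show ?thesis
  proof cases
    case 2 then show ?thesis using main[OF assms(1) 2] mono[OF assms(1), of b] by (simp add: max_def)
  next
    case 3 then show ?thesis using main[OF assms(2) 3] mono[OF assms(2), of a] by (simp add: max_def)
  qed simp
qed

lemma powr_diff_bound_abs:
  fixes a b p L :: real
  assumes p: "2 < p" and L: "\<bar>a\<bar> + \<bar>b\<bar> \<le> L"
  shows "\<bar>\<bar>a\<bar> powr p - \<bar>b\<bar> powr p\<bar> \<le> p * L powr (p - 2) * ((\<bar>a\<bar> + \<bar>b\<bar>) * \<bar>a - b\<bar>)"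
proof -
  let ?s = "\<bar>a\<bar> + \<bar>b\<bar>"
  have 1: "(max \<bar>a\<bar> \<bar>b\<bar>) powr (p - 1) \<le> L powr (p - 2) * ?s"
  proof (cases "?s = 0")
    case True
    then have "a = 0" "b = 0" by auto
    then show ?thesis by simp
  next
    case False
    then have s: "?s > 0" by linarith
    have "(max \<bar>a\<bar> \<bar>b\<bar>) powr (p - 1) \<le> ?s powr (p - 1)" using p by (intro powr_mono2) auto
    also have "?s powr (p - 1) = ?s powr ((p - 2) + 1)" by simp
    also have "\<dots> = ?s powr (p - 2) * ?s powr 1" by (rule powr_add)
    also have "\<dots> = ?s powr (p - 2) * ?s" using s by simp
    also have "\<dots> \<le> L powr (p - 2) * ?s" using L p s by (intro mult_right_mono powr_mono2) auto
    finally show ?thesis .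
  qed
  have "\<bar>\<bar>a\<bar> powr p - \<bar>b\<bar> powr p\<bar> \<le> p * (max \<bar>a\<bar> \<bar>b\<bar>) powr (p - 1) * \<bar>\<bar>a\<bar> - \<bar>b\<bar>\<bar>"
    using p by (intro powr_diff_bound) auto
  also have "\<dots> \<le> p * (L powr (p - 2) * ?s) * \<bar>a - b\<bar>"
    using 1 p by (intro mult_mono mult_left_mono) auto
  finally show ?thesis by (simp add: mult_ac)
qed

text \<open>A power below \<open>1\<close> is absorbed by a small multiple of the identity: beyond the threshold \<open>X\<close>
  the linear term dominates, and up to it the power is bounded by a constant.\<close>

lemma subcritical_absorb:
  fixes B \<theta> :: real
  assumes B: "B \<ge> 0" and t: "0 < \<theta>" "\<theta> < 1"
  shows "\<exists>D. \<forall>x\<ge>1. B * x powr \<theta> \<le> x / 4 + D"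
proof -
  \<comment> \<open>The solution of \<open>X powr (1 - \<theta>) = 4 * B + 1\<close>.\<close>
  define X where "X = (4 * B + 1) powr (1 / (1 - \<theta>))"
  show ?thesis
  proof (intro exI allI impI)
    fix x :: real assume x: "1 \<le> x"
    show "B * x powr \<theta> \<le> x / 4 + B * X powr \<theta>"
    proof (cases "x \<le> X")
      case True
      then have "B * x powr \<theta> \<le> B * X powr \<theta>" using x B t by (intro mult_left_mono powr_mono2) auto
      then show ?thesis using x by simp
    next
      case False
      then have "X powr (1 - \<theta>) \<le> x powr (1 - \<theta>)" using t by (intro powr_mono2) (auto simp: X_def)
      moreover have "X powr (1 - \<theta>) = 4 * B + 1" using B t by (simp add: X_def powr_powr)
      ultimately have "4 * B \<le> x powr (1 - \<theta>)" by simp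
      then have "4 * B * x powr \<theta> \<le> x powr (1 - \<theta>) * x powr \<theta>" by (rule mult_right_mono) simp
      also have "\<dots> = x" using x by (simp flip: powr_add)
      finally have "B * x powr \<theta> \<le> x / 4" by simp
      moreover have "0 \<le> B * X powr \<theta>" using B by simp
      ultimately show ?thesis by linarith
    qed
  qed
qed

section \<open>Coercivity of the energy\<close>

text \<open>The Gagliardo--Nirenberg inequality for the supremum: the scale \<open>R\<close> is chosen with
  \<open>R^(2 * m) = 1 + kinetic m u\<close>, which balances the two terms of \<open>continuous_rep_sup_bound\<close>.\<close>

lemma continuous_rep_sup_bound_interpolation:
  assumes m: "m \<ge> 1" and u: "u \<in> sobolev m" and Q: "mass u \<le> Q"
  shows "(continuous_rep u x)\<^sup>2 \<le> weight_integral m * (Q + 1) * (1 + kinetic m u) powr (1 / (2 * real m))"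
proof -
  let ?K = "kinetic m u"
  define R where "R = (1 + ?K) powr (1 / (2 * real m))"
  have R1: "R \<ge> 1" unfolding R_def using m by (intro ge_one_powr_ge_zero) auto
  have K: "0 \<le> ?K" by simp
  have Rpow: "R ^ (2 * m) = 1 + ?K"
  proof -
    have "R ^ (2 * m) = R powr (real (2 * m))" using R1 by (intro powr_realpow[symmetric]) simp
    also have "\<dots> = (1 + ?K) powr 1" unfolding R_def powr_powr using m by simp
    finally show ?thesis using K by simp
  qed
  have le1: "?K / R ^ (2 * m) \<le> 1" unfolding Rpow by (subst divide_le_eq_1_pos) (use K in linarith)+
  then have "R * (mass u + ?K / R ^ (2 * m)) \<le> R * (Q + 1)" using R1 by (intro mult_left_mono add_mono Q le1) auto
  then have "weight_integral m * (R * (mass u + ?K / R ^ (2 * m))) \<le> weight_integral m * (R * (Q + 1))"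
    by (rule mult_left_mono[OF _ weight_integral_nonneg])
  then have "(continuous_rep u x)\<^sup>2 \<le> weight_integral m * (R * (Q + 1))"
    using R1 by (intro order_trans[OF continuous_rep_sup_bound[OF m u, of R x]]) auto
  then show ?thesis unfolding R_def by (simp only: mult_ac)
qed

text \<open>The potential is at most a constant times the power \<open>\<theta> = (p - 2)/(4m)\<close> of \<open>1 + kinetic m u\<close>.
  Subcriticality is the inequality \<open>\<theta> < 1\<close>, and half of the kinetic part absorbs the potential.\<close>

lemma energy_coercive:
  assumes m: "m \<ge> 1" and p: "2 < p" "p < 4 * real m + 2" and Q: "Q \<ge> 0"
  shows "\<exists>D. \<forall>u\<in>sobolev m. mass u \<le> Q \<longrightarrow> kinetic m u / 4 - D \<le> energy m p u"
proof -
  define A where "A = weight_integral m * (Q + 1)"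
  define \<theta> where "\<theta> = (p - 2) / (4 * real m)"
  define B where "B = A powr ((p - 2) / 2) * Q / (p * (p - 1))"
  have A: "A \<ge> 0" using weight_integral_nonneg[of m] Q by (simp add: A_def)
  have t: "0 < \<theta>" "\<theta> < 1" using m p by (auto simp: \<theta>_def divide_simps)
  have B: "B \<ge> 0" using Q p by (simp add: B_def)
  obtain D where D: "\<And>x. x \<ge> 1 \<Longrightarrow> B * x powr \<theta> \<le> x / 4 + D" using subcritical_absorb[OF B t] by blast
  have "kinetic m u / 4 - (D + 1/4) \<le> energy m p u" if u: "u \<in> sobolev m" and Qu: "mass u \<le> Q" for u
  proof -
    let ?K = "kinetic m u"
    define S where "S = A * (1 + ?K) powr (1 / (2 * real m))"
    have S: "S \<ge> 0" using A by (simp add: S_def)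
    have sup: "\<bar>continuous_rep u x\<bar> \<le> sqrt S" for x
      using continuous_rep_sup_bound_interpolation[OF m u Qu, of x] by (intro real_le_rsqrt) (simp add: S_def A_def)
    have "potential p u = potential p (continuous_rep u)" by (simp add: continuous_rep_sobolev[OF m u])
    also have "\<dots> \<le> sqrt S powr (p - 2) * mass (continuous_rep u)"
      by (rule potential_bound(2)[OF p(1) sobolevD(2)[OF continuous_rep_sobolev(1)[OF m u]] sup])
    also have "\<dots> \<le> sqrt S powr (p - 2) * Q" using Qu by (simp add: continuous_rep_sobolev[OF m u] mult_left_mono)
    also have "sqrt S powr (p - 2) = S powr ((p - 2) / 2)"
      using S by (simp add: powr_half_sqrt[symmetric] powr_powr)
    also have "S powr ((p - 2) / 2) = A powr ((p - 2) / 2) * (1 + ?K) powr \<theta>"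
      unfolding S_def \<theta>_def using A by (simp add: powr_mult powr_powr mult.commute)
    finally have "potential p u / (p * (p - 1)) \<le> A powr ((p - 2) / 2) * (1 + ?K) powr \<theta> * Q / (p * (p - 1))"
      using p by (intro divide_right_mono) auto
    also have "\<dots> = B * (1 + ?K) powr \<theta>" by (simp add: B_def mult_ac)
    also have "\<dots> \<le> (1 + ?K) / 4 + D" by (rule D) simp
    finally have "potential p u / (p * (p - 1)) \<le> (1 + ?K) / 4 + D" .
    moreover have "a / 4 - (D + 1/4) \<le> a / 2 - b" if "b \<le> (1 + a) / 4 + D" for a b :: real
      using that by argo
    ultimately show ?thesis unfolding energy_eq[OF m u p(1)] by blast
  qed
  then show ?thesis by blast
qed

section \<open>Pointwise convergent subsequences\<close>

text \<open>Arzela--Ascoli without compactness of the domain: a diagonal subsequence converges on the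
  rationals, and equicontinuity extends the convergence to all points.\<close>

lemma pointwise_convergent_subsequence:
  fixes f :: "nat \<Rightarrow> real \<Rightarrow> real"
  assumes M: "\<And>n x. \<bar>f n x\<bar> \<le> M" and eq: "\<And>n x y. \<bar>f n x - f n y\<bar> \<le> w (x - y)"
    and w: "\<And>h. h \<longlonglongrightarrow> (0::real) \<Longrightarrow> (\<lambda>n. w (h n)) \<longlonglongrightarrow> (0::real)"
  obtains r g where "strict_mono (r :: nat \<Rightarrow> nat)" "\<And>x. (\<lambda>n. f (r n) x) \<longlonglongrightarrow> g x"
proof -
  have "countable (\<rat> :: real set)" by (rule countable_rat)
  then obtain r where r: "strict_mono (r :: nat \<Rightarrow> nat)" and conv: "\<And>x. x \<in> \<rat> \<Longrightarrow> \<exists>l. (\<lambda>n. f (r n) x) \<longlonglongrightarrow> l"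
    using function_convergent_subsequence[of "\<rat> :: real set" f M] M by auto
  have "convergent (\<lambda>n. f (r n) x)" for x
  proof (rule Cauchy_convergent, rule metric_CauchyI)
    fix e :: real assume e: "e > 0"
    have "\<forall>n. \<exists>q. q \<in> \<rat> \<and> \<bar>q - x\<bar> < inverse (real (Suc n))"
    proof
      fix n
      obtain q where "q \<in> \<rat>" "x < q" "q < x + inverse (real (Suc n))"
        using Rats_dense_in_real[of x "x + inverse (real (Suc n))"] by auto
      then show "\<exists>q. q \<in> \<rat> \<and> \<bar>q - x\<bar> < inverse (real (Suc n))" by (intro exI[of _ q]) auto
    qed
    from choice[OF this] obtain q where q: "\<And>n. q n \<in> \<rat>" "\<And>n. \<bar>q n - x\<bar> < inverse (real (Suc n))" by blast
    have "(\<lambda>n. x - q n) \<longlonglongrightarrow> 0"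
      by (rule Lim_null_comparison[OF _ LIMSEQ_inverse_real_of_nat]) (use q(2) in \<open>auto simp: abs_minus_commute intro!: always_eventually less_imp_le\<close>)
    then have "(\<lambda>n. w (x - q n)) \<longlonglongrightarrow> 0" by (rule w)
    then have "\<forall>\<^sub>F n in sequentially. w (x - q n) < e / 3" by (rule order_tendstoD(2)) (use e in simp)
    then obtain k where k: "w (x - q k) < e / 3" by (auto simp: eventually_sequentially)
    obtain l where "(\<lambda>n. f (r n) (q k)) \<longlonglongrightarrow> l" using conv[OF q(1)] by blast
    then have "Cauchy (\<lambda>n. f (r n) (q k))" by (intro convergent_Cauchy) (auto simp: convergent_def)
    then obtain N where N: "\<And>i j. i \<ge> N \<Longrightarrow> j \<ge> N \<Longrightarrow> dist (f (r i) (q k)) (f (r j) (q k)) < e / 3"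
      using e by (meson metric_CauchyD divide_pos_pos zero_less_numeral)
    have "dist (f (r i) x) (f (r j) x) < e" if "i \<ge> N" "j \<ge> N" for i j
      using N[OF that] eq[of "r i" x "q k"] eq[of "r j" x "q k"] k unfolding dist_real_def by linarith
    then show "\<exists>N. \<forall>i\<ge>N. \<forall>j\<ge>N. dist (f (r i) x) (f (r j) x) < e" by blast
  qed
  then have "\<And>x. (\<lambda>n. f (r n) x) \<longlonglongrightarrow> lim (\<lambda>n. f (r n) x)" by (simp add: convergent_LIMSEQ_iff)
  then show thesis by (rule that[OF r])
qed

section \<open>Splitting of mass and energy along pointwise limits\<close>

text \<open>Fatou's lemma.\<close>

lemma mass_limit:
  fixes v :: "nat \<Rightarrow> real \<Rightarrow> real"
  assumes s: "\<And>n. sqint (cplx (v n))" and Q: "\<And>n. mass (v n) \<le> Q" and lim: "\<And>x. (\<lambda>n. v n x) \<longlonglongrightarrow> g x"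
  shows "sqint (cplx g)" "mass g \<le> Q"
proof -
  have [measurable]: "v n \<in> borel_measurable borel" for n using s[of n] by (simp add: sqint_cplx_iff)
  have [measurable]: "g \<in> borel_measurable borel"
    by (rule borel_measurable_LIMSEQ_real[OF lim]) simp
  have Q0: "Q \<ge> 0" using Q[of 0] mass_nonneg[of "v 0"] by linarith
  have "(\<integral>\<^sup>+x. ennreal ((cmod (cplx g x))\<^sup>2) \<partial>lborel) = (\<integral>\<^sup>+x. liminf (\<lambda>n. ennreal ((cmod (cplx (v n) x))\<^sup>2)) \<partial>lborel)"
    by (intro nn_integral_cong lim_imp_Liminf[symmetric] tendsto_ennrealI tendsto_intros lim) simp
  also have "\<dots> \<le> liminf (\<lambda>n. \<integral>\<^sup>+x. ennreal ((cmod (cplx (v n) x))\<^sup>2) \<partial>lborel)"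
    by (rule nn_integral_liminf) measurable
  also have "\<dots> = liminf (\<lambda>n. ennreal (mass (v n)))"
    by (subst nrm2_nn[OF s]) (simp only: nrm2_cplx)
  also have "\<dots> \<le> ennreal Q"
    by (rule Liminf_le) (auto intro!: always_eventually ennreal_leI Q)
  finally show "sqint (cplx g)" "mass g \<le> Q" using sqint_nnI[of "cplx g" Q] Q0 by (auto simp: nrm2_cplx)
qed

text \<open>A bounded sequence in \<open>H\<^sup>m\<close> that converges pointwise converges weakly, and each part of the
  energy then decouples in the limit into the contribution of \<open>g\<close> and that of the remainder
  \<open>v n - g\<close>.\<close>

context
  fixes v :: "nat \<Rightarrow> real \<Rightarrow> real" and g :: "real \<Rightarrow> real" and Q K M p :: real and m :: nat
  assumes m: "m \<ge> 1" and p: "2 < p"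
    and v: "\<And>n. v n \<in> sobolev m" and Q: "\<And>n. mass (v n) \<le> Q" and K: "\<And>n. kinetic m (v n) \<le> K"
    and M: "\<And>n x. \<bar>v n x\<bar> \<le> M" and lim: "\<And>x. (\<lambda>n. v n x) \<longlonglongrightarrow> g x"
begin

lemma limit_sqint: "sqint (cplx g)" "mass g \<le> Q"
  using mass_limit[OF sobolevD(2)[OF v] Q lim] by auto

lemma limit_bound: "\<bar>g x\<bar> \<le> M"
  by (rule LIMSEQ_le_const2[OF tendsto_rabs[OF lim]]) (use M in auto)

lemma difference_mass_bound: "mass (\<lambda>x. v n x - g x) \<le> 4 * Q"
proof -
  have Q0: "Q \<ge> 0" using Q[of 0] mass_nonneg[of "v 0"] by linarith
  have "sqrt (mass (\<lambda>x. v n x - g x)) \<le> sqrt (mass (v n)) + sqrt (mass g)"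
    using minkowski[OF sobolevD(2)[OF v[of n]] sqint_uminus[OF limit_sqint(1)]] 
    by (simp add: nrm2_def mass_def flip: of_real_diff)
  also have "\<dots> \<le> sqrt Q + sqrt Q" by (intro add_mono real_sqrt_le_mono Q limit_sqint(2))
  finally have "sqrt (mass (\<lambda>x. v n x - g x)) \<le> 2 * sqrt Q" by simp
  from power_mono[OF this, of 2] show ?thesis using Q0 by (simp add: power_mult_distrib)
qed

lemma difference_bound: "\<bar>v n x - g x\<bar> \<le> 2 * M"
  using M[of n x] limit_bound[of x] by linarith

lemma measurable_v: "v n \<in> borel_measurable borel" using sobolevD(1)[OF v] .
lemma measurable_g: "g \<in> borel_measurable borel" using limit_sqint(1) by (simp add: sqint_cplx_iff)

lemma difference_square_integrable: "integrable lborel (\<lambda>x. (v n x - g x)\<^sup>2)"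
  using sqint_diff[OF sobolevD(2)[OF v[of n]] limit_sqint(1)] by (simp add: sqint_cplx_iff flip: of_real_diff)

lemma difference_tendsto_0: "(\<lambda>n. v n x - g x) \<longlonglongrightarrow> 0"
  using lim by (simp add: LIM_zero_iff)

lemma weak_limit:
  assumes h: "sqint h" shows "(\<lambda>n. inner_L2 (cplx (v n)) h) \<longlonglongrightarrow> inner_L2 (cplx g) h"
proof -
  note [measurable] = sqintD[OF h] measurable_v measurable_g
  have "(\<lambda>n. LINT x|lborel. \<bar>v n x - g x\<bar> * cmod (h x)) \<longlonglongrightarrow> 0"
  proof (rule integral_tendsto_0_local[where h="\<lambda>n x. \<bar>v n x - g x\<bar>" and v="\<lambda>x. cmod (h x)" and K="2 * M" and C="4 * Q"])
    show "(\<lambda>n. \<bar>v n x - g x\<bar> * cmod (h x)) \<longlonglongrightarrow> 0" for x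
      by (intro tendsto_mult_left_zero tendsto_rabs_zero difference_tendsto_0)
    show "(LINT x|lborel. \<bar>v n x - g x\<bar>\<^sup>2) \<le> 4 * Q" for n using difference_mass_bound[of n] by (simp add: mass_def)
  qed (use h difference_bound difference_square_integrable in \<open>auto simp: sqint_def\<close>)
  moreover have "norm (inner_L2 (cplx (v n)) h - inner_L2 (cplx g) h) \<le> (LINT x|lborel. \<bar>v n x - g x\<bar> * cmod (h x))" for n
  proof -
    have "inner_L2 (cplx (v n)) h - inner_L2 (cplx g) h = inner_L2 (\<lambda>x. cplx (v n) x - cplx g x) h"
      by (rule inner_L2_diff_left[OF sobolevD(2)[OF v] limit_sqint(1) h, symmetric])
    then show ?thesis
      using integral_norm_bound[of lborel "\<lambda>x. (cplx (v n) x - cplx g x) * cnj (h x)"]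
      by (simp add: inner_L2_def norm_mult flip: of_real_diff)
  qed
  ultimately have "(\<lambda>n. inner_L2 (cplx (v n)) h - inner_L2 (cplx g) h) \<longlonglongrightarrow> 0"
    by (intro Lim_null_comparison[of "\<lambda>n. inner_L2 (cplx (v n)) h - inner_L2 (cplx g) h" "\<lambda>n. LINT x|lborel. \<bar>v n x - g x\<bar> * cmod (h x)"] always_eventually allI)
  then show ?thesis by (simp add: LIM_zero_iff)
qed

text \<open>Parseval's identity carries weak convergence to the Fourier side.\<close>

lemma weak_limit_fourier:
  assumes h: "sqint h" shows "(\<lambda>n. inner_L2 (fourier (v n)) h) \<longlonglongrightarrow> inner_L2 (fourier g) h"
proof -
  obtain k where k: "fourier_pair k h" using fourier_pair_exists_inverse[OF h] by blast
  have "inner_L2 (fourier (v n)) h = inner_L2 (cplx (v n)) k" for n by (rule fourier_pair_parseval[OF sobolevD(3)[OF v] k])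
  moreover have "inner_L2 (fourier g) h = inner_L2 (cplx g) k"
    by (rule fourier_pair_parseval[OF fourier_pair_fourier[OF limit_sqint(1)] k])
  ultimately show ?thesis using weak_limit[OF fourier_pairD(1)[OF k]] by simp
qed

text \<open>Weak lower semicontinuity of the kinetic energy: testing the transforms of \<open>v n\<close> with the
  truncated transform of \<open>g\<close>, weighted by the square of the symbol, bounds the norm of the
  truncations uniformly.\<close>

lemma limit_sobolev: "g \<in> sobolev m" "kinetic m g \<le> K"
proof -
  let ?U = "fourier g"
  have U: "sqint ?U" using fourier_pairD(2)[OF fourier_pair_fourier[OF limit_sqint(1)]] .
  note [measurable] = sqintD[OF U]
  have K0: "K \<ge> 0" using K[of 0] kinetic_nonneg[of m "v 0"] by linarith
  let ?W = "\<lambda>\<xi>. complex_of_real (\<xi> ^ m) * ?U \<xi>"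
  \<comment> \<open>For these pairs \<open>inner_L2 ?U (gR R)\<close> is the squared norm of \<open>WR R\<close>, while \<open>gR R\<close> is
    square-integrable and thus admissible in \<open>weak_limit_fourier\<close>.\<close>
  define WR where "WR R \<xi> = complex_of_real (indicat_real {-real R..real R} \<xi>) * ?W \<xi>" for R :: nat and \<xi>
  define gR where "gR R \<xi> = complex_of_real (indicat_real {-real R..real R} \<xi> * \<xi> ^ (2 * m)) * ?U \<xi>" for R :: nat and \<xi>
  have pw: "\<bar>\<xi>\<bar> ^ j \<le> real R ^ j" if "\<xi> \<in> {-real R..real R}" for R :: nat and \<xi> :: real and j
    using that by (intro power_mono) auto
  have sW: "sqint (WR R)" for R
  proof (rule sqint_dominated[OF _ U, of _ "real R ^ m"])
    show "WR R \<in> borel_measurable borel" unfolding WR_def by measurable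
    show "cmod (WR R \<xi>) \<le> real R ^ m * cmod (?U \<xi>)" for \<xi>
      using pw[of \<xi> R m] by (auto simp: WR_def norm_mult norm_power indicator_def intro!: mult_right_mono)
  qed
  have sg: "sqint (gR R)" for R
  proof (rule sqint_dominated[OF _ U, of _ "real R ^ (2 * m)"])
    show "gR R \<in> borel_measurable borel" unfolding gR_def by measurable
    show "cmod (gR R \<xi>) \<le> real R ^ (2 * m) * cmod (?U \<xi>)" for \<xi>
      using pw[of \<xi> R "2 * m"] by (auto simp: gR_def norm_mult norm_power indicator_def intro!: mult_right_mono)
  qed
  have bound: "nrm2 (WR R) \<le> K" for R
  proof -
    have eq1: "inner_L2 (fourier (v n)) (gR R) = inner_L2 (\<lambda>\<xi>. complex_of_real (\<xi> ^ m) * fourier (v n) \<xi>) (WR R)" for n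
      unfolding inner_L2_def gR_def WR_def by (intro Bochner_Integration.integral_cong refl) (simp add: power_mult power2_eq_square mult_ac mult_2 power_add)
    have eq2: "inner_L2 ?U (gR R) = inner_L2 (WR R) (WR R)"
    proof -
      have "gR R \<xi> = complex_of_real (\<xi> ^ m) * WR R \<xi>" for \<xi>
      proof -
        have "\<xi> ^ (2 * m) = \<xi> ^ m * \<xi> ^ m" by (simp add: mult_2 power_add)
        then show ?thesis unfolding gR_def WR_def by (simp only: of_real_mult mult_ac)
      qed
      moreover have "?U \<xi> * cnj (complex_of_real (\<xi> ^ m) * WR R \<xi>) = WR R \<xi> * cnj (WR R \<xi>)" for \<xi>
        by (cases "\<xi> \<in> {-real R..real R}") (simp_all add: WR_def)
      ultimately show ?thesis unfolding inner_L2_def by (simp only:)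
    qed
    have "(\<lambda>n. cmod (inner_L2 (fourier (v n)) (gR R))) \<longlonglongrightarrow> cmod (inner_L2 ?U (gR R))"
      by (intro tendsto_norm weak_limit_fourier sg)
    moreover have "cmod (inner_L2 (fourier (v n)) (gR R)) \<le> sqrt K * sqrt (nrm2 (WR R))" for n
    proof -
      have "cmod (inner_L2 (fourier (v n)) (gR R)) \<le> sqrt (kinetic m (v n)) * sqrt (nrm2 (WR R))"
        unfolding eq1 kinetic_def by (rule cauchy_schwarz_inner[OF sobolevD(5)[OF v] sW])
      also have "\<dots> \<le> sqrt K * sqrt (nrm2 (WR R))" by (intro mult_right_mono real_sqrt_le_mono K) simp
      finally show ?thesis .
    qed
    ultimately have "cmod (inner_L2 ?U (gR R)) \<le> sqrt K * sqrt (nrm2 (WR R))"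
      by (intro LIMSEQ_le_const2[where X="\<lambda>n. cmod (inner_L2 (fourier (v n)) (gR R))"]) auto
    then have "nrm2 (WR R) \<le> sqrt K * sqrt (nrm2 (WR R))" unfolding eq2 inner_L2_self by simp
    then have "sqrt (nrm2 (WR R)) * sqrt (nrm2 (WR R)) \<le> sqrt K * sqrt (nrm2 (WR R))" by simp
    then have "nrm2 (WR R) = 0 \<or> sqrt (nrm2 (WR R)) \<le> sqrt K"
      by (metis mult_right_le_imp_le nrm2_nonneg order_le_less real_sqrt_gt_0_iff)
    then show ?thesis using K0 by auto
  qed
  \<comment> \<open>Fatou's lemma removes the truncation.\<close>
  have "(\<integral>\<^sup>+\<xi>. ennreal ((cmod (?W \<xi>))\<^sup>2) \<partial>lborel) = (\<integral>\<^sup>+\<xi>. liminf (\<lambda>R. ennreal ((cmod (WR R \<xi>))\<^sup>2)) \<partial>lborel)"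
  proof (intro nn_integral_cong lim_imp_Liminf[symmetric] tendsto_ennrealI)
    fix \<xi> :: real
    obtain N where "\<bar>\<xi>\<bar> \<le> real N" using real_arch_simple by blast
    then have "\<forall>n\<ge>N. (cmod (WR n \<xi>))\<^sup>2 = (cmod (?W \<xi>))\<^sup>2" by (auto simp: WR_def indicator_def)
    then have "\<forall>\<^sub>F n in sequentially. (cmod (WR n \<xi>))\<^sup>2 = (cmod (?W \<xi>))\<^sup>2"
      unfolding eventually_sequentially by blast
    then show "(\<lambda>n. (cmod (WR n \<xi>))\<^sup>2) \<longlonglongrightarrow> (cmod (?W \<xi>))\<^sup>2" by (rule tendsto_eventually)
  qed simp
  also have "\<dots> \<le> liminf (\<lambda>R. \<integral>\<^sup>+\<xi>. ennreal ((cmod (WR R \<xi>))\<^sup>2) \<partial>lborel)"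
    by (rule nn_integral_liminf) (use sqintD[OF sW] in measurable)
  also have "\<dots> = liminf (\<lambda>R. ennreal (nrm2 (WR R)))" by (subst nrm2_nn[OF sW]) simp
  also have "\<dots> \<le> ennreal K" by (rule Liminf_le) (auto intro!: always_eventually ennreal_leI bound)
  finally have W: "sqint ?W" "nrm2 ?W \<le> K" using sqint_nnI[of ?W K] K0 by auto
  show "g \<in> sobolev m" using W(1) limit_sqint(1) by (simp add: sobolev_iff)
  show "kinetic m g \<le> K" using W(2) by (simp add: kinetic_def)
qed

lemma mass_splitting: "(\<lambda>n. mass (v n) - mass (\<lambda>x. v n x - g x)) \<longlonglongrightarrow> mass g"
proof -
  have "mass (v n) - mass (\<lambda>x. v n x - g x) = 2 * Re (inner_L2 (cplx (v n)) (cplx g)) - mass g" for n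
    using nrm2_diff[OF sobolevD(2)[OF v[of n]] limit_sqint(1)] by (simp flip: of_real_diff add: nrm2_cplx)
  moreover have "(\<lambda>n. 2 * Re (inner_L2 (cplx (v n)) (cplx g)) - mass g) \<longlonglongrightarrow> 2 * Re (inner_L2 (cplx g) (cplx g)) - mass g"
    by (intro tendsto_intros weak_limit limit_sqint)
  ultimately show ?thesis by (simp add: inner_L2_self nrm2_cplx)
qed

text \<open>The mixed term is the pairing of \<open>v n - g\<close> with \<open>g\<close>. Weak convergence is available only
  against square-integrable functions, and \<open>\<xi>^(2 * m)\<close> times the transform of \<open>g\<close> need not be one,
  so the frequencies of \<open>g\<close> are truncated first.\<close>

lemma kinetic_splitting: "(\<lambda>n. kinetic m (v n) - kinetic m (\<lambda>x. v n x - g x)) \<longlonglongrightarrow> kinetic m g"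
proof -
  let ?W = "\<lambda>\<xi>. complex_of_real (\<xi> ^ m) * fourier g \<xi>"
  have W: "sqint ?W" by (rule sobolevD(5)[OF limit_sobolev(1)])
  define w where "w n x = v n x - g x" for n x
  have w: "w n \<in> sobolev m" for n unfolding w_def by (rule sobolev_diff[OF v limit_sobolev(1)])
  let ?V = "\<lambda>n \<xi>. complex_of_real (\<xi> ^ m) * fourier (w n) \<xi>"
  note V = sobolevD(5)[OF w]
  have K0: "K \<ge> 0" using K[of 0] kinetic_nonneg[of m "v 0"] by linarith
  have Vb: "sqrt (nrm2 (?V n)) \<le> 2 * sqrt K" for n
  proof -
    have "sqrt (kinetic m (\<lambda>x. v n x + (-1) * g x)) \<le> sqrt (kinetic m (v n)) + sqrt (kinetic m (\<lambda>x. (-1) * g x))"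
      by (rule sobolev_add(2)[OF v sobolev_cmult(1)[OF limit_sobolev(1)]])
    also have "\<dots> \<le> sqrt K + sqrt K"
      unfolding sobolev_cmult(2)[OF limit_sobolev(1)] using limit_sobolev(2) K by (intro add_mono real_sqrt_le_mono) auto
    finally show ?thesis by (simp add: kinetic_def w_def[abs_def])
  qed
  define WR where "WR R \<xi> = complex_of_real (indicat_real {-real R..real R} \<xi>) * ?W \<xi>" for R :: nat and \<xi>
  have sWR: "sqint (WR R)" for R unfolding WR_def by (rule sqint_trunc[OF W]) simp
  have "(\<lambda>n. inner_L2 (?V n) ?W) \<longlonglongrightarrow> 0"
  proof (rule tendsto_zero_by_approximation)
    show "(\<lambda>n. inner_L2 (?V n) (WR R)) \<longlonglongrightarrow> 0" for R
    proof -
      define gR where "gR \<xi> = complex_of_real (\<xi> ^ m) * WR R \<xi>" for \<xi>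
      have gR: "sqint gR"
      proof (rule sqint_dominated[OF _ W, of _ "real R ^ m"])
        show "gR \<in> borel_measurable borel" unfolding gR_def using sqintD[OF sWR] by measurable
        have "\<bar>\<xi>\<bar> ^ m \<le> real R ^ m" if "\<xi> \<in> {-real R..real R}" for \<xi> using that by (intro power_mono) auto
        then show "cmod (gR \<xi>) \<le> real R ^ m * cmod (?W \<xi>)" for \<xi>
          by (auto simp: gR_def WR_def norm_mult norm_power indicator_def intro!: mult_right_mono)
      qed
      have "inner_L2 (?V n) (WR R) = inner_L2 (fourier (v n)) gR - inner_L2 (fourier g) gR" for n
      proof -
        have "AE \<xi> in lborel. fourier (w n) \<xi> = fourier (v n) \<xi> - fourier g \<xi>"
          using fourier_pair_diff[OF sobolevD(3)[OF v[of n]] sobolevD(3)[OF limit_sobolev(1)]]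
          by (intro fourier_unique_AE) (simp add: w_def[abs_def])
        then have ae: "AE \<xi> in lborel. ?V n \<xi> * cnj (WR R \<xi>) = (fourier (v n) \<xi> - fourier g \<xi>) * cnj (gR \<xi>)"
          by eventually_elim (simp add: gR_def mult_ac)
        note [measurable] = sqintD[OF V] sqintD[OF sWR] sqintD[OF gR] sqintD[OF sobolevD(4)[OF v]] sqintD[OF sobolevD(4)[OF limit_sobolev(1)]]
        have "inner_L2 (?V n) (WR R) = inner_L2 (\<lambda>\<xi>. fourier (v n) \<xi> - fourier g \<xi>) gR"
          unfolding inner_L2_def by (rule integral_cong_AE[OF _ _ ae]) measurable
        then show ?thesis using inner_L2_diff_left[OF sobolevD(4)[OF v] sobolevD(4)[OF limit_sobolev(1)] gR] by simp
      qed
      moreover have "(\<lambda>n. inner_L2 (fourier (v n)) gR - inner_L2 (fourier g) gR) \<longlonglongrightarrow> inner_L2 (fourier g) gR - inner_L2 (fourier g) gR"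
        by (intro tendsto_intros weak_limit_fourier gR)
      ultimately show ?thesis by simp
    qed
    have "(\<lambda>R. sqrt (nrm2 (\<lambda>\<xi>. ?W \<xi> - WR R \<xi>))) \<longlonglongrightarrow> 0"
      using tendsto_real_sqrt[OF tendsto_truncations[OF W]] by (simp add: WR_def[abs_def])
    then show "(\<lambda>R. 2 * sqrt K * sqrt (nrm2 (\<lambda>\<xi>. ?W \<xi> - WR R \<xi>))) \<longlonglongrightarrow> 0" by (rule tendsto_mult_right_zero)
    show "norm (inner_L2 (?V n) ?W - inner_L2 (?V n) (WR R)) \<le> 2 * sqrt K * sqrt (nrm2 (\<lambda>\<xi>. ?W \<xi> - WR R \<xi>))" for n R
    proof -
      have "inner_L2 (?V n) ?W - inner_L2 (?V n) (WR R) = inner_L2 (?V n) (\<lambda>\<xi>. ?W \<xi> - WR R \<xi>)"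
        by (rule inner_L2_diff_right[OF W sWR V, symmetric])
      then have "norm (inner_L2 (?V n) ?W - inner_L2 (?V n) (WR R)) \<le> sqrt (nrm2 (?V n)) * sqrt (nrm2 (\<lambda>\<xi>. ?W \<xi> - WR R \<xi>))"
        using cauchy_schwarz_inner[OF V sqint_diff[OF W sWR]] by simp
      also have "\<dots> \<le> 2 * sqrt K * sqrt (nrm2 (\<lambda>\<xi>. ?W \<xi> - WR R \<xi>))" by (rule mult_right_mono[OF Vb]) simp
      finally show ?thesis .
    qed
  qed
  then have "(\<lambda>n. kinetic m g + 2 * Re (inner_L2 (?V n) ?W)) \<longlonglongrightarrow> kinetic m g + 2 * Re 0" by (intro tendsto_intros)
  moreover have "kinetic m (v n) - kinetic m (w n) = kinetic m g + 2 * Re (inner_L2 (?V n) ?W)" for n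
    using sobolev_add(3)[OF w[of n] limit_sobolev(1)] by (simp add: w_def)
  ultimately show ?thesis by (simp add: w_def[abs_def])
qed

text \<open>The lemma of Brezis and Lieb in a bounded setting. The three \<open>p\<close>-th powers differ by at most a
  bounded sequence in \<open>L\<^sup>2\<close> times \<open>\<bar>g\<bar>\<close>, and the difference tends to \<open>0\<close> pointwise.\<close>

lemma potential_splitting: "(\<lambda>n. potential p (v n) - potential p (\<lambda>x. v n x - g x)) \<longlonglongrightarrow> potential p g"
proof -
  note [measurable] = measurable_v measurable_g
  have M0: "M \<ge> 0" using M[of 0 0] by linarith
  \<comment> \<open>A bound for \<open>\<bar>v n x\<bar> + \<bar>v n x - g x\<bar> + \<bar>g x\<bar>\<close>, from \<open>M + 2 * M + M\<close>.\<close>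
  let ?L = "4 * M"
  let ?c = "(p + 1) * ?L powr (p - 2)"
  have c0: "?c \<ge> 0" using p by simp
  have sd: "sqint (cplx (\<lambda>x. v n x - g x))" for n using sobolevD(2)[OF sobolev_diff[OF v limit_sobolev(1)]] .
  have i1: "integrable lborel (\<lambda>x. \<bar>v n x\<bar> powr p)" for n by (rule potential_bound(1)[OF p sobolevD(2)[OF v] M])
  have i2: "integrable lborel (\<lambda>x. \<bar>v n x - g x\<bar> powr p)" for n by (rule potential_bound(1)[OF p sd difference_bound])
  have i3: "integrable lborel (\<lambda>x. \<bar>g x\<bar> powr p)" by (rule potential_bound(1)[OF p limit_sqint(1) limit_bound])
  let ?f = "\<lambda>n x. \<bar>v n x\<bar> powr p - \<bar>v n x - g x\<bar> powr p - \<bar>g x\<bar> powr p"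
  let ?h = "\<lambda>n x. ?c * (\<bar>v n x\<bar> + \<bar>v n x - g x\<bar> + \<bar>g x\<bar>)"
  have "(\<lambda>n. LINT x|lborel. ?f n x) \<longlonglongrightarrow> 0"
  proof (rule integral_tendsto_0_local[where h="?h" and v="\<lambda>x. \<bar>g x\<bar>" and K="?c * ?L" and C="?c\<^sup>2 * (12 * Q + 12 * Q + 12 * Q)"])
    show "(\<lambda>n. ?f n x) \<longlonglongrightarrow> 0" for x
    proof -
      have "(\<lambda>n. ?f n x) \<longlonglongrightarrow> \<bar>g x\<bar> powr p - \<bar>0\<bar> powr p - \<bar>g x\<bar> powr p"
        using p by (intro tendsto_diff tendsto_powr' tendsto_rabs lim difference_tendsto_0 tendsto_const) auto
      then show ?thesis using p by simp
    qed
    show "\<bar>?f n x\<bar> \<le> ?h n x * \<bar>g x\<bar>" for n x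
    proof -
      have b1: "\<bar>\<bar>v n x\<bar> powr p - \<bar>v n x - g x\<bar> powr p\<bar> \<le> p * ?L powr (p - 2) * ((\<bar>v n x\<bar> + \<bar>v n x - g x\<bar>) * \<bar>v n x - (v n x - g x)\<bar>)"
        using M[of n x] difference_bound[of n x] M0 by (intro powr_diff_bound_abs p) linarith
      have b2: "\<bar>g x\<bar> powr p \<le> ?L powr (p - 2) * (\<bar>g x\<bar> * \<bar>g x\<bar>)"
        using powr_bound[of "\<bar>g x\<bar>" ?L p] limit_bound[of x] M0 p by (simp add: power2_eq_square)
      have gen: "\<bar>a - b - c\<bar> \<le> d + e" if "\<bar>a - b\<bar> \<le> d" "c \<le> e" "0 \<le> c" for a b c d e :: real
        using that by linarith
      have "\<bar>?f n x\<bar> \<le> p * ?L powr (p - 2) * ((\<bar>v n x\<bar> + \<bar>v n x - g x\<bar>) * \<bar>v n x - (v n x - g x)\<bar>) + ?L powr (p - 2) * (\<bar>g x\<bar> * \<bar>g x\<bar>)"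
        by (rule gen[OF b1 b2 powr_ge_zero])
      also have "v n x - (v n x - g x) = g x" by simp
      also have "p * ?L powr (p - 2) * ((\<bar>v n x\<bar> + \<bar>v n x - g x\<bar>) * \<bar>g x\<bar>) + ?L powr (p - 2) * (\<bar>g x\<bar> * \<bar>g x\<bar>)
        \<le> ?c * ((\<bar>v n x\<bar> + \<bar>v n x - g x\<bar>) * \<bar>g x\<bar>) + ?c * (\<bar>g x\<bar> * \<bar>g x\<bar>)"
      proof -
        have A1: "p * ?L powr (p - 2) \<le> ?c" by (rule mult_right_mono) auto
        have "1 * ?L powr (p - 2) \<le> ?c" using p by (intro mult_right_mono) auto
        then have A2: "?L powr (p - 2) \<le> ?c" by simp
        show ?thesis by (rule add_mono[OF mult_right_mono[OF A1] mult_right_mono[OF A2]]) auto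
      qed
      also have "\<dots> = ?h n x * \<bar>g x\<bar>" by (simp add: algebra_simps)
      finally show ?thesis .
    qed
    show "0 \<le> ?h n x" for n x by (rule mult_nonneg_nonneg[OF c0]) auto
    show "?h n x \<le> ?c * ?L" for n x
      using M[of n x] difference_bound[of n x] limit_bound[of x] M0 by (intro mult_left_mono c0) linarith
    have sq: "(?h n x)\<^sup>2 \<le> ?c\<^sup>2 * (3 * (v n x)\<^sup>2 + 3 * (v n x - g x)\<^sup>2 + 3 * (g x)\<^sup>2)" for n x
    proof -
      have "(a + b + c)\<^sup>2 \<le> 3 * a\<^sup>2 + 3 * b\<^sup>2 + 3 * c\<^sup>2" for a b c :: real
        using sum_squares_bound[of a b] sum_squares_bound[of a c] sum_squares_bound[of b c]
        by (simp add: power2_eq_square algebra_simps)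
      from this[of "\<bar>v n x\<bar>" "\<bar>v n x - g x\<bar>" "\<bar>g x\<bar>"] show ?thesis
        unfolding power_mult_distrib by (intro mult_left_mono) auto
    qed
    have isq: "integrable lborel (\<lambda>x. ?c\<^sup>2 * (3 * (v n x)\<^sup>2 + 3 * (v n x - g x)\<^sup>2 + 3 * (g x)\<^sup>2))" for n
      using sobolevD(6)[OF v[of n]] difference_square_integrable[of n] limit_sqint(1)
      by (intro integrable_mult_right Bochner_Integration.integrable_add) (auto simp: sqint_cplx_iff)
    show ih: "integrable lborel (\<lambda>x. (?h n x)\<^sup>2)" for n
      by (rule Bochner_Integration.integrable_bound[OF isq[of n]]) (auto intro!: AE_I2 order_trans[OF sq])
    show "(LINT x|lborel. (?h n x)\<^sup>2) \<le> ?c\<^sup>2 * (12 * Q + 12 * Q + 12 * Q)" for n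
    proof -
      have Q0: "Q \<ge> 0" using Q[of 0] mass_nonneg[of "v 0"] by linarith
      have "(LINT x|lborel. (?h n x)\<^sup>2) \<le> (LINT x|lborel. ?c\<^sup>2 * (3 * (v n x)\<^sup>2 + 3 * (v n x - g x)\<^sup>2 + 3 * (g x)\<^sup>2))"
        by (rule integral_mono[OF ih isq sq])
      also have "\<dots> = ?c\<^sup>2 * (3 * mass (v n) + 3 * mass (\<lambda>x. v n x - g x) + 3 * mass g)"
        using sobolevD(6)[OF v[of n]] difference_square_integrable[of n] limit_sqint(1)
        by (simp add: mass_def sqint_cplx_iff)
      also have "\<dots> \<le> ?c\<^sup>2 * (12 * Q + 12 * Q + 12 * Q)"
        using Q[of n] difference_mass_bound[of n] limit_sqint(2) Q0 by (intro mult_left_mono) auto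
      finally show ?thesis .
    qed
    show "integrable lborel (\<lambda>x. \<bar>g x\<bar>\<^sup>2)" using limit_sqint(1) by (simp add: sqint_cplx_iff)
  qed auto
  moreover have "(LINT x|lborel. ?f n x) = potential p (v n) - potential p (\<lambda>x. v n x - g x) - potential p g" for n
    unfolding potential_def using i1[of n] i2[of n] i3 by simp
  ultimately have "(\<lambda>n. potential p (v n) - potential p (\<lambda>x. v n x - g x) - potential p g) \<longlonglongrightarrow> 0" by simp
  then show ?thesis by (simp add: LIM_zero_iff)
qed

lemma energy_splitting: "(\<lambda>n. energy m p (v n) - energy m p (\<lambda>x. v n x - g x)) \<longlonglongrightarrow> energy m p g"
proof -
  have "(\<lambda>n. (kinetic m (v n) - kinetic m (\<lambda>x. v n x - g x)) / 2 - (potential p (v n) - potential p (\<lambda>x. v n x - g x)) / (p * (p - 1)))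
    \<longlonglongrightarrow> kinetic m g / 2 - potential p g / (p * (p - 1))"
    using p by (intro tendsto_intros kinetic_splitting potential_splitting) auto
  then show ?thesis
    by (simp add: energy_eq[OF m _ p] v limit_sobolev(1) sobolev_diff diff_divide_distrib algebra_simps)
qed

end

section \<open>Strict scaling and compactness of minimizing sequences\<close>

lemma potential_cmult: "potential p (\<lambda>x. c * u x) = \<bar>c\<bar> powr p * potential p u"
  unfolding potential_def by (simp add: abs_mult powr_mult)

lemma mass_zero_iff: "sqint (cplx u) \<Longrightarrow> mass u = 0 \<longleftrightarrow> (AE x in lborel. u x = 0)"
  using nrm2_eq_0_iff[of "cplx u"] by (simp add: nrm2_cplx)

lemma potential_pos:
  assumes m: "m \<ge> 1" and p: "2 < p" and u: "u \<in> sobolev m" and pos: "mass u > 0"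
  shows "potential p u > 0"
proof (rule ccontr)
  assume "\<not> potential p u > 0"
  then have "potential p u = 0" using potential_nonneg[of p u] by linarith
  then have "AE x in lborel. \<bar>u x\<bar> powr p = 0"
    unfolding potential_def using integral_nonneg_eq_0_iff_AE[OF potential_integrable[OF m u p]] by simp
  then have "AE x in lborel. u x = 0" by eventually_elim simp
  then have "mass u = 0" using mass_zero_iff[OF sobolevD(2)[OF u]] by simp
  then show False using pos by simp
qed

lemma energy_mass_zero:
  assumes m: "m \<ge> 1" and p: "2 < p" and u: "u \<in> sobolev m" and z: "mass u = 0"
  shows "energy m p u = 0"
proof -
  have ae: "AE x in lborel. u x = 0 * u x" using mass_zero_iff[OF sobolevD(2)[OF u]] z by simp
  have z: "(\<lambda>x. 0 * u x) \<in> borel_measurable borel" using sobolev_cmult(1)[OF u, of 0] by (rule sobolevD(1))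
  have "kinetic m u = 0" using sobolev_cong_AE(2)[OF u z ae] sobolev_cmult(2)[OF u, of 0] by simp
  moreover have "potential p u = 0" using sobolev_cong_AE(4)[OF u z ae, of p] p by (simp add: potential_def)
  ultimately show ?thesis by (simp add: energy_eq[OF m u p])
qed

lemma mass_pos_continuous:
  assumes c: "continuous_on UNIV g" and x0: "g x0 \<noteq> 0" and s: "sqint (cplx g)"
  shows "mass g > 0"
proof -
  have "isCont (\<lambda>x. (g x)\<^sup>2) x0" using c by (intro continuous_intros) (simp add: continuous_on_eq_continuous_at)
  then have "((\<lambda>x. (g x)\<^sup>2) \<longlongrightarrow> (g x0)\<^sup>2) (at x0)" by (simp add: isCont_def)
  then have "\<forall>\<^sub>F x in at x0. (g x)\<^sup>2 > (g x0)\<^sup>2 / 2" by (rule order_tendstoD(1)) (use x0 in simp)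
  then obtain d where d: "d > 0" "\<And>x. x \<noteq> x0 \<Longrightarrow> dist x x0 < d \<Longrightarrow> (g x)\<^sup>2 > (g x0)\<^sup>2 / 2"
    unfolding eventually_at by auto
  have "(LINT x|lborel. (g x0)\<^sup>2 / 2 * indicat_real {x0..x0 + d / 2} x) \<le> mass g"
    unfolding mass_def
  proof (rule integral_mono)
    show "integrable lborel (\<lambda>x. (g x0)\<^sup>2 / 2 * indicat_real {x0..x0 + d / 2} x)"
      by (intro integrable_mult_right integrable_indicator_Icc)
    show "integrable lborel (\<lambda>x. (g x)\<^sup>2)" using s by (simp add: sqint_cplx_iff)
    show "(g x0)\<^sup>2 / 2 * indicat_real {x0..x0 + d / 2} x \<le> (g x)\<^sup>2" for x
      using d(2)[of x] d(1) by (cases "x = x0") (auto simp: indicator_def dist_real_def)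
  qed
  moreover have "(LINT x|lborel. (g x0)\<^sup>2 / 2 * indicat_real {x0..x0 + d / 2} x) = (g x0)\<^sup>2 / 2 * (d / 2)"
    using d(1) by simp
  moreover have "(g x0)\<^sup>2 / 2 * (d / 2) > 0" using d(1) x0 by simp
  ultimately show ?thesis by linarith
qed

text \<open>Multiplying \<open>w\<close> by \<open>s > 1\<close> to reach mass \<open>\<mu>\<close> multiplies the mass and the kinetic energy by
  \<open>s\<^sup>2\<close>, but the potential by the larger factor \<open>s powr p\<close>. This is what prevents a minimizing
  sequence from splitting into two distant pieces.\<close>

lemma energy_scaling_strict:
  assumes m: "m \<ge> 1" and p: "2 < p" and low: "\<And>u. u \<in> sobolev m \<Longrightarrow> mass u = \<mu> \<Longrightarrow> I \<le> energy m p u"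
    and w: "w \<in> sobolev m" and mw: "0 < mass w" "mass w < \<mu>"
  shows "mass w / \<mu> * I < energy m p w"
proof -
  define s where "s = sqrt (\<mu> / mass w)"
  have s1: "s > 1" using mw by (simp add: s_def)
  have s2: "s\<^sup>2 = \<mu> / mass w" using mw by (simp add: s_def)
  define N where "N = potential p w / (p * (p - 1))"
  have N: "N > 0" using potential_pos[OF m p w mw(1)] p by (simp add: N_def)
  have Ew: "energy m p w = kinetic m w / 2 - N" by (simp add: energy_eq[OF m w p] N_def)
  have sw: "(\<lambda>x. s * w x) \<in> sobolev m" by (rule sobolev_cmult(1)[OF w])
  have "mass (\<lambda>x. s * w x) = \<mu>" using mw by (simp add: mass_cmult s2)
  then have "I \<le> energy m p (\<lambda>x. s * w x)" by (rule low[OF sw])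
  also have "\<dots> = s\<^sup>2 * (kinetic m w / 2) - s powr p * N"
    unfolding energy_eq[OF m sw p] sobolev_cmult(2)[OF w] potential_cmult N_def using s1 by simp
  also have "\<dots> < s\<^sup>2 * (kinetic m w / 2) - s\<^sup>2 * N"
  proof -
    have "s powr 2 < s powr p" using s1 p by (intro powr_less_mono) auto
    then have "s\<^sup>2 < s powr p" using s1 by simp
    then have "s\<^sup>2 * N < s powr p * N" using N by (rule mult_strict_right_mono)
    then show ?thesis by simp
  qed
  also have "\<dots> = s\<^sup>2 * energy m p w" unfolding Ew by (simp only: right_diff_distrib)
  finally have *: "I < \<mu> / mass w * energy m p w" unfolding s2 .
  have "mass w / \<mu> * I < mass w / \<mu> * (\<mu> / mass w * energy m p w)"
    using mw by (intro mult_strict_left_mono *) auto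
  then show ?thesis using mw by simp
qed

text \<open>The version without strictness also covers vanishing mass, which the remainders in a splitting
  may have.\<close>

lemma energy_scaling:
  assumes m: "m \<ge> 1" and p: "2 < p" and low: "\<And>u. u \<in> sobolev m \<Longrightarrow> mass u = \<mu> \<Longrightarrow> I \<le> energy m p u"
    and w: "w \<in> sobolev m" and mw: "mass w < \<mu>"
  shows "mass w / \<mu> * I \<le> energy m p w"
proof (cases "mass w = 0")
  case True then show ?thesis using energy_mass_zero[OF m p w] by simp
next
  case False
  then have "0 < mass w" using mass_nonneg[of w] by linarith
  from energy_scaling_strict[OF m p low w this mw] show ?thesis by simp
qed

text \<open>The concentration-compactness argument outlined at the beginning. It is stated for masses that
  only tend to \<open>\<mu>\<close>, as needed for stability, where the perturbed data have slightly different
  masses.\<close>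

theorem minimizing_sequence_compact:
  fixes u :: "nat \<Rightarrow> real \<Rightarrow> real"
  assumes m: "m \<ge> 1" and p: "2 < p" "p < 4 * real m + 2" and mu: "\<mu> > 0" and I: "I < 0"
    and low: "\<And>u. u \<in> sobolev m \<Longrightarrow> mass u = \<mu> \<Longrightarrow> I \<le> energy m p u"
    and u: "\<And>n. u n \<in> sobolev m" and mass_lim: "(\<lambda>n. mass (u n)) \<longlonglongrightarrow> \<mu>" and energy_lim: "(\<lambda>n. energy m p (u n)) \<longlonglongrightarrow> I"
  shows "\<exists>r \<tau> g. strict_mono (r :: nat \<Rightarrow> nat) \<and> g \<in> sobolev m \<and> mass g = \<mu> \<and> energy m p g = I \<and>
     (\<lambda>k. sobolev_dist m (\<lambda>x. u (r k) (x - \<tau> k)) g) \<longlonglongrightarrow> 0"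
proof -
  obtain Q where "\<And>n. norm (mass (u n)) \<le> Q"
    using convergent_imp_Bseq[OF convergentI[OF mass_lim]] by (elim BseqE) blast
  then have Q: "\<And>n. mass (u n) \<le> Q" by (simp only: real_norm_def abs_le_iff)
  have Q0: "Q \<ge> 0" using Q[of 0] mass_nonneg[of "u 0"] by linarith
  obtain E0 where "\<And>n. norm (energy m p (u n)) \<le> E0"
    using convergent_imp_Bseq[OF convergentI[OF energy_lim]] by (elim BseqE) blast
  then have E0: "\<And>n. energy m p (u n) \<le> E0" by (simp only: real_norm_def abs_le_iff)
  obtain D where D: "\<And>w. w \<in> sobolev m \<Longrightarrow> mass w \<le> Q \<Longrightarrow> kinetic m w / 4 - D \<le> energy m p w"
    using energy_coercive[OF m p Q0] by blast
  define K where "K = 4 * (E0 + D)"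
  have K: "kinetic m (u n) \<le> K" for n using D[OF u Q, of n] E0[of n] by (simp add: K_def)
  have K0: "K \<ge> 0" using K[of 0] kinetic_nonneg[of m "u 0"] by linarith
  define M where "M = sqrt (weight_integral m * (Q + K))"
  have M: "\<bar>continuous_rep (u n) x\<bar> \<le> M" for n x
    unfolding M_def using Q[of n] K[of n]
    by (intro order_trans[OF continuous_rep_bounded[OF m u]] real_sqrt_le_mono mult_left_mono weight_integral_nonneg) auto
  \<comment> \<open>If the supremum of a state were below \<open>\<kappa>\<close>, its potential would be at most \<open>X * mass\<close>, too small
    for an energy below \<open>I / 2\<close>. The value \<open>X\<close> is chosen for the bound \<open>Q + 1\<close> on the masses.\<close>
  define X where "X = p * (p - 1) * (- I) / (2 * (Q + 1))"
  define \<kappa> where "\<kappa> = X powr (1 / (p - 2))"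
  have X: "X > 0" unfolding X_def using p I Q0 by (intro divide_pos_pos mult_pos_pos) auto
  have kpos: "\<kappa> > 0" using X by (simp add: \<kappa>_def)
  have kX: "\<kappa> powr (p - 2) = X" using X p by (simp add: \<kappa>_def powr_powr)
  have "\<forall>\<^sub>F n in sequentially. energy m p (u n) < I / 2" using energy_lim by (rule order_tendstoD(2)) (use I in simp)
  then obtain N0 where N0: "\<And>n. n \<ge> N0 \<Longrightarrow> energy m p (u n) < I / 2" by (auto simp: eventually_sequentially)
  have "\<exists>x. \<kappa> \<le> \<bar>continuous_rep (u n) x\<bar>" if n: "n \<ge> N0" for n
  proof (rule ccontr)
    assume "\<not> (\<exists>x. \<kappa> \<le> \<bar>continuous_rep (u n) x\<bar>)"
    then have k: "\<And>x. \<bar>continuous_rep (u n) x\<bar> \<le> \<kappa>" by (meson le_cases)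
    have "potential p (u n) = potential p (continuous_rep (u n))" by (simp add: continuous_rep_sobolev[OF m u])
    also have "\<dots> \<le> \<kappa> powr (p - 2) * mass (continuous_rep (u n))"
      by (rule potential_bound(2)[OF p(1) sobolevD(2)[OF continuous_rep_sobolev(1)[OF m u]] k])
    also have "\<dots> = X * mass (u n)" by (simp add: kX continuous_rep_sobolev[OF m u])
    also have "\<dots> \<le> X * Q" using Q X by (intro mult_left_mono) auto
    also have "\<dots> < X * (Q + 1)" using X by simp
    also have "\<dots> = p * (p - 1) * (- I / 2)" using Q0 by (simp add: X_def field_simps)
    finally have "potential p (u n) / (p * (p - 1)) < - I / 2" using p by (simp add: pos_divide_less_eq mult_ac)
    moreover have "energy m p (u n) = kinetic m (u n) / 2 - potential p (u n) / (p * (p - 1))" by (rule energy_eq[OF m u p(1)])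
    ultimately show False using N0[OF n] kinetic_nonneg[of m "u n"] by linarith
  qed
  then have "\<forall>n. \<exists>x. \<kappa> \<le> \<bar>continuous_rep (u (n + N0)) x\<bar>" by simp
  from choice[OF this] obtain y where y: "\<And>n. \<kappa> \<le> \<bar>continuous_rep (u (n + N0)) (y n)\<bar>" by blast
  \<comment> \<open>Translated so that the large value sits at the origin.\<close>
  define v0 where "v0 n x = continuous_rep (u (n + N0)) (x - (- y n))" for n x
  note rs = continuous_rep_sobolev[OF m u]
  have v0s: "v0 n \<in> sobolev m" "kinetic m (v0 n) = kinetic m (u (n + N0))" for n
    unfolding v0_def[abs_def] using sobolev_shift[OF rs(1)[of "n + N0"], of "- y n"] rs(2)[of "n + N0"] by simp_all
  have v0m: "mass (v0 n) = mass (u (n + N0))" for n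
    unfolding v0_def[abs_def] mass_shift by (rule rs(3))
  have v0p: "potential p (v0 n) = potential p (u (n + N0))" for n
    unfolding v0_def[abs_def] potential_shift by (rule rs(4))
  define \<omega> where "\<omega> h = sqrt (Q + K) * sqrt (modulus m h)" for h
  have eq: "\<bar>v0 n x - v0 n z\<bar> \<le> \<omega> (x - z)" for n x z
  proof -
    have "\<bar>v0 n x - v0 n z\<bar> \<le> sqrt (mass (u (n + N0)) + kinetic m (u (n + N0))) * sqrt (modulus m (x - z))"
      unfolding v0_def using continuous_rep_equicontinuous[OF m u, of "n + N0" "x - - y n" "z - - y n"] by simp
    also have "\<dots> \<le> \<omega> (x - z)"
      unfolding \<omega>_def using Q[of "n + N0"] K[of "n + N0"]
      by (intro mult_right_mono real_sqrt_le_mono add_mono) (auto simp: modulus_def intro!: Bochner_Integration.integral_nonneg divide_nonneg_pos one_plus_even_power_pos)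
    finally show ?thesis .
  qed
  have om: "(\<lambda>n. \<omega> (h n)) \<longlonglongrightarrow> 0" if "h \<longlonglongrightarrow> 0" for h
    unfolding \<omega>_def using tendsto_real_sqrt[OF modulus_tendsto_0[OF m that]] by (auto intro!: tendsto_mult_right_zero)
  obtain r g where r: "strict_mono (r :: nat \<Rightarrow> nat)" and lim: "\<And>x. (\<lambda>n. v0 (r n) x) \<longlonglongrightarrow> g x"
    using pointwise_convergent_subsequence[of v0 M \<omega>] M eq om unfolding v0_def by metis
  define v where "v n = v0 (r n)" for n
  have vs: "v n \<in> sobolev m" for n unfolding v_def by (rule v0s)
  have vQ: "mass (v n) \<le> Q" for n unfolding v_def v0m by (rule Q)
  have vK: "kinetic m (v n) \<le> K" for n unfolding v_def v0s by (rule K)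
  have vM: "\<bar>v n x\<bar> \<le> M" for n x unfolding v_def v0_def by (rule M)
  have vlim: "(\<lambda>n. v n x) \<longlonglongrightarrow> g x" for x unfolding v_def by (rule lim)
  note ctx = m p(1) vs vQ vK vM vlim
  have gs: "g \<in> sobolev m" by (rule limit_sobolev(1)[OF ctx])
  define r2 where "r2 n = r n + N0" for n
  have r2: "strict_mono r2" using r by (simp add: r2_def strict_mono_def)
  have mv: "(\<lambda>n. mass (v n)) \<longlonglongrightarrow> \<mu>"
    using LIMSEQ_subseq_LIMSEQ[OF mass_lim r2] by (simp add: v_def v0m r2_def comp_def)
  have Ev: "energy m p (v n) = energy m p (u (r2 n))" for n
    unfolding energy_eq[OF m vs p(1)] energy_eq[OF m u p(1)] by (simp add: v_def v0s v0p r2_def)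
  have ev: "(\<lambda>n. energy m p (v n)) \<longlonglongrightarrow> I"
    using LIMSEQ_subseq_LIMSEQ[OF energy_lim r2] by (simp add: Ev comp_def)
  \<comment> \<open>The value at the origin survives in the limit, which is continuous and therefore has positive
    mass.\<close>
  have g0: "\<bar>g 0\<bar> \<ge> \<kappa>"
    by (rule LIMSEQ_le_const[OF tendsto_rabs[OF vlim[of 0]]]) (use y in \<open>auto simp: v_def v0_def\<close>)
  have gcont: "continuous_on UNIV g"
  proof -
    have le: "\<bar>g x - g z\<bar> \<le> \<omega> (x - z)" for x z
      by (rule LIMSEQ_le_const2[OF tendsto_rabs[OF tendsto_diff[OF vlim vlim]]]) (use eq in \<open>auto simp: v_def\<close>)
    have "isCont g x" for x
      unfolding continuous_at_sequentially
    proof (intro allI impI)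
      fix s assume s: "s \<longlonglongrightarrow> x"
      have "(\<lambda>n. g (s n) - g x) \<longlonglongrightarrow> 0"
        by (rule Lim_null_comparison[where g="\<lambda>n. \<omega> (s n - x)"]) (use le om[of "\<lambda>n. s n - x"] s in \<open>auto simp: LIM_zero\<close>)
      then show "(g \<circ> s) \<longlonglongrightarrow> g x" by (simp add: LIM_zero_iff comp_def)
    qed
    then show ?thesis by (simp add: continuous_on_eq_continuous_at)
  qed
  have gpos: "mass g > 0" by (rule mass_pos_continuous[OF gcont, of 0]) (use g0 kpos sobolevD(2)[OF gs] in auto)
  define w where "w n x = v n x - g x" for n x
  have ws: "w n \<in> sobolev m" for n unfolding w_def by (rule sobolev_diff[OF vs gs])
  have mw: "(\<lambda>n. mass (w n)) \<longlonglongrightarrow> \<mu> - mass g"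
    using tendsto_diff[OF mv mass_splitting[OF ctx]] by (simp add: w_def[abs_def])
  have ew: "(\<lambda>n. energy m p (w n)) \<longlonglongrightarrow> I - energy m p g"
    using tendsto_diff[OF ev energy_splitting[OF ctx]] by (simp add: w_def[abs_def])
  have "0 \<le> \<mu> - mass g" by (rule LIMSEQ_le_const[OF mw]) simp
  \<comment> \<open>Dichotomy is excluded: the two scaling inequalities for remainder and limit would sum to
    \<open>I < I\<close>.\<close>
  moreover have "\<not> mass g < \<mu>"
  proof
    assume lt: "mass g < \<mu>"
    have "\<forall>\<^sub>F n in sequentially. mass (w n) < \<mu>" using mw by (rule order_tendstoD(2)) (use gpos in simp)
    then have "\<forall>\<^sub>F n in sequentially. mass (w n) / \<mu> * I \<le> energy m p (w n)"
      by eventually_elim (rule energy_scaling[OF m p(1) low ws])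
    moreover have "(\<lambda>n. mass (w n) / \<mu> * I) \<longlonglongrightarrow> (\<mu> - mass g) / \<mu> * I" using mu by (intro tendsto_intros mw) auto
    ultimately have "(\<mu> - mass g) / \<mu> * I \<le> I - energy m p g"
      by (intro tendsto_le[OF _ ew]) auto
    moreover have "mass g / \<mu> * I < energy m p g" by (rule energy_scaling_strict[OF m p(1) low gs gpos lt])
    moreover have "(\<mu> - mass g) / \<mu> * I = I - mass g / \<mu> * I" using mu by (simp add: field_simps)
    moreover have False if "a \<le> j - e" "b < e" "a = j - b" for a b e j :: real using that by linarith
    ultimately show False by blast
  qed
  ultimately have gmu: "mass g = \<mu>" by linarith
  have mw0: "(\<lambda>n. mass (w n)) \<longlonglongrightarrow> 0" using mw gmu by simp
  have pw0: "(\<lambda>n. potential p (w n)) \<longlonglongrightarrow> 0"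
  proof (rule Lim_null_comparison)
    have "potential p (w n) \<le> (2 * M) powr (p - 2) * mass (w n)" for n
      using difference_bound[OF ctx, of n] by (intro potential_bound(2)[OF p(1) sobolevD(2)[OF ws]]) (simp add: w_def)
    then show "\<forall>\<^sub>F n in sequentially. norm (potential p (w n)) \<le> (2 * M) powr (p - 2) * mass (w n)" by simp
    show "(\<lambda>n. (2 * M) powr (p - 2) * mass (w n)) \<longlonglongrightarrow> 0" by (intro tendsto_mult_right_zero mw0)
  qed
  \<comment> \<open>No mass is left to the remainder, hence no potential, and the energy that is left is purely
    kinetic.\<close>
  have kw: "(\<lambda>n. kinetic m (w n)) \<longlonglongrightarrow> 2 * (I - energy m p g)"
  proof -
    have "(\<lambda>n. 2 * (energy m p (w n) + potential p (w n) / (p * (p - 1)))) \<longlonglongrightarrow> 2 * (I - energy m p g + 0 / (p * (p - 1)))"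
      using p by (intro tendsto_intros ew pw0) auto
    then show ?thesis by (simp add: energy_eq[OF m ws p(1)])
  qed
  have "0 \<le> 2 * (I - energy m p g)" by (rule LIMSEQ_le_const[OF kw]) simp
  then have Eg: "energy m p g = I" using low[OF gs gmu] by simp
  have kw0: "(\<lambda>n. kinetic m (w n)) \<longlonglongrightarrow> 0" using kw Eg by simp
  have "(\<lambda>n. sqrt (mass (w n) + kinetic m (w n))) \<longlonglongrightarrow> sqrt (0 + 0)" by (intro tendsto_intros mw0 kw0)
  then have dist0: "(\<lambda>n. sobolev_dist m (v n) g) \<longlonglongrightarrow> 0" by (simp add: sobolev_dist_eq vs gs w_def[abs_def])
  \<comment> \<open>The argument ran with continuous representatives; the distance does not distinguish them from
    the given functions.\<close>
  have "sobolev_dist m (\<lambda>x. u (r2 n) (x - (- y (r n)))) g = sobolev_dist m (v n) g" for n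
  proof -
    let ?a = "- y (r n)"
    let ?g = "\<lambda>x. g (x + ?a)"
    have g': "?g \<in> sobolev m" using sobolev_shift(1)[OF gs, of "- ?a"] by simp
    have gg: "(\<lambda>x. ?g (x - ?a)) = g" by simp
    have "sobolev_dist m (\<lambda>x. u (r2 n) (x - ?a)) (\<lambda>x. ?g (x - ?a)) = sobolev_dist m (u (r2 n)) ?g"
      by (rule sobolev_dist_shift[OF u g'])
    also have "\<dots> = sobolev_dist m (continuous_rep (u (r2 n))) ?g"
      by (rule sobolev_dist_cong_AE[OF u g' rs(1) continuous_rep_AE_eq[OF m u], symmetric])
    also have "\<dots> = sobolev_dist m (\<lambda>x. continuous_rep (u (r2 n)) (x - ?a)) (\<lambda>x. ?g (x - ?a))"
      by (rule sobolev_dist_shift[OF rs(1) g', symmetric])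
    also have "(\<lambda>x. continuous_rep (u (r2 n)) (x - ?a)) = v n" by (simp add: v_def v0_def[abs_def] r2_def)
    finally show ?thesis unfolding gg .
  qed
  with dist0 have "(\<lambda>k. sobolev_dist m (\<lambda>x. u (r2 k) (x - (- y (r k)))) g) \<longlonglongrightarrow> 0" by simp
  with r2 gs gmu Eg show ?thesis by (intro exI[of _ r2] exI[of _ "\<lambda>k. - y (r k)"] exI[of _ g]) simp
qed

text \<open>The potential of \<open>A * \<phi>\<close> grows with a higher power of \<open>A\<close> than the kinetic energy, so that a
  large multiple of a bump has negative energy.\<close>

lemma negative_energy_state:
  assumes m: "m \<ge> 1" and p: "2 < p"
  shows "\<exists>w\<in>sobolev m. 0 < mass w \<and> energy m p w < 0"
proof -
  define \<phi> where "\<phi> = bump 0 1 1"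
  have t: "test_function \<phi>" unfolding \<phi>_def by (rule test_function_bump)
  have ps: "\<phi> \<in> sobolev m" by (rule test_function_sobolev[OF t])
  have "\<phi> (1/2) \<noteq> 0" by (simp add: \<phi>_def bump_def flat_exp_def)
  then have mp: "mass \<phi> > 0"
    by (rule mass_pos_continuous[OF smooth_continuous[OF test_function_smooth[OF t]]]) (rule test_function_sqint[OF t])
  define N where "N = potential p \<phi> / (p * (p - 1))"
  have N: "N > 0" using potential_pos[OF m p ps mp] p by (simp add: N_def)
  let ?K = "kinetic m \<phi>"
  \<comment> \<open>Chosen so that \<open>A powr (p - 2) * N = kinetic m \<phi> + N\<close>.\<close>
  define A where "A = (?K / N + 1) powr (1 / (p - 2))"
  have b: "?K / N + 1 > 0" using N by (intro add_nonneg_pos) auto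
  have A: "A > 0" using b by (simp add: A_def)
  have "A powr p = A powr (2 + (p - 2))" by simp
  also have "\<dots> = A powr 2 * A powr (p - 2)" by (rule powr_add)
  also have "A powr (p - 2) = ?K / N + 1" using b p by (simp add: A_def powr_powr)
  also have "A powr 2 = A\<^sup>2" using A by simp
  finally have Ap: "A powr p * N = A\<^sup>2 * (?K + N)" using N by (simp add: field_simps)
  have As: "(\<lambda>x. A * \<phi> x) \<in> sobolev m" by (rule sobolev_cmult(1)[OF ps])
  have "energy m p (\<lambda>x. A * \<phi> x) = A\<^sup>2 * ?K / 2 - A powr p * N"
    unfolding energy_eq[OF m As p] sobolev_cmult(2)[OF ps] potential_cmult N_def using A by simp
  also have "\<dots> = A\<^sup>2 * (- ?K / 2 - N)" unfolding Ap by (simp add: algebra_simps)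
  also have "\<dots> < 0"
  proof (rule mult_pos_neg)
    show "0 < A\<^sup>2" using A by simp
    show "- ?K / 2 - N < 0" using N kinetic_nonneg[of m \<phi>] by linarith
  qed
  finally have "energy m p (\<lambda>x. A * \<phi> x) < 0" .
  moreover have "0 < mass (\<lambda>x. A * \<phi> x)" using A mp by (simp add: mass_cmult)
  ultimately show ?thesis using As by blast
qed

text \<open>The level \<open>\<mu>\<close> is the mass of a state of negative energy, so that the infimum at this level is
  negative.\<close>

theorem minimizer_exists:
  assumes m: "m \<ge> 1" and p: "2 < p" "p < 4 * real m + 2"
  shows "\<exists>\<mu> I g. \<mu> > 0 \<and> I < 0 \<and> (\<forall>u\<in>sobolev m. mass u = \<mu> \<longrightarrow> I \<le> energy m p u) \<and> g \<in> sobolev m \<and> mass g = \<mu> \<and> energy m p g = I"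
proof -
  obtain w where w: "w \<in> sobolev m" "0 < mass w" "energy m p w < 0" using negative_energy_state[OF m p(1)] by blast
  define \<mu> where "\<mu> = mass w"
  define A where "A = {u \<in> sobolev m. mass u = \<mu>}"
  obtain D where D: "\<And>u. u \<in> sobolev m \<Longrightarrow> mass u \<le> \<mu> \<Longrightarrow> kinetic m u / 4 - D \<le> energy m p u"
    using energy_coercive[OF m p, of \<mu>] w(2) unfolding \<mu>_def by auto
  have bdd: "bdd_below (energy m p ` A)"
  proof (rule bdd_belowI2)
    fix u assume "u \<in> A"
    then have "kinetic m u / 4 - D \<le> energy m p u" by (intro D) (simp_all add: A_def)
    then show "- D \<le> energy m p u" using kinetic_nonneg[of m u] by linarith
  qed
  define I where "I = (INF u\<in>A. energy m p u)"
  have wA: "w \<in> A" using w by (simp add: A_def \<mu>_def)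
  have low: "I \<le> energy m p u" if "u \<in> sobolev m" "mass u = \<mu>" for u
    unfolding I_def by (rule cINF_lower[OF bdd]) (use that in \<open>simp add: A_def\<close>)
  have I: "I < 0" using low[of w] w by (simp add: \<mu>_def)
  have "\<forall>n. \<exists>u. u \<in> A \<and> energy m p u < I + inverse (real (Suc n))"
  proof
    fix n
    have "I < I + inverse (real (Suc n))" by simp
    then have "(INF u\<in>A. energy m p u) < I + inverse (real (Suc n))" by (simp only: I_def)
    then show "\<exists>u. u \<in> A \<and> energy m p u < I + inverse (real (Suc n))"
      using cINF_less_iff[of A "energy m p"] wA bdd by blast
  qed
  from choice[OF this] obtain u where u: "\<And>n. u n \<in> A" "\<And>n. energy m p (u n) < I + inverse (real (Suc n))" by blast
  have us: "u n \<in> sobolev m" "mass (u n) = \<mu>" for n using u(1)[of n] by (auto simp: A_def)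
  have elim: "(\<lambda>n. energy m p (u n)) \<longlonglongrightarrow> I"
  proof (rule tendsto_sandwich)
    show "\<forall>\<^sub>F n in sequentially. I \<le> energy m p (u n)" using low us by simp
    show "\<forall>\<^sub>F n in sequentially. energy m p (u n) \<le> I + inverse (real (Suc n))" using u(2) by (auto intro!: always_eventually less_imp_le)
    show "(\<lambda>n. I + inverse (real (Suc n))) \<longlonglongrightarrow> I" using tendsto_add[OF tendsto_const LIMSEQ_inverse_real_of_nat, of I] by simp
  qed simp
  have mlim: "(\<lambda>n. mass (u n)) \<longlonglongrightarrow> \<mu>" by (simp add: us)
  have mu: "\<mu> > 0" using w by (simp add: \<mu>_def)
  have "\<exists>r \<tau> g. strict_mono (r :: nat \<Rightarrow> nat) \<and> g \<in> sobolev m \<and> mass g = \<mu> \<and> energy m p g = I \<and>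
     (\<lambda>k. sobolev_dist m (\<lambda>x. u (r k) (x - \<tau> k)) g) \<longlonglongrightarrow> 0"
    by (rule minimizing_sequence_compact[OF m p mu I _ us(1) mlim elim]) (rule low)
  then obtain g where g: "g \<in> sobolev m" "mass g = \<mu>" "energy m p g = I" by (elim exE conjE)
  show ?thesis
    by (rule exI[of _ \<mu>], rule exI[of _ I], rule exI[of _ g]) (use mu I low g in auto)
qed

section \<open>Lipschitz continuity of mass and energy on bounded sets\<close>

lemma mass_lipschitz:
  assumes u: "u \<in> sobolev m" and w: "w \<in> sobolev m" and Q: "mass u \<le> Q" "mass w \<le> Q"
  shows "\<bar>mass u - mass w\<bar> \<le> 2 * sqrt Q * sobolev_dist m u w"
proof -
  have Q0: "0 \<le> Q" using mass_nonneg[of u] Q(1) by linarith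
  have "\<bar>sqrt (mass u) - sqrt (mass w)\<bar> \<le> sqrt (mass (\<lambda>x. u x - w x))"
    using nrm2_triangle_abs[OF sobolevD(2)[OF u] sobolevD(2)[OF w]] by (simp flip: of_real_diff add: nrm2_cplx)
  also have "\<dots> \<le> sobolev_dist m u w" by (rule sobolev_dist_bounds[OF u w])
  finally have d: "\<bar>sqrt (mass u) - sqrt (mass w)\<bar> \<le> sobolev_dist m u w" .
  have s: "sqrt (mass u) + sqrt (mass w) \<le> 2 * sqrt Q" using Q real_sqrt_le_mono[of "mass u" Q] real_sqrt_le_mono[of "mass w" Q] by linarith
  have "mass u - mass w = (sqrt (mass u) + sqrt (mass w)) * (sqrt (mass u) - sqrt (mass w))"
    by (simp add: algebra_simps)
  then have "\<bar>mass u - mass w\<bar> = (sqrt (mass u) + sqrt (mass w)) * \<bar>sqrt (mass u) - sqrt (mass w)\<bar>"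
    by (simp add: abs_mult)
  also have "\<dots> \<le> 2 * sqrt Q * sobolev_dist m u w" by (rule mult_mono[OF s d]) (use Q0 in auto)
  finally show ?thesis .
qed

lemma kinetic_lipschitz:
  assumes u: "u \<in> sobolev m" and w: "w \<in> sobolev m" and Q: "kinetic m u \<le> K" "kinetic m w \<le> K"
  shows "\<bar>kinetic m u - kinetic m w\<bar> \<le> 2 * sqrt K * sobolev_dist m u w"
proof -
  have K0: "0 \<le> K" using kinetic_nonneg[of m u] Q(1) by linarith
  have "sqrt (kinetic m u) \<le> sqrt (kinetic m (\<lambda>x. u x - w x)) + sqrt (kinetic m w)"
    using sobolev_add(2)[OF sobolev_diff[OF u w] w] by simp
  moreover have "sqrt (kinetic m w) \<le> sqrt (kinetic m (\<lambda>x. w x - u x)) + sqrt (kinetic m u)"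
    using sobolev_add(2)[OF sobolev_diff[OF w u] u] by simp
  moreover have "sqrt (kinetic m (\<lambda>x. u x - w x)) \<le> sobolev_dist m u w" by (rule sobolev_dist_bounds[OF u w])
  moreover have "sqrt (kinetic m (\<lambda>x. w x - u x)) \<le> sobolev_dist m u w"
    using sobolev_dist_bounds(2)[OF w u] sobolev_dist_commute[OF u w] by simp
  ultimately have d: "\<bar>sqrt (kinetic m u) - sqrt (kinetic m w)\<bar> \<le> sobolev_dist m u w" by linarith
  have s: "sqrt (kinetic m u) + sqrt (kinetic m w) \<le> 2 * sqrt K" using Q real_sqrt_le_mono[of "kinetic m u" K] real_sqrt_le_mono[of "kinetic m w" K] by linarith
  have "kinetic m u - kinetic m w = (sqrt (kinetic m u) + sqrt (kinetic m w)) * (sqrt (kinetic m u) - sqrt (kinetic m w))"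
    by (simp add: algebra_simps)
  then have "\<bar>kinetic m u - kinetic m w\<bar> = (sqrt (kinetic m u) + sqrt (kinetic m w)) * \<bar>sqrt (kinetic m u) - sqrt (kinetic m w)\<bar>"
    by (simp add: abs_mult)
  also have "\<dots> \<le> 2 * sqrt K * sobolev_dist m u w" by (rule mult_mono[OF s d]) (use K0 in auto)
  finally show ?thesis .
qed

lemma potential_lipschitz:
  assumes m: "m \<ge> 1" and p: "2 < p" and u0: "u \<in> sobolev m" and w0: "w \<in> sobolev m"
    and Q: "mass u \<le> Q" "mass w \<le> Q" and K: "kinetic m u \<le> K" "kinetic m w \<le> K"
  shows "\<bar>potential p u - potential p w\<bar> \<le> p * (2 * sqrt (weight_integral m * (Q + K))) powr (p - 2) * (2 * sqrt Q) * sobolev_dist m u w"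
proof -
  define L where "L = 2 * sqrt (weight_integral m * (Q + K))"
  define a where "a = continuous_rep u"
  define b where "b = continuous_rep w"
  have u: "a \<in> sobolev m" and w: "b \<in> sobolev m" unfolding a_def b_def by (intro continuous_rep_sobolev m u0 w0)+
  note [measurable] = sobolevD(1)[OF u] sobolevD(1)[OF w]
  have "\<bar>a x\<bar> \<le> L / 2" for x
  proof -
    have "\<bar>a x\<bar> \<le> sqrt (weight_integral m * (mass u + kinetic m u))" unfolding a_def by (rule continuous_rep_bounded[OF m u0])
    also have "\<dots> \<le> sqrt (weight_integral m * (Q + K))" using Q K by (intro real_sqrt_le_mono mult_left_mono weight_integral_nonneg) auto
    finally show ?thesis by (simp add: L_def)
  qed
  moreover have "\<bar>b x\<bar> \<le> L / 2" for x
  proof -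
    have "\<bar>b x\<bar> \<le> sqrt (weight_integral m * (mass w + kinetic m w))" unfolding b_def by (rule continuous_rep_bounded[OF m w0])
    also have "\<dots> \<le> sqrt (weight_integral m * (Q + K))" using Q K by (intro real_sqrt_le_mono mult_left_mono weight_integral_nonneg) auto
    finally show ?thesis by (simp add: L_def)
  qed
  ultimately have L: "\<bar>a x\<bar> + \<bar>b x\<bar> \<le> L" for x by (smt (verit) field_sum_of_halves)
  let ?c = "p * L powr (p - 2)"
  have c0: "?c \<ge> 0" using p by simp
  have sd: "(\<lambda>x. a x - b x) \<in> sobolev m" by (rule sobolev_diff[OF u w])
  have cs: "integrable lborel (\<lambda>x. f x * (a x - b x))" "(LINT x|lborel. \<bar>f x * (a x - b x)\<bar>) \<le> sqrt (mass f) * sqrt (mass (\<lambda>x. a x - b x))"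
    if "f \<in> sobolev m" for f
    using cauchy_schwarz_real[OF sobolevD(1)[OF that] sobolevD(1)[OF sd] sobolevD(6)[OF that] sobolevD(6)[OF sd]]
    by (simp_all add: mass_def)
  have "\<bar>potential p a - potential p b\<bar> = \<bar>LINT x|lborel. \<bar>a x\<bar> powr p - \<bar>b x\<bar> powr p\<bar>"
    unfolding potential_def using potential_integrable[OF m u p] potential_integrable[OF m w p] by simp
  also have "\<dots> \<le> (LINT x|lborel. \<bar>\<bar>a x\<bar> powr p - \<bar>b x\<bar> powr p\<bar>)" by (rule integral_abs_bound)
  also have "\<dots> \<le> (LINT x|lborel. ?c * (\<bar>a x * (a x - b x)\<bar> + \<bar>b x * (a x - b x)\<bar>))"
  proof (rule integral_mono)
    show "integrable lborel (\<lambda>x. \<bar>\<bar>a x\<bar> powr p - \<bar>b x\<bar> powr p\<bar>)"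
      by (rule integrable_abs[OF Bochner_Integration.integrable_diff[OF potential_integrable[OF m u p] potential_integrable[OF m w p]]])
    show "integrable lborel (\<lambda>x. ?c * (\<bar>a x * (a x - b x)\<bar> + \<bar>b x * (a x - b x)\<bar>))"
      by (intro integrable_mult_right Bochner_Integration.integrable_add integrable_abs cs u w)
    show "\<bar>\<bar>a x\<bar> powr p - \<bar>b x\<bar> powr p\<bar> \<le> ?c * (\<bar>a x * (a x - b x)\<bar> + \<bar>b x * (a x - b x)\<bar>)" for x
      using powr_diff_bound_abs[OF p L[of x]] by (simp only: abs_mult distrib_right)
  qed
  also have "\<dots> = ?c * ((LINT x|lborel. \<bar>a x * (a x - b x)\<bar>) + (LINT x|lborel. \<bar>b x * (a x - b x)\<bar>))"
    using integrable_abs[OF cs(1)[OF u]] integrable_abs[OF cs(1)[OF w]] by simp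
  also have "\<dots> \<le> ?c * (sqrt (mass a) * sqrt (mass (\<lambda>x. a x - b x)) + sqrt (mass b) * sqrt (mass (\<lambda>x. a x - b x)))"
    by (intro mult_left_mono add_mono cs u w c0)
  also have "\<dots> \<le> ?c * (sqrt Q * sobolev_dist m a b + sqrt Q * sobolev_dist m a b)"
    using Q order_trans[OF mass_nonneg Q(1)]
    by (intro mult_left_mono add_mono mult_mono real_sqrt_le_mono sobolev_dist_bounds[OF u w] c0) (auto simp: a_def b_def continuous_rep_sobolev[OF m u0] continuous_rep_sobolev[OF m w0])
  also have "sobolev_dist m a b = sobolev_dist m u w"
    using sobolev_dist_cong_AE[OF u0 w u, OF continuous_rep_AE_eq[OF m u0, folded a_def]]
      sobolev_dist_cong_AE[OF w0 u0 w, OF continuous_rep_AE_eq[OF m w0, folded b_def]]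
      sobolev_dist_commute[OF u0 w] sobolev_dist_commute[OF u0 w0] by simp
  finally show ?thesis by (simp add: a_def b_def continuous_rep_sobolev[OF m u0] continuous_rep_sobolev[OF m w0] L_def algebra_simps)
qed

lemma energy_lipschitz:
  assumes m: "m \<ge> 1" and p: "2 < p"
  shows "\<exists>C. \<forall>u\<in>sobolev m. \<forall>w\<in>sobolev m. mass u \<le> Q \<longrightarrow> mass w \<le> Q \<longrightarrow> kinetic m u \<le> K \<longrightarrow> kinetic m w \<le> K \<longrightarrow>
    \<bar>energy m p u - energy m p w\<bar> \<le> C * sobolev_dist m u w"
proof -
  let ?C1 = "p * (2 * sqrt (weight_integral m * (Q + K))) powr (p - 2) * (2 * sqrt Q)"
  let ?C = "sqrt K + ?C1 / (p * (p - 1))"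
  have "\<bar>energy m p u - energy m p w\<bar> \<le> ?C * sobolev_dist m u w"
    if u: "u \<in> sobolev m" and w: "w \<in> sobolev m" and Q: "mass u \<le> Q" "mass w \<le> Q" and K: "kinetic m u \<le> K" "kinetic m w \<le> K" for u w
  proof -
    have pp: "p * (p - 1) > 0" using p by simp
    have "energy m p u - energy m p w = (kinetic m u - kinetic m w) / 2 - (potential p u - potential p w) / (p * (p - 1))"
      by (simp add: energy_eq[OF m _ p] u w diff_divide_distrib)
    also have "\<bar>\<dots>\<bar> \<le> \<bar>kinetic m u - kinetic m w\<bar> / 2 + \<bar>potential p u - potential p w\<bar> / (p * (p - 1))"
      using abs_triangle_ineq4[of "(kinetic m u - kinetic m w) / 2" "(potential p u - potential p w) / (p * (p - 1))"] pp
      by (simp add: abs_of_pos)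
    also have "\<dots> \<le> (2 * sqrt K * sobolev_dist m u w) / 2 + (?C1 * sobolev_dist m u w) / (p * (p - 1))"
      using pp by (intro add_mono divide_right_mono kinetic_lipschitz potential_lipschitz m p u w Q K) auto
    also have "\<dots> = ?C * sobolev_dist m u w" by (simp add: distrib_right)
    finally show ?thesis .
  qed
  then show ?thesis by blast
qed

section \<open>Differentiability of the potential\<close>

text \<open>Up to the factor \<open>p\<close> the derivative of \<open>\<bar>y\<bar> powr p\<close>.\<close>

definition nonlin :: "real \<Rightarrow> real \<Rightarrow> real" where "nonlin p y = \<bar>y\<bar> powr (p - 2) * y"

text \<open>At \<open>y = 0\<close> this uses \<open>p > 2\<close>; elsewhere the function is locally a signed power.\<close>

lemma nonlin_has_derivative:
  assumes p: "2 < p"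
  shows "(nonlin p has_real_derivative (p - 1) * \<bar>y\<bar> powr (p - 2)) (at y)"
proof -
  have sp: "z powr (p - 2) * z = z powr (p - 1)" if "z > 0" for z :: real
  proof -
    have "z powr (p - 1) = z powr ((p - 2) + 1)" by simp
    also have "\<dots> = z powr (p - 2) * z powr 1" by (rule powr_add)
    finally show ?thesis using that by simp
  qed
  consider "y > 0" | "y < 0" | "y = 0" by linarith
  then show ?thesis
  proof cases
    case 1
    have "((\<lambda>z. z powr (p - 1)) has_real_derivative (p - 1) * y powr (p - 1 - 1)) (at y)"
      by (rule has_real_derivative_powr[OF 1])
    then have "((\<lambda>z. z powr (p - 1)) has_real_derivative (p - 1) * \<bar>y\<bar> powr (p - 2)) (at y)" using 1 by simp
    then show ?thesis
      by (rule has_field_derivative_transform_within_open[of _ _ _ "{0<..}"]) (use 1 in \<open>auto simp: nonlin_def sp\<close>)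
  next
    case 2
    have "((\<lambda>z. z powr (p - 1)) has_real_derivative (p - 1) * (- y) powr (p - 1 - 1)) (at (- y))"
      by (rule has_real_derivative_powr) (use 2 in simp)
    then have "((\<lambda>z. - ((- z) powr (p - 1))) has_real_derivative - ((p - 1) * (- y) powr (p - 1 - 1) * (- 1))) (at y)"
      by (intro DERIV_minus DERIV_chain2[of "\<lambda>z. z powr (p - 1)" _ uminus]) (auto intro!: derivative_eq_intros)
    then have "((\<lambda>z. - ((- z) powr (p - 1))) has_real_derivative (p - 1) * \<bar>y\<bar> powr (p - 2)) (at y)" using 2 by simp
    then show ?thesis
    proof (rule has_field_derivative_transform_within_open[of _ _ _ "{..<0}"])
      fix z :: real assume "z \<in> {..<0}"
      then show "- ((- z) powr (p - 1)) = nonlin p z" using sp[of "- z"] by (simp add: nonlin_def)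
    qed (use 2 in auto)
  next
    case 3
    have "((\<lambda>h. \<bar>h\<bar> powr (p - 2)) \<longlongrightarrow> \<bar>0\<bar> powr (p - 2)) (at (0::real))"
      using p by (intro tendsto_powr' tendsto_intros) auto
    then have "((\<lambda>h. \<bar>h\<bar> powr (p - 2)) \<longlongrightarrow> 0) (at (0::real))" using p by simp
    moreover have "\<forall>\<^sub>F h in at (0::real). \<bar>h\<bar> powr (p - 2) = (nonlin p (0 + h) - nonlin p 0) / h"
      by (simp add: eventually_at_filter nonlin_def)
    ultimately have "((\<lambda>h. (nonlin p (0 + h) - nonlin p 0) / h) \<longlongrightarrow> 0) (at 0)"
      by (rule Lim_transform_eventually)
    then show ?thesis using 3 p by (simp add: DERIV_def)
  qed
qed

lemma abs_powr_has_derivative: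
  assumes p: "2 < p"
  shows "((\<lambda>y. \<bar>y\<bar> powr p) has_real_derivative p * nonlin p y) (at y)"
proof -
  have e: "\<bar>z\<bar> powr p = nonlin p z * z" for z
  proof (cases "z = 0")
    case False
    have "\<bar>z\<bar> powr p = \<bar>z\<bar> powr ((p - 2) + 2)" by simp
    also have "\<dots> = \<bar>z\<bar> powr (p - 2) * \<bar>z\<bar> powr 2" by (rule powr_add)
    also have "\<bar>z\<bar> powr 2 = z * z" using False by (simp add: power2_eq_square)
    finally show ?thesis by (simp add: nonlin_def)
  qed (use p in \<open>simp add: nonlin_def\<close>)
  have "((\<lambda>z. nonlin p z * z) has_real_derivative (p - 1) * \<bar>y\<bar> powr (p - 2) * y + 1 * nonlin p y) (at y)"
    by (rule DERIV_mult[OF nonlin_has_derivative[OF p] DERIV_ident])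
  moreover have "(p - 1) * \<bar>y\<bar> powr (p - 2) * y + 1 * nonlin p y = p * nonlin p y"
    by (simp add: nonlin_def algebra_simps)
  ultimately show ?thesis by (simp add: e)
qed

lemma nonlin_lipschitz:
  assumes p: "2 < p" and y: "\<bar>y\<bar> \<le> L" and z: "\<bar>z\<bar> \<le> L"
  shows "\<bar>nonlin p y - nonlin p z\<bar> \<le> (p - 1) * L powr (p - 2) * \<bar>y - z\<bar>"
proof -
  have "norm (nonlin p y - nonlin p z) \<le> (p - 1) * L powr (p - 2) * norm (y - z)"
  proof (rule field_differentiable_bound[of "{-L..L}"])
    fix x assume x: "x \<in> {-L..L}"
    show "(nonlin p has_field_derivative (p - 1) * \<bar>x\<bar> powr (p - 2)) (at x within {-L..L})"
      by (rule has_field_derivative_at_within[OF nonlin_has_derivative[OF p]])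
    have "\<bar>x\<bar> powr (p - 2) \<le> L powr (p - 2)" using x p by (intro powr_mono2) auto
    then show "norm ((p - 1) * \<bar>x\<bar> powr (p - 2)) \<le> (p - 1) * L powr (p - 2)"
      using p by (simp add: abs_mult)
  qed (use y z in auto)
  then show ?thesis by simp
qed

lemma abs_powr_taylor:
  assumes p: "2 < p" and y: "\<bar>y\<bar> \<le> L" and t: "\<bar>y + t\<bar> \<le> L"
  shows "\<bar>\<bar>y + t\<bar> powr p - \<bar>y\<bar> powr p - p * nonlin p y * t\<bar> \<le> p * (p - 1) * L powr (p - 2) * t\<^sup>2"
proof -
  let ?G = "\<lambda>z. \<bar>z\<bar> powr p - p * nonlin p y * z"
  let ?B = "p * ((p - 1) * L powr (p - 2) * \<bar>t\<bar>)"
  have A: "norm (?G (y + t) - ?G y) \<le> ?B * norm ((y + t) - y)"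
  proof (rule field_differentiable_bound[of "closed_segment y (y + t)"])
    fix x assume x: "x \<in> closed_segment y (y + t)"
    show "(?G has_field_derivative (p * nonlin p x - p * nonlin p y)) (at x within closed_segment y (y + t))"
      by (rule has_field_derivative_at_within[OF DERIV_diff[OF abs_powr_has_derivative[OF p] DERIV_cmult_Id]])
    have xL: "\<bar>x\<bar> \<le> L" "\<bar>x - y\<bar> \<le> \<bar>t\<bar>"
      using x y t by (auto simp: closed_segment_eq_real_ivl split: if_splits)
    have "\<bar>nonlin p x - nonlin p y\<bar> \<le> (p - 1) * L powr (p - 2) * \<bar>x - y\<bar>" by (rule nonlin_lipschitz[OF p xL(1) y])
    also have "\<dots> \<le> (p - 1) * L powr (p - 2) * \<bar>t\<bar>" using xL(2) p by (intro mult_left_mono) auto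
    finally have "p * \<bar>nonlin p x - nonlin p y\<bar> \<le> ?B" using p by (intro mult_left_mono) auto
    moreover have "norm (p * nonlin p x - p * nonlin p y) = p * \<bar>nonlin p x - nonlin p y\<bar>"
      using p by (simp flip: right_diff_distrib add: abs_mult)
    ultimately show "norm (p * nonlin p x - p * nonlin p y) \<le> ?B" by simp
  qed auto
  have B: "?G (y + t) - ?G y = \<bar>y + t\<bar> powr p - \<bar>y\<bar> powr p - p * nonlin p y * t" by (simp add: algebra_simps)
  have C: "?B * \<bar>(y + t) - y\<bar> = p * (p - 1) * L powr (p - 2) * t\<^sup>2"
    by (simp add: power2_eq_square mult.assoc)
  show ?thesis using A unfolding B C real_norm_def .
qed

lemma nonlin_measurable [measurable]: "nonlin p \<in> borel_measurable borel" unfolding nonlin_def by measurable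

lemma nonlin_sqint:
  assumes p: "2 < p" and s: "sqint (cplx u)" and M: "\<And>x. \<bar>u x\<bar> \<le> M"
  shows "sqint (cplx (\<lambda>x. nonlin p (u x)))"
proof (rule sqint_dominated[OF _ s, of _ "M powr (p - 2)"])
  have [measurable]: "u \<in> borel_measurable borel" using s by (simp add: sqint_cplx_iff)
  show "cplx (\<lambda>x. nonlin p (u x)) \<in> borel_measurable borel" by measurable
  fix x
  have "\<bar>u x\<bar> powr (p - 2) \<le> M powr (p - 2)" using M[of x] p by (intro powr_mono2) auto
  then show "cmod (cplx (\<lambda>x. nonlin p (u x)) x) \<le> M powr (p - 2) * cmod (cplx u x)"
    by (simp add: nonlin_def norm_mult mult_right_mono)
qed

lemma sqint_real_mult_integrable:
  assumes "sqint (cplx f)" "sqint (cplx g)" shows "integrable lborel (\<lambda>x. f x * g x)"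
  by (rule cauchy_schwarz_real(1)) (use assms in \<open>auto simp: sqint_cplx_iff\<close>)

text \<open>A quadratic polynomial without constant term that is nonnegative near \<open>0\<close> has no linear term.
  It extracts the first variation from second-order estimates, without differentiating the energy.\<close>

lemma linear_term_zero:
  fixes d C :: real
  assumes h: "\<And>s. \<bar>s\<bar> \<le> 1 \<Longrightarrow> 0 \<le> s * d + s\<^sup>2 * C" shows "d = 0"
proof (rule ccontr)
  assume d: "d \<noteq> 0"
  define N where "N = \<bar>C\<bar> + \<bar>d\<bar> + 1"
  have N: "N > 0" "C < N" "\<bar>d\<bar> \<le> N" by (auto simp: N_def)
  have "0 \<le> (- d / N) * d + (- d / N)\<^sup>2 * C" using N by (intro h) (simp add: field_simps)
  also have "\<dots> = (d\<^sup>2 / N\<^sup>2) * (C - N)" using N by (simp add: power2_eq_square field_simps)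
  also have "\<dots> < 0" using d N by (intro mult_pos_neg) auto
  finally show False by simp
qed

text \<open>Bernoulli's inequality for the factor that renormalizes the mass of a perturbed minimizer.\<close>

lemma powr_minus_bernoulli:
  fixes x r :: real assumes "x \<ge> 0" "r \<ge> 0" shows "1 - r * x \<le> (1 + x) powr (- r)"
proof -
  have "r * ln (1 + x) \<le> r * x" using assms by (intro mult_left_mono ln_add_one_self_le_self) auto
  then have "1 - r * x \<le> 1 + (- r * ln (1 + x))" by simp
  also have "\<dots> \<le> exp (- r * ln (1 + x))" by (rule exp_ge_add_one_self)
  also have "\<dots> = (1 + x) powr (- r)" using assms by (simp add: powr_def)
  finally show ?thesis .
qed

section \<open>The Euler--Lagrange equation and regularity of minimizers\<close>

text \<open>The bilinear form of \<open>kinetic\<close>, on transforms.\<close>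

abbreviation kinetic_form :: "nat \<Rightarrow> (real \<Rightarrow> complex) \<Rightarrow> (real \<Rightarrow> complex) \<Rightarrow> real" where
  "kinetic_form m U V \<equiv> Re (inner_L2 (\<lambda>\<xi>. complex_of_real (\<xi> ^ m) * U \<xi>) (\<lambda>\<xi>. complex_of_real (\<xi> ^ m) * V \<xi>))"

lemma kinetic_line:
  assumes u: "u \<in> sobolev m" and v: "v \<in> sobolev m"
  shows "kinetic m (\<lambda>x. u x + s * v x) = kinetic m u + 2 * s * kinetic_form m (fourier u) (fourier v) + s\<^sup>2 * kinetic m v"
proof -
  define U where "U = (\<lambda>\<xi>. complex_of_real (\<xi> ^ m) * fourier u \<xi>)"
  define V where "V = (\<lambda>\<xi>. complex_of_real (\<xi> ^ m) * fourier v \<xi>)"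
  have U: "sqint U" and V: "sqint V" using sobolevD(5) u v by (auto simp: U_def V_def)
  let ?W = "\<lambda>\<xi>. complex_of_real (\<xi> ^ m) * (fourier u \<xi> + complex_of_real s * fourier v \<xi>)"
  have eq: "?W = (\<lambda>\<xi>. U \<xi> + complex_of_real s * V \<xi>)" unfolding U_def V_def by (simp only: distrib_left mult_ac)
  have sV: "sqint (\<lambda>\<xi>. complex_of_real s * V \<xi>)" by (rule sqint_cmult[OF V])
  have W: "sqint ?W" unfolding eq by (rule sqint_add[OF U sV])
  have pair: "fourier_pair (cplx (\<lambda>x. u x + s * v x)) (\<lambda>\<xi>. fourier u \<xi> + complex_of_real s * fourier v \<xi>)"
    by (rule fourier_pair_add_real[OF sobolevD(3)[OF u] fourier_pair_cmult_real[OF sobolevD(3)[OF v]]])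
  have "inner_L2 U (\<lambda>\<xi>. complex_of_real s * V \<xi>) = (LINT \<xi>|lborel. complex_of_real s * (U \<xi> * cnj (V \<xi>)))"
    unfolding inner_L2_def by (simp only: complex_cnj_mult complex_cnj_complex_of_real mult_ac)
  also have "\<dots> = complex_of_real s * inner_L2 U V" unfolding inner_L2_def by (rule integral_mult_right_zero)
  finally have "Re (inner_L2 U (\<lambda>\<xi>. complex_of_real s * V \<xi>)) = s * Re (inner_L2 U V)" by simp
  then have "kinetic m (\<lambda>x. u x + s * v x) = nrm2 U + s\<^sup>2 * nrm2 V + 2 * (s * Re (inner_L2 U V))"
    unfolding sobolevI(2)[OF pair W] eq nrm2_add[OF U sV] nrm2_cmult by simp
  moreover have "nrm2 U = kinetic m u" "nrm2 V = kinetic m v" by (simp_all only: kinetic_def U_def V_def)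
  ultimately have "kinetic m (\<lambda>x. u x + s * v x) = kinetic m u + 2 * s * Re (inner_L2 U V) + s\<^sup>2 * kinetic m v" by simp
  then show ?thesis unfolding U_def V_def .
qed

lemma mass_line:
  assumes u: "sqint (cplx u)" and v: "sqint (cplx v)"
  shows "mass (\<lambda>x. u x + s * v x) = mass u + 2 * s * (LINT x|lborel. u x * v x) + s\<^sup>2 * mass v"
proof -
  have i: "integrable lborel (\<lambda>x. (u x)\<^sup>2)" "integrable lborel (\<lambda>x. (v x)\<^sup>2)" "integrable lborel (\<lambda>x. u x * v x)"
    using u v sqint_real_mult_integrable[OF u v] by (auto simp: sqint_cplx_iff)
  have "mass (\<lambda>x. u x + s * v x) = (LINT x|lborel. (u x)\<^sup>2 + 2 * s * (u x * v x) + s\<^sup>2 * (v x)\<^sup>2)"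
    unfolding mass_def by (intro Bochner_Integration.integral_cong refl) (simp add: power2_eq_square algebra_simps)
  then show ?thesis using i by (simp add: mass_def)
qed

lemma potential_line:
  assumes p: "2 < p" and u: "sqint (cplx u)" and v: "sqint (cplx v)" and M: "\<And>x. \<bar>u x\<bar> \<le> M" "\<And>x. \<bar>v x\<bar> \<le> M" and s: "\<bar>s\<bar> \<le> 1"
  shows "\<bar>potential p (\<lambda>x. u x + s * v x) - potential p u - p * s * (LINT x|lborel. nonlin p (u x) * v x)\<bar>
    \<le> p * (p - 1) * (2 * M) powr (p - 2) * mass v * s\<^sup>2"
proof -
  have M0: "0 \<le> M" using M(1)[of 0] by linarith
  have sv: "\<bar>s * v x\<bar> \<le> M" for x
  proof -
    have "\<bar>s\<bar> * \<bar>v x\<bar> \<le> 1 * M" by (intro mult_mono s M) auto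
    then show ?thesis by (simp add: abs_mult)
  qed
  have b: "\<bar>u x + s * v x\<bar> \<le> 2 * M" for x using M(1)[of x] sv[of x] by linarith
  have b0: "\<bar>u x\<bar> \<le> 2 * M" for x using M(1)[of x] M0 by linarith
  have w: "sqint (cplx (\<lambda>x. u x + s * v x))" using sqint_add[OF u sqint_cmult[OF v, of "complex_of_real s"]] by simp
  have i1: "integrable lborel (\<lambda>x. \<bar>u x + s * v x\<bar> powr p)" by (rule potential_bound(1)[OF p w b])
  have i2: "integrable lborel (\<lambda>x. \<bar>u x\<bar> powr p)" by (rule potential_bound(1)[OF p u M(1)])
  have i3: "integrable lborel (\<lambda>x. nonlin p (u x) * v x)" by (rule sqint_real_mult_integrable[OF nonlin_sqint[OF p u M(1)] v])
  have i4: "integrable lborel (\<lambda>x. (v x)\<^sup>2)" using v by (simp add: sqint_cplx_iff)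
  let ?f = "\<lambda>x. \<bar>u x + s * v x\<bar> powr p - \<bar>u x\<bar> powr p - p * s * (nonlin p (u x) * v x)"
  have fi: "integrable lborel ?f" by (intro Bochner_Integration.integrable_diff integrable_mult_right i1 i2 i3)
  have "(LINT x|lborel. ?f x) = (LINT x|lborel. \<bar>u x + s * v x\<bar> powr p - \<bar>u x\<bar> powr p) - (LINT x|lborel. p * s * (nonlin p (u x) * v x))"
    by (rule Bochner_Integration.integral_diff[OF Bochner_Integration.integrable_diff[OF i1 i2] integrable_mult_right[OF i3]])
  also have "(LINT x|lborel. \<bar>u x + s * v x\<bar> powr p - \<bar>u x\<bar> powr p) = potential p (\<lambda>x. u x + s * v x) - potential p u"
    unfolding potential_def by (rule Bochner_Integration.integral_diff[OF i1 i2])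
  also have "(LINT x|lborel. p * s * (nonlin p (u x) * v x)) = p * s * (LINT x|lborel. nonlin p (u x) * v x)"
    by (rule integral_mult_right_zero)
  finally have "potential p (\<lambda>x. u x + s * v x) - potential p u - p * s * (LINT x|lborel. nonlin p (u x) * v x) = (LINT x|lborel. ?f x)"
    by (rule sym)
  then have "\<bar>potential p (\<lambda>x. u x + s * v x) - potential p u - p * s * (LINT x|lborel. nonlin p (u x) * v x)\<bar> = \<bar>LINT x|lborel. ?f x\<bar>"
    by (rule arg_cong)
  also have "\<dots> \<le> (LINT x|lborel. \<bar>?f x\<bar>)" by (rule integral_abs_bound)
  also have "\<dots> \<le> (LINT x|lborel. p * (p - 1) * (2 * M) powr (p - 2) * s\<^sup>2 * (v x)\<^sup>2)"
  proof (rule integral_mono)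
    show "integrable lborel (\<lambda>x. \<bar>?f x\<bar>)" by (rule integrable_abs[OF fi])
    show "integrable lborel (\<lambda>x. p * (p - 1) * (2 * M) powr (p - 2) * s\<^sup>2 * (v x)\<^sup>2)" by (rule integrable_mult_right[OF i4])
    show "\<bar>?f x\<bar> \<le> p * (p - 1) * (2 * M) powr (p - 2) * s\<^sup>2 * (v x)\<^sup>2" for x
    proof -
      have "p * (p - 1) * (2 * M) powr (p - 2) * (s * v x)\<^sup>2 = p * (p - 1) * (2 * M) powr (p - 2) * s\<^sup>2 * (v x)\<^sup>2"
        by (simp only: power_mult_distrib mult.assoc)
      moreover have "p * nonlin p (u x) * (s * v x) = p * s * (nonlin p (u x) * v x)" by (simp only: mult_ac)
      ultimately show ?thesis using abs_powr_taylor[OF p b0[of x] b[of x]] by (simp only:)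
    qed
  qed
  also have "\<dots> = p * (p - 1) * (2 * M) powr (p - 2) * s\<^sup>2 * mass v" unfolding mass_def by (rule integral_mult_right_zero)
  finally show ?thesis by (simp only: mult_ac)
qed

text \<open>Along a direction orthogonal to \<open>u\<close> the mass of \<open>u + s * v\<close> changes only to second order in
  \<open>s\<close>. Rescaling back to mass \<open>\<mu>\<close> therefore costs a term of order \<open>s\<^sup>2\<close>, and minimality forces the
  coefficient of \<open>s\<close> to vanish.\<close>

lemma euler_lagrange_tangent:
  assumes m: "m \<ge> 1" and p: "2 < p" and mu: "\<mu> > 0" and low: "\<And>u. u \<in> sobolev m \<Longrightarrow> mass u = \<mu> \<Longrightarrow> I \<le> energy m p u"
    and u: "u \<in> sobolev m" "mass u = \<mu>" "energy m p u = I" and v: "v \<in> sobolev m"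
    and M: "\<And>x. \<bar>u x\<bar> \<le> M" "\<And>x. \<bar>v x\<bar> \<le> M" and orth: "(LINT x|lborel. u x * v x) = 0"
  shows "kinetic_form m (fourier u) (fourier v) = (LINT x|lborel. nonlin p (u x) * v x) / (p - 1)"
proof -
  define a where "a = kinetic_form m (fourier u) (fourier v)"
  define c where "c = (LINT x|lborel. nonlin p (u x) * v x)"
  define q where "q = mass v / \<mu>"
  define C where "C = (2 * M) powr (p - 2) * mass v"
  define P where "P = potential p u / (p * (p - 1))"
  have pp: "p * (p - 1) > 0" using p by simp
  have q0: "q \<ge> 0" using mu by (simp add: q_def)
  have C0: "C \<ge> 0" by (simp add: C_def)
  have "0 \<le> s * (a - c / (p - 1)) + s\<^sup>2 * (kinetic m v / 2 + C + p / 2 * q * (P + \<bar>c\<bar> / (p - 1) + C))" if s: "\<bar>s\<bar> \<le> 1" for s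
  proof -
    define w where "w x = u x + s * v x" for x
    have ws: "w \<in> sobolev m" unfolding w_def[abs_def] by (rule sobolev_add(1)[OF u(1) sobolev_cmult(1)[OF v]])
    have mw: "mass w = \<mu> * (1 + q * s\<^sup>2)"
      unfolding w_def[abs_def] mass_line[OF sobolevD(2)[OF u(1)] sobolevD(2)[OF v]] orth u(2) using mu by (simp add: q_def field_simps)
    \<comment> \<open>Multiplication by \<open>sqrt \<theta>\<close> brings \<open>w\<close> back to mass \<open>\<mu>\<close>.\<close>
    define \<theta> where "\<theta> = 1 / (1 + q * s\<^sup>2)"
    have qs: "q * s\<^sup>2 \<ge> 0" using q0 by simp
    have th: "0 < \<theta>" "\<theta> \<le> 1" using qs by (auto simp: \<theta>_def)
    define Pw where "Pw = potential p w / (p * (p - 1))"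
    have kw: "kinetic m w = kinetic m u + 2 * s * a + s\<^sup>2 * kinetic m v"
      unfolding w_def[abs_def] a_def by (rule kinetic_line[OF u(1) v])
    have "\<bar>potential p w - potential p u - p * s * c\<bar> \<le> p * (p - 1) * C * s\<^sup>2"
      unfolding w_def[abs_def] c_def C_def using potential_line[OF p sobolevD(2)[OF u(1)] sobolevD(2)[OF v] M s] by (simp only: mult.assoc)
    then have "\<bar>potential p w - potential p u - p * s * c\<bar> / (p * (p - 1)) \<le> p * (p - 1) * C * s\<^sup>2 / (p * (p - 1))"
      using pp by (intro divide_right_mono) auto
    moreover have "\<bar>potential p w - potential p u - p * s * c\<bar> / (p * (p - 1)) = \<bar>Pw - P - s * c / (p - 1)\<bar>"
    proof -
      have "(potential p w - potential p u - p * s * c) / (p * (p - 1)) = Pw - P - s * c / (p - 1)"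
        using p by (simp add: Pw_def P_def diff_divide_distrib)
      then show ?thesis using pp by (metis abs_divide abs_of_pos)
    qed
    moreover have "p * (p - 1) * C * s\<^sup>2 / (p * (p - 1)) = C * s\<^sup>2" using p by simp
    ultimately have pot: "\<bar>Pw - P - s * c / (p - 1)\<bar> \<le> C * s\<^sup>2" by simp
    have Pw0: "Pw \<ge> 0" using pp by (simp add: Pw_def)
    have s2: "s\<^sup>2 \<le> 1" using s by (simp add: abs_square_le_1)
    have "s * c / (p - 1) \<le> \<bar>c\<bar> / (p - 1)"
    proof -
      have "s * c \<le> \<bar>s\<bar> * \<bar>c\<bar>" by (metis abs_ge_self abs_mult)
      also have "\<dots> \<le> 1 * \<bar>c\<bar>" using s by (intro mult_right_mono) auto
      finally show ?thesis using p by (intro divide_right_mono) auto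
    qed
    moreover have "C * s\<^sup>2 \<le> C" using C0 s2 by (simp add: mult_left_le)
    \<comment> \<open>A bound that does not depend on \<open>s\<close>, so that the correction for the rescaling is of order
      \<open>s\<^sup>2\<close>.\<close>
    ultimately have PwB: "Pw \<le> P + \<bar>c\<bar> / (p - 1) + C" using pot by linarith
    let ?z = "\<lambda>x. sqrt \<theta> * w x"
    have zs: "?z \<in> sobolev m" by (rule sobolev_cmult(1)[OF ws])
    have "mass ?z = \<mu>" unfolding mass_cmult mw using th qs by (simp add: \<theta>_def)
    then have "I \<le> energy m p ?z" by (rule low[OF zs])
    also have "\<dots> = \<theta> * kinetic m w / 2 - sqrt \<theta> powr p * Pw"
      unfolding energy_eq[OF m zs p] sobolev_cmult(2)[OF ws] potential_cmult Pw_def using th by simp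
    also have "\<dots> \<le> kinetic m w / 2 - (1 - p / 2 * (q * s\<^sup>2)) * Pw"
    proof -
      have "\<theta> * kinetic m w \<le> 1 * kinetic m w" using th by (intro mult_right_mono) auto
      moreover have "(1 - p / 2 * (q * s\<^sup>2)) * Pw \<le> sqrt \<theta> powr p * Pw"
      proof (rule mult_right_mono[OF _ Pw0])
        have "sqrt \<theta> powr p = \<theta> powr (p / 2)" using th by (simp add: powr_half_sqrt[symmetric] powr_powr)
        also have "\<dots> = (1 + q * s\<^sup>2) powr (- (p / 2))"
          using qs by (simp add: \<theta>_def powr_minus_divide powr_divide)
        finally show "1 - p / 2 * (q * s\<^sup>2) \<le> sqrt \<theta> powr p"
          using powr_minus_bernoulli[OF qs, of "p / 2"] p by simp
      qed
      ultimately show ?thesis by linarith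
    qed
    also have "\<dots> = kinetic m w / 2 - Pw + s\<^sup>2 * (p / 2 * q) * Pw" by (simp add: algebra_simps)
    also have "\<dots> \<le> kinetic m w / 2 - Pw + s\<^sup>2 * (p / 2 * q) * (P + \<bar>c\<bar> / (p - 1) + C)"
      using PwB q0 p by (intro add_left_mono mult_left_mono) auto
    also have "\<dots> \<le> kinetic m w / 2 - (P + s * c / (p - 1) - C * s\<^sup>2) + s\<^sup>2 * (p / 2 * q) * (P + \<bar>c\<bar> / (p - 1) + C)"
    proof -
      have "P + t - r \<le> Pw" if "\<bar>Pw - P - t\<bar> \<le> r" for t r using that by linarith
      from this[OF pot] show ?thesis by (intro add_right_mono diff_left_mono)
    qed
    finally have Ile: "I \<le> (kinetic m u + 2 * s * a + s\<^sup>2 * kinetic m v) / 2 - (P + s * c / (p - 1) - C * s\<^sup>2) + s\<^sup>2 * (p / 2 * q) * (P + \<bar>c\<bar> / (p - 1) + C)"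
      unfolding kw .
    have Ieq: "I = kinetic m u / 2 - P" unfolding u(3)[symmetric] P_def by (rule energy_eq[OF m u(1) p])
    have "0 \<le> (2 * s * a + s\<^sup>2 * kinetic m v) / 2 - s * c / (p - 1) + C * s\<^sup>2 + s\<^sup>2 * (p / 2 * q) * (P + \<bar>c\<bar> / (p - 1) + C)"
    proof -
      have "0 \<le> (A + B) / 2 - t + r + W" if "I \<le> (k + A + B) / 2 - (P + t - r) + W" "I = k / 2 - P" for k A B t r W :: real
        using that by argo
      from this[OF Ile Ieq] show ?thesis .
    qed
    also have "\<dots> = s * (a - c / (p - 1)) + s\<^sup>2 * (kinetic m v / 2 + C + p / 2 * q * (P + \<bar>c\<bar> / (p - 1) + C))"
      by (simp add: algebra_simps add_divide_distrib)
    finally show ?thesis .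
  qed
  then have "a - c / (p - 1) = 0" by (rule linear_term_zero)
  then show ?thesis by (simp add: a_def c_def)
qed

text \<open>The Lagrange multiplier, found by testing the Euler--Lagrange equation with \<open>u\<close> itself.\<close>

definition multiplier :: "nat \<Rightarrow> real \<Rightarrow> (real \<Rightarrow> real) \<Rightarrow> real" where
  "multiplier m p u = (kinetic m u - potential p u / (p - 1)) / mass u"

text \<open>A general direction is its component along \<open>u\<close> plus a tangential one; the component along \<open>u\<close>
  contributes the multiplier.\<close>

lemma euler_lagrange:
  assumes m: "m \<ge> 1" and p: "2 < p" and mu: "\<mu> > 0" and low: "\<And>u. u \<in> sobolev m \<Longrightarrow> mass u = \<mu> \<Longrightarrow> I \<le> energy m p u"
    and u: "u \<in> sobolev m" "mass u = \<mu>" "energy m p u = I" and v: "v \<in> sobolev m"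
    and M: "\<And>x. \<bar>u x\<bar> \<le> M" "\<And>x. \<bar>v x\<bar> \<le> N"
  shows "kinetic_form m (fourier u) (fourier v) = (LINT x|lborel. (nonlin p (u x) / (p - 1) + multiplier m p u * u x) * v x)"
proof -
  define b where "b = (LINT x|lborel. u x * v x) / \<mu>"
  define w where "w x = v x + (- b) * u x" for x
  note us = sobolevD(2)[OF u(1)] and vs = sobolevD(2)[OF v]
  have ws: "w \<in> sobolev m" unfolding w_def[abs_def] by (rule sobolev_add(1)[OF v sobolev_cmult(1)[OF u(1)]])
  have iuv: "integrable lborel (\<lambda>x. u x * v x)" by (rule sqint_real_mult_integrable[OF us vs])
  have iuu: "integrable lborel (\<lambda>x. u x * u x)" by (rule sqint_real_mult_integrable[OF us us])
  have ns: "sqint (cplx (\<lambda>x. nonlin p (u x)))" by (rule nonlin_sqint[OF p us M(1)])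
  have inv: "integrable lborel (\<lambda>x. nonlin p (u x) * v x)" by (rule sqint_real_mult_integrable[OF ns vs])
  have inu: "integrable lborel (\<lambda>x. nonlin p (u x) * u x)" by (rule sqint_real_mult_integrable[OF ns us])
  have uu: "(LINT x|lborel. u x * u x) = \<mu>" using u(2) by (simp add: mass_def power2_eq_square)
  have "(LINT x|lborel. u x * w x) = (LINT x|lborel. u x * v x - b * (u x * u x))"
    unfolding w_def by (intro Bochner_Integration.integral_cong refl) (simp add: algebra_simps)
  also have "\<dots> = (LINT x|lborel. u x * v x) - b * \<mu>" using iuv iuu uu by simp
  finally have orth: "(LINT x|lborel. u x * w x) = 0" using mu by (simp add: b_def)
  define L where "L = M + N + \<bar>b\<bar> * M"
  have M0: "M \<ge> 0" "N \<ge> 0" using M(1)[of 0] M(2)[of 0] by auto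
  have bM: "0 \<le> \<bar>b\<bar> * M" using M0 by simp
  have uL: "\<bar>u x\<bar> \<le> L" for x using M(1)[of x] M0 bM unfolding L_def by linarith
  have wL: "\<bar>w x\<bar> \<le> L" for x
  proof -
    have "\<bar>w x\<bar> \<le> \<bar>v x\<bar> + \<bar>b\<bar> * \<bar>u x\<bar>" unfolding w_def using abs_triangle_ineq[of "v x" "(- b) * u x"] by (simp add: abs_mult)
    also have "\<dots> \<le> N + \<bar>b\<bar> * M" by (intro add_mono M mult_left_mono) auto
    finally show ?thesis using M0 by (simp add: L_def)
  qed
  have t: "kinetic_form m (fourier u) (fourier w) = (LINT x|lborel. nonlin p (u x) * w x) / (p - 1)"
    by (rule euler_lagrange_tangent[OF m p mu low u ws uL wL orth])
  have e: "\<bar>u x\<bar> powr p = nonlin p (u x) * u x" for x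
  proof (cases "u x = 0")
    case False
    have "\<bar>u x\<bar> powr p = \<bar>u x\<bar> powr ((p - 2) + 2)" by simp
    also have "\<dots> = \<bar>u x\<bar> powr (p - 2) * \<bar>u x\<bar> powr 2" by (rule powr_add)
    finally show ?thesis using False by (simp add: nonlin_def power2_eq_square)
  qed (use p in \<open>simp add: nonlin_def\<close>)
  have "(LINT x|lborel. nonlin p (u x) * w x) = (LINT x|lborel. nonlin p (u x) * v x - b * (nonlin p (u x) * u x))"
    unfolding w_def by (intro Bochner_Integration.integral_cong refl) (simp add: algebra_simps)
  also have "\<dots> = (LINT x|lborel. nonlin p (u x) * v x) - b * potential p u" using inv inu by (simp add: potential_def e)
  finally have rhs: "(LINT x|lborel. nonlin p (u x) * w x) = (LINT x|lborel. nonlin p (u x) * v x) - b * potential p u" .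
  \<comment> \<open>The transform of \<open>w\<close> is known only almost everywhere, so linearity of the form is derived
    through integrals.\<close>
  let ?U = "\<lambda>\<xi>. complex_of_real (\<xi> ^ m) * fourier u \<xi>" and ?V = "\<lambda>\<xi>. complex_of_real (\<xi> ^ m) * fourier v \<xi>"
  have ae: "AE \<xi> in lborel. fourier w \<xi> = fourier v \<xi> - complex_of_real b * fourier u \<xi>"
    using fourier_unique_AE[OF fourier_pair_add_real[OF sobolevD(3)[OF v] fourier_pair_cmult_real[OF sobolevD(3)[OF u(1)], of "- b"]]]
    by (simp add: w_def[abs_def])
  note [measurable] = sqintD[OF sobolevD(4)[OF u(1)]] sqintD[OF sobolevD(4)[OF v]] sqintD[OF sobolevD(4)[OF ws]]
  have "inner_L2 ?U (\<lambda>\<xi>. complex_of_real (\<xi> ^ m) * fourier w \<xi>) = inner_L2 ?U (\<lambda>\<xi>. ?V \<xi> - complex_of_real b * ?U \<xi>)"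
  proof -
    have ae2: "AE \<xi> in lborel. complex_of_real (\<xi> ^ m) * fourier w \<xi> = ?V \<xi> - complex_of_real b * ?U \<xi>"
      using ae by eventually_elim (simp only: right_diff_distrib mult_ac)
    show ?thesis by (rule inner_L2_cong_AE[OF _ _ _ _ _ ae2]) (simp_all, measurable)
  qed
  also have "\<dots> = inner_L2 ?U ?V - inner_L2 ?U (\<lambda>\<xi>. complex_of_real b * ?U \<xi>)"
    by (rule inner_L2_diff_right[OF sobolevD(5)[OF v] sqint_cmult[OF sobolevD(5)[OF u(1)]] sobolevD(5)[OF u(1)]])
  also have "inner_L2 ?U (\<lambda>\<xi>. complex_of_real b * ?U \<xi>) = (LINT \<xi>|lborel. complex_of_real b * (?U \<xi> * cnj (?U \<xi>)))"
    unfolding inner_L2_def by (intro Bochner_Integration.integral_cong refl) simp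
  also have "\<dots> = complex_of_real b * inner_L2 ?U ?U" unfolding inner_L2_def by (rule integral_mult_right_zero)
  also have "\<dots> = complex_of_real (b * kinetic m u)" unfolding inner_L2_self kinetic_def by simp
  finally have "kinetic_form m (fourier u) (fourier w) = kinetic_form m (fourier u) (fourier v) - b * kinetic m u"
    by (simp only: minus_complex.sel Re_complex_of_real)
  then have "kinetic_form m (fourier u) (fourier v) = (LINT x|lborel. nonlin p (u x) * v x) / (p - 1) + b * (kinetic m u - potential p u / (p - 1))"
    using t unfolding rhs by (simp add: diff_divide_distrib algebra_simps)
  also have "b * (kinetic m u - potential p u / (p - 1)) = multiplier m p u * (LINT x|lborel. u x * v x)"
    by (simp add: b_def multiplier_def u(2))
  also have "(LINT x|lborel. nonlin p (u x) * v x) / (p - 1) + multiplier m p u * (LINT x|lborel. u x * v x)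
    = (LINT x|lborel. (nonlin p (u x) * v x) / (p - 1) + multiplier m p u * (u x * v x))"
    using inv iuv by simp
  also have "\<dots> = (LINT x|lborel. (nonlin p (u x) / (p - 1) + multiplier m p u * u x) * v x)"
    by (simp add: distrib_right mult.assoc)
  finally show ?thesis .
qed

text \<open>The right-hand side \<open>f\<close> of the equation is square-integrable because \<open>u\<close> is bounded, so its
  transform \<open>F\<close> is too. Testing the equation with the function whose transform is the residual
  \<open>\<xi>^(2 * m) * U - F\<close>, truncated to \<open>[-R, R]\<close>, shows that the residual vanishes there. Hence
  \<open>\<xi>^(2 * m) * U = F\<close> is square-integrable.\<close>

lemma euler_lagrange_regularity:
  assumes m: "m \<ge> 1" and p: "2 < p" and mu: "\<mu> > 0" and low: "\<And>u. u \<in> sobolev m \<Longrightarrow> mass u = \<mu> \<Longrightarrow> I \<le> energy m p u"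
    and u: "u \<in> sobolev m" "mass u = \<mu>" "energy m p u = I" and M: "\<And>x. \<bar>u x\<bar> \<le> M"
  shows "u \<in> sobolev (2 * m)"
proof -
  define f where "f x = nonlin p (u x) / (p - 1) + multiplier m p u * u x" for x
  note us = sobolevD(2)[OF u(1)]
  have "sqint (\<lambda>x. complex_of_real (1 / (p - 1)) * cplx (\<lambda>x. nonlin p (u x)) x + complex_of_real (multiplier m p u) * cplx u x)"
    by (intro sqint_add sqint_cmult us nonlin_sqint[OF p us M])
  then have fs: "sqint (cplx f)" by (simp add: f_def)
  define F where "F = fourier f"
  define U where "U = fourier u"
  have fF: "fourier_pair (cplx f) F" unfolding F_def by (rule fourier_pair_fourier[OF fs])
  have uU: "fourier_pair (cplx u) U" unfolding U_def by (rule sobolevD(3)[OF u(1)])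
  note Fs = fourier_pairD(2)[OF fF] and Us = fourier_pairD(2)[OF uU]
  note [measurable] = sqintD[OF Fs] sqintD[OF Us]
  define W where "W \<xi> = complex_of_real (\<xi> ^ (2 * m)) * U \<xi> - F \<xi>" for \<xi>
  have [measurable]: "W \<in> borel_measurable borel" unfolding W_def by measurable
  have "AE \<xi> in lborel. indicat_real {- real R..real R} \<xi> *\<^sub>R W \<xi> = 0" for R :: nat
  proof -
    define V where "V \<xi> = complex_of_real (indicat_real {- real R..real R} \<xi>) * W \<xi>" for \<xi>
    have pw: "\<bar>\<xi>\<bar> ^ j \<le> real R ^ j" if "\<xi> \<in> {-real R..real R}" for \<xi> :: real and j
      using that by (intro power_mono) auto
    have s1: "sqint (\<lambda>\<xi>. complex_of_real (indicat_real {- real R..real R} \<xi> * \<xi> ^ (2 * m)) * U \<xi>)"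
    proof (rule sqint_mult_bounded[OF Us, of _ "real R ^ (2 * m)"])
      show "cmod (complex_of_real (indicat_real {- real R..real R} \<xi> * \<xi> ^ (2 * m))) \<le> real R ^ (2 * m)" for \<xi>
        using pw[of \<xi> "2 * m"] by (auto simp: norm_mult norm_power indicator_def)
    qed measurable
    have Vs: "sqint V"
    proof -
      have "V = (\<lambda>\<xi>. complex_of_real (indicat_real {- real R..real R} \<xi> * \<xi> ^ (2 * m)) * U \<xi> - complex_of_real (indicat_real {- real R..real R} \<xi>) * F \<xi>)"
        by (simp add: V_def W_def fun_eq_iff algebra_simps)
      then show ?thesis using sqint_diff[OF s1 sqint_trunc[OF Fs]] by simp
    qed
    have sV: "sqint (\<lambda>\<xi>. complex_of_real (\<xi> ^ m) * V \<xi>)"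
    proof (rule sqint_dominated[OF _ Vs, of _ "real R ^ m"])
      show "(\<lambda>\<xi>. complex_of_real (\<xi> ^ m) * V \<xi>) \<in> borel_measurable borel" using sqintD[OF Vs] by measurable
      show "cmod (complex_of_real (\<xi> ^ m) * V \<xi>) \<le> real R ^ m * cmod (V \<xi>)" for \<xi>
        using pw[of \<xi> m] by (auto simp: V_def norm_mult norm_power indicator_def intro!: mult_right_mono)
    qed
    obtain G where G: "fourier_pair G V" using fourier_pair_exists_inverse[OF Vs] by blast
    have "AE \<xi> in lborel. cnj (V (- \<xi>)) = V \<xi>"
      using fourier_pair_real_symmetric[OF fF] fourier_pair_real_symmetric[OF uU]
    proof eventually_elim
      case (elim \<xi>)
      have "indicat_real {- real R..real R} (- \<xi>) = indicat_real {- real R..real R} \<xi>" by (auto simp: indicator_def)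
      moreover have "(- \<xi>) ^ (2 * m) = \<xi> ^ (2 * m)" by (simp add: power_mult)
      ultimately show ?case
        using elim by (simp only: V_def W_def complex_cnj_mult complex_cnj_diff complex_cnj_complex_of_real)
    qed
    with fourier_pair_symmetric_real[OF G] obtain v0 where v0: "fourier_pair (cplx v0) V" by blast
    have v0s: "v0 \<in> sobolev m" by (rule sobolevI(1)[OF v0 sV])
    \<comment> \<open>The equation is available for bounded test functions; the continuous representative is one.\<close>
    define v where "v = continuous_rep v0"
    have v: "v \<in> sobolev m" unfolding v_def by (rule continuous_rep_sobolev(1)[OF m v0s])
    have vV: "fourier_pair (cplx v) V"
    proof (rule fourier_pair_cong_AE[OF v0])
      show "cplx v \<in> borel_measurable borel" by (rule sqintD[OF sobolevD(2)[OF v]])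
      show "AE x in lborel. cplx v0 x = cplx v x" using continuous_rep_AE_eq[OF m v0s] unfolding v_def by eventually_elim simp
    qed (use sqintD[OF Vs] in auto)
    note [measurable] = sqintD[OF Vs] sqintD[OF sobolevD(4)[OF v]]
    have "kinetic_form m U (fourier v) = (LINT x|lborel. f x * v x)"
      unfolding U_def f_def
      by (rule euler_lagrange[OF m p mu low u v M continuous_rep_bounded[OF m v0s, folded v_def]])
    also have "\<dots> = Re (inner_L2 (cplx f) (cplx v))" by (simp add: inner_L2_cplx)
    also have "inner_L2 (cplx f) (cplx v) = inner_L2 F V" by (rule fourier_pair_parseval[OF fF vV, symmetric])
    also have "inner_L2 (\<lambda>\<xi>. complex_of_real (\<xi> ^ m) * U \<xi>) (\<lambda>\<xi>. complex_of_real (\<xi> ^ m) * fourier v \<xi>)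
      = inner_L2 (\<lambda>\<xi>. complex_of_real (\<xi> ^ m) * U \<xi>) (\<lambda>\<xi>. complex_of_real (\<xi> ^ m) * V \<xi>)"
    proof -
      have ae2: "AE \<xi> in lborel. complex_of_real (\<xi> ^ m) * fourier v \<xi> = complex_of_real (\<xi> ^ m) * V \<xi>"
        using fourier_unique_AE[OF vV] by eventually_elim simp
      show ?thesis by (rule inner_L2_cong_AE[OF _ _ _ _ _ ae2]) (simp_all, measurable)
    qed
    also have "\<dots> = (LINT \<xi>|lborel. (complex_of_real (indicat_real {- real R..real R} \<xi> * \<xi> ^ (2 * m)) * U \<xi>) * cnj (V \<xi>))"
      unfolding inner_L2_def by (intro Bochner_Integration.integral_cong refl) (simp add: V_def indicator_def mult_2 power_add)
    also have "\<dots> = inner_L2 (\<lambda>\<xi>. complex_of_real (indicat_real {- real R..real R} \<xi> * \<xi> ^ (2 * m)) * U \<xi>) V" by (simp only: inner_L2_def)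
    finally have k: "Re (inner_L2 (\<lambda>\<xi>. complex_of_real (indicat_real {- real R..real R} \<xi> * \<xi> ^ (2 * m)) * U \<xi>) V) = Re (inner_L2 F V)" .
    have "inner_L2 V V = inner_L2 (\<lambda>\<xi>. complex_of_real (indicat_real {- real R..real R} \<xi> * \<xi> ^ (2 * m)) * U \<xi> - F \<xi>) V"
      unfolding inner_L2_def by (intro Bochner_Integration.integral_cong refl) (simp add: V_def W_def indicator_def)
    also have "\<dots> = inner_L2 (\<lambda>\<xi>. complex_of_real (indicat_real {- real R..real R} \<xi> * \<xi> ^ (2 * m)) * U \<xi>) V - inner_L2 F V"
      by (rule inner_L2_diff_left[OF s1 Fs Vs])
    finally have "Re (inner_L2 V V) = 0" using k by simp
    then have "nrm2 V = 0" by (simp add: inner_L2_self)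
    then have "AE \<xi> in lborel. V \<xi> = 0" using nrm2_eq_0_iff[OF Vs] by simp
    then show ?thesis by (simp add: V_def scaleR_conv_of_real)
  qed
  then have "AE \<xi> in lborel. \<forall>R::nat. indicat_real {- real R..real R} \<xi> *\<^sub>R W \<xi> = 0" by (subst AE_all_countable) blast
  then have "AE \<xi> in lborel. F \<xi> = complex_of_real (\<xi> ^ (2 * m)) * U \<xi>"
  proof eventually_elim
    case (elim \<xi>)
    obtain R :: nat where "\<bar>\<xi>\<bar> \<le> real R" using real_arch_simple by blast
    then have "W \<xi> = 0" using elim[rule_format, of R] by (simp add: indicator_def)
    then show ?case by (simp add: W_def)
  qed
  then have "sqint (\<lambda>\<xi>. complex_of_real (\<xi> ^ (2 * m)) * U \<xi>)" by (intro sqint_cong_AE[OF Fs]) measurable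
  then show ?thesis by (rule sobolevI(1)[OF uU])
qed

section \<open>The profile equation\<close>

lemma sobolev_one:
  assumes m: "m \<ge> 1" and u: "u \<in> sobolev m" shows "u \<in> sobolev 1"
proof -
  note U = sobolevD[OF u]
  note [measurable] = sqintD[OF U(4)]
  have "sqint (\<lambda>\<xi>. complex_of_real (\<bar>\<xi>\<bar> ^ m) * fourier u \<xi>)"
    by (rule sqint_dominated[OF _ U(5), of _ 1]) (auto simp: norm_mult norm_power)
  then have "sqint (\<lambda>\<xi>. fourier u \<xi> + complex_of_real (\<bar>\<xi>\<bar> ^ m) * fourier u \<xi>)" by (rule sqint_add[OF U(4)])
  then have "sqint (\<lambda>\<xi>. complex_of_real (\<xi> ^ 1) * fourier u \<xi>)"
  proof (rule sqint_dominated[of _ _ 1, rotated])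
    fix \<xi> :: real
    have le: "\<bar>\<xi>\<bar> \<le> 1 + \<bar>\<xi>\<bar> ^ m"
    proof (cases "\<bar>\<xi>\<bar> \<le> 1")
      case True
      have "\<bar>\<xi>\<bar> \<le> 1 + 0" using True by simp
      also have "\<dots> \<le> 1 + \<bar>\<xi>\<bar> ^ m" by (intro add_left_mono) simp
      finally show ?thesis .
    next
      case False
      then have "\<bar>\<xi>\<bar> \<le> \<bar>\<xi>\<bar> ^ m" using m by (intro self_le_power) auto
      then show ?thesis by (rule order_trans) simp
    qed
    have "fourier u \<xi> + complex_of_real (\<bar>\<xi>\<bar> ^ m) * fourier u \<xi> = complex_of_real (1 + \<bar>\<xi>\<bar> ^ m) * fourier u \<xi>"
      by (simp add: distrib_right)
    moreover have "\<bar>1 + \<bar>\<xi>\<bar> ^ m\<bar> = 1 + \<bar>\<xi>\<bar> ^ m" by (rule abs_of_nonneg) (intro add_nonneg_nonneg zero_le_power, auto)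
    ultimately have "cmod (fourier u \<xi> + complex_of_real (\<bar>\<xi>\<bar> ^ m) * fourier u \<xi>) = (1 + \<bar>\<xi>\<bar> ^ m) * cmod (fourier u \<xi>)"
      by (simp only: norm_mult norm_of_real)
    then show "cmod (complex_of_real (\<xi> ^ 1) * fourier u \<xi>) \<le> 1 * cmod (fourier u \<xi> + complex_of_real (\<bar>\<xi>\<bar> ^ m) * fourier u \<xi>)"
      using mult_right_mono[OF le, of "cmod (fourier u \<xi>)"] by (simp only: norm_mult norm_of_real power_one_right mult_1 norm_ge_zero simp_thms)
  qed measurable
  then show ?thesis using U(2) by (simp only: sobolev_iff)
qed

text \<open>The symbol of a difference quotient against that of the derivative: the second bound gives
  pointwise convergence, the first one a dominating function.\<close>

lemma exp_quotient_bounds: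
  fixes h \<xi> :: real assumes h: "h > 0"
  defines "D \<equiv> (exp (- (\<i> * complex_of_real (- h * \<xi>))) - 1) / complex_of_real h"
  shows "cmod (D - \<i> * complex_of_real \<xi>) \<le> 2 * \<bar>\<xi>\<bar>" "cmod (D - \<i> * complex_of_real \<xi>) \<le> h * \<xi>\<^sup>2 / 2"
proof -
  let ?x = "h * \<xi>"
  have e: "exp (- (\<i> * complex_of_real (- h * \<xi>))) = iexp ?x" by simp
  have 1: "cmod (iexp ?x - 1) \<le> \<bar>?x\<bar>" using iexp_approx1[of ?x 0] by simp
  have 2: "cmod (iexp ?x - (1 + \<i> * complex_of_real ?x)) \<le> \<bar>?x\<bar>\<^sup>2 / 2" using iexp_approx1[of ?x 1] by (simp add: numeral_2_eq_2)
  have "cmod D \<le> \<bar>\<xi>\<bar>" unfolding D_def e norm_divide using 1 h by (simp add: pos_divide_le_eq abs_mult mult.commute)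
  moreover have "cmod (D - \<i> * complex_of_real \<xi>) \<le> cmod D + cmod (\<i> * complex_of_real \<xi>)" by (rule norm_triangle_ineq4)
  ultimately show "cmod (D - \<i> * complex_of_real \<xi>) \<le> 2 * \<bar>\<xi>\<bar>" by (simp add: norm_mult)
  have "D - \<i> * complex_of_real \<xi> = (iexp ?x - (1 + \<i> * complex_of_real ?x)) / complex_of_real h"
    unfolding D_def e using h by (simp add: field_simps)
  then have "cmod (D - \<i> * complex_of_real \<xi>) = cmod (iexp ?x - (1 + \<i> * complex_of_real ?x)) / h"
    using h by (simp add: norm_divide)
  also have "\<dots> \<le> (\<bar>?x\<bar>\<^sup>2 / 2) / h" using 2 h by (intro divide_right_mono) auto
  also have "\<dots> = h * \<xi>\<^sup>2 / 2" using h by (simp add: power2_eq_square field_simps)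
  finally show "cmod (D - \<i> * complex_of_real \<xi>) \<le> h * \<xi>\<^sup>2 / 2" .
qed

text \<open>Difference quotients converge in \<open>L\<^sup>2\<close> to the weak derivative, by dominated convergence on the
  Fourier side.\<close>

lemma difference_quotient_tendsto:
  assumes u: "u \<in> sobolev 1" and g: "fourier_pair (cplx g) (\<lambda>\<xi>. (\<i> * complex_of_real \<xi>) * fourier u \<xi>)"
    and h: "h \<longlonglongrightarrow> (0::real)" "\<And>n. h n > 0"
  shows "(\<lambda>n. mass (\<lambda>x. (u (x + h n) - u x) / h n - g x)) \<longlonglongrightarrow> 0"
proof -
  note U = sobolevD[OF u]
  note [measurable] = sqintD[OF U(4)]
  define D where "D n \<xi> = (exp (- (\<i> * complex_of_real (- h n * \<xi>))) - 1) / complex_of_real (h n)" for n \<xi>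
  have [measurable]: "D n \<in> borel_measurable borel" for n unfolding D_def by measurable
  have pair: "fourier_pair (cplx (\<lambda>x. (u (x + h n) - u x) / h n - g x)) (\<lambda>\<xi>. (D n \<xi> - \<i> * complex_of_real \<xi>) * fourier u \<xi>)" for n
  proof -
    have "fourier_pair (\<lambda>x. complex_of_real (1 / h n) * (cplx u (x - (- h n)) - cplx u x) - cplx g x)
      (\<lambda>\<xi>. complex_of_real (1 / h n) * (exp (- (\<i> * complex_of_real (- h n * \<xi>))) * fourier u \<xi> - fourier u \<xi>) - (\<i> * complex_of_real \<xi>) * fourier u \<xi>)"
      by (intro fourier_pair_diff[OF fourier_pair_cmult[OF fourier_pair_diff[OF fourier_pair_shift[OF U(3)] U(3)]] g])
    moreover have "(\<lambda>x. complex_of_real (1 / h n) * (cplx u (x - (- h n)) - cplx u x) - cplx g x) = cplx (\<lambda>x. (u (x + h n) - u x) / h n - g x)"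
      by (simp add: fun_eq_iff)
    moreover have "complex_of_real (1 / h n) * (exp (- (\<i> * complex_of_real (- h n * \<xi>))) * fourier u \<xi> - fourier u \<xi>) - (\<i> * complex_of_real \<xi>) * fourier u \<xi>
       = (D n \<xi> - \<i> * complex_of_real \<xi>) * fourier u \<xi>" for \<xi>
      unfolding D_def by (simp add: diff_divide_distrib algebra_simps)
    ultimately show ?thesis by (simp only:)
  qed
  have "mass (\<lambda>x. (u (x + h n) - u x) / h n - g x) = nrm2 (\<lambda>\<xi>. (D n \<xi> - \<i> * complex_of_real \<xi>) * fourier u \<xi>)" for n
    using fourier_pair_nrm2[OF pair[of n]] unfolding nrm2_cplx by (rule sym)
  moreover have "(\<lambda>n. LINT \<xi>|lborel. (cmod ((D n \<xi> - \<i> * complex_of_real \<xi>) * fourier u \<xi>))\<^sup>2) \<longlonglongrightarrow> (LINT \<xi>::real|lborel. (0::real))"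
  proof (rule lborel_dominated_convergence[where w="\<lambda>\<xi>. 4 * (cmod (complex_of_real (\<xi> ^ 1) * fourier u \<xi>))\<^sup>2"])
    show "integrable lborel (\<lambda>\<xi>. 4 * (cmod (complex_of_real (\<xi> ^ 1) * fourier u \<xi>))\<^sup>2)"
      by (intro integrable_mult_right sqint_integrable U(5))
    fix \<xi> :: real
    have D0: "(\<lambda>n. D n \<xi> - \<i> * complex_of_real \<xi>) \<longlonglongrightarrow> 0"
    proof (rule Lim_null_comparison)
      show "\<forall>\<^sub>F n in sequentially. norm (D n \<xi> - \<i> * complex_of_real \<xi>) \<le> h n * \<xi>\<^sup>2 / 2"
        unfolding D_def by (intro always_eventually allI exp_quotient_bounds h)
      show "(\<lambda>n. h n * \<xi>\<^sup>2 / 2) \<longlonglongrightarrow> 0" using h(1) by (auto intro!: tendsto_eq_intros)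
    qed
    have "(\<lambda>n. (cmod ((D n \<xi> - \<i> * complex_of_real \<xi>) * fourier u \<xi>))\<^sup>2) \<longlonglongrightarrow> (cmod (0 * fourier u \<xi>))\<^sup>2"
      by (intro tendsto_intros D0)
    then show "(\<lambda>n. (cmod ((D n \<xi> - \<i> * complex_of_real \<xi>) * fourier u \<xi>))\<^sup>2) \<longlonglongrightarrow> 0" by simp
    fix n
    have "cmod (D n \<xi> - \<i> * complex_of_real \<xi>) \<le> 2 * \<bar>\<xi>\<bar>" unfolding D_def by (rule exp_quotient_bounds(1)[OF h(2)])
    then have "cmod ((D n \<xi> - \<i> * complex_of_real \<xi>) * fourier u \<xi>) \<le> 2 * \<bar>\<xi>\<bar> * cmod (fourier u \<xi>)"
      unfolding norm_mult by (rule mult_right_mono) simp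
    from power_mono[OF this, of 2]
    show "norm ((cmod ((D n \<xi> - \<i> * complex_of_real \<xi>) * fourier u \<xi>))\<^sup>2) \<le> 4 * (cmod (complex_of_real (\<xi> ^ 1) * fourier u \<xi>))\<^sup>2"
      by (simp add: power_mult_distrib norm_mult)
  qed measurable
  ultimately show ?thesis by (simp only: nrm2_def) simp
qed

lemma test_function_difference_quotient:
  assumes t: "test_function \<phi>" and f: "f \<in> borel_measurable borel" and b: "\<And>x. \<bar>f x\<bar> \<le> B"
    and h: "h \<longlonglongrightarrow> (0::real)" "\<And>n. h n > 0" "\<And>n. h n \<le> 1"
  shows "(\<lambda>n. LINT x|lborel. f x * ((\<phi> (x - h n) - \<phi> x) / h n)) \<longlonglongrightarrow> - (LINT x|lborel. f x * deriv \<phi> x)"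
proof -
  note [measurable] = f test_function_measurable[OF t] test_function_measurable[OF test_function_deriv[OF t]]
  obtain R where R: "\<And>x. \<bar>x\<bar> > R \<Longrightarrow> \<phi> x = 0" using test_function_support[OF t] by blast
  obtain M R' where M: "M \<ge> 0" "\<And>x. \<bar>deriv \<phi> x\<bar> \<le> M * indicat_real {-R'..R'} x" using test_function_bounded[OF test_function_deriv[OF t]] by blast
  have Mb: "\<bar>deriv \<phi> x\<bar> \<le> M" for x using M(2)[of x] M(1) by (cases "x \<in> {-R'..R'}") simp_all
  have D: "(\<phi> has_field_derivative deriv \<phi> x) (at x)" for x by (rule smooth_has_derivative[OF test_function_smooth[OF t]])
  have lip: "\<bar>\<phi> y - \<phi> x\<bar> \<le> M * \<bar>y - x\<bar>" for x y
    using field_differentiable_bound[of UNIV \<phi> "deriv \<phi>" M y x] D Mb by simp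
  have B0: "B \<ge> 0" using b[of 0] by linarith
  have "(\<lambda>n. LINT x|lborel. f x * ((\<phi> (x - h n) - \<phi> x) / h n)) \<longlonglongrightarrow> (LINT x|lborel. f x * (- deriv \<phi> x))"
  proof (rule lborel_dominated_convergence[where w="\<lambda>x. B * M * indicat_real {-(R + 1)..R + 1} x"])
    show "integrable lborel (\<lambda>x. B * M * indicat_real {-(R + 1)..R + 1} x)" by (intro integrable_mult_right integrable_indicator_Icc)
    fix x
    have "((\<lambda>k. (\<phi> (x + k) - \<phi> x) / k) \<longlongrightarrow> deriv \<phi> x) (at 0)" using D[of x] by (simp add: DERIV_def)
    moreover have "filterlim (\<lambda>n. - h n) (at 0) sequentially"
      using tendsto_minus[OF h(1)] h(2) by (intro filterlim_atI) (auto simp: less_imp_neq[symmetric])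
    ultimately have "(\<lambda>n. (\<phi> (x + - h n) - \<phi> x) / (- h n)) \<longlonglongrightarrow> deriv \<phi> x" by (rule filterlim_compose)
    then have "(\<lambda>n. - ((\<phi> (x + - h n) - \<phi> x) / (- h n))) \<longlonglongrightarrow> - deriv \<phi> x" by (rule tendsto_minus)
    then show "(\<lambda>n. f x * ((\<phi> (x - h n) - \<phi> x) / h n)) \<longlonglongrightarrow> f x * (- deriv \<phi> x)"
      by (intro tendsto_mult_left) simp
    fix n
    have q: "\<bar>(\<phi> (x - h n) - \<phi> x) / h n\<bar> \<le> M * indicat_real {-(R + 1)..R + 1} x"
    proof (cases "x \<in> {-(R + 1)..R + 1}")
      case True
      have "\<bar>\<phi> (x - h n) - \<phi> x\<bar> \<le> M * h n" using lip[of "x - h n" x] h(2)[of n] by simp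
      then show ?thesis using True h(2)[of n] by (simp add: abs_divide pos_divide_le_eq)
    next
      case False
      then have "\<bar>x\<bar> > R" "\<bar>x - h n\<bar> > R" using h(2)[of n] h(3)[of n] by auto
      then show ?thesis using R M(1) by simp
    qed
    have "\<bar>f x\<bar> * \<bar>(\<phi> (x - h n) - \<phi> x) / h n\<bar> \<le> B * (M * indicat_real {-(R + 1)..R + 1} x)"
      by (rule mult_mono[OF b q B0]) simp
    then show "norm (f x * ((\<phi> (x - h n) - \<phi> x) / h n)) \<le> B * M * indicat_real {-(R + 1)..R + 1} x"
      by (simp only: real_norm_def abs_mult mult.assoc)
  qed measurable
  then show ?thesis by simp
qed

text \<open>The quotients of \<open>nonlin p \<circ> u\<close> factor as \<open>A n * q n\<close>, where \<open>q n\<close> is the quotient of \<open>u\<close> and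
  \<open>A n\<close> a slope of \<open>nonlin p\<close>. The slopes are bounded and converge pointwise by continuity of \<open>u\<close>,
  while \<open>q n\<close> converges in \<open>L\<^sup>2\<close>; together this identifies the limit without mollifying \<open>u\<close>.\<close>

lemma nonlin_chain_rule:
  assumes p: "2 < p" and u: "u \<in> sobolev 1" and c: "continuous_on UNIV u" and M: "\<And>x. \<bar>u x\<bar> \<le> M"
    and t: "test_function \<phi>"
  shows "(LINT x|lborel. \<bar>u x\<bar> powr (p - 2) * weak_deriv 1 u x * \<phi> x) = - (LINT x|lborel. nonlin p (u x) / (p - 1) * deriv \<phi> x)"
proof -
  obtain g where g: "fourier_pair (cplx g) (\<lambda>\<xi>. (\<i> * complex_of_real \<xi>) ^ 1 * fourier u \<xi>)" and ae: "AE x in lborel. weak_deriv 1 u x = g x"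
    and li: "locally_integrable (weak_deriv 1 u)" using weak_deriv_sobolev[OF u] by blast
  have gs: "sqint (cplx g)" by (rule fourier_pairD(1)[OF g])
  have us: "sqint (cplx u)" by (rule sobolevD(2)[OF u])
  have ps: "sqint (cplx \<phi>)" by (rule test_function_sqint[OF t])
  have [measurable]: "g \<in> borel_measurable borel" "u \<in> borel_measurable borel" "\<phi> \<in> borel_measurable borel" "weak_deriv 1 u \<in> borel_measurable borel"
    using gs us ps li by (auto simp: sqint_cplx_iff locally_integrable_def)
  have M0: "M \<ge> 0" using M[of 0] by linarith
  define h where "h n = 1 / real (Suc n)" for n
  have h: "h \<longlonglongrightarrow> 0" "\<And>n. h n > 0" "\<And>n. h n \<le> 1"
    unfolding h_def using LIMSEQ_inverse_real_of_nat by (simp_all add: inverse_eq_divide)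
  define C where "C = (p - 1) * M powr (p - 2)"
  have C0: "C \<ge> 0" using p by (simp add: C_def)
  define F' where "F' y = (p - 1) * \<bar>y\<bar> powr (p - 2)" for y
  define q where "q n x = (u (x + h n) - u x) / h n" for n x
  \<comment> \<open>Filled in with the derivative where \<open>u\<close> takes the same value twice, so that \<open>A n * q n\<close> is the
    quotient of the composition everywhere.\<close>
  define A where "A n x = (if u (x + h n) = u x then F' (u x) else (nonlin p (u (x + h n)) - nonlin p (u x)) / (u (x + h n) - u x))" for n x
  have [measurable]: "A n \<in> borel_measurable borel" "q n \<in> borel_measurable borel" for n unfolding A_def q_def F'_def by measurable
  have Fb: "\<bar>F' (u x)\<bar> \<le> C" for x
    using M[of x] p unfolding F'_def C_def by (simp add: abs_mult powr_mono2)
  have Ab: "\<bar>A n x\<bar> \<le> C" for n x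
  proof (cases "u (x + h n) = u x")
    case True then show ?thesis using Fb by (simp add: A_def)
  next
    case False
    have "\<bar>nonlin p (u (x + h n)) - nonlin p (u x)\<bar> \<le> C * \<bar>u (x + h n) - u x\<bar>"
      unfolding C_def by (rule nonlin_lipschitz[OF p M M])
    then show ?thesis using False by (simp add: A_def abs_divide pos_divide_le_eq)
  qed
  have Aq: "A n x * q n x = (nonlin p (u (x + h n)) - nonlin p (u x)) / h n" for n x
    by (cases "u (x + h n) = u x") (simp_all add: A_def q_def)
  have Alim: "(\<lambda>n. A n x) \<longlonglongrightarrow> F' (u x)" for x
  proof -
    \<comment> \<open>Caratheodory's form of differentiability: the slopes are values of one function that is
      continuous at \<open>u x\<close>.\<close>
    obtain k where k: "\<And>z. nonlin p z - nonlin p (u x) = k z * (z - u x)" "isCont k (u x)" "k (u x) = F' (u x)"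
      using nonlin_has_derivative[OF p, of "u x"] unfolding CARAT_DERIV F'_def by blast
    have "A n x = k (u (x + h n))" for n
      using k(1)[of "u (x + h n)"] k(3) by (auto simp: A_def)
    moreover have "(\<lambda>n. k (u (x + h n))) \<longlonglongrightarrow> k (u x)"
    proof (rule isCont_tendsto_compose[OF k(2)])
      have "isCont u (x + 0)" using c by (simp add: continuous_on_eq_continuous_at)
      then have "(\<lambda>n. u (x + h n)) \<longlonglongrightarrow> u (x + 0)" by (rule isCont_tendsto_compose) (intro tendsto_intros h)
      then show "(\<lambda>n. u (x + h n)) \<longlonglongrightarrow> u x" by simp
    qed
    ultimately show ?thesis by (simp add: k(3))
  qed
  have nu: "sqint (cplx (\<lambda>x. nonlin p (u x)))" by (rule nonlin_sqint[OF p us M])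
  have nb: "\<bar>nonlin p (u x)\<bar> \<le> M powr (p - 2) * M" for x
    unfolding nonlin_def abs_mult using M[of x] p by (intro mult_mono) (auto simp: powr_mono2)
  \<comment> \<open>The discrete integration by parts that shifts the quotient from the test function to the
    composition.\<close>
  have lhs: "(LINT x|lborel. nonlin p (u x) * ((\<phi> (x - h n) - \<phi> x) / h n)) = (LINT x|lborel. A n x * q n x * \<phi> x)" for n
  proof -
    have s1: "sqint (cplx (\<lambda>x. \<phi> (x - h n)))" using sqint_shift[OF ps, of "- h n"] by simp
    have s2: "sqint (cplx (\<lambda>x. nonlin p (u (x + h n))))" using sqint_shift[OF nu, of "h n"] by simp
    have i1: "integrable lborel (\<lambda>x. nonlin p (u x) * \<phi> (x - h n))" by (rule sqint_real_mult_integrable[OF nu s1])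
    have i2: "integrable lborel (\<lambda>x. nonlin p (u x) * \<phi> x)" by (rule sqint_real_mult_integrable[OF nu ps])
    have i3: "integrable lborel (\<lambda>x. nonlin p (u (x + h n)) * \<phi> x)" by (rule sqint_real_mult_integrable[OF s2 ps])
    have sh: "(LINT x|lborel. nonlin p (u x) * \<phi> (x - h n)) = (LINT x|lborel. nonlin p (u (x + h n)) * \<phi> x)"
      using integral_shift[of "\<lambda>x. nonlin p (u (x + h n)) * \<phi> x" "h n"] by simp
    have "(LINT x|lborel. nonlin p (u x) * ((\<phi> (x - h n) - \<phi> x) / h n)) = (LINT x|lborel. (nonlin p (u x) * \<phi> (x - h n) - nonlin p (u x) * \<phi> x) / h n)"
      by (simp only: right_diff_distrib times_divide_eq_right)
    also have "\<dots> = (LINT x|lborel. nonlin p (u x) * \<phi> (x - h n) - nonlin p (u x) * \<phi> x) / h n" by (rule integral_divide_zero)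
    also have "(LINT x|lborel. nonlin p (u x) * \<phi> (x - h n) - nonlin p (u x) * \<phi> x) = (LINT x|lborel. nonlin p (u (x + h n)) * \<phi> x) - (LINT x|lborel. nonlin p (u x) * \<phi> x)"
      unfolding sh[symmetric] by (rule Bochner_Integration.integral_diff[OF i1 i2])
    also have "\<dots> = (LINT x|lborel. nonlin p (u (x + h n)) * \<phi> x - nonlin p (u x) * \<phi> x)"
      by (rule Bochner_Integration.integral_diff[OF i3 i2, symmetric])
    also have "\<dots> / h n = (LINT x|lborel. (nonlin p (u (x + h n)) * \<phi> x - nonlin p (u x) * \<phi> x) / h n)" by (rule integral_divide_zero[symmetric])
    also have "\<dots> = (LINT x|lborel. A n x * q n x * \<phi> x)" unfolding Aq by (simp only: left_diff_distrib times_divide_eq_left)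
    finally show ?thesis .
  qed
  have L: "(\<lambda>n. LINT x|lborel. A n x * q n x * \<phi> x) \<longlonglongrightarrow> - (LINT x|lborel. nonlin p (u x) * deriv \<phi> x)"
  proof -
    have fm: "(\<lambda>x. nonlin p (u x)) \<in> borel_measurable borel" by measurable
    from test_function_difference_quotient[OF t fm nb h] show ?thesis unfolding lhs .
  qed
  have qs: "sqint (cplx (q n))" for n
  proof -
    have "sqint (\<lambda>x. complex_of_real (1 / h n) * (cplx u (x + h n) - cplx u x))" by (intro sqint_cmult sqint_diff sqint_shift us)
    then show ?thesis by (simp add: q_def)
  qed
  have qg: "(\<lambda>n. sqrt (mass (\<lambda>x. q n x - g x))) \<longlonglongrightarrow> 0"
    using tendsto_real_sqrt[OF difference_quotient_tendsto[OF u _ h(1,2)]] g unfolding q_def by simp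
  have dqs: "sqint (cplx (\<lambda>x. q n x - g x))" for n using sqint_diff[OF qs gs] by simp
  have Aps: "sqint (cplx (\<lambda>x. A n x * \<phi> x))" for n
  proof (rule sqint_dominated[OF _ ps, of _ C])
    show "cmod (cplx (\<lambda>x. A n x * \<phi> x) x) \<le> C * cmod (cplx \<phi> x)" for x
      using Ab[of n x] by (simp add: norm_mult mult_right_mono)
  qed measurable
  have gp: "integrable lborel (\<lambda>x. g x * \<phi> x)" by (rule sqint_real_mult_integrable[OF gs ps])
  have t1: "(\<lambda>n. LINT x|lborel. (A n x * \<phi> x) * (q n x - g x)) \<longlonglongrightarrow> 0"
  proof (rule Lim_null_comparison)
    have "\<bar>LINT x|lborel. (A n x * \<phi> x) * (q n x - g x)\<bar> \<le> C * sqrt (mass \<phi>) * sqrt (mass (\<lambda>x. q n x - g x))" for n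
    proof -
      have "\<bar>LINT x|lborel. (A n x * \<phi> x) * (q n x - g x)\<bar> \<le> (LINT x|lborel. \<bar>(A n x * \<phi> x) * (q n x - g x)\<bar>)" by (rule integral_abs_bound)
      also have "\<dots> \<le> sqrt (mass (\<lambda>x. A n x * \<phi> x)) * sqrt (mass (\<lambda>x. q n x - g x))"
        unfolding mass_def by (rule cauchy_schwarz_real(2)) (use Aps[of n, unfolded sqint_cplx_iff] dqs[of n, unfolded sqint_cplx_iff] in auto)
      also have "\<dots> \<le> C * sqrt (mass \<phi>) * sqrt (mass (\<lambda>x. q n x - g x))"
      proof (rule mult_right_mono)
        have "mass (\<lambda>x. A n x * \<phi> x) \<le> mass (\<lambda>x. C * \<phi> x)"
          unfolding mass_def
        proof (rule integral_mono)
          show "integrable lborel (\<lambda>x. (A n x * \<phi> x)\<^sup>2)" by (rule conjunct2[OF iffD1[OF sqint_cplx_iff Aps]])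
          show "integrable lborel (\<lambda>x. (C * \<phi> x)\<^sup>2)" using ps by (simp add: sqint_cplx_iff power_mult_distrib)
          show "(A n x * \<phi> x)\<^sup>2 \<le> (C * \<phi> x)\<^sup>2" for x
            unfolding power_mult_distrib using Ab[of n x] C0 by (intro mult_right_mono) (auto simp: abs_le_square_iff[symmetric])
        qed
        then have "sqrt (mass (\<lambda>x. A n x * \<phi> x)) \<le> sqrt (C\<^sup>2 * mass \<phi>)" unfolding mass_cmult by (rule real_sqrt_le_mono)
        then show "sqrt (mass (\<lambda>x. A n x * \<phi> x)) \<le> C * sqrt (mass \<phi>)" using C0 by (simp add: real_sqrt_mult)
      qed simp
      finally show ?thesis .
    qed
    then show "\<forall>\<^sub>F n in sequentially. norm (LINT x|lborel. (A n x * \<phi> x) * (q n x - g x)) \<le> C * sqrt (mass \<phi>) * sqrt (mass (\<lambda>x. q n x - g x))" by simp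
    show "(\<lambda>n. C * sqrt (mass \<phi>) * sqrt (mass (\<lambda>x. q n x - g x))) \<longlonglongrightarrow> 0" by (intro tendsto_mult_right_zero qg)
  qed
  have t2: "(\<lambda>n. LINT x|lborel. A n x * (g x * \<phi> x)) \<longlonglongrightarrow> (LINT x|lborel. F' (u x) * (g x * \<phi> x))"
  proof (rule lborel_dominated_convergence[where w="\<lambda>x. C * \<bar>g x * \<phi> x\<bar>"])
    show "(\<lambda>n. A n x * (g x * \<phi> x)) \<longlonglongrightarrow> F' (u x) * (g x * \<phi> x)" for x by (intro tendsto_mult_right Alim)
    show "norm (A n x * (g x * \<phi> x)) \<le> C * \<bar>g x * \<phi> x\<bar>" for n x
      unfolding real_norm_def abs_mult[of "A n x"] by (rule mult_right_mono[OF Ab]) simp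
    show "integrable lborel (\<lambda>x. C * \<bar>g x * \<phi> x\<bar>)" by (intro integrable_mult_right integrable_abs gp)
    show "(\<lambda>x. F' (u x) * (g x * \<phi> x)) \<in> borel_measurable borel" unfolding F'_def by measurable
  qed measurable
  have split: "(LINT x|lborel. A n x * q n x * \<phi> x) = (LINT x|lborel. (A n x * \<phi> x) * (q n x - g x)) + (LINT x|lborel. A n x * (g x * \<phi> x))" for n
  proof -
    have j1: "integrable lborel (\<lambda>x. (A n x * \<phi> x) * (q n x - g x))" by (rule sqint_real_mult_integrable[OF Aps dqs])
    have "integrable lborel (\<lambda>x. (A n x * \<phi> x) * g x)" by (rule sqint_real_mult_integrable[OF Aps gs])
    then have j2: "integrable lborel (\<lambda>x. A n x * (g x * \<phi> x))" by (simp only: mult_ac)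
    have "(LINT x|lborel. A n x * q n x * \<phi> x) = (LINT x|lborel. (A n x * \<phi> x) * (q n x - g x) + A n x * (g x * \<phi> x))"
      by (intro Bochner_Integration.integral_cong refl) (simp add: algebra_simps)
    then show ?thesis using Bochner_Integration.integral_add[OF j1 j2] by (simp only:)
  qed
  have "(\<lambda>n. LINT x|lborel. A n x * q n x * \<phi> x) \<longlonglongrightarrow> 0 + (LINT x|lborel. F' (u x) * (g x * \<phi> x))"
    unfolding split by (rule tendsto_add[OF t1 t2])
  from LIMSEQ_unique[OF this L]
  have main: "(LINT x|lborel. F' (u x) * (g x * \<phi> x)) = - (LINT x|lborel. nonlin p (u x) * deriv \<phi> x)" by simp
  have "(LINT x|lborel. \<bar>u x\<bar> powr (p - 2) * weak_deriv 1 u x * \<phi> x) = (LINT x|lborel. (1 / (p - 1)) * (F' (u x) * (g x * \<phi> x)))"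
  proof (rule integral_cong_AE)
    show "AE x in lborel. \<bar>u x\<bar> powr (p - 2) * weak_deriv 1 u x * \<phi> x = (1 / (p - 1)) * (F' (u x) * (g x * \<phi> x))"
      using ae by eventually_elim (use p in \<open>simp add: F'_def\<close>)
    show "(\<lambda>x. (1 / (p - 1)) * (F' (u x) * (g x * \<phi> x))) \<in> borel_measurable lborel" unfolding F'_def by measurable
  qed measurable
  also have "\<dots> = (1 / (p - 1)) * (LINT x|lborel. F' (u x) * (g x * \<phi> x))" by (rule integral_mult_right_zero)
  also have "\<dots> = - ((1 / (p - 1)) * (LINT x|lborel. nonlin p (u x) * deriv \<phi> x))" unfolding main by simp
  also have "(1 / (p - 1)) * (LINT x|lborel. nonlin p (u x) * deriv \<phi> x) = (LINT x|lborel. (1 / (p - 1)) * (nonlin p (u x) * deriv \<phi> x))"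
    by (rule integral_mult_right_zero[symmetric])
  finally show ?thesis by simp
qed

text \<open>Half of the derivatives are moved to \<open>u\<close>, on the Fourier side; the sign comes from the square
  of \<open>\<i> \<xi>\<close>.\<close>

lemma kinetic_form_test_function:
  assumes u: "u \<in> sobolev m" and t: "test_function \<psi>"
  shows "(LINT x|lborel. u x * (deriv ^^ (2 * m)) \<psi> x) = (-1) ^ m * kinetic_form m (fourier u) (fourier \<psi>)"
proof -
  note [measurable] = sqintD[OF sobolevD(4)[OF u]] sqintD[OF fourier_pairD(2)[OF fourier_pair_test_function[OF t]]]
    sqintD[OF sobolevD(4)[OF test_function_sobolev[OF t, of m]]]
  let ?P = "fourier_int (cplx \<psi>)"
  have "complex_of_real (LINT x|lborel. u x * (deriv ^^ (2 * m)) \<psi> x) = inner_L2 (cplx u) (cplx ((deriv ^^ (2 * m)) \<psi>))" by (simp only: inner_L2_cplx)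
  also have "\<dots> = inner_L2 (fourier u) (\<lambda>\<xi>. (\<i> * complex_of_real \<xi>) ^ (2 * m) * ?P \<xi>)"
    by (rule fourier_pair_parseval[OF sobolevD(3)[OF u] fourier_pair_test_function_deriv[OF t], symmetric])
  also have "\<dots> = (LINT \<xi>|lborel. (-1) ^ m * ((complex_of_real (\<xi> ^ m) * fourier u \<xi>) * cnj (complex_of_real (\<xi> ^ m) * ?P \<xi>)))"
  proof -
    have e: "(\<i> * complex_of_real \<xi>) ^ (2 * m) = (-1) ^ m * complex_of_real (\<xi> ^ m) * complex_of_real (\<xi> ^ m)" for \<xi>
    proof -
      have "(\<i> * complex_of_real \<xi>) ^ (2 * m) = ((\<i> * complex_of_real \<xi>)\<^sup>2) ^ m" by (rule power_mult)
      also have "(\<i> * complex_of_real \<xi>)\<^sup>2 = (-1) * (complex_of_real \<xi> * complex_of_real \<xi>)" by (simp add: complex_eq_iff power2_eq_square)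
      finally show ?thesis by (simp only: power_mult_distrib of_real_power mult.assoc)
    qed
    have c1: "cnj ((-1) ^ m) = (-1) ^ m" by simp
    show ?thesis unfolding inner_L2_def e
      by (simp only: complex_cnj_mult complex_cnj_complex_of_real c1 mult_ac)
  qed
  also have "\<dots> = (-1) ^ m * inner_L2 (\<lambda>\<xi>. complex_of_real (\<xi> ^ m) * fourier u \<xi>) (\<lambda>\<xi>. complex_of_real (\<xi> ^ m) * ?P \<xi>)"
    unfolding inner_L2_def by (rule integral_mult_right_zero)
  also have "inner_L2 (\<lambda>\<xi>. complex_of_real (\<xi> ^ m) * fourier u \<xi>) (\<lambda>\<xi>. complex_of_real (\<xi> ^ m) * ?P \<xi>)
    = inner_L2 (\<lambda>\<xi>. complex_of_real (\<xi> ^ m) * fourier u \<xi>) (\<lambda>\<xi>. complex_of_real (\<xi> ^ m) * fourier \<psi> \<xi>)"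
  proof -
    have ae: "AE \<xi> in lborel. complex_of_real (\<xi> ^ m) * ?P \<xi> = complex_of_real (\<xi> ^ m) * fourier \<psi> \<xi>"
      using fourier_unique_AE[OF fourier_pair_test_function[OF t]] by eventually_elim simp
    show ?thesis by (rule inner_L2_cong_AE[OF _ _ _ _ _ ae]) (simp_all, measurable)
  qed
  finally have "complex_of_real (LINT x|lborel. u x * (deriv ^^ (2 * m)) \<psi> x) = complex_of_real ((-1) ^ m) * inner_L2 (\<lambda>\<xi>. complex_of_real (\<xi> ^ m) * fourier u \<xi>) (\<lambda>\<xi>. complex_of_real (\<xi> ^ m) * fourier \<psi> \<xi>)"
    by simp
  then have "Re (complex_of_real (LINT x|lborel. u x * (deriv ^^ (2 * m)) \<psi> x)) = (-1) ^ m * kinetic_form m (fourier u) (fourier \<psi>)"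
    by (simp only: Re_complex_of_real Im_complex_of_real times_complex.sel mult_zero_left diff_zero)
  then show ?thesis by (simp only: Re_complex_of_real)
qed

text \<open>The profile equation is the derivative of the Euler--Lagrange equation: the latter is tested
  with \<open>deriv \<phi>\<close>, and the chain rule moves the derivative from the test function to the
  nonlinearity.\<close>

theorem minimizer_travelling_profile:
  assumes m: "m \<ge> 1" and p: "2 < p" and mu: "\<mu> > 0" and low: "\<And>u. u \<in> sobolev m \<Longrightarrow> mass u = \<mu> \<Longrightarrow> I \<le> energy m p u"
    and u: "u \<in> sobolev m" "mass u = \<mu>" "energy m p u = I" and M: "\<And>x. \<bar>u x\<bar> \<le> M" and c: "continuous_on UNIV u"
  shows "weak_travelling_profile m p (multiplier m p u) u"
  unfolding weak_travelling_profile_def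
proof (intro allI impI)
  fix \<phi> assume t: "test_function \<phi>"
  let ?\<psi> = "deriv \<phi>"
  let ?l = "multiplier m p u"
  have tp: "test_function ?\<psi>" by (rule test_function_deriv[OF t])
  obtain N R where N: "N \<ge> 0" "\<And>x. \<bar>?\<psi> x\<bar> \<le> N * indicat_real {-R..R} x" using test_function_bounded[OF tp] by blast
  have Nb: "\<bar>?\<psi> x\<bar> \<le> N" for x using N(2)[of x] N(1) by (cases "x \<in> {-R..R}") simp_all
  have us: "sqint (cplx u)" and ps: "sqint (cplx ?\<psi>)" using sobolevD(2)[OF u(1)] test_function_sqint[OF tp] by auto
  have i1: "integrable lborel (\<lambda>x. nonlin p (u x) / (p - 1) * ?\<psi> x)"
    using sqint_real_mult_integrable[OF nonlin_sqint[OF p us M] ps] by simp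
  have i2: "integrable lborel (\<lambda>x. ?l * (u x * ?\<psi> x))" by (intro integrable_mult_right sqint_real_mult_integrable us ps)
  have "kinetic_form m (fourier u) (fourier ?\<psi>) = (LINT x|lborel. (nonlin p (u x) / (p - 1) + ?l * u x) * ?\<psi> x)"
    by (rule euler_lagrange[OF m p mu low u test_function_sobolev[OF tp] M Nb])
  also have "\<dots> = (LINT x|lborel. nonlin p (u x) / (p - 1) * ?\<psi> x + ?l * (u x * ?\<psi> x))" by (simp only: distrib_right mult.assoc)
  also have "\<dots> = (LINT x|lborel. nonlin p (u x) / (p - 1) * ?\<psi> x) + (LINT x|lborel. ?l * (u x * ?\<psi> x))"
    by (rule Bochner_Integration.integral_add[OF i1 i2])
  also have "(LINT x|lborel. ?l * (u x * ?\<psi> x)) = ?l * (LINT x|lborel. u x * ?\<psi> x)" by (rule integral_mult_right_zero)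
  finally have el: "kinetic_form m (fourier u) (fourier ?\<psi>) = (LINT x|lborel. nonlin p (u x) / (p - 1) * ?\<psi> x) + ?l * (LINT x|lborel. u x * ?\<psi> x)" .
  have cr: "(LINT x|lborel. \<bar>u x\<bar> powr (p - 2) * weak_deriv 1 u x * \<phi> x) = - (LINT x|lborel. nonlin p (u x) / (p - 1) * ?\<psi> x)"
    by (rule nonlin_chain_rule[OF p sobolev_one[OF m u(1)] c M t])
  have "(deriv ^^ (2 * m + 1)) \<phi> = (deriv ^^ (2 * m)) ?\<psi>" by (simp add: funpow_swap1)
  then have "distr_deriv (2 * m + 1) u \<phi> = - (LINT x|lborel. u x * (deriv ^^ (2 * m)) ?\<psi> x)" by (simp add: distr_deriv_def)
  also have "\<dots> = - ((-1) ^ m * kinetic_form m (fourier u) (fourier ?\<psi>))" unfolding kinetic_form_test_function[OF u(1) tp] ..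
  finally have "(-1) ^ m * distr_deriv (2 * m + 1) u \<phi> = - (((-1) ^ m * (-1) ^ m) * kinetic_form m (fourier u) (fourier ?\<psi>))" by (simp only: mult_minus_right mult.assoc)
  also have "(-1) ^ m * (-1) ^ m = (1::real)" by (simp flip: power_mult_distrib)
  finally have d1: "(-1) ^ m * distr_deriv (2 * m + 1) u \<phi> = - kinetic_form m (fourier u) (fourier ?\<psi>)" by simp
  have d2: "distr_deriv 1 u \<phi> = - (LINT x|lborel. u x * ?\<psi> x)" by (simp add: distr_deriv_def)
  show "(-1) ^ m * distr_deriv (2 * m + 1) u \<phi> - (LINT x|lborel. \<bar>u x\<bar> powr (p - 2) * weak_deriv 1 u x * \<phi> x) = ?l * distr_deriv 1 u \<phi>"
    unfolding d1 d2 cr el by simp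
qed

section \<open>Travelling waves in space-time\<close>

definition box_supported :: "real \<Rightarrow> (real \<Rightarrow> real \<Rightarrow> real) \<Rightarrow> bool" where
  "box_supported R \<phi> \<longleftrightarrow> (\<forall>t x. \<bar>t\<bar> > R \<or> \<bar>x\<bar> > R \<longrightarrow> \<phi> t x = 0)"

lemma box_supportedD: "box_supported R \<phi> \<Longrightarrow> \<bar>t\<bar> > R \<or> \<bar>x\<bar> > R \<Longrightarrow> \<phi> t x = 0"
  by (auto simp: box_supported_def)

lemma box_supported_dt:
  assumes b: "box_supported R \<phi>" shows "box_supported R (dt \<phi>)"
  unfolding box_supported_def
proof (intro allI impI)
  fix t x assume "\<bar>t\<bar> > R \<or> \<bar>x\<bar> > R"
  then show "dt \<phi> t x = 0"
  proof
    assume t: "\<bar>t\<bar> > R"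
    show ?thesis unfolding dt_def by (rule deriv_zero_outside[OF _ t]) (use b in \<open>simp add: box_supported_def\<close>)
  next
    assume "\<bar>x\<bar> > R"
    then have "(\<lambda>s. \<phi> s x) = (\<lambda>s. 0)" using b by (simp add: box_supported_def fun_eq_iff)
    then show ?thesis by (simp add: dt_def)
  qed
qed

lemma box_supported_dx:
  assumes b: "box_supported R \<phi>" shows "box_supported R (dx \<phi>)"
  unfolding box_supported_def
proof (intro allI impI)
  fix t x assume "\<bar>t\<bar> > R \<or> \<bar>x\<bar> > R"
  then show "dx \<phi> t x = 0"
  proof
    assume x: "\<bar>x\<bar> > R"
    show ?thesis unfolding dx_def by (rule deriv_zero_outside[OF _ x]) (use b in \<open>simp add: box_supported_def\<close>)
  next
    assume "\<bar>t\<bar> > R"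
    then have "\<phi> t = (\<lambda>s. 0)" using b by (simp add: box_supported_def fun_eq_iff)
    then show ?thesis by (simp add: dx_def)
  qed
qed

lemma box_supported_dx_power: "box_supported R \<phi> \<Longrightarrow> box_supported R ((dx ^^ k) \<phi>)"
  by (induction k) (auto intro: box_supported_dx)

lemma spacetime_support:
  assumes "spacetime_test_function I \<phi>" obtains R where "R > 0" "box_supported R \<phi>"
proof -
  obtain K where K: "compact K" "\<And>t x. (t, x) \<notin> K \<Longrightarrow> \<phi> t x = 0" using assms by (auto simp: spacetime_test_function_def)
  obtain R where R: "\<And>q. q \<in> K \<Longrightarrow> norm q \<le> R" using compact_imp_bounded[OF K(1)] by (auto simp: bounded_iff)
  have "box_supported (\<bar>R\<bar> + 1) \<phi>"
    unfolding box_supported_def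
  proof (intro allI impI)
    fix t x assume a: "\<bar>t\<bar> > \<bar>R\<bar> + 1 \<or> \<bar>x\<bar> > \<bar>R\<bar> + 1"
    have "(t, x) \<notin> K"
    proof
      assume "(t, x) \<in> K"
      then have "norm (t, x) \<le> R" by (rule R)
      moreover have "\<bar>t\<bar> \<le> norm (t, x)" "\<bar>x\<bar> \<le> norm (t, x)" by (simp_all add: norm_Pair)
      ultimately show False using a by linarith
    qed
    then show "\<phi> t x = 0" by (rule K(2))
  qed
  then show thesis by (rule that[rotated]) simp
qed

text \<open>Differentiability in both variables jointly gives the derivative along the characteristic
  \<open>y + a * s\<close>.\<close>

lemma joint_derivative:
  assumes d: "(\<lambda>(t, x). \<psi> t x) differentiable_on UNIV"
  shows "(\<psi> t has_field_derivative dx \<psi> t x) (at x)"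
    "((\<lambda>s. \<psi> s (y + a * s)) has_field_derivative (dt \<psi> s (y + a * s) + a * dx \<psi> s (y + a * s))) (at s)"
proof -
  have line: "((\<lambda>r. \<psi> (t0 + b * r) (x0 + c * r)) has_field_derivative D (b, c)) (at r0)"
    if D: "((\<lambda>(t, x). \<psi> t x) has_derivative D) (at (t0 + b * r0, x0 + c * r0))" for D t0 x0 b c r0
  proof -
    have "((\<lambda>r. (t0 + b * r, x0 + c * r)) has_derivative (\<lambda>h. (b * h, c * h))) (at r0)"
      by (auto intro!: derivative_eq_intros)
    from diff_chain_at[OF this D]
    have "((\<lambda>r. \<psi> (t0 + b * r) (x0 + c * r)) has_derivative (\<lambda>h. D (b * h, c * h))) (at r0)" by (simp add: comp_def)
    moreover have "D (b * h, c * h) = D (b, c) * h" for h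
    proof -
      have "linear D" using has_derivative_linear[OF D] .
      from linear_scale[OF this, of h "(b, c)"] show ?thesis by (simp add: mult.commute)
    qed
    ultimately show ?thesis by (simp add: has_field_derivative_def)
  qed
  have ex: "\<exists>D. ((\<lambda>(t, x). \<psi> t x) has_derivative D) (at q)" for q
    using d[unfolded differentiable_on_def differentiable_def, rule_format, of q] by simp
  have x: "(\<psi> t has_field_derivative D (0, 1)) (at x)" if D: "((\<lambda>(t, x). \<psi> t x) has_derivative D) (at (t, x))" for D t x
  proof -
    have "((\<lambda>r. \<psi> (t + 0 * r) (0 + 1 * r)) has_field_derivative D (0, 1)) (at x)" by (rule line) (use D in simp)
    then show ?thesis by simp
  qed
  show "(\<psi> t has_field_derivative dx \<psi> t x) (at x)"
  proof -
    obtain D where D: "((\<lambda>(t, x). \<psi> t x) has_derivative D) (at (t, x))" using ex by blast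
    have "dx \<psi> t x = D (0, 1)" unfolding dx_def by (rule DERIV_imp_deriv[OF x[OF D]])
    then show ?thesis using x[OF D] by simp
  qed
  obtain D where D: "((\<lambda>(t, x). \<psi> t x) has_derivative D) (at (s, y + a * s))" using ex by blast
  have "((\<lambda>r. \<psi> (0 + 1 * r) (y + a * r)) has_field_derivative D (1, a)) (at s)" by (rule line) (use D in simp)
  moreover have "dt \<psi> s (y + a * s) = D (1, 0)"
  proof -
    have "((\<lambda>r. \<psi> (0 + 1 * r) ((y + a * s) + 0 * r)) has_field_derivative D (1, 0)) (at s)" by (rule line) (use D in simp)
    then show ?thesis unfolding dt_def by (intro DERIV_imp_deriv) simp
  qed
  moreover have "dx \<psi> s (y + a * s) = D (0, 1)" unfolding dx_def by (rule DERIV_imp_deriv[OF x[OF D]])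
  moreover have "D (1, a) = D (1, 0) + a * D (0, 1)"
  proof -
    have l: "linear D" using has_derivative_linear[OF D] .
    have "(1, a) = (1, 0) + a *\<^sub>R (0, 1::real)" by simp
    then show ?thesis using linear_add[OF l, of "(1, 0)" "a *\<^sub>R (0, 1)"] linear_scale[OF l, of a "(0, 1)"] by simp
  qed
  ultimately show "((\<lambda>s. \<psi> s (y + a * s)) has_field_derivative (dt \<psi> s (y + a * s) + a * dx \<psi> s (y + a * s))) (at s)" by simp
qed

lemma spacetime_differentiable:
  assumes "spacetime_test_function I \<phi>"
  shows "(\<lambda>(t, x). (dx ^^ k) \<phi> t x) differentiable_on UNIV" "(\<lambda>(t, x). dt \<phi> t x) differentiable_on UNIV"
proof -
  have d: "(\<lambda>(t, x). (dt ^^ i) ((dx ^^ j) \<phi>) t x) differentiable_on UNIV" for i j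
    using assms by (simp add: spacetime_test_function_def)
  show "(\<lambda>(t, x). (dx ^^ k) \<phi> t x) differentiable_on UNIV" using d[of 0 k] by simp
  show "(\<lambda>(t, x). dt \<phi> t x) differentiable_on UNIV" using d[of 1 0] by simp
qed

lemma deriv_slice: "(deriv ^^ k) (\<phi> t) = (dx ^^ k) \<phi> t"
  by (induction k) (simp_all add: dx_def)

lemma test_function_slice:
  assumes s: "spacetime_test_function I \<phi>" shows "test_function (\<phi> t)"
proof -
  obtain R where R: "R > 0" "box_supported R \<phi>" using spacetime_support[OF s] by blast
  have "smooth (\<phi> t)"
    unfolding smooth_def deriv_slice field_differentiable_def
    using joint_derivative(1)[OF spacetime_differentiable(1)[OF s]] by blast
  then show ?thesis by (rule test_functionI[of _ R]) (use R(2) in \<open>simp add: box_supported_def\<close>)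
qed

lemma integrable_bounded_box:
  fixes f :: "real \<times> real \<Rightarrow> real"
  assumes [measurable]: "f \<in> borel_measurable (borel \<Otimes>\<^sub>M borel)" and b: "\<And>t x. \<bar>f (t, x)\<bar> \<le> C"
    and z: "\<And>t x. \<bar>t\<bar> > S \<or> \<bar>x\<bar> > S \<Longrightarrow> f (t, x) = 0"
  shows "integrable (lborel \<Otimes>\<^sub>M lborel) f"
proof -
  have i: "integrable (lborel \<Otimes>\<^sub>M lborel) (\<lambda>(t, x). (C * indicat_real {-S..S} t) * indicat_real {-S..S} x)"
  proof (rule lborel_pair.Fubini_integrable)
    show "integrable lborel (\<lambda>t. LINT x|lborel. norm (case (t, x) of (t, x) \<Rightarrow> C * indicat_real {-S..S} t * indicat_real {-S..S} x))"
    proof -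
      have "integrable lborel (\<lambda>t. \<bar>C\<bar> * indicat_real {-S..S} t * (LINT x|lborel. indicat_real {-S..S} x))"
        by (intro integrable_mult_left integrable_mult_right integrable_indicator_Icc)
      moreover have "(LINT x|lborel. norm (case (t, x) of (t, x) \<Rightarrow> C * indicat_real {-S..S} t * indicat_real {-S..S} x))
        = \<bar>C\<bar> * indicat_real {-S..S} t * (LINT x|lborel. indicat_real {-S..S} x)" for t
        by (simp add: abs_mult)
      ultimately show ?thesis by (simp only:)
    qed
    show "AE t in lborel. integrable lborel (\<lambda>x. case (t, x) of (t, x) \<Rightarrow> C * indicat_real {-S..S} t * indicat_real {-S..S} x)"
      by (intro AE_I2) (simp add: integrable_indicator_Icc)
  qed measurable
  then show ?thesis
  proof (rule Bochner_Integration.integrable_bound)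
    have "norm (f (t, x)) \<le> norm (C * indicat_real {-S..S} t * indicat_real {-S..S} x)" for t x
    proof (cases "\<bar>t\<bar> > S \<or> \<bar>x\<bar> > S")
      case True then show ?thesis using z by simp
    next
      case False
      then have "t \<in> {-S..S}" "x \<in> {-S..S}" by auto
      then show ?thesis using b[of t x] by simp
    qed
    then show "AE q in lborel \<Otimes>\<^sub>M lborel. norm (f q) \<le> norm (case q of (t, x) \<Rightarrow> C * indicat_real {-S..S} t * indicat_real {-S..S} x)"
      by (intro AE_I2) (auto split: prod.split)
  qed measurable
qed

lemma box_continuous_bounded:
  assumes c: "continuous_on UNIV (\<lambda>(t, x). \<psi> t x)" and b: "box_supported R \<psi>"
  obtains B where "B \<ge> 0" "\<And>t x. \<bar>\<psi> t x\<bar> \<le> (B::real)"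
proof -
  have "compact ((\<lambda>(t, x). \<psi> t x) ` ({-R..R} \<times> {-R..R}))"
    by (intro compact_continuous_image continuous_on_subset[OF c] compact_Times compact_Icc) auto
  from compact_imp_bounded[OF this] obtain B where B': "\<forall>y \<in> (\<lambda>(t, x). \<psi> t x) ` ({-R..R} \<times> {-R..R}). norm y \<le> B"
    unfolding bounded_iff by blast
  have B: "\<bar>\<psi> t x\<bar> \<le> B" if "t \<in> {-R..R}" "x \<in> {-R..R}" for t x
  proof -
    have "\<psi> t x \<in> (\<lambda>(t, x). \<psi> t x) ` ({-R..R} \<times> {-R..R})" using that by (intro image_eqI[of _ _ "(t, x)"]) auto
    then show ?thesis using B' by auto
  qed
  have "\<bar>\<psi> t x\<bar> \<le> \<bar>B\<bar>" for t x
  proof (cases "\<bar>t\<bar> > R \<or> \<bar>x\<bar> > R")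
    case True then show ?thesis using box_supportedD[OF b] by simp
  next
    case False
    then have "\<bar>\<psi> t x\<bar> \<le> B" by (intro B) auto
    then show ?thesis by linarith
  qed
  then show thesis by (intro that[of "\<bar>B\<bar>"]) auto
qed

text \<open>In the second integrand, in coordinates that move with the wave, the support is sheared; the
  larger box of half-width \<open>\<bar>R\<bar> + \<bar>a\<bar> * \<bar>R\<bar>\<close> contains it.\<close>

lemma integrable_moving_frame:
  assumes c: "continuous_on UNIV (\<lambda>(t, x). \<psi> t x)" and b: "box_supported R \<psi>"
    and u: "u \<in> borel_measurable borel" and M: "\<And>x. \<bar>u x\<bar> \<le> M"
  shows "integrable (lborel \<Otimes>\<^sub>M lborel) (\<lambda>(t, x). u (x - a * t) * \<psi> t x)"
    "integrable (lborel \<Otimes>\<^sub>M lborel) (\<lambda>(t, x). u x * \<psi> t (x + a * t))"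
proof -
  obtain B where B: "B \<ge> 0" "\<And>t x. \<bar>\<psi> t x\<bar> \<le> B" using box_continuous_bounded[OF c b] by blast
  have M0: "M \<ge> 0" using M[of 0] by linarith
  note [measurable] = u
  have "(\<lambda>q. (case q of (t, x) \<Rightarrow> \<psi> t x)) \<in> borel_measurable borel" by (rule borel_measurable_continuous_onI[OF c])
  then have psi: "(\<lambda>(t, x). \<psi> t x) \<in> borel_measurable (borel \<Otimes>\<^sub>M borel)" by (simp add: borel_prod)
  have meas2: "(\<lambda>(t, x). \<psi> t (x + a * t)) \<in> borel_measurable (borel \<Otimes>\<^sub>M borel)"
  proof -
    have "(\<lambda>q::real \<times> real. (fst q, snd q + a * fst q)) \<in> borel \<Otimes>\<^sub>M borel \<rightarrow>\<^sub>M borel \<Otimes>\<^sub>M borel" by measurable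
    from measurable_compose[OF this psi] show ?thesis by (simp add: case_prod_beta)
  qed
  have bb: "\<bar>u x * \<psi> s y\<bar> \<le> M * B" for x s y
    unfolding abs_mult using M B M0 by (intro mult_mono) auto
  show "integrable (lborel \<Otimes>\<^sub>M lborel) (\<lambda>(t, x). u (x - a * t) * \<psi> t x)"
  proof (rule integrable_bounded_box[where C="M * B" and S=R])
    have "(\<lambda>q::real \<times> real. u (snd q - a * fst q) * (case q of (t, x) \<Rightarrow> \<psi> t x)) \<in> borel_measurable (borel \<Otimes>\<^sub>M borel)"
      using psi by measurable
    then show "(\<lambda>(t, x). u (x - a * t) * \<psi> t x) \<in> borel_measurable (borel \<Otimes>\<^sub>M borel)" by (simp add: case_prod_beta)
    show "\<bar>case (t, x) of (t, x) \<Rightarrow> u (x - a * t) * \<psi> t x\<bar> \<le> M * B" for t x using bb by simp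
    show "(case (t, x) of (t, x) \<Rightarrow> u (x - a * t) * \<psi> t x) = 0" if "\<bar>t\<bar> > R \<or> \<bar>x\<bar> > R" for t x
      using box_supportedD[OF b that] by simp
  qed
  show "integrable (lborel \<Otimes>\<^sub>M lborel) (\<lambda>(t, x). u x * \<psi> t (x + a * t))"
  proof (rule integrable_bounded_box[where C="M * B" and S="\<bar>R\<bar> + \<bar>a\<bar> * \<bar>R\<bar>"])
    have "(\<lambda>q::real \<times> real. u (snd q) * (case q of (t, x) \<Rightarrow> \<psi> t (x + a * t))) \<in> borel_measurable (borel \<Otimes>\<^sub>M borel)"
      using meas2 by measurable
    then show "(\<lambda>(t, x). u x * \<psi> t (x + a * t)) \<in> borel_measurable (borel \<Otimes>\<^sub>M borel)" by (simp add: case_prod_beta)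
    show "\<bar>case (t, x) of (t, x) \<Rightarrow> u x * \<psi> t (x + a * t)\<bar> \<le> M * B" for t x using bb by simp
    show "(case (t, x) of (t, x) \<Rightarrow> u x * \<psi> t (x + a * t)) = 0" if o: "\<bar>t\<bar> > \<bar>R\<bar> + \<bar>a\<bar> * \<bar>R\<bar> \<or> \<bar>x\<bar> > \<bar>R\<bar> + \<bar>a\<bar> * \<bar>R\<bar>" for t x
    proof -
      have "\<bar>t\<bar> > R \<or> \<bar>x + a * t\<bar> > R"
      proof (rule ccontr)
        assume n: "\<not> (\<bar>t\<bar> > R \<or> \<bar>x + a * t\<bar> > R)"
        then have t: "\<bar>t\<bar> \<le> \<bar>R\<bar>" and x: "\<bar>x + a * t\<bar> \<le> \<bar>R\<bar>" by auto
        have "\<bar>a * t\<bar> \<le> \<bar>a\<bar> * \<bar>R\<bar>" unfolding abs_mult by (rule mult_left_mono[OF t]) simp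
        moreover have "0 \<le> \<bar>a\<bar> * \<bar>R\<bar>" by simp
        ultimately have "\<bar>t\<bar> \<le> \<bar>R\<bar> + \<bar>a\<bar> * \<bar>R\<bar>" "\<bar>x\<bar> \<le> \<bar>R\<bar> + \<bar>a\<bar> * \<bar>R\<bar>" using t x by linarith+
        then show False using o by linarith
      qed
      then show ?thesis using box_supportedD[OF b] by simp
    qed
  qed
qed

text \<open>At each time the profile equation expresses the nonlinear term through the dispersive term and
  \<open>l\<close> times the space derivative of the test function. What is left is the integral of \<open>u\<close> against
  the derivative of \<open>\<phi>\<close> along the characteristics \<open>x + l * t\<close>, and for fixed \<open>x\<close> this derivative
  integrates to zero over all times.\<close>

theorem travelling_wave_evolution:
  assumes prof: "\<And>a. weak_travelling_profile m p l (\<lambda>x. u (x - a))"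
    and u [measurable]: "u \<in> borel_measurable borel" and M: "\<And>x. \<bar>u x\<bar> \<le> M"
  shows "weak_evolution m p UNIV (\<lambda>t x. u (x - l * t))"
  unfolding weak_evolution_def
proof (intro allI impI)
  fix \<phi> assume s: "spacetime_test_function UNIV \<phi>"
  obtain R where R: "R > 0" "box_supported R \<phi>" using spacetime_support[OF s] by blast
  have ts: "test_function (\<phi> t)" for t by (rule test_function_slice[OF s])
  have cx: "continuous_on UNIV (\<lambda>(t, x). (dx ^^ k) \<phi> t x)" for k
    by (rule differentiable_imp_continuous_on[OF spacetime_differentiable(1)[OF s]])
  have ct: "continuous_on UNIV (\<lambda>(t, x). dt \<phi> t x)"
    by (rule differentiable_imp_continuous_on[OF spacetime_differentiable(2)[OF s]])
  have cx1: "continuous_on UNIV (\<lambda>(t, x). dx \<phi> t x)" using cx[of 1] by simp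
  define A where "A t = (LINT x|lborel. u (x - l * t) * dt \<phi> t x)" for t
  define E where "E t = (LINT x|lborel. u (x - l * t) * dx \<phi> t x)" for t
  define H where "H t = (LINT x|lborel. u (x - l * t) * (dx ^^ (2 * m + 1)) \<phi> t x)" for t
  define B where "B t = distr_deriv (2 * m + 1) (\<lambda>x. u (x - l * t)) (\<phi> t)" for t
  define C where "C t = (LINT x|lborel. \<bar>u (x - l * t)\<bar> powr (p - 2) * weak_deriv 1 (\<lambda>x. u (x - l * t)) x * \<phi> t x)" for t
  note ipA = integrable_moving_frame[OF ct box_supported_dt[OF R(2)] u M, of l]
  note ipE = integrable_moving_frame[OF cx1 box_supported_dx[OF R(2)] u M, of l]
  note ipH = integrable_moving_frame[OF cx[of "2 * m + 1"] box_supported_dx_power[OF R(2), of "2 * m + 1"] u M, of l]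
  have iA: "integrable lborel A" using lborel_pair.integrable_fst'[OF ipA(1)] by (simp add: A_def[abs_def])
  have iE: "integrable lborel E" using lborel_pair.integrable_fst'[OF ipE(1)] by (simp add: E_def[abs_def])
  have iH: "integrable lborel H" using lborel_pair.integrable_fst'[OF ipH(1)] by (simp add: H_def[abs_def])
  have BH: "B t = - H t" for t unfolding B_def H_def distr_deriv_def deriv_slice by simp
  have iB: "integrable lborel B" unfolding BH[abs_def] using iH by simp
  have CB: "C t = (-1) ^ m * B t + l * E t" for t
  proof -
    have "(-1) ^ m * B t - C t = l * distr_deriv 1 (\<lambda>x. u (x - l * t)) (\<phi> t)"
      unfolding B_def C_def using prof[of "l * t"] ts[of t] unfolding weak_travelling_profile_def by blast
    also have "distr_deriv 1 (\<lambda>x. u (x - l * t)) (\<phi> t) = - E t"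
      unfolding distr_deriv_def deriv_slice E_def by simp
    finally show ?thesis by simp
  qed
  have iC: "(LINT t|lborel. C t) = (-1) ^ m * (LINT t|lborel. B t) + l * (LINT t|lborel. E t)"
    unfolding CB using iB iE by simp
  \<comment> \<open>The shift \<open>x \<mapsto> x + l * t\<close> freezes the wave, and Fubini allows the time integral to be taken
    first.\<close>
  have AE0: "(LINT t|lborel. A t) + l * (LINT t|lborel. E t) = 0"
  proof -
    define \<psi> where "\<psi> t x = dt \<phi> t x + l * dx \<phi> t x" for t x
    have cpsi: "continuous_on UNIV (\<lambda>(t, x). \<psi> t x)"
      using continuous_on_add[OF ct continuous_on_mult_left[OF cx1, of l]] by (simp add: \<psi>_def case_prod_beta)
    have bpsi: "box_supported R \<psi>"
      using box_supported_dt[OF R(2)] box_supported_dx[OF R(2)] by (simp add: box_supported_def \<psi>_def)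
    have slice: "continuous_on UNIV (f t)" if "continuous_on UNIV (\<lambda>(t, x). f t x)" for f :: "real \<Rightarrow> real \<Rightarrow> real" and t
      using continuous_on_compose2[OF that, of UNIV "\<lambda>x. (t, x)"] by (simp add: continuous_on_Pair)
    have si: "integrable lborel (\<lambda>x. u (x - l * t) * f t x)"
      if cf: "continuous_on UNIV (\<lambda>(t, x). f t x)" and bf: "box_supported R f" for f t
    proof -
      have "integrable lborel (f t)" by (rule continuous_compact_integrable[OF slice[OF cf], of R]) (use bf in \<open>simp add: box_supported_def\<close>)
      then have "integrable lborel (\<lambda>x. M * f t x)" by simp
      then show ?thesis
      proof (rule Bochner_Integration.integrable_bound)
        have "norm (u y * f t x) \<le> norm (M * f t x)" for x y
          using M[of y] by (simp add: abs_mult mult_right_mono)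
        then show "AE x in lborel. norm (u (x - l * t) * f t x) \<le> norm (M * f t x)" by simp
        show "(\<lambda>x. u (x - l * t) * f t x) \<in> borel_measurable lborel"
          using borel_measurable_continuous_onI[OF slice[OF cf], of t] by measurable
      qed
    qed
    have "(LINT t|lborel. A t) + l * (LINT t|lborel. E t) = (LINT t|lborel. A t + l * E t)" using iA iE by simp
    also have "\<dots> = (LINT t|lborel. LINT x|lborel. u x * \<psi> t (x + l * t))"
    proof (rule Bochner_Integration.integral_cong[OF refl])
      fix t
      have i1: "integrable lborel (\<lambda>x. u (x - l * t) * dt \<phi> t x)" by (rule si[OF ct box_supported_dt[OF R(2)]])
      have i2: "integrable lborel (\<lambda>x. u (x - l * t) * dx \<phi> t x)" by (rule si[OF cx1 box_supported_dx[OF R(2)]])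
      have "A t + l * E t = (LINT x|lborel. u (x - l * t) * dt \<phi> t x + l * (u (x - l * t) * dx \<phi> t x))"
        unfolding A_def E_def using i1 i2 by simp
      also have "\<dots> = (LINT x|lborel. u (x - l * t) * \<psi> t x)"
        by (intro Bochner_Integration.integral_cong refl) (simp add: \<psi>_def algebra_simps)
      also have "\<dots> = (LINT x|lborel. u x * \<psi> t (x + l * t))"
        using integral_shift[of "\<lambda>x. u x * \<psi> t (x + l * t)" "l * t"] by simp
      finally show "A t + l * E t = (LINT x|lborel. u x * \<psi> t (x + l * t))" .
    qed
    also have "\<dots> = (LINT x|lborel. LINT t|lborel. u x * \<psi> t (x + l * t))"
      using lborel_pair.Fubini_integral[OF integrable_moving_frame(2)[OF cpsi bpsi u M, of l]] by simp
    also have "\<dots> = (LINT x::real|lborel. 0)"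
    proof (rule Bochner_Integration.integral_cong[OF refl])
      fix x
      have "(LINT t|lborel. \<psi> t (x + l * t)) = 0"
      proof (rule integral_derivative_compact[where F="\<lambda>t. \<phi> t (x + l * t)" and R=R])
        show "((\<lambda>t. \<phi> t (x + l * t)) has_vector_derivative \<psi> t (x + l * t)) (at t)" for t
          using joint_derivative(2)[OF spacetime_differentiable(1)[OF s, of 0], of x l t]
          by (simp add: \<psi>_def has_real_derivative_iff_has_vector_derivative)
        show "continuous_on UNIV (\<lambda>t. \<psi> t (x + l * t))"
          using continuous_on_compose2[OF cpsi, of UNIV "\<lambda>t. (t, x + l * t)"] by (simp add: continuous_on_Pair continuous_intros)
      qed (use R(2) bpsi in \<open>auto simp: box_supported_def\<close>)
      then show "(LINT t|lborel. u x * \<psi> t (x + l * t)) = 0" by (simp only: integral_mult_right_zero mult_zero_right)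
    qed
    finally show ?thesis by simp
  qed
  have "- (LINT t|lborel. A t) + (-1) ^ m * (LINT t|lborel. B t) - (LINT t|lborel. C t) = 0"
    unfolding iC using AE0 by simp
  then show "- (LINT t|lborel. LINT x|lborel. u (x - l * t) * dt \<phi> t x)
     + (-1) ^ m * (LINT t|lborel. distr_deriv (2 * m + 1) (\<lambda>x. u (x - l * t)) (\<phi> t))
     - (LINT t|lborel. LINT x|lborel. \<bar>u (x - l * t)\<bar> powr (p - 2) * weak_deriv 1 (\<lambda>x. u (x - l * t)) x * \<phi> t x)
     = 0"
    unfolding A_def B_def C_def .
qed

section \<open>Orbital stability and solitons\<close>

text \<open>Below the life span some time interval is good in the sense of the definition. The flow is a
  choice among all solutions, which need not be the conserving one; uniqueness makes them agree
  almost everywhere, and mass and energy do not see the difference.\<close>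

lemma flow_conserves:
  assumes m: "m \<ge> 1" and p: "2 < p" and T: "is_life_span m p T" and u0: "u0 \<in> sobolev m" and t: "0 \<le> t" "ereal t < T u0"
  shows "flow m p t u0 \<in> sobolev m" "energy m p (flow m p t u0) = energy m p u0" "mass (flow m p t u0) = mass u0"
proof -
  have "ereal t < Sup {ereal \<tau> |\<tau>. 0 \<le> \<tau> \<and> good_time m p T u0 \<tau>}"
    using t(2) T u0 by (simp add: is_life_span_def)
  then obtain \<tau> where tau: "good_time m p T u0 \<tau>" "t < \<tau>"
    unfolding less_Sup_iff by auto
  obtain u where sol: "cauchy_solution m p u0 \<tau> u"
    and uniq: "\<And>\<sigma> v s. cauchy_solution m p u0 \<sigma> v \<Longrightarrow> 0 \<le> s \<Longrightarrow> s < \<tau> \<Longrightarrow> s < \<sigma> \<Longrightarrow> AE x in lborel. v s x = u s x"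
    and cons: "\<And>s. s \<in> {0..<\<tau>} \<Longrightarrow> energy m p (u s) = energy m p u0 \<and> charge (u s) = charge u0"
    using tau(1) unfolding good_time_def by blast
  have "\<exists>\<tau> w. t < \<tau> \<and> cauchy_solution m p u0 \<tau> w \<and> flow m p t u0 = w t"
    unfolding flow_def by (rule someI[where P="\<lambda>v. \<exists>\<tau> w. t < \<tau> \<and> cauchy_solution m p u0 \<tau> w \<and> v = w t" and x="u t"]) (use sol tau(2) in blast)
  then obtain \<sigma> w where w: "t < \<sigma>" "cauchy_solution m p u0 \<sigma> w" "flow m p t u0 = w t" by blast
  have ts: "t \<in> {0..<\<tau>}" "t \<in> {0..<\<sigma>}" using t tau w by auto
  have us: "u t \<in> sobolev m" and ws: "w t \<in> sobolev m"
    using sol w(2) ts unfolding cauchy_solution_def by blast+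
  have ae: "AE x in lborel. u t x = w t x"
    using uniq[OF w(2) t(1) tau(2) w(1)] by eventually_elim simp
  note eq = sobolev_cong_AE[OF us sobolevD(1)[OF ws] ae]
  show "flow m p t u0 \<in> sobolev m" unfolding w(3) by (rule ws)
  have "energy m p (w t) = energy m p (u t)" unfolding energy_eq[OF m us p] energy_eq[OF m ws p] eq(2) eq(4) ..
  then show "energy m p (flow m p t u0) = energy m p u0" using cons[OF ts(1)] by (simp add: w(3))
  show "mass (flow m p t u0) = mass u0" using cons[OF ts(1)] eq(3) by (simp add: w(3) charge_eq_mass)
qed

lemma sobolev_setdist_le: "v \<in> \<Gamma> \<Longrightarrow> sobolev_setdist m u \<Gamma> \<le> sobolev_dist m u v"
  unfolding sobolev_setdist_def by (rule cINF_lower) (auto intro: bdd_belowI2[of _ 0])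

lemma sobolev_setdist_less: "\<Gamma> \<noteq> {} \<Longrightarrow> sobolev_setdist m u \<Gamma> < c \<Longrightarrow> \<exists>v\<in>\<Gamma>. sobolev_dist m u v < c"
proof -
  assume a: "\<Gamma> \<noteq> {}" "sobolev_setdist m u \<Gamma> < c"
  have b: "bdd_below (sobolev_dist m u ` \<Gamma>)" by (rule bdd_belowI2[of _ 0]) simp
  show ?thesis using cINF_less_iff[OF a(1) b, of c] a(2) unfolding sobolev_setdist_def by blast
qed

text \<open>If stability fails, there are data \<open>u n\<close> approaching \<open>\<Gamma>\<close> whose orbits reach states \<open>z n\<close> at
  distance more than \<open>\<epsilon>\<close> from \<open>\<Gamma>\<close>. Conservation laws and Lipschitz continuity make \<open>z n\<close> a
  minimizing sequence, and its compactness up to translations contradicts the distance, because \<open>\<Gamma>\<close>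
  is invariant under translations.\<close>

theorem ground_states_stable:
  assumes m: "m \<ge> 1" and p: "2 < p" "p < 4 * real m + 2" and T: "is_life_span m p T"
    and mu: "\<mu> > 0" and I: "I < 0" and low: "\<And>u. u \<in> sobolev m \<Longrightarrow> mass u = \<mu> \<Longrightarrow> I \<le> energy m p u"
    and \<Gamma>: "\<Gamma> = {u \<in> sobolev m. energy m p u = I \<and> mass u = \<mu>}" and ne: "\<Gamma> \<noteq> {}"
  shows "stable_set m p T \<Gamma>"
proof (rule ccontr)
  assume "\<not> stable_set m p T \<Gamma>"
  then obtain \<epsilon> where eps: "\<epsilon> > 0" and bad: "\<And>\<eta>. \<eta> > 0 \<Longrightarrow> \<exists>u\<in>sobolev m. sobolev_setdist m u \<Gamma> \<le> \<eta> \<and>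
      (\<exists>t. 0 \<le> t \<and> ereal t < T u \<and> \<not> sobolev_setdist m (flow m p t u) \<Gamma> \<le> \<epsilon>)"
    unfolding stable_set_def by blast
  \<comment> \<open>Data at distance at most \<open>\<eta> n\<close>; since the distance to \<open>\<Gamma>\<close> is an infimum, an element within
    \<open>2 * \<eta> n\<close> is chosen below.\<close>
  define \<eta> where "\<eta> n = inverse (real (Suc n))" for n
  have eta: "\<eta> n > 0" "\<eta> n \<le> 1" for n by (auto simp: \<eta>_def inverse_eq_divide)
  have eta0: "\<eta> \<longlonglongrightarrow> 0" unfolding \<eta>_def by (rule LIMSEQ_inverse_real_of_nat)
  have "\<forall>n. \<exists>q. fst q \<in> sobolev m \<and> sobolev_setdist m (fst q) \<Gamma> \<le> \<eta> n \<and> 0 \<le> snd q \<and> ereal (snd q) < T (fst q) \<and>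
     \<not> sobolev_setdist m (flow m p (snd q) (fst q)) \<Gamma> \<le> \<epsilon>"
    using bad[OF eta(1)] by (metis fst_conv snd_conv)
  from choice[OF this] obtain q where q: "\<And>n. fst (q n) \<in> sobolev m" "\<And>n. sobolev_setdist m (fst (q n)) \<Gamma> \<le> \<eta> n"
    "\<And>n. 0 \<le> snd (q n)" "\<And>n. ereal (snd (q n)) < T (fst (q n))" "\<And>n. \<not> sobolev_setdist m (flow m p (snd (q n)) (fst (q n))) \<Gamma> \<le> \<epsilon>"
    by blast
  define u where "u n = fst (q n)" for n
  define z where "z n = flow m p (snd (q n)) (u n)" for n
  have us: "u n \<in> sobolev m" for n unfolding u_def by (rule q)
  have zs: "z n \<in> sobolev m" and zE: "energy m p (z n) = energy m p (u n)" and zM: "mass (z n) = mass (u n)" for n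
    unfolding z_def by (rule flow_conserves[OF m p(1) T us q(3)]; simp add: u_def q(4))+
  have "\<forall>n. \<exists>w. w \<in> \<Gamma> \<and> sobolev_dist m (u n) w < 2 * \<eta> n"
  proof
    fix n
    have "sobolev_setdist m (u n) \<Gamma> < 2 * \<eta> n" using q(2)[of n] eta(1)[of n] unfolding u_def by linarith
    from sobolev_setdist_less[OF ne this] show "\<exists>w. w \<in> \<Gamma> \<and> sobolev_dist m (u n) w < 2 * \<eta> n" by blast
  qed
  from choice[OF this] obtain w where w: "\<And>n. w n \<in> \<Gamma>" "\<And>n. sobolev_dist m (u n) (w n) < 2 * \<eta> n" by blast
  have ws: "w n \<in> sobolev m" "energy m p (w n) = I" "mass (w n) = \<mu>" for n using w(1)[of n] by (auto simp: \<Gamma>)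
  obtain D where D: "\<And>v. v \<in> sobolev m \<Longrightarrow> mass v \<le> \<mu> \<Longrightarrow> kinetic m v / 4 - D \<le> energy m p v"
    using energy_coercive[OF m p, of \<mu>] mu by auto
  \<comment> \<open>Coercivity bounds the kinetic energy on \<open>\<Gamma>\<close>; the data are within distance \<open>2\<close> of it, so they
    lie in one bounded set, on which mass and energy are Lipschitz.\<close>
  define K0 where "K0 = 4 * (I + D)"
  have wK: "kinetic m (w n) \<le> K0" for n using D[OF ws(1), of n] ws(2,3)[of n] by (simp add: K0_def)
  have K0: "K0 \<ge> 0" using wK[of 0] kinetic_nonneg[of m "w 0"] by linarith
  have d2: "sobolev_dist m (u n) (w n) \<le> 2" for n using w(2)[of n] eta(2)[of n] by linarith
  define Q where "Q = (sqrt \<mu> + 2)\<^sup>2"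
  define K where "K = (sqrt K0 + 2)\<^sup>2"
  have uQ: "mass (u n) \<le> Q" for n
  proof -
    have "sqrt (mass (u n)) \<le> sqrt (mass (\<lambda>x. u n x - w n x)) + sqrt (mass (w n))"
      using mass_triangle[OF sobolev_diff[OF us ws(1)] ws(1), of n n n] by simp
    also have "\<dots> \<le> 2 + sqrt \<mu>" using sobolev_dist_bounds(1)[OF us ws(1), of n n] d2[of n] by (simp add: ws)
    finally have "(sqrt (mass (u n)))\<^sup>2 \<le> (2 + sqrt \<mu>)\<^sup>2" by (rule power_mono) simp
    then show ?thesis by (simp add: Q_def add.commute)
  qed
  have uK: "kinetic m (u n) \<le> K" for n
  proof -
    have "sqrt (kinetic m (u n)) \<le> sqrt (kinetic m (\<lambda>x. u n x - w n x)) + sqrt (kinetic m (w n))"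
      using sobolev_add(2)[OF sobolev_diff[OF us ws(1)] ws(1), of n n n] by simp
    also have "\<dots> \<le> 2 + sqrt K0"
      using sobolev_dist_bounds(2)[OF us ws(1), of n n] d2[of n] real_sqrt_le_mono[OF wK[of n]] by linarith
    finally have "(sqrt (kinetic m (u n)))\<^sup>2 \<le> (2 + sqrt K0)\<^sup>2" by (rule power_mono) simp
    then show ?thesis by (simp add: K_def add.commute)
  qed
  have wQ: "mass (w n) \<le> Q" for n
  proof -
    have "(sqrt \<mu>)\<^sup>2 \<le> (sqrt \<mu> + 2)\<^sup>2" using mu by (intro power_mono) auto
    then show ?thesis using mu by (simp add: Q_def ws)
  qed
  have wK2: "kinetic m (w n) \<le> K" for n
  proof -
    have "(sqrt K0)\<^sup>2 \<le> (sqrt K0 + 2)\<^sup>2" using K0 by (intro power_mono) auto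
    then show ?thesis using wK[of n] K0 by (simp add: K_def)
  qed
  have dist0: "(\<lambda>n. sobolev_dist m (u n) (w n)) \<longlonglongrightarrow> 0"
  proof (rule Lim_null_comparison)
    show "\<forall>\<^sub>F n in sequentially. norm (sobolev_dist m (u n) (w n)) \<le> 2 * \<eta> n" using w(2) by (auto intro!: always_eventually less_imp_le)
    show "(\<lambda>n. 2 * \<eta> n) \<longlonglongrightarrow> 0" by (intro tendsto_mult_right_zero eta0)
  qed
  have "(\<lambda>n. mass (u n) - \<mu>) \<longlonglongrightarrow> 0"
  proof (rule Lim_null_comparison)
    show "\<forall>\<^sub>F n in sequentially. norm (mass (u n) - \<mu>) \<le> 2 * sqrt Q * sobolev_dist m (u n) (w n)"
      using mass_lipschitz[OF us ws(1) uQ wQ] by (simp add: ws)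
    show "(\<lambda>n. 2 * sqrt Q * sobolev_dist m (u n) (w n)) \<longlonglongrightarrow> 0" by (intro tendsto_mult_right_zero dist0)
  qed
  then have zmass: "(\<lambda>n. mass (z n)) \<longlonglongrightarrow> \<mu>" unfolding zM by (simp add: LIM_zero_iff)
  obtain C where C: "\<And>n. \<bar>energy m p (u n) - energy m p (w n)\<bar> \<le> C * sobolev_dist m (u n) (w n)"
    using energy_lipschitz[OF m p(1), of Q K] us ws(1) uQ wQ uK wK2 by blast
  have "(\<lambda>n. energy m p (u n) - I) \<longlonglongrightarrow> 0"
  proof (rule Lim_null_comparison)
    show "\<forall>\<^sub>F n in sequentially. norm (energy m p (u n) - I) \<le> C * sobolev_dist m (u n) (w n)"
      using C by (simp add: ws)
    show "(\<lambda>n. C * sobolev_dist m (u n) (w n)) \<longlonglongrightarrow> 0" by (intro tendsto_mult_right_zero dist0)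
  qed
  then have zenergy: "(\<lambda>n. energy m p (z n)) \<longlonglongrightarrow> I" unfolding zE by (simp add: LIM_zero_iff)
  have "\<exists>r \<tau> g. strict_mono (r :: nat \<Rightarrow> nat) \<and> g \<in> sobolev m \<and> mass g = \<mu> \<and> energy m p g = I \<and>
     (\<lambda>k. sobolev_dist m (\<lambda>x. z (r k) (x - \<tau> k)) g) \<longlonglongrightarrow> 0"
    by (rule minimizing_sequence_compact[OF m p mu I _ zs zmass zenergy]) (rule low)
  then obtain r :: "nat \<Rightarrow> nat" and \<tau> g where g: "g \<in> sobolev m" "mass g = \<mu>" "energy m p g = I"
    and lim: "(\<lambda>k. sobolev_dist m (\<lambda>x. z (r k) (x - \<tau> k)) g) \<longlonglongrightarrow> 0" by (elim exE conjE)
  have "\<forall>\<^sub>F k in sequentially. sobolev_dist m (\<lambda>x. z (r k) (x - \<tau> k)) g < \<epsilon>" using lim eps by (rule order_tendstoD(2))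
  then obtain k where k: "sobolev_dist m (\<lambda>x. z (r k) (x - \<tau> k)) g < \<epsilon>" by (auto simp: eventually_sequentially)
  \<comment> \<open>The limit is translated back instead of the sequence.\<close>
  define g' where "g' x = g (x - (- \<tau> k))" for x
  have g's: "g' \<in> sobolev m" unfolding g'_def by (rule sobolev_shift(1)[OF g(1)])
  have "energy m p g' = energy m p g"
    unfolding energy_eq[OF m g(1) p(1)] energy_eq[OF m g's p(1)] g'_def sobolev_shift(2)[OF g(1)] potential_shift ..
  moreover have "mass g' = mass g" unfolding g'_def by (rule mass_shift)
  ultimately have g'\<Gamma>: "g' \<in> \<Gamma>" using g g's by (simp add: \<Gamma>)
  have "sobolev_setdist m (z (r k)) \<Gamma> \<le> sobolev_dist m (z (r k)) g'" by (rule sobolev_setdist_le[OF g'\<Gamma>])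
  also have "\<dots> = sobolev_dist m (\<lambda>x. z (r k) (x - \<tau> k)) (\<lambda>x. g' (x - \<tau> k))" by (rule sobolev_dist_shift[OF zs g's, symmetric])
  also have "(\<lambda>x. g' (x - \<tau> k)) = g" by (simp add: g'_def)
  finally have "sobolev_setdist m (z (r k)) \<Gamma> \<le> \<epsilon>" using k by linarith
  then show False using q(5)[of "r k"] by (simp add: z_def u_def)
qed

theorem theorem2:
  fixes m :: nat and p :: real and T :: "(real \<Rightarrow> real) \<Rightarrow> ereal"
  assumes "m \<ge> 1"
    and "is_life_span m p T"
    and "globally_well_posed_in m T (sobolev (2 * m))"
    and "2 < p" and "p < 4 * real m + 2"
  shows "\<exists>\<delta>_inf>0. \<exists>(u :: real \<Rightarrow> real \<Rightarrow> real) (lam :: real \<Rightarrow> real). \<forall>\<delta>\<in>{0<..<\<delta>_inf}.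
           hylomorphic_soliton m p T (u \<delta>) \<and>
           weak_travelling_profile m p (lam \<delta>) (u \<delta>) \<and>
           weak_evolution m p UNIV (\<lambda>t x. u \<delta> (x - lam \<delta> * t))"
proof -
  note m = assms(1) and T = assms(2) and wp = assms(3) and p = assms(4,5)
  obtain \<mu> I g where mu: "\<mu> > 0" and I: "I < 0" and low: "\<And>u. u \<in> sobolev m \<Longrightarrow> mass u = \<mu> \<Longrightarrow> I \<le> energy m p u"
    and g: "g \<in> sobolev m" "mass g = \<mu>" "energy m p g = I"
    using minimizer_exists[OF m p] by blast
  define \<Gamma> where "\<Gamma> = {u \<in> sobolev m. energy m p u = I \<and> mass u = \<mu>}"
  have charge: "\<bar>charge v\<bar> = \<mu> / 2 \<longleftrightarrow> mass v = \<mu>" for v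
    using mass_nonneg[of v] by (simp add: charge_eq_mass)
  have rep_min: "continuous_rep v \<in> sobolev m \<and> mass (continuous_rep v) = \<mu> \<and> energy m p (continuous_rep v) = I" if "v \<in> \<Gamma>" for v
  proof -
    have v: "v \<in> sobolev m" "energy m p v = I" "mass v = \<mu>" using that by (auto simp: \<Gamma>_def)
    have "energy m p (continuous_rep v) = energy m p v"
      unfolding energy_eq[OF m v(1) p(1)] energy_eq[OF m continuous_rep_sobolev(1)[OF m v(1)] p(1)] continuous_rep_sobolev(2,4)[OF m v(1)] ..
    then show ?thesis using continuous_rep_sobolev[OF m v(1)] v by simp
  qed
  \<comment> \<open>Regularity enters here: minimizers lie in \<open>H\<^sup>2\<^sup>m\<close>, where the life span is infinite.\<close>
  have global: "\<Gamma> \<subseteq> global_states m T"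
  proof
    fix v assume vG: "v \<in> \<Gamma>"
    then have v: "v \<in> sobolev m" by (simp add: \<Gamma>_def)
    note r = rep_min[OF vG]
    have "continuous_rep v \<in> sobolev (2 * m)"
      by (rule euler_lagrange_regularity[OF m p(1) mu low _ _ _ continuous_rep_bounded[OF m v]]) (use r in auto)
    moreover have "AE x in lborel. continuous_rep v x = v x" using continuous_rep_AE_eq[OF m v] by eventually_elim simp
    ultimately have "v \<in> sobolev (2 * m)" by (rule sobolev_cong_AE(1)[OF _ sobolevD(1)[OF v]])
    then show "v \<in> global_states m T" using wp unfolding globally_well_posed_in_def by blast
  qed
  \<comment> \<open>The continuous representative, as the chain rule uses continuity.\<close>
  define w where "w = continuous_rep g"
  have gG: "g \<in> \<Gamma>" using g by (simp add: \<Gamma>_def)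
  have w: "w \<in> sobolev m" "mass w = \<mu>" "energy m p w = I" unfolding w_def using rep_min[OF gG] by auto
  have wG: "w \<in> \<Gamma>" using w by (simp add: \<Gamma>_def)
  define M where "M = sqrt (weight_integral m * (mass g + kinetic m g))"
  have wM: "\<bar>w x\<bar> \<le> M" for x unfolding w_def M_def by (rule continuous_rep_bounded[OF m g(1)])
  have wc: "continuous_on UNIV w" unfolding w_def by (rule continuous_on_continuous_rep[OF m g(1)])
  define l where "l = multiplier m p w"
  \<comment> \<open>Every translate is a minimizer with the same multiplier, so the profile equation holds at all
    times.\<close>
  have prof: "weak_travelling_profile m p l (\<lambda>x. w (x - a))" for a
  proof -
    have s: "(\<lambda>x. w (x - a)) \<in> sobolev m" by (rule sobolev_shift(1)[OF w(1)])
    have e: "energy m p (\<lambda>x. w (x - a)) = I"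
      using w(3) unfolding energy_eq[OF m s p(1)] energy_eq[OF m w(1) p(1)] sobolev_shift(2)[OF w(1)] potential_shift .
    have mm: "mass (\<lambda>x. w (x - a)) = \<mu>" using w(2) by (simp add: mass_shift)
    have "multiplier m p (\<lambda>x. w (x - a)) = l"
      unfolding l_def multiplier_def sobolev_shift(2)[OF w(1)] potential_shift mass_shift ..
    moreover have "weak_travelling_profile m p (multiplier m p (\<lambda>x. w (x - a))) (\<lambda>x. w (x - a))"
    proof (rule minimizer_travelling_profile[OF m p(1) mu low s mm e wM])
      show "continuous_on UNIV (\<lambda>x. w (x - a))"
        by (rule continuous_on_compose2[OF wc]) (auto intro!: continuous_intros)
    qed
    ultimately show ?thesis by simp
  qed
  have inv: "invariant_set m p T \<Gamma>"
    unfolding invariant_set_def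
  proof (intro ballI allI impI)
    fix u t assume u: "u \<in> \<Gamma>" and t: "0 \<le> t \<and> ereal t < T u"
    have us: "u \<in> sobolev m" using u by (simp add: \<Gamma>_def)
    show "flow m p t u \<in> \<Gamma>"
      using flow_conserves[OF m p(1) T us] t u by (simp add: \<Gamma>_def)
  qed
  have stable: "stable_set m p T \<Gamma>"
    by (rule ground_states_stable[OF m p T mu I low \<Gamma>_def]) (use gG in auto)
  have compact: "compact_up_to_translations m \<Gamma>"
    unfolding compact_up_to_translations_def
  proof (intro allI impI)
    fix u :: "nat \<Rightarrow> real \<Rightarrow> real" assume "\<forall>n. u n \<in> \<Gamma>"
    then have u: "u n \<in> sobolev m" "energy m p (u n) = I" "mass (u n) = \<mu>" for n by (auto simp: \<Gamma>_def)
    have "\<exists>r \<tau> g. strict_mono (r :: nat \<Rightarrow> nat) \<and> g \<in> sobolev m \<and> mass g = \<mu> \<and> energy m p g = I \<and>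
       (\<lambda>k. sobolev_dist m (\<lambda>x. u (r k) (x - \<tau> k)) g) \<longlonglongrightarrow> 0"
      by (rule minimizing_sequence_compact[OF m p mu I _ u(1)]) (auto simp: u intro: low)
    then show "\<exists>r. strict_mono r \<and> (\<exists>\<tau>. \<exists>v\<in>sobolev m. (\<lambda>k. sobolev_dist m (\<lambda>x. u (r k) (x - \<tau> k)) v) \<longlonglongrightarrow> 0)"
      by blast
  qed
  have \<Gamma>_charge: "\<Gamma> = {u \<in> sobolev m. energy m p u = I \<and> \<bar>charge u\<bar> = \<mu> / 2}" unfolding \<Gamma>_def charge ..
  have sol: "soliton_via m p T {u \<in> sobolev m. energy m p u = I \<and> \<bar>charge u\<bar> = \<mu> / 2} w"
    unfolding soliton_via_def \<Gamma>_charge[symmetric] using wG global inv stable compact by blast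
  have "hylomorphic_soliton m p T w"
    unfolding hylomorphic_soliton_def
  proof (intro exI conjI)
    show "\<mu> / 2 > 0" using mu by simp
    show "I \<in> energy m p ` {u \<in> sobolev m. \<bar>charge u\<bar> = \<mu> / 2}" unfolding charge using w by (intro image_eqI[of _ _ w]) auto
    show "\<forall>u\<in>sobolev m. \<bar>charge u\<bar> = \<mu> / 2 \<longrightarrow> I \<le> energy m p u" unfolding charge using low by blast
  qed (rule sol)
  moreover have "weak_travelling_profile m p l w" using prof[of 0] by simp
  moreover have "weak_evolution m p UNIV (\<lambda>t x. w (x - l * t))"
    by (rule travelling_wave_evolution[OF prof sobolevD(1)[OF w(1)] wM])
  ultimately show ?thesis
    by (intro exI[of _ "1::real"] conjI exI[of _ "\<lambda>_. w"] exI[of _ "\<lambda>_. l"]) auto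
qed

end
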